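(* Let $\theta$ be an antisymmetric real $n\times n$ matrix and let $A(z)\in\Psi(\mathbb{T}^n_\theta)$, $z\in\mathbb{C}$, be a holomorphic family of classical toroidal pseudodifferential operators on the noncommutative torus, of order $-qz+a$ for some $q>0$ and $a\in\mathbb{R}$. Put $d_j=\frac{a+n-j}{q}$, $j\in\mathbb{Z}_{\ge0}$. (1) The map $z\mapsto\mathrm{TR}_\theta(A(z))$ is meromorphic with simple poles $d_j$, $j\in\mathbb{Z}_{\ge0}$. (2) The complex residue at $d_j$ is $\mathrm{Res}_{z=d_j}\mathrm{TR}_\theta(A(z))=\frac1q\,\mathrm{Res}_\theta(A(d_j))$. (3) If $A(d_j)$ is a differential operator, then $A'(d_j)$ has a well-defined Wodzicki residue $\mathrm{Res}_\theta(A'(d_j))$ and the finite part at $d_j$ is $$\mathrm{fp}_{z=d_j}\mathrm{TR}_\theta(A(z))=\frac1q\,\mathrm{Res}_\theta(A'(d_j)).$$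
   Context: Noncommutative torus: $A_\theta$ is the $C^*$-algebra generated by unitaries $U_k$, $k\in\mathbb{Z}^n$, with $U_0=1$ and $U_kU_l=e^{-2\pi i\langle k,\theta l\rangle}U_lU_k$ (with $U_kU_l$ proportional to $U_{k+l}$). $\mathcal{A}_\theta=\{\sum_ka_kU_k:(a_k)\in\mathcal{S}(\mathbb{Z}^n)\}$, $\mathbf{t}(\sum_ka_kU_k)=a_0$, $\delta_j(\sum_ka_kU_k)=\sum_kk_ja_kU_k$. A classical toroidal symbol of order $m\in\mathbb{C}$ is the restriction to $\mathbb{Z}^n$ of a smooth map $\sigma\colon\mathbb{R}^n\to\mathcal{A}_\theta$ with $\sigma\sim\sum_{j\ge0}\omega\,\sigma_{m-j}$. Here $\sigma_{m-j}\colon\mathbb{R}^n\setminus\{0\}\to\mathcal{A}_\theta$ is smooth and positively homogeneous of degree $m-j$, $\omega$ is smooth, zero near $0$ and $1$ outside the unit ball, and $\sim$ means that for all $N,\alpha,\beta$, $\|\delta^\alpha\partial_\xi^\beta(\sigma-\sum_{j<N}\omega\sigma_{m-j})(\xi)\|\le C(1+|\xi|)^{\mathrm{Re}(m)-N-|\beta|}$. The operator is $\mathrm{Op}_\theta(\sigma)(\sum_ka_kU_k)=\sum_ka_k\,\sigma(k)U_k$ on $\mathcal{A}_\theta$; $\mathrm{Op}_\theta$ is injective on symbols on $\mathbb{Z}^n$, and $\Psi(\mathbb{T}^n_\theta)$ is the set of such operators. Differential operators are those with polynomial symbols $\sum_{|\alpha|\le m}a_\alpha k^\alpha$, $a_\alpha\in\mathcal{A}_\theta$.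 A holomorphic family of order $\alpha(z)=-qz+a$ is $A(z)=\mathrm{Op}_\theta(\sigma(z))$, with $\sigma(z)\sim\sum_j\omega\,\sigma_{\alpha(z)-j}(z)$ classical of order $\alpha(z)$, $\sigma(z)$ and $\sigma_{\alpha(z)-j}(z)$ holomorphic in $z$, and each $\partial_z^k$ of the remainder $\sigma(z)-\sum_{j<N}\omega\,\sigma_{\alpha(z)-j}(z)$ a symbol of order $\mathrm{Re}\,\alpha(z)-N+\epsilon$ for all $\epsilon>0$, locally uniformly in $z$. Canonical trace: $\mathrm{TR}_\theta(A)$ is the cut-off sum over $\mathbb{Z}^n$ of $\mathbf{t}(\mathrm{Op}_\theta^{-1}(A))$. For $A=\mathrm{Op}_\theta(\sigma)$ of order not in $\mathbb{Z}\cap[-n,\infty)$ it is the constant term in the asymptotic expansion as $N\to\infty$ of $\sum_{k\in\mathbb{Z}^n,\,|k|_\infty\le N}\mathbf{t}(\sigma(k))$. Residue: $\mathrm{Res}_\theta(A)=\int_{|\xi|=1}\mathbf{t}(\sigma_{-n}(\xi))\,d_S\xi$, where $\sigma_{-n}$ is the degree $-n$ homogeneous component of the symbol. For $A'(d_j)=\partial_zA(z)|_{z=d_j}$ the same formula is used with $\sigma_{-n}$ replaced by $\partial_z\sigma_{\alpha(z)-j}(z)|_{z=d_j}$ on $|\xi|=1$ (note $\alpha(d_j)-j=-n$). The finite part is the constant term of the Laurent expansion. *)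

theory Defs
  imports
    "HOL-Complex_Analysis.Complex_Analysis"
    "HOL-Library.Landau_Symbols"
begin

section \<open>The noncommutative torus\<close>

text \<open>
  An element \<open>\<Sum>\<^sub>k a\<^sub>k U\<^sub>k\<close> of the smooth algebra is represented by its coefficient
  sequence \<open>a\<close>. The lattice \<open>\<int>\<^sup>n\<close> is the type \<open>int ^ 'n\<close>, with \<open>n = CARD('n)\<close>.
\<close>

type_synonym 'n coeffs = "int ^ 'n \<Rightarrow> complex"

type_synonym 'n cocycle = "int ^ 'n \<Rightarrow> int ^ 'n \<Rightarrow> complex"

type_synonym 'n multiindex = "'n \<Rightarrow> nat"

definition lattice_vec :: "int ^ 'n \<Rightarrow> real ^ 'n" where
  "lattice_vec k = (\<chi> i. of_int (k $ i))"

text \<open>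
  The scalars in \<open>U\<^sub>k U\<^sub>l = c k l U\<^bsub>k+l\<^esub>\<close> for unitaries \<open>U\<^sub>k\<close> with \<open>U\<^sub>0 = 1\<close>: unimodularity
  is unitarity, the third condition is associativity, and the last one is
  \<open>U\<^sub>k U\<^sub>l = exp (-2 \<pi> \<i> \<langle>k, \<theta> l\<rangle>) U\<^sub>l U\<^sub>k\<close>. Every normalisation of the \<open>U\<^sub>k\<close> is covered; the
  usual one is \<open>c k l = exp (- \<pi> \<i> \<langle>k, \<theta> l\<rangle>)\<close>, see \<open>nct_cocycle_standard\<close> below.
\<close>

definition nct_cocycle :: "real ^ 'n ^ 'n \<Rightarrow> 'n::finite cocycle \<Rightarrow> bool" where
  "nct_cocycle \<theta> c \<longleftrightarrow>
     (\<forall>k l. norm (c k l) = 1) \<and>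
     (\<forall>k. c 0 k = 1 \<and> c k 0 = 1) \<and>
     (\<forall>k l m. c k l * c (k + l) m = c k (l + m) * c l m) \<and>
     (\<forall>k l. c k l = cis (- 2 * pi * (lattice_vec k \<bullet> (\<theta> *v lattice_vec l))) * c l k)"

lemma lattice_vec_simps:
  "lattice_vec 0 = 0" "lattice_vec (k + l) = lattice_vec k + lattice_vec l"
  by (simp_all add: lattice_vec_def vec_eq_iff)

lemma nct_cocycle_standard:
  fixes \<theta> :: "real ^ 'n ^ 'n"
  assumes "transpose \<theta> = - \<theta>"
  shows "nct_cocycle \<theta> (\<lambda>k l. cis (- pi * (lattice_vec k \<bullet> (\<theta> *v lattice_vec l))))"
proof -
  have anti: "y \<bullet> (\<theta> *v x) = - (x \<bullet> (\<theta> *v y))" for x y :: "real ^ 'n"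
  proof -
    have "y \<bullet> (\<theta> *v x) = (transpose \<theta> *v y) \<bullet> x"
      by (metis dot_lmul_matrix transpose_matrix_vector)
    also have "\<dots> = (- \<theta> *v y) \<bullet> x"
      using assms by simp
    also have "- \<theta> *v y = - (\<theta> *v y)"
      by (simp add: matrix_vector_mult_def vec_eq_iff sum_negf)
    finally show ?thesis by (simp add: inner_commute)
  qed
  have flip: "cis (- pi * (lattice_vec k \<bullet> (\<theta> *v lattice_vec l))) =
        cis (- 2 * pi * (lattice_vec k \<bullet> (\<theta> *v lattice_vec l))) *
        cis (- pi * (lattice_vec l \<bullet> (\<theta> *v lattice_vec k)))" for k l
    by (simp add: cis_mult anti[of "lattice_vec l" "lattice_vec k"])
  show ?thesis
    unfolding nct_cocycle_def
    by (intro conjI allI flip)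
       (simp_all add: lattice_vec_simps cis_mult inner_add_left inner_add_right
         matrix_vector_right_distrib algebra_simps)
qed

definition nct_smooth_algebra :: "'n::finite coeffs set" where
  "nct_smooth_algebra = {a. \<forall>N. \<exists>C. \<forall>k. norm (a k) * (1 + norm (lattice_vec k)) ^ N \<le> C}"

definition nct_U :: "int ^ 'n \<Rightarrow> 'n::finite coeffs" where
  "nct_U k = (\<lambda>l. if l = k then 1 else 0)"

definition nct_mult :: "'n::finite cocycle \<Rightarrow> 'n coeffs \<Rightarrow> 'n coeffs \<Rightarrow> 'n coeffs" where
  "nct_mult c a b = (\<lambda>m. \<Sum>\<^sub>\<infinity>k. a k * b (m - k) * c k (m - k))"

text \<open>The adjoint is determined by \<open>U\<^sub>k\<^sup>* = U\<^sub>k\<^sup>-\<^sup>1 = cnj (c k (- k)) U\<^bsub>- k\<^esub>\<close>.\<close>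

definition nct_star :: "'n::finite cocycle \<Rightarrow> 'n coeffs \<Rightarrow> 'n coeffs" where
  "nct_star c a = (\<lambda>k. cnj (c (- k) k * a (- k)))"

lemma nct_mult_U: "nct_mult c (nct_U k) (nct_U l) = (\<lambda>m. c k l * nct_U (k + l) m)"
proof
  fix m
  have "nct_mult c (nct_U k) (nct_U l) m =
        (\<Sum>\<^sub>\<infinity>j\<in>{k}. nct_U k j * nct_U l (m - j) * c j (m - j))"
    unfolding nct_mult_def by (rule infsum_cong_neutral) (auto simp: nct_U_def)
  then show "nct_mult c (nct_U k) (nct_U l) m = c k l * nct_U (k + l) m"
    by (auto simp: nct_U_def algebra_simps)
qed

lemma nct_U_commute:
  assumes "nct_cocycle \<theta> c"
  shows "nct_mult c (nct_U k) (nct_U l) =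
    (\<lambda>m. cis (- 2 * pi * (lattice_vec k \<bullet> (\<theta> *v lattice_vec l))) * nct_mult c (nct_U l) (nct_U k) m)"
proof -
  have "c k l = cis (- 2 * pi * (lattice_vec k \<bullet> (\<theta> *v lattice_vec l))) * c l k"
    using assms unfolding nct_cocycle_def by blast
  then show ?thesis
    by (simp add: nct_mult_U add.commute mult.assoc)
qed

lemma nct_U_unitary:
  assumes "nct_cocycle \<theta> c"
  shows "nct_mult c (nct_U k) (nct_star c (nct_U k)) = nct_U 0"
    and "nct_mult c (nct_star c (nct_U k)) (nct_U k) = nct_U 0"
proof -
  have norm: "norm (c j l) = 1" and zero: "c 0 l = 1" "c l 0 = 1" for j l
    using assms unfolding nct_cocycle_def by blast+
  have 1: "cnj (c j l) * c j l = 1" for j l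
    using complex_norm_square[of "c j l"] by (simp add: norm mult.commute)
  have 2: "c (- k) k = c k (- k)"
  proof -
    have "c k (- k) * c (k + - k) k = c k (- k + k) * c (- k) k"
      using assms unfolding nct_cocycle_def by blast
    then show ?thesis by (simp add: zero)
  qed
  have 3: "cnj (c k (- k)) * (c k (- k) * y) = y" for y
    by (simp only: mult.assoc[symmetric] 1 mult_1)
  have star: "nct_star c (nct_U k) = (\<lambda>l. cnj (c k (- k)) * nct_U (- k) l)"
    by (auto simp: nct_star_def nct_U_def fun_eq_iff)
  have "nct_mult c (nct_U k) (nct_star c (nct_U k)) m =
        cnj (c k (- k)) * nct_mult c (nct_U k) (nct_U (- k)) m" for m
    unfolding star nct_mult_def infsum_cmult_right'[symmetric]
    by (rule infsum_cong) (simp only: mult_ac)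
  then show "nct_mult c (nct_U k) (nct_star c (nct_U k)) = nct_U 0"
    by (simp add: nct_mult_U fun_eq_iff 3)
  have "nct_mult c (nct_star c (nct_U k)) (nct_U k) m =
        cnj (c k (- k)) * nct_mult c (nct_U (- k)) (nct_U k) m" for m
    unfolding star nct_mult_def infsum_cmult_right'[symmetric]
    by (rule infsum_cong) (simp only: mult_ac)
  then show "nct_mult c (nct_star c (nct_U k)) (nct_U k) = nct_U 0"
    by (simp add: nct_mult_U fun_eq_iff 2 3)
qed

text \<open>
  The norm of the (universal) \<open>C\<^sup>*\<close>-algebra generated by the \<open>U\<^sub>k\<close> is the largest
  \<open>C\<^sup>*\<close>-seminorm. As the \<open>U\<^sub>k\<close> are unitary, the norm of \<open>\<Sum>\<^sub>k a\<^sub>k U\<^sub>k\<close> in any representation is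
  at most \<open>\<Sum>\<^sub>k \<bar>a\<^sub>k\<bar>\<close>; this is the last condition, and it makes the supremum finite.
\<close>

definition nct_cstar_seminorm ::
    "'n::finite cocycle \<Rightarrow> ('n coeffs \<Rightarrow> real) \<Rightarrow> bool" where
  "nct_cstar_seminorm c p \<longleftrightarrow>
     (\<forall>a\<in>nct_smooth_algebra. \<forall>b\<in>nct_smooth_algebra.
        p (\<lambda>k. a k + b k) \<le> p a + p b \<and> p (nct_mult c a b) \<le> p a * p b) \<and>
     (\<forall>a\<in>nct_smooth_algebra. \<forall>w::complex. p (\<lambda>k. w * a k) = norm w * p a) \<and>
     (\<forall>a\<in>nct_smooth_algebra. p (nct_mult c (nct_star c a) a) = (p a)\<^sup>2) \<and>
     (\<forall>a\<in>nct_smooth_algebra. 0 \<le> p a \<and> p a \<le> (\<Sum>\<^sub>\<infinity>k. norm (a k)))"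

definition nct_norm :: "'n::finite cocycle \<Rightarrow> 'n coeffs \<Rightarrow> real" where
  "nct_norm c a = (SUP p\<in>Collect (nct_cstar_seminorm c). p a)"

definition nct_trace :: "'n::finite coeffs \<Rightarrow> complex" where
  "nct_trace a = a 0"

definition nct_delta :: "'n multiindex \<Rightarrow> 'n coeffs \<Rightarrow> 'n::finite coeffs" where
  "nct_delta \<alpha> a = (\<lambda>k. (\<Prod>i\<in>UNIV. of_int (k $ i) ^ \<alpha> i) * a k)"


section \<open>Smooth and holomorphic maps into the smooth algebra\<close>

text \<open>
  The smooth algebra carries the Frechet topology of the seminorms \<open>a \<mapsto> \<parallel>\<delta>\<^sup>\<alpha> a\<parallel>\<close>.
  \<open>nct_derivs c S f D\<close> says that \<open>f\<close> is smooth on the open set \<open>S\<close> and that \<open>D \<beta>\<close> is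
  \<open>\<partial>\<^sup>\<beta> f\<close> there, for every multi-index \<open>\<beta>\<close>.
\<close>

definition nct_tendsto ::
    "'n::finite cocycle \<Rightarrow> ('b \<Rightarrow> 'n::finite coeffs) \<Rightarrow> 'n coeffs \<Rightarrow> 'b filter \<Rightarrow> bool" where
  "nct_tendsto c f l F \<longleftrightarrow>
     (\<forall>\<alpha>. ((\<lambda>x. nct_norm c (nct_delta \<alpha> (\<lambda>k. f x k - l k))) \<longlongrightarrow> 0) F)"

definition nct_derivs ::
    "'n::finite cocycle \<Rightarrow> (real ^ 'n) set \<Rightarrow> (real ^ 'n \<Rightarrow> 'n::finite coeffs) \<Rightarrow>
     ('n multiindex \<Rightarrow> real ^ 'n \<Rightarrow> 'n coeffs) \<Rightarrow> bool" where
  "nct_derivs c S f D \<longleftrightarrow>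
     (\<forall>\<xi>\<in>S. D (\<lambda>_. 0) \<xi> = f \<xi>) \<and>
     (\<forall>\<beta>. \<forall>\<xi>\<in>S. D \<beta> \<xi> \<in> nct_smooth_algebra) \<and>
     (\<forall>\<beta>. \<forall>\<xi>\<in>S. nct_tendsto c (D \<beta>) (D \<beta> \<xi>) (at \<xi> within S)) \<and>
     (\<forall>\<beta> i. \<forall>\<xi>\<in>S. nct_tendsto c
        (\<lambda>h::real. \<lambda>k. (D \<beta> (\<xi> + h *\<^sub>R axis i 1) k - D \<beta> \<xi> k) / of_real h)
        (D (\<beta>(i := Suc (\<beta> i))) \<xi>) (at 0))"

definition nct_smooth_on ::
    "'n::finite cocycle \<Rightarrow> (real ^ 'n) set \<Rightarrow> (real ^ 'n \<Rightarrow> 'n::finite coeffs) \<Rightarrow> bool" where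
  "nct_smooth_on c S f \<longleftrightarrow> (\<exists>D. nct_derivs c S f D)"

text \<open>
  \<open>nct_holo_derivs c S f D\<close> says that \<open>z \<mapsto> f z\<close> is an entire map into the Frechet space of
  smooth maps on \<open>S\<close> (topology of uniform convergence on compact sets of all \<open>\<xi>\<close>-derivatives),
  and that \<open>D k \<beta> z\<close> is \<open>\<partial>\<^sub>z\<^sup>k \<partial>\<^sub>\<xi>\<^sup>\<beta> f z\<close>.
\<close>

definition nct_holo_derivs ::
    "'n::finite cocycle \<Rightarrow> (real ^ 'n) set \<Rightarrow>
     (complex \<Rightarrow> real ^ 'n \<Rightarrow> 'n::finite coeffs) \<Rightarrow>
     (nat \<Rightarrow> 'n multiindex \<Rightarrow> complex \<Rightarrow> real ^ 'n \<Rightarrow> 'n coeffs) \<Rightarrow> bool" where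
  "nct_holo_derivs c S f D \<longleftrightarrow>
     (\<forall>z. \<forall>\<xi>\<in>S. D 0 (\<lambda>_. 0) z \<xi> = f z \<xi>) \<and>
     (\<forall>k z. nct_derivs c S (D k (\<lambda>_. 0) z) (\<lambda>\<beta>. D k \<beta> z)) \<and>
     (\<forall>k \<beta> z \<alpha> K. compact K \<and> K \<subseteq> S \<longrightarrow>
        uniform_limit K
          (\<lambda>h \<xi>. nct_norm c (nct_delta \<alpha>
             (\<lambda>l. (D k \<beta> (z + h) \<xi> l - D k \<beta> z \<xi> l) / h - D (Suc k) \<beta> z \<xi> l)))
          (\<lambda>\<xi>. 0) (at 0))"

definition nct_holomorphic ::
    "'n::finite cocycle \<Rightarrow> (real ^ 'n) set \<Rightarrow>
     (complex \<Rightarrow> real ^ 'n \<Rightarrow> 'n::finite coeffs) \<Rightarrow> bool" where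
  "nct_holomorphic c S f \<longleftrightarrow> (\<exists>D. nct_holo_derivs c S f D)"


section \<open>Classical toroidal symbols and operators\<close>

definition nct_excision :: "(real ^ 'n::finite \<Rightarrow> real) \<Rightarrow> bool" where
  "nct_excision \<omega> \<longleftrightarrow>
     (\<exists>D :: 'n multiindex \<Rightarrow> real ^ 'n \<Rightarrow> real. D (\<lambda>_. 0) = \<omega> \<and>
        (\<forall>\<beta>. continuous_on UNIV (D \<beta>)) \<and>
        (\<forall>\<beta> i \<xi>. ((\<lambda>h. D \<beta> (\<xi> + h *\<^sub>R axis i 1)) has_real_derivative
                    D (\<beta>(i := Suc (\<beta> i))) \<xi>) (at 0))) \<and>
     (\<forall>\<^sub>F \<xi> in nhds 0. \<omega> \<xi> = 0) \<and>
     (\<forall>\<xi>. 1 \<le> norm \<xi> \<longrightarrow> \<omega> \<xi> = 1)"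

definition nct_homogeneous :: "complex \<Rightarrow> (real ^ 'n::finite \<Rightarrow> 'n coeffs) \<Rightarrow> bool" where
  "nct_homogeneous s f \<longleftrightarrow>
     (\<forall>\<xi> t. \<xi> \<noteq> 0 \<and> 0 < t \<longrightarrow> f (t *\<^sub>R \<xi>) = (\<lambda>k. of_real t powr s * f \<xi> k))"

definition nct_remainder ::
    "(real ^ 'n \<Rightarrow> real) \<Rightarrow> (real ^ 'n \<Rightarrow> 'n::finite coeffs) \<Rightarrow> (nat \<Rightarrow> real ^ 'n \<Rightarrow> 'n coeffs) \<Rightarrow>
     nat \<Rightarrow> real ^ 'n \<Rightarrow> 'n coeffs" where
  "nct_remainder \<omega> \<sigma> \<tau> N = (\<lambda>\<xi> k. \<sigma> \<xi> k - (\<Sum>j<N. of_real (\<omega> \<xi>) * \<tau> j \<xi> k))"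

text \<open>\<open>\<sigma> \<sim> \<Sum>\<^sub>j \<omega> \<sigma>\<^bsub>m-j\<^esub>\<close>, where \<open>\<tau> j\<close> stands for \<open>\<sigma>\<^bsub>m-j\<^esub>\<close>; its value at the origin is irrelevant.\<close>

definition nct_classical_expansion ::
    "'n::finite cocycle \<Rightarrow> (real ^ 'n \<Rightarrow> real) \<Rightarrow> complex \<Rightarrow>
     (real ^ 'n \<Rightarrow> 'n::finite coeffs) \<Rightarrow> (nat \<Rightarrow> real ^ 'n \<Rightarrow> 'n coeffs) \<Rightarrow> bool" where
  "nct_classical_expansion c \<omega> m \<sigma> \<tau> \<longleftrightarrow>
     nct_smooth_on c UNIV \<sigma> \<and>
     (\<forall>j. nct_smooth_on c (- {0}) (\<tau> j) \<and> nct_homogeneous (m - of_nat j) (\<tau> j)) \<and>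
     (\<forall>N. \<exists>D. nct_derivs c UNIV (nct_remainder \<omega> \<sigma> \<tau> N) D \<and>
        (\<forall>\<alpha> \<beta>. \<exists>C. \<forall>\<xi>. nct_norm c (nct_delta \<alpha> (D \<beta> \<xi>)) \<le>
           C * (1 + norm \<xi>) powr (Re m - real N - real (\<Sum>i\<in>UNIV. \<beta> i))))"

definition nct_Op ::
    "'n::finite cocycle \<Rightarrow> (int ^ 'n \<Rightarrow> 'n coeffs) \<Rightarrow> 'n coeffs \<Rightarrow> 'n coeffs" where
  "nct_Op c \<sigma> = (\<lambda>a\<in>nct_smooth_algebra. \<lambda>m. \<Sum>\<^sub>\<infinity>k. a k * nct_mult c (\<sigma> k) (nct_U k) m)"

text \<open>
  \<open>nct_classical_op c A \<omega> m \<sigma> \<tau>\<close>: the restriction of \<open>\<sigma>\<close> to the lattice is a classical toroidal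
  symbol of order \<open>m\<close>, with homogeneous components \<open>\<tau> j\<close>, and it is the symbol of \<open>A\<close>.
\<close>

definition nct_classical_op ::
    "'n::finite cocycle \<Rightarrow> ('n coeffs \<Rightarrow> 'n coeffs) \<Rightarrow> (real ^ 'n \<Rightarrow> real) \<Rightarrow> complex \<Rightarrow>
     (real ^ 'n \<Rightarrow> 'n::finite coeffs) \<Rightarrow> (nat \<Rightarrow> real ^ 'n \<Rightarrow> 'n coeffs) \<Rightarrow> bool" where
  "nct_classical_op c A \<omega> m \<sigma> \<tau> \<longleftrightarrow>
     nct_excision \<omega> \<and> nct_classical_expansion c \<omega> m \<sigma> \<tau> \<and> A = nct_Op c (\<lambda>k. \<sigma> (lattice_vec k))"

definition nct_differential_operator ::
    "'n::finite cocycle \<Rightarrow> ('n coeffs \<Rightarrow> 'n::finite coeffs) \<Rightarrow> bool" where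
  "nct_differential_operator c A \<longleftrightarrow>
     (\<exists>(M::nat) (b :: 'n multiindex \<Rightarrow> 'n coeffs). (\<forall>\<alpha>. b \<alpha> \<in> nct_smooth_algebra) \<and>
        A = nct_Op c (\<lambda>k l. \<Sum>\<alpha> | (\<Sum>i\<in>UNIV. \<alpha> i) \<le> M.
              (\<Prod>i\<in>UNIV. of_int (k $ i) ^ \<alpha> i) * b \<alpha> l))"


section \<open>Holomorphic families of order \<open>- q z + a\<close>\<close>

definition nct_order :: "real \<Rightarrow> real \<Rightarrow> complex \<Rightarrow> complex" where
  "nct_order q a z = - of_real q * z + of_real a"

definition nct_family_symbol ::
    "'n::finite cocycle \<Rightarrow> real \<Rightarrow> real \<Rightarrow> (complex \<Rightarrow> 'n coeffs \<Rightarrow> 'n coeffs) \<Rightarrow>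
     (complex \<Rightarrow> real ^ 'n \<Rightarrow> 'n::finite coeffs) \<Rightarrow> (nat \<Rightarrow> complex \<Rightarrow> real ^ 'n \<Rightarrow> 'n coeffs) \<Rightarrow> bool" where
  "nct_family_symbol c q a A \<sigma> \<tau> \<longleftrightarrow>
     (\<exists>\<omega>. (\<forall>z. nct_classical_op c (A z) \<omega> (nct_order q a z) (\<sigma> z) (\<lambda>j. \<tau> j z)) \<and>
       nct_holomorphic c UNIV \<sigma> \<and>
       (\<forall>j. nct_holomorphic c (- {0}) (\<tau> j)) \<and>
       (\<forall>N. \<exists>D. nct_holo_derivs c UNIV (\<lambda>z. nct_remainder \<omega> (\<sigma> z) (\<lambda>j. \<tau> j z) N) D \<and>
          (\<forall>k \<epsilon> Z \<alpha> \<beta>. 0 < \<epsilon> \<and> compact Z \<longrightarrow>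
             (\<exists>C. \<forall>z\<in>Z. \<forall>\<xi>. nct_norm c (nct_delta \<alpha> (D k \<beta> z \<xi>)) \<le>
                C * (1 + norm \<xi>) powr
                  (Re (nct_order q a z) - real N + \<epsilon> - real (\<Sum>i\<in>UNIV. \<beta> i))))))"

definition nct_holomorphic_family ::
    "'n::finite cocycle \<Rightarrow> real \<Rightarrow> real \<Rightarrow>
     (complex \<Rightarrow> 'n coeffs \<Rightarrow> 'n::finite coeffs) \<Rightarrow> bool" where
  "nct_holomorphic_family c q a A \<longleftrightarrow> (\<exists>\<sigma> \<tau>. nct_family_symbol c q a A \<sigma> \<tau>)"

definition nct_family_deriv ::
    "(complex \<Rightarrow> 'n coeffs \<Rightarrow> 'n::finite coeffs) \<Rightarrow> complex \<Rightarrow> 'n coeffs \<Rightarrow> 'n coeffs" where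
  "nct_family_deriv A z0 = (\<lambda>b\<in>nct_smooth_algebra. \<lambda>k. deriv (\<lambda>z. A z b k) z0)"


section \<open>Canonical trace\<close>

text \<open>
  \<open>f N \<sim> L + \<Sum>\<^sub>j b\<^sub>j N\<^bsup>s-j\<^esup>\<close> as \<open>N \<rightarrow> \<infinity>\<close>. The constant term \<open>L\<close> is unique if no exponent
  \<open>s - j\<close> vanishes.
\<close>

definition has_constant_term :: "complex \<Rightarrow> (nat \<Rightarrow> complex) \<Rightarrow> complex \<Rightarrow> bool" where
  "has_constant_term s f L \<longleftrightarrow>
     (\<exists>b. \<forall>J. (\<lambda>N. f N - L - (\<Sum>j<J. b j * of_nat N powr (s - of_nat j)))
                \<in> O(\<lambda>N. of_real (real N powr (Re s - real J))))"

definition nct_TR ::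
    "'n::finite cocycle \<Rightarrow> ('n coeffs \<Rightarrow> 'n::finite coeffs) \<Rightarrow> complex" where
  "nct_TR c A = (THE L. \<exists>\<omega> m \<sigma> \<tau>.
     nct_classical_op c A \<omega> m \<sigma> \<tau> \<and> m \<notin> of_int ` {- int CARD('n)..} \<and>
     has_constant_term (m + of_nat CARD('n))
       (\<lambda>N. \<Sum>k | \<forall>i. \<bar>k $ i\<bar> \<le> int N. nct_trace (\<sigma> (lattice_vec k))) L)"


section \<open>Wodzicki residue\<close>

text \<open>
  Surface measure of the unit sphere: the measure of a Borel set \<open>E\<close> of unit vectors is
  \<open>n\<close> times the Lebesgue measure of the cone \<open>{t x | x \<in> E \<and> 0 < t < 1}\<close>.
\<close>

definition sphere_measure :: "'a::euclidean_space measure" where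
  "sphere_measure =
     scale_measure (of_nat DIM('a)) (distr (restrict_space lborel (ball 0 1 - {0})) borel sgn)"

definition nct_sphere_integral :: "(real ^ 'n \<Rightarrow> 'n::finite coeffs) \<Rightarrow> complex" where
  "nct_sphere_integral f = (LINT \<xi>|sphere_measure. nct_trace (f \<xi>))"

definition nct_component ::
    "complex \<Rightarrow> (nat \<Rightarrow> real ^ 'n \<Rightarrow> 'n::finite coeffs) \<Rightarrow> complex \<Rightarrow> real ^ 'n \<Rightarrow> 'n coeffs" where
  "nct_component m \<tau> s =
     (if \<exists>j::nat. m - of_nat j = s then \<tau> (THE j. m - of_nat j = s) else (\<lambda>_ _. 0))"

definition nct_Res ::
    "'n::finite cocycle \<Rightarrow> ('n coeffs \<Rightarrow> 'n::finite coeffs) \<Rightarrow> complex" where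
  "nct_Res c A = (THE r. \<exists>\<omega> m \<sigma> \<tau>.
     nct_classical_op c A \<omega> m \<sigma> \<tau> \<and>
     r = nct_sphere_integral (nct_component m \<tau> (- of_nat CARD('n))))"

definition nct_component_deriv ::
    "(nat \<Rightarrow> complex \<Rightarrow> real ^ 'n \<Rightarrow> 'n::finite coeffs) \<Rightarrow> nat \<Rightarrow> complex \<Rightarrow> real ^ 'n \<Rightarrow> 'n coeffs" where
  "nct_component_deriv \<tau> j z0 = (\<lambda>\<xi> k. deriv (\<lambda>z. \<tau> j z \<xi> k) z0)"

text \<open>
  Residue of an operator \<open>B\<close> that is the derivative \<open>A'(z0)\<close> of a holomorphic family. In general
  \<open>\<partial>\<^sub>z \<sigma>\<^bsub>\<alpha>(z)-j\<^esub>(z)\<close> at \<open>z0\<close> is homogeneous only up to a multiple of \<open>log \<bar>\<xi>\<bar>\<close>; the residue is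
  defined when this logarithmic term is absent in degree \<open>- n\<close>.
\<close>

definition nct_has_deriv_Res ::
    "'n::finite cocycle \<Rightarrow> ('n coeffs \<Rightarrow> 'n::finite coeffs) \<Rightarrow> complex \<Rightarrow> bool" where
  "nct_has_deriv_Res c B r \<longleftrightarrow> (\<exists>q a A \<sigma> \<tau> z0 j.
     0 < q \<and> nct_family_symbol c q a A \<sigma> \<tau> \<and> B = nct_family_deriv A z0 \<and>
     nct_order q a z0 - of_nat j = - of_nat CARD('n) \<and>
     nct_homogeneous (- of_nat CARD('n)) (nct_component_deriv \<tau> j z0) \<and>
     r = nct_sphere_integral (nct_component_deriv \<tau> j z0))"

definition nct_deriv_Res ::
    "'n::finite cocycle \<Rightarrow> ('n coeffs \<Rightarrow> 'n::finite coeffs) \<Rightarrow> complex" where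
  "nct_deriv_Res c B = (THE r. nct_has_deriv_Res c B r)"

text \<open>Constant term of the Laurent expansion.\<close>

definition finite_part :: "(complex \<Rightarrow> complex) \<Rightarrow> complex \<Rightarrow> complex" where
  "finite_part f z = fls_nth (laurent_expansion f z) 0"

end

theory Submission
  imports Defs
begin

text \<open>
  In the left regular representation the coefficients of an element are bounded by its norm, so
  everything reduces to the scalar symbols \<open>\<xi> \<mapsto> \<t>(\<sigma>(z)(\<xi>))\<close>. The value of a smooth
  function at a lattice point is, up to a remainder of any prescribed decay, a combination of
  averages of its derivatives over the surrounding unit cell; hence the sum of a homogeneous function
  over a cube of lattice points is a sum of integrals over a cube. Rescaling such a function changes
  it by a function of compact support only, which does not contribute to the integrals of its
  derivatives. So the derivative terms are homogeneous in the side length, and the integral of a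
  function of degree \<open>s\<close> itself contributes the constant \<open>- S / (s + n)\<close>, where \<open>S\<close> is its
  integral over the unit sphere. This is the only source of poles: at \<open>d\<^sub>j\<close> the residue is
  \<open>S / q\<close>, and the finite part is \<open>1 / q\<close> times the derivative of \<open>S\<close> up to the regularised
  sum of the symbol at \<open>d\<^sub>j\<close>. For a differential operator the symbol is a polynomial, whose
  regularised sum over the lattice is zero.
\<close>

section \<open>Lattice points\<close>

text \<open>Two obstacles shape the development. The components are singular at the origin, whereas
  cell averages and Taylor expansions need functions that are smooth everywhere. Each component
  therefore enters multiplied by the cut-off, with its derivatives obtained as differences of those
  of two consecutive remainders of the symbol. The price is that homogeneity holds only outside the
  unit ball and that integrals over that ball enter the regular part. The constant
  \<open>- S / (s + n)\<close> comes from the inner end of the shell between the unit sphere and the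
  sphere of radius R, whose integral is \<open>S * (R powr (s + n) - 1) / (s + n)\<close>. Second,
  trace and residues are definite descriptions over all symbols, orders and families presenting the
  same operator. An operator fixes its symbol only on the lattice, so two presentations are compared
  along the multiples \<open>N l\<close> of a lattice point; there uniqueness of expansions in
  complex powers, logarithms included, identifies the components. For a polynomial the ball
  integrals do not disappear: they evaluate to \<open>S / (j - i)\<close> and cancel exactly the
  polar terms of the other components at \<open>d j\<close>, which is why the regularised sum is
  zero.\<close>

definition lattice_box :: "nat \<Rightarrow> (int ^ 'n::finite) set" where
  "lattice_box N = {k. \<forall>i. \<bar>k $ i\<bar> \<le> int N}"

lemma sum_lattice_box_prod:
  fixes f :: "int \<Rightarrow> 'a::comm_semiring_1"
  shows "finite (lattice_box N :: (int ^ 'n::finite) set)"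
    and "(\<Sum>k\<in>(lattice_box N :: (int ^ 'n) set). \<Prod>i\<in>UNIV. f (k $ i)) =
      (\<Sum>j=- int N..int N. f j) ^ CARD('n)"
proof -
  have bij: "bij_betw vec_lambda (UNIV \<rightarrow>\<^sub>E {- int N..int N}) (lattice_box N :: (int ^ 'n) set)"
    by (rule bij_betw_byWitness[where f' = vec_nth])
      (auto simp: lattice_box_def PiE_def Pi_def abs_le_iff minus_le_iff)
  have "finite ((UNIV :: 'n set) \<rightarrow>\<^sub>E {- int N..int N})"
    by (intro finite_PiE) auto
  then show "finite (lattice_box N :: (int ^ 'n::finite) set)"
    using bij bij_betw_finite by blast
  have "(\<Sum>k\<in>(lattice_box N :: (int ^ 'n) set). \<Prod>i\<in>UNIV. f (k $ i)) =
      (\<Sum>g\<in>(UNIV :: 'n set) \<rightarrow>\<^sub>E {- int N..int N}. \<Prod>i\<in>UNIV. f (g i))"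
    by (subst sum.reindex_bij_betw[OF bij, symmetric]) simp
  also have "\<dots> = (\<Prod>i\<in>(UNIV :: 'n set). \<Sum>j=- int N..int N. f j)"
    by (subst prod_sum_PiE) auto
  finally show "(\<Sum>k\<in>(lattice_box N :: (int ^ 'n) set). \<Prod>i\<in>UNIV. f (k $ i)) =
      (\<Sum>j=- int N..int N. f j) ^ CARD('n)" by simp
qed

lemma lattice_box_mono: "M \<le> N \<Longrightarrow> lattice_box M \<subseteq> lattice_box N"
  unfolding lattice_box_def by (auto intro: order_trans)

lemma finite_subset_lattice_box:
  fixes F :: "(int ^ 'n::finite) set"
  assumes "finite F"
  shows "\<exists>N. F \<subseteq> lattice_box N"
  using assms
proof (induction F)
  case (insert k F)
  then obtain N where N: "F \<subseteq> lattice_box N" by blast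
  define M where "M = Max (range (\<lambda>i. nat \<bar>k $ i\<bar>))"
  have "nat \<bar>k $ i\<bar> \<le> M" for i
    unfolding M_def by (rule Max_ge) auto
  then have "k \<in> lattice_box M"
    by (auto simp: lattice_box_def) (metis nat_le_iff)
  then have "insert k F \<subseteq> lattice_box (max M N)"
    using N lattice_box_mono[of M "max M N"] lattice_box_mono[of N "max M N"] by auto
  then show ?case by blast
qed simp

text \<open>The bare bound 3 does not pass through the induction. With
  \<open>2 / (real N + 1)\<close> subtracted it telescopes: the two new summands add 2/(N+2)^2,
  which is at most 2/(N+1) - 2/(N+2). The constant 3 makes N = 0 an equality.\<close>

lemma sum_inverse_square_int_le:
  "(\<Sum>j=- int N..int N. 1 / (1 + real_of_int \<bar>j\<bar>)\<^sup>2) \<le> 3 - 2 / (real N + 1)"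
proof (induction N)
  case (Suc N)
  have "{- int (Suc N)..int (Suc N)} = insert (- int (Suc N)) (insert (int (Suc N)) {- int N..int N})"
    by auto
  then have "(\<Sum>j=- int (Suc N)..int (Suc N). 1 / (1 + real_of_int \<bar>j\<bar>)\<^sup>2) =
      2 / (real N + 2)\<^sup>2 + (\<Sum>j=- int N..int N. 1 / (1 + real_of_int \<bar>j\<bar>)\<^sup>2)"
    by (simp add: add.commute)
  also have "2 / (real N + 2)\<^sup>2 \<le> 2 / (real N + 1) - 2 / (real N + 2)"
  proof -
    have "2 / (real N + 2)\<^sup>2 \<le> 2 / ((real N + 1) * (real N + 2))"
      by (intro divide_left_mono) (auto simp: power2_eq_square)
    also have "\<dots> = 2 / (real N + 1) - 2 / (real N + 2)"
      by (simp add: field_simps)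
    finally show ?thesis .
  qed
  finally show ?case using Suc by (simp add: add.commute)
qed simp

lemma norm_lattice_vec_ge: "\<bar>real_of_int (k $ i)\<bar> \<le> norm (lattice_vec k)"
  using component_le_norm_cart[of "lattice_vec k" i] by (simp add: lattice_vec_def)

lemma norm_lattice_vec_ge_1:
  assumes "k \<noteq> 0" shows "1 \<le> norm (lattice_vec k)"
proof -
  obtain i where "k $ i \<noteq> 0" using assms by (auto simp: vec_eq_iff)
  then have "1 \<le> \<bar>k $ i\<bar>" by auto
  then have "1 \<le> \<bar>real_of_int (k $ i)\<bar>" by linarith
  then show ?thesis using norm_lattice_vec_ge[of k i] by linarith
qed

text \<open>Each factor \<open>1 + norm (lattice_vec k)\<close> dominates 1 + |k_i|, so the exponent
  2n hands a square to every coordinate, and partial sums are at most the n-th power of a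
  one-dimensional sum. This exponent is the source of every margin \<open>2 * real CARD('n)\<close>
  below.\<close>

lemma summable_lattice_weight:
  "(\<lambda>k::int ^ 'n::finite. 1 / (1 + norm (lattice_vec k)) ^ (2 * CARD('n))) summable_on UNIV"
proof (rule nonneg_bdd_above_summable_on)
  show "bdd_above (sum (\<lambda>k::int ^ 'n. 1 / (1 + norm (lattice_vec k)) ^ (2 * CARD('n))) `
      {F. F \<subseteq> UNIV \<and> finite F})"
  proof (rule bdd_aboveI2)
    fix F :: "(int ^ 'n) set" assume "F \<in> {F. F \<subseteq> UNIV \<and> finite F}"
    then obtain N where N: "F \<subseteq> lattice_box N" using finite_subset_lattice_box by blast
    let ?w = "\<lambda>j::int. 1 / (1 + real_of_int \<bar>j\<bar>)\<^sup>2"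
    have le: "1 / (1 + norm (lattice_vec k)) ^ (2 * CARD('n)) \<le> (\<Prod>i\<in>UNIV. ?w (k $ i))"
      for k :: "int ^ 'n"
    proof -
      have "0 < 1 + norm (lattice_vec k)" by (simp add: add_pos_nonneg)
      then have "(\<Prod>i\<in>(UNIV::'n set). 1 / (1 + norm (lattice_vec k))\<^sup>2) \<le> (\<Prod>i\<in>UNIV. ?w (k $ i))"
        using norm_lattice_vec_ge[of k]
        by (intro prod_mono conjI divide_left_mono power_mono) auto
      then show ?thesis by (simp add: power_mult power_divide)
    qed
    have "sum (\<lambda>k::int ^ 'n. 1 / (1 + norm (lattice_vec k)) ^ (2 * CARD('n))) F \<le>
        sum (\<lambda>k::int ^ 'n. 1 / (1 + norm (lattice_vec k)) ^ (2 * CARD('n))) (lattice_box N)"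
      using N by (intro sum_mono2 sum_lattice_box_prod) auto
    also have "\<dots> \<le> (\<Sum>k\<in>lattice_box N. \<Prod>i\<in>(UNIV::'n set). ?w (k $ i))"
      by (intro sum_mono le)
    also have "\<dots> = (\<Sum>j=- int N..int N. ?w j) ^ CARD('n)"
      by (rule sum_lattice_box_prod)
    also have "\<dots> \<le> 3 ^ CARD('n)"
    proof (rule power_mono)
      have "0 \<le> 2 / (real N + 1)" by simp
      then show "(\<Sum>j=- int N..int N. ?w j) \<le> 3"
        using sum_inverse_square_int_le[of N] by linarith
    qed (intro sum_nonneg, simp)
    finally show "sum (\<lambda>k::int ^ 'n. 1 / (1 + norm (lattice_vec k)) ^ (2 * CARD('n))) F \<le> 3 ^ CARD('n)" .
  qed
qed auto

section \<open>The left regular representation\<close>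

no_notation Infinite_Set_Sum.abs_summable_on (infix \<open>abs'_summable'_on\<close> 50)

section \<open>Square-summable sequences and convolution\<close>

lemma infsum_Cauchy_Schwarz:
  fixes f g :: "'a \<Rightarrow> real"
  assumes f: "(\<lambda>k. (f k)\<^sup>2) summable_on A" and g: "(\<lambda>k. (g k)\<^sup>2) summable_on A"
    and nonneg: "\<And>k. 0 \<le> f k" "\<And>k. 0 \<le> g k"
  shows "(\<lambda>k. f k * g k) summable_on A"
    and "(\<Sum>\<^sub>\<infinity>k\<in>A. f k * g k) \<le> sqrt (\<Sum>\<^sub>\<infinity>k\<in>A. (f k)\<^sup>2) * sqrt (\<Sum>\<^sub>\<infinity>k\<in>A. (g k)\<^sup>2)"
proof -
  have "(\<lambda>k. f k * g k) abs_summable_on A"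
  proof (rule Infinite_Sum.abs_summable_product)
    have sq: "norm (t * t) = t\<^sup>2" for t :: real
      by (simp only: power2_eq_square[symmetric] real_norm_def abs_power2)
    show "(\<lambda>i. f i * f i) abs_summable_on A" "(\<lambda>i. g i * g i) abs_summable_on A"
      unfolding sq by (rule f, rule g)
  qed
  then show sum: "(\<lambda>k. f k * g k) summable_on A" by (rule Infinite_Sum.abs_summable_summable)
  show "(\<Sum>\<^sub>\<infinity>k\<in>A. f k * g k) \<le> sqrt (\<Sum>\<^sub>\<infinity>k\<in>A. (f k)\<^sup>2) * sqrt (\<Sum>\<^sub>\<infinity>k\<in>A. (g k)\<^sup>2)"
  proof (rule infsum_le_finite_sums[OF sum])
    fix F assume F: "finite F" "F \<subseteq> A"
    have "(\<Sum>k\<in>F. f k * g k)\<^sup>2 \<le> (\<Sum>k\<in>F. (f k)\<^sup>2) * (\<Sum>k\<in>F. (g k)\<^sup>2)"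
      by (rule Cauchy_Schwarz_ineq_sum)
    also have "\<dots> \<le> (\<Sum>\<^sub>\<infinity>k\<in>A. (f k)\<^sup>2) * (\<Sum>\<^sub>\<infinity>k\<in>A. (g k)\<^sup>2)"
      using F f g by (intro mult_mono finite_sum_le_infsum sum_nonneg infsum_nonneg) auto
    finally show "(\<Sum>k\<in>F. f k * g k) \<le> sqrt (\<Sum>\<^sub>\<infinity>k\<in>A. (f k)\<^sup>2) * sqrt (\<Sum>\<^sub>\<infinity>k\<in>A. (g k)\<^sup>2)"
      by (simp add: real_le_rsqrt real_sqrt_mult[symmetric])
  qed
qed

lemma infsum_translate:
  fixes f :: "'a::group_add \<Rightarrow> 'b::{comm_monoid_add,t2_space}"
  shows "(\<Sum>\<^sub>\<infinity>m. f (m - k)) = (\<Sum>\<^sub>\<infinity>m. f m)" "(\<lambda>m. f (m - k)) summable_on UNIV \<longleftrightarrow> f summable_on UNIV"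
  by (rule infsum_reindex_bij_witness[of _ "\<lambda>m. m + k" "\<lambda>m. m - k"]
      summable_on_reindex_bij_witness[of _ "\<lambda>m. m + k" "\<lambda>m. m - k"]; simp)+

lemma infsum_reflect:
  fixes f :: "'a::group_add \<Rightarrow> 'b::{comm_monoid_add,t2_space}"
  shows "(\<Sum>\<^sub>\<infinity>m. f (- m)) = (\<Sum>\<^sub>\<infinity>m. f m)" "(\<lambda>m. f (- m)) summable_on UNIV \<longleftrightarrow> f summable_on UNIV"
  by (rule infsum_reindex_bij_witness[of _ uminus uminus]
      summable_on_reindex_bij_witness[of _ uminus uminus]; simp)+

text \<open>Tonelli: translation invariance makes the inner sum over m equal to
  \<open>norm (a k)\<close> times the sum of the norms of \<open>x\<close>. The interchanges of sums
  in the representation rest on this.\<close>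

lemma convolution_abs_summable:
  fixes a x :: "'a::group_add \<Rightarrow> 'b::real_normed_field"
  assumes a: "a abs_summable_on UNIV" and x: "x abs_summable_on UNIV"
  shows "(\<lambda>(k, m). a k * x (m - k)) abs_summable_on UNIV \<times> UNIV"
proof -
  have 1: "(\<lambda>m. norm (a k * x (m - k))) summable_on UNIV" for k
    using infsum_translate(2)[of "\<lambda>m. norm (x m)" k] x
    by (auto simp: norm_mult intro: summable_on_cmult_right)
  have 2: "(\<Sum>\<^sub>\<infinity>m. norm (a k * x (m - k))) = norm (a k) * (\<Sum>\<^sub>\<infinity>m. norm (x m))" for k
    using infsum_translate(1)[of "\<lambda>m. norm (x m)" k]
    by (simp add: norm_mult infsum_cmult_right')
  have "(\<lambda>k. norm (a k) * (\<Sum>\<^sub>\<infinity>m. norm (x m))) summable_on UNIV"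
    using a by (rule summable_on_cmult_left)
  then show ?thesis
    unfolding Infinite_Sum.abs_summable_on_Sigma_iff using 1 2 by (simp add: infsum_nonneg abs_mult)
qed

lemma abs_summable_norm_le: "x abs_summable_on UNIV \<Longrightarrow> norm (x k) \<le> (\<Sum>\<^sub>\<infinity>m. norm (x m))"
  using finite_sum_le_infsum[of "\<lambda>k. norm (x k)" UNIV "{k}"] by simp

lemma abs_summable_square:
  assumes "x abs_summable_on UNIV"
  shows "(\<lambda>k. (norm (x k))\<^sup>2) summable_on UNIV"
proof (rule summable_on_comparison_test)
  show "(\<lambda>k. (\<Sum>\<^sub>\<infinity>m. norm (x m)) * norm (x k)) summable_on UNIV"
    using assms by (rule summable_on_cmult_right)
qed (use abs_summable_norm_le[OF assms] in \<open>auto simp: power2_eq_square intro: mult_right_mono\<close>)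

text \<open>Vectors are always taken absolutely summable, a dense subspace of the square-summable
  ones that left multiplication preserves. The double sums then converge absolutely and no
  completion enters.\<close>

definition l2_norm :: "('a \<Rightarrow> complex) \<Rightarrow> real" where
  "l2_norm x = sqrt (\<Sum>\<^sub>\<infinity>k. (norm (x k))\<^sup>2)"

definition l2_inner :: "('a \<Rightarrow> complex) \<Rightarrow> ('a \<Rightarrow> complex) \<Rightarrow> complex" where
  "l2_inner x y = (\<Sum>\<^sub>\<infinity>k. x k * cnj (y k))"

lemma l2_norm_nonneg: "0 \<le> l2_norm x"
  by (simp add: l2_norm_def infsum_nonneg)

lemma l2_norm_sq: "(l2_norm x)\<^sup>2 = (\<Sum>\<^sub>\<infinity>k. (norm (x k))\<^sup>2)"
  by (simp add: l2_norm_def infsum_nonneg)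

lemma norm_le_l2_norm:
  assumes "x abs_summable_on UNIV"
  shows "norm (x k) \<le> l2_norm x"
proof -
  have "(norm (x k))\<^sup>2 \<le> (l2_norm x)\<^sup>2"
    using finite_sum_le_infsum[OF abs_summable_square[OF assms], of "{k}"] by (simp add: l2_norm_sq)
  then show ?thesis using l2_norm_nonneg power2_le_imp_le by blast
qed

lemma l2_inner_self:
  assumes "x abs_summable_on UNIV"
  shows "l2_inner x x = of_real ((l2_norm x)\<^sup>2)"
proof -
  have "((\<lambda>k. complex_of_real ((norm (x k))\<^sup>2)) has_sum of_real ((l2_norm x)\<^sup>2)) UNIV"
    unfolding l2_norm_sq by (intro has_sum_of_real has_sum_infsum abs_summable_square assms)
  then show ?thesis
    unfolding l2_inner_def by (intro infsumI) (simp only: complex_norm_square)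
qed

lemma norm_l2_inner_le:
  assumes "x abs_summable_on UNIV" "y abs_summable_on UNIV"
  shows "norm (l2_inner x y) \<le> l2_norm x * l2_norm y"
proof -
  note cs = infsum_Cauchy_Schwarz[OF abs_summable_square[OF assms(1)] abs_summable_square[OF assms(2)]]
  have "norm (l2_inner x y) \<le> (\<Sum>\<^sub>\<infinity>k. norm (x k) * norm (y k))"
    unfolding l2_inner_def using cs(1) by (intro order_trans[OF norm_infsum_bound]) (simp_all add: norm_mult)
  then show ?thesis using cs(2) by (simp add: l2_norm_def)
qed

lemma l2_norm_add:
  assumes x: "x abs_summable_on UNIV" and y: "y abs_summable_on UNIV"
  shows "l2_norm (\<lambda>k. x k + y k) \<le> l2_norm x + l2_norm y"
proof -
  note cs = infsum_Cauchy_Schwarz[OF abs_summable_square[OF x] abs_summable_square[OF y]]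
  note sx = abs_summable_square[OF x] and sy = abs_summable_square[OF y]
  have s: "(\<lambda>k. (norm (x k))\<^sup>2 + (norm (y k))\<^sup>2 + 2 * (norm (x k) * norm (y k))) summable_on UNIV"
    by (intro summable_on_add sx sy summable_on_cmult_right cs(1)) auto
  have le: "(norm (x k + y k))\<^sup>2 \<le> (norm (x k))\<^sup>2 + (norm (y k))\<^sup>2 + 2 * (norm (x k) * norm (y k))" for k
  proof -
    have "(norm (x k + y k))\<^sup>2 \<le> (norm (x k) + norm (y k))\<^sup>2"
      by (intro power_mono norm_triangle_ineq) auto
    then show ?thesis by (simp add: power2_sum)
  qed
  have xy: "(\<lambda>k. x k + y k) abs_summable_on UNIV"
    by (rule summable_on_comparison_test[OF summable_on_add[OF x y]]) (auto intro: norm_triangle_ineq)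
  have "(l2_norm (\<lambda>k. x k + y k))\<^sup>2 \<le>
      (\<Sum>\<^sub>\<infinity>k. (norm (x k))\<^sup>2 + (norm (y k))\<^sup>2 + 2 * (norm (x k) * norm (y k)))"
    unfolding l2_norm_sq by (rule infsum_mono[OF abs_summable_square[OF xy] s le])
  also have "\<dots> = (l2_norm x)\<^sup>2 + (l2_norm y)\<^sup>2 + 2 * (\<Sum>\<^sub>\<infinity>k. norm (x k) * norm (y k))"
    using sx sy cs(1) by (simp add: infsum_add summable_on_add summable_on_cmult_right infsum_cmult_right' l2_norm_sq)
  also have "\<dots> \<le> (l2_norm x)\<^sup>2 + (l2_norm y)\<^sup>2 + 2 * (l2_norm x * l2_norm y)"
    using cs(2) by (simp add: l2_norm_def)
  finally have "(l2_norm (\<lambda>k. x k + y k))\<^sup>2 \<le> (l2_norm x + l2_norm y)\<^sup>2"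
    by (simp add: power2_sum)
  then show ?thesis
    by (rule power2_le_imp_le) (simp add: l2_norm_nonneg)
qed

lemma l2_norm_scale: "l2_norm (\<lambda>k. w * x k) = norm w * l2_norm x"
  by (simp add: l2_norm_def norm_mult power_mult_distrib infsum_cmult_right' real_sqrt_mult)

lemma smooth_abs_summable:
  assumes "a \<in> nct_smooth_algebra"
  shows "a abs_summable_on (UNIV :: (int ^ 'n::finite) set)"
proof -
  obtain C where C: "norm (a k) * (1 + norm (lattice_vec k)) ^ (2 * CARD('n)) \<le> C" for k
    using assms unfolding nct_smooth_algebra_def by blast
  have "(\<lambda>k::int^'n. C * (1 / (1 + norm (lattice_vec k)) ^ (2 * CARD('n)))) summable_on UNIV"
    by (intro summable_on_cmult_right summable_lattice_weight)
  then show ?thesis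
  proof (rule summable_on_comparison_test)
    show "norm (a k) \<le> C * (1 / (1 + norm (lattice_vec k)) ^ (2 * CARD('n)))" for k
    proof -
      have "0 < (1 + norm (lattice_vec k)) ^ (2 * CARD('n))" by (simp add: add_pos_nonneg)
      then show ?thesis using C[of k] by (simp add: pos_le_divide_eq)
    qed
  qed auto
qed

section \<open>Left multiplication as a star-representation on sequences\<close>

context
  fixes \<theta> :: "real ^ 'n::finite ^ 'n" and c :: "'n cocycle"
  assumes cocycle: "nct_cocycle \<theta> c"
begin

lemma norm_cocycle: "norm (c k l) = 1"
  and cocycle_0: "c 0 k = 1" "c k 0 = 1"
  and cocycle_assoc: "c k l * c (k + l) m = c k (l + m) * c l m"
  using cocycle unfolding nct_cocycle_def by blast+

text \<open>The bounded weight \<open>w\<close> absorbs the cocycle together with the values of a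
  third sequence, so that associativity and the adjoint relation, which involve three sequences, are
  covered by double sums.\<close>

lemma mult_pair_summable:
  fixes a b :: "'n coeffs"
  assumes "a abs_summable_on UNIV" "b abs_summable_on UNIV" and "\<And>k m. norm (w k m) \<le> B"
  shows "(\<lambda>(k, m). a k * b (m - k) * w k m) abs_summable_on UNIV \<times> UNIV"
proof -
  have B: "0 \<le> B" using assms(3)[of undefined undefined] norm_ge_zero order_trans by blast
  have "(\<lambda>p. B * norm (case p of (k, m) \<Rightarrow> a k * b (m - k))) summable_on UNIV \<times> UNIV"
    using convolution_abs_summable[OF assms(1,2)] by (intro summable_on_cmult_right) simp
  then show ?thesis
    by (rule summable_on_comparison_test)
      (use assms(3) B in \<open>auto simp: norm_mult mult.commute intro!: mult_right_mono\<close>)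
qed

lemma nct_mult_summable:
  assumes "a abs_summable_on UNIV" "b abs_summable_on UNIV"
  shows "(\<lambda>k. a k * b (m - k) * c k (m - k)) abs_summable_on UNIV"
proof -
  have "(\<lambda>k. (\<Sum>\<^sub>\<infinity>m. norm (b m)) * norm (a k)) summable_on UNIV"
    using assms by (intro summable_on_cmult_right) simp
  then show ?thesis
    by (rule summable_on_comparison_test)
      (use abs_summable_norm_le[OF assms(2)] in \<open>auto simp: norm_mult norm_cocycle mult.commute intro!: mult_left_mono\<close>)
qed

lemma norm_nct_mult_le:
  assumes "a abs_summable_on UNIV" "b abs_summable_on UNIV"
  shows "norm (nct_mult c a b m) \<le> (\<Sum>\<^sub>\<infinity>k. norm (a k) * norm (b (m - k)))"
    using norm_infsum_bound[OF nct_mult_summable[OF assms, of m]]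
    by (simp add: nct_mult_def norm_mult norm_cocycle)

lemma abs_summable_nct_mult:
  assumes "a abs_summable_on UNIV" "b abs_summable_on UNIV"
  shows "nct_mult c a b abs_summable_on UNIV"
proof -
  have "(\<lambda>(m, k). a k * b (m - k)) abs_summable_on UNIV \<times> UNIV"
    using summable_on_swap[of "\<lambda>p. norm (case p of (k, m) \<Rightarrow> a k * b (m - k))" UNIV UNIV]
      convolution_abs_summable[OF assms] by (simp add: case_prod_unfold o_def)
  then have "(\<lambda>m. \<Sum>\<^sub>\<infinity>k. norm (a k) * norm (b (m - k))) abs_summable_on UNIV"
    unfolding Infinite_Sum.abs_summable_on_Sigma_iff by (simp add: norm_mult)
  then show ?thesis
    by (rule Infinite_Sum.abs_summable_on_comparison_test)
      (use norm_nct_mult_le[OF assms] in \<open>fastforce intro: order_trans\<close>)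
qed

lemma nct_mult_assoc:
  assumes a: "a abs_summable_on UNIV" and b: "b abs_summable_on UNIV" and x: "x abs_summable_on UNIV"
  shows "nct_mult c (nct_mult c a b) x = nct_mult c a (nct_mult c b x)"
proof
  fix m
  let ?F = "\<lambda>k j. a k * b (j - k) * (c k (j - k) * (x (m - j) * c j (m - j)))"
  have sum: "(\<lambda>(k, j). ?F k j) summable_on UNIV \<times> UNIV"
    by (rule Infinite_Sum.abs_summable_summable[OF mult_pair_summable[OF a b, where B = "\<Sum>\<^sub>\<infinity>m. norm (x m)"]])
      (simp add: norm_mult norm_cocycle abs_summable_norm_le[OF x])
  have "nct_mult c (nct_mult c a b) x m = (\<Sum>\<^sub>\<infinity>j. \<Sum>\<^sub>\<infinity>k. ?F k j)"
    unfolding nct_mult_def infsum_cmult_left'[symmetric] by (simp only: mult.assoc)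
  also have "\<dots> = (\<Sum>\<^sub>\<infinity>k. \<Sum>\<^sub>\<infinity>j. ?F k j)"
    by (rule infsum_swap_banach[symmetric, OF sum])
  also have "\<dots> = (\<Sum>\<^sub>\<infinity>k. \<Sum>\<^sub>\<infinity>i. ?F k (i + k))"
    using infsum_translate(1)[of "\<lambda>i. ?F k (i + k)" k for k]
    by (simp only: diff_add_cancel)
  also have "\<dots> = (\<Sum>\<^sub>\<infinity>k. \<Sum>\<^sub>\<infinity>i. a k * (b i * x (m - k - i) * c i (m - k - i)) * c k (m - k))"
  proof (intro infsum_cong)
    fix k i
    show "?F k (i + k) = a k * (b i * x (m - k - i) * c i (m - k - i)) * c k (m - k)"
    proof -
    \<comment> \<open>Associativity of the product is the cocycle identity at \<open>k\<close>,
      \<open>i\<close> and \<open>m - (i + k)\<close>, after the substitution j = i + k.\<close>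
    have "c k i * c (i + k) (m - (i + k)) = c k (m - k) * c i (m - k - i)"
      using cocycle_assoc[of k i "m - (i + k)"] by (simp add: add.commute diff_diff_eq algebra_simps)
    then have "?F k (i + k) = a k * b i * x (m - k - i) * (c k (m - k) * c i (m - k - i))"
      by (simp add: diff_diff_eq add.commute mult_ac)
    then show ?thesis by (simp add: mult_ac)
    qed
  qed
  finally show "nct_mult c (nct_mult c a b) x m = nct_mult c a (nct_mult c b x) m"
    unfolding nct_mult_def by (simp add: infsum_cmult_left' infsum_cmult_right')
qed

lemma cocycle_neg: "c (- k) k = c k (- k)"
  using cocycle_assoc[of k "- k" k] by (simp add: cocycle_0)

lemma cocycle_cnj: "cnj (c k l) * c k l = 1" "c k l * cnj (c k l) = 1"
  using complex_norm_square[of "c k l"] by (simp_all add: norm_cocycle mult.commute)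

lemma nct_star_star: "nct_star c (nct_star c a) = a"
proof
  fix k
  have "nct_star c (nct_star c a) k = (cnj (c (- k) k) * c (- k) k) * a k"
    by (simp add: nct_star_def cocycle_neg mult.assoc)
  then show "nct_star c (nct_star c a) k = a k" by (simp add: cocycle_cnj)
qed

lemma abs_summable_nct_star:
  assumes "a abs_summable_on UNIV" shows "nct_star c a abs_summable_on UNIV"
  using assms infsum_reflect(2)[of "\<lambda>k. norm (a k)"]
  by (simp add: nct_star_def norm_mult norm_cocycle)

text \<open>The change of variables m = j + k followed by the reflection of k matches the two double
  sums; the remaining identity of scalars is the cocycle relation at \<open>- k\<close>,
  \<open>k\<close>, \<open>j - k\<close>. This makes left multiplication a
  star-representation.\<close>

lemma l2_inner_nct_mult:
  assumes a: "a abs_summable_on UNIV" and x: "x abs_summable_on UNIV" and y: "y abs_summable_on UNIV"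
  shows "l2_inner (nct_mult c a x) y = l2_inner x (nct_mult c (nct_star c a) y)"
proof -
  let ?F = "\<lambda>k m. a k * x (m - k) * (c k (m - k) * cnj (y m))"
  have s: "(\<lambda>(k, m). ?F k m) summable_on UNIV \<times> UNIV"
    by (rule Infinite_Sum.abs_summable_summable[OF mult_pair_summable[OF a x, where B = "\<Sum>\<^sub>\<infinity>m. norm (y m)"]])
      (simp add: norm_mult norm_cocycle abs_summable_norm_le[OF y])
  have s': "(\<lambda>(k, j). ?F k (j + k)) summable_on UNIV \<times> UNIV"
    using s by (subst summable_on_reindex_bij_witness[of _ "\<lambda>(k, m). (k, m - k)" "\<lambda>(k, j). (k, j + k)"]) auto
  have "l2_inner (nct_mult c a x) y = (\<Sum>\<^sub>\<infinity>m. \<Sum>\<^sub>\<infinity>k. ?F k m)"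
    unfolding nct_mult_def l2_inner_def infsum_cmult_left'[symmetric] by (simp only: mult.assoc)
  also have "\<dots> = (\<Sum>\<^sub>\<infinity>k. \<Sum>\<^sub>\<infinity>m. ?F k m)"
    by (rule infsum_swap_banach[symmetric, OF s])
  also have "\<dots> = (\<Sum>\<^sub>\<infinity>k. \<Sum>\<^sub>\<infinity>j. ?F k (j + k))"
    using infsum_translate(1)[of "\<lambda>i. ?F k (i + k)" k for k]
    by (simp only: diff_add_cancel)
  also have "\<dots> = (\<Sum>\<^sub>\<infinity>j. \<Sum>\<^sub>\<infinity>k. ?F k (j + k))"
    by (rule infsum_swap_banach[OF s'])
  also have "\<dots> = (\<Sum>\<^sub>\<infinity>j. \<Sum>\<^sub>\<infinity>k. ?F (- k) (j + (- k)))"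
    by (intro infsum_cong infsum_reflect(1)[symmetric])
  also have "\<dots> = (\<Sum>\<^sub>\<infinity>j. \<Sum>\<^sub>\<infinity>k. x j * cnj (nct_star c a k * y (j - k) * c k (j - k)))"
  proof (intro infsum_cong)
    fix j k
    show "?F (- k) (j + (- k)) = x j * cnj (nct_star c a k * y (j - k) * c k (j - k))"
    proof -
    have "c (- k) k * 1 = c (- k) j * c k (j - k)"
      using cocycle_assoc[of "- k" k "j - k"] by (simp add: cocycle_0)
    then have "c (- k) k * cnj (c k (j - k)) = c (- k) j"
      by (simp add: mult.assoc cocycle_cnj)
    then show ?thesis
      by (simp add: nct_star_def diff_conv_add_uminus[symmetric] mult_ac del: diff_conv_add_uminus)
    qed
  qed
  finally show ?thesis
    unfolding l2_inner_def nct_mult_def by (simp only: infsum_cmult_right' infsum_cnj)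
qed

text \<open>Young's inequality for l1 and l2: |a| is split into two square roots, Cauchy-Schwarz is
  applied at each m, and the result is summed over m with Tonelli.\<close>

lemma l2_norm_nct_mult_le:
  assumes a: "a abs_summable_on UNIV" and x: "x abs_summable_on UNIV"
  shows "l2_norm (nct_mult c a x) \<le> (\<Sum>\<^sub>\<infinity>k. norm (a k)) * l2_norm x"
proof -
  let ?S = "\<Sum>\<^sub>\<infinity>k. norm (a k)"
  let ?G = "\<lambda>k m. norm (a k) * (norm (x (m - k)))\<^sup>2"
  have S: "0 \<le> ?S" by (simp add: infsum_nonneg)
  have G: "(\<lambda>(k, m). ?G k m) abs_summable_on UNIV \<times> UNIV"
    using convolution_abs_summable[of "\<lambda>k. norm (a k)" "\<lambda>k. (norm (x k))\<^sup>2"] a abs_summable_square[OF x]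
    by simp
  have G1: "(\<lambda>(k, m). ?G k m) summable_on UNIV \<times> UNIV"
    by (rule Infinite_Sum.abs_summable_summable[OF G])
  have G2: "(\<lambda>(m, k). ?G k m) summable_on UNIV \<times> UNIV"
    using summable_on_swap[of "\<lambda>p. (case p of (k, m) \<Rightarrow> ?G k m)" UNIV UNIV] G1
    by (simp add: case_prod_unfold o_def)
  have pt: "(norm (nct_mult c a x m))\<^sup>2 \<le> ?S * (\<Sum>\<^sub>\<infinity>k. ?G k m)" for m
  proof -
    have f: "(\<lambda>k. (sqrt (norm (a k)))\<^sup>2) summable_on UNIV" using a by simp
    have g: "(\<lambda>k. (sqrt (norm (a k)) * norm (x (m - k)))\<^sup>2) summable_on UNIV"
    proof -
      have "(\<lambda>p. norm (case p of (m, k) \<Rightarrow> ?G k m)) summable_on UNIV \<times> UNIV"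
        using G2 by (simp add: case_prod_unfold)
      then show ?thesis
        unfolding Infinite_Sum.abs_summable_on_Sigma_iff by (simp add: power_mult_distrib)
    qed
    have "norm (nct_mult c a x m) \<le> (\<Sum>\<^sub>\<infinity>k. sqrt (norm (a k)) * (sqrt (norm (a k)) * norm (x (m - k))))"
      using norm_nct_mult_le[OF a x, of m] by (simp flip: mult.assoc)
    also have "\<dots> \<le> sqrt ?S * sqrt (\<Sum>\<^sub>\<infinity>k. ?G k m)"
      using infsum_Cauchy_Schwarz(2)[OF f g] by (simp add: power_mult_distrib)
    finally have "(norm (nct_mult c a x m))\<^sup>2 \<le> (sqrt ?S * sqrt (\<Sum>\<^sub>\<infinity>k. ?G k m))\<^sup>2"
      by (intro power_mono) auto
    then show ?thesis using S by (simp add: power_mult_distrib infsum_nonneg)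
  qed
  have "(l2_norm (nct_mult c a x))\<^sup>2 \<le> (\<Sum>\<^sub>\<infinity>m. ?S * (\<Sum>\<^sub>\<infinity>k. ?G k m))"
    unfolding l2_norm_sq
    by (intro infsum_mono abs_summable_square abs_summable_nct_mult a x pt
        summable_on_cmult_right summable_on_Sigma_banach[of "\<lambda>m k. ?G k m"] G2)
  also have "\<dots> = ?S * (\<Sum>\<^sub>\<infinity>k. \<Sum>\<^sub>\<infinity>m. ?G k m)"
    using infsum_swap_banach[OF G1] by (simp add: infsum_cmult_right')
  also have "\<dots> = ?S * (?S * (l2_norm x)\<^sup>2)"
    using infsum_translate(1)[of "\<lambda>m. (norm (x m))\<^sup>2"]
    by (simp add: infsum_cmult_right' infsum_cmult_left' l2_norm_sq)
  finally have "(l2_norm (nct_mult c a x))\<^sup>2 \<le> (?S * l2_norm x)\<^sup>2"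
    by (simp add: power2_eq_square mult_ac)
  then show ?thesis by (rule power2_le_imp_le) (simp add: S l2_norm_nonneg)
qed

text \<open>The operator norm of left multiplication on square-summable sequences, with the supremum
  taken over the absolutely summable vectors of the unit ball.\<close>

definition regular_norm :: "'n coeffs \<Rightarrow> real" where
  "regular_norm a = (SUP x\<in>{x. x abs_summable_on UNIV \<and> l2_norm x \<le> 1}. l2_norm (nct_mult c a x))"

lemma zero_in_l2_ball: "(\<lambda>_. 0) \<in> {x :: 'n coeffs. x abs_summable_on UNIV \<and> l2_norm x \<le> 1}"
  by (simp add: l2_norm_def)

lemma regular_norm_least:
  assumes "\<And>x. x abs_summable_on UNIV \<Longrightarrow> l2_norm x \<le> 1 \<Longrightarrow> l2_norm (nct_mult c a x) \<le> B"
  shows "regular_norm a \<le> B"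
  unfolding regular_norm_def
proof (rule cSUP_least)
  show "{x :: 'n coeffs. x abs_summable_on UNIV \<and> l2_norm x \<le> 1} \<noteq> {}"
    by (rule ex_in_conv[THEN iffD1], rule exI, rule zero_in_l2_ball)
  fix x assume "x \<in> {x :: 'n coeffs. x abs_summable_on UNIV \<and> l2_norm x \<le> 1}"
  then show "l2_norm (nct_mult c a x) \<le> B" using assms[of x] by blast
qed

lemma regular_norm_le_sum:
  assumes "a abs_summable_on UNIV"
  shows "regular_norm a \<le> (\<Sum>\<^sub>\<infinity>k. norm (a k))"
proof (rule regular_norm_least)
  fix x :: "'n coeffs" assume "x abs_summable_on UNIV" "l2_norm x \<le> 1"
  then show "l2_norm (nct_mult c a x) \<le> (\<Sum>\<^sub>\<infinity>k. norm (a k))"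
    using l2_norm_nct_mult_le[OF assms, of x] mult_left_mono[of "l2_norm x" 1 "\<Sum>\<^sub>\<infinity>k. norm (a k)"]
    by (simp add: infsum_nonneg)
qed

lemma nct_mult_scale: "nct_mult c (\<lambda>k. w * a k) x = (\<lambda>m. w * nct_mult c a x m)"
    "nct_mult c a (\<lambda>k. w * x k) = (\<lambda>m. w * nct_mult c a x m)"
proof -
  show "nct_mult c (\<lambda>k. w * a k) x = (\<lambda>m. w * nct_mult c a x m)"
    unfolding nct_mult_def infsum_cmult_right'[symmetric] by (simp only: mult.assoc)
  have "a k * (w * y) * z = w * (a k * y * z)" for k y z by (simp only: mult_ac)
  then show "nct_mult c a (\<lambda>k. w * x k) = (\<lambda>m. w * nct_mult c a x m)"
    unfolding nct_mult_def infsum_cmult_right'[symmetric] by (simp only:)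
qed

lemma bdd_above_regular_norm:
  assumes a: "a abs_summable_on UNIV"
  shows "bdd_above ((\<lambda>x. l2_norm (nct_mult c a x)) ` {x. x abs_summable_on UNIV \<and> l2_norm x \<le> 1})"
proof (rule bdd_aboveI2)
  fix x :: "'n coeffs" assume "x \<in> {x. x abs_summable_on UNIV \<and> l2_norm x \<le> 1}"
  then show "l2_norm (nct_mult c a x) \<le> (\<Sum>\<^sub>\<infinity>k. norm (a k)) * 1"
    by (intro order_trans[OF l2_norm_nct_mult_le[OF a]] mult_left_mono) (auto simp: infsum_nonneg)
qed

lemma regular_norm_nonneg:
  assumes "a abs_summable_on UNIV" shows "0 \<le> regular_norm a"
  using cSUP_upper[OF zero_in_l2_ball bdd_above_regular_norm[OF assms]] l2_norm_nonneg
  unfolding regular_norm_def by (rule order_trans[rotated])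

lemma l2_norm_le_regular_norm:
  assumes a: "a abs_summable_on UNIV" and x: "x abs_summable_on UNIV"
  shows "l2_norm (nct_mult c a x) \<le> regular_norm a * l2_norm x"
proof (cases "l2_norm x = 0")
  case True
  then show ?thesis using l2_norm_nct_mult_le[OF a x] by simp
next
  case False
  then have pos: "0 < l2_norm x" using l2_norm_nonneg[of x] by linarith
  let ?y = "\<lambda>k. of_real (1 / l2_norm x) * x k"
  have "l2_norm (nct_mult c a ?y) \<le> regular_norm a"
    unfolding regular_norm_def
  proof (rule cSUP_upper[OF _ bdd_above_regular_norm[OF a]])
    have "?y abs_summable_on UNIV"
      unfolding norm_mult by (rule summable_on_cmult_right[OF x])
    moreover have "l2_norm ?y = 1"
      unfolding l2_norm_scale using pos by (simp add: norm_divide)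
    ultimately show "?y \<in> {x. x abs_summable_on UNIV \<and> l2_norm x \<le> 1}" by simp
  qed
  then show ?thesis
    using pos by (simp only: nct_mult_scale l2_norm_scale) (simp add: norm_divide field_simps)
qed

lemma nct_mult_add:
  assumes "a abs_summable_on UNIV" "b abs_summable_on UNIV" "x abs_summable_on UNIV"
  shows "nct_mult c (\<lambda>k. a k + b k) x = (\<lambda>m. nct_mult c a x m + nct_mult c b x m)"
proof
  fix m
  show "nct_mult c (\<lambda>k. a k + b k) x m = nct_mult c a x m + nct_mult c b x m"
    using infsum_add[OF Infinite_Sum.abs_summable_summable[OF nct_mult_summable[OF assms(1,3), of m]]
      Infinite_Sum.abs_summable_summable[OF nct_mult_summable[OF assms(2,3), of m]]]
    by (simp add: nct_mult_def distrib_right)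
qed

text \<open>As \<open>nct_norm\<close> is a supremum over seminorms, a lower bound for it requires
  one explicit member of the family. The operator norm of the regular representation is that
  member.\<close>

lemma nct_cstar_seminorm_regular_norm: "nct_cstar_seminorm c regular_norm"
proof -
  have add: "regular_norm (\<lambda>k. a k + b k) \<le> regular_norm a + regular_norm b"
    if "a abs_summable_on UNIV" "b abs_summable_on UNIV" for a b
  proof (rule regular_norm_least)
    fix x :: "'n coeffs" assume x: "x abs_summable_on UNIV" "l2_norm x \<le> 1"
    have "l2_norm (nct_mult c (\<lambda>k. a k + b k) x) \<le> l2_norm (nct_mult c a x) + l2_norm (nct_mult c b x)"
      by (simp add: nct_mult_add that x l2_norm_add abs_summable_nct_mult)
    also have "\<dots> \<le> regular_norm a * l2_norm x + regular_norm b * l2_norm x"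
      by (intro add_mono l2_norm_le_regular_norm that x)
    also have "\<dots> \<le> regular_norm a * 1 + regular_norm b * 1"
      by (intro add_mono mult_left_mono regular_norm_nonneg that x)
    finally show "l2_norm (nct_mult c (\<lambda>k. a k + b k) x) \<le> regular_norm a + regular_norm b" by simp
  qed
  have mult: "regular_norm (nct_mult c a b) \<le> regular_norm a * regular_norm b"
    if "a abs_summable_on UNIV" "b abs_summable_on UNIV" for a b
  proof (rule regular_norm_least)
    fix x :: "'n coeffs" assume x: "x abs_summable_on UNIV" "l2_norm x \<le> 1"
    have "l2_norm (nct_mult c (nct_mult c a b) x) \<le> regular_norm a * l2_norm (nct_mult c b x)"
      by (simp add: nct_mult_assoc l2_norm_le_regular_norm abs_summable_nct_mult that x)
    also have "\<dots> \<le> regular_norm a * (regular_norm b * l2_norm x)"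
      by (intro mult_left_mono l2_norm_le_regular_norm regular_norm_nonneg that x)
    also have "\<dots> \<le> regular_norm a * (regular_norm b * 1)"
      by (intro mult_left_mono regular_norm_nonneg that x)
    finally show "l2_norm (nct_mult c (nct_mult c a b) x) \<le> regular_norm a * regular_norm b" by simp
  qed
  have scale: "regular_norm (\<lambda>k. w * a k) = norm w * regular_norm a" if a: "a abs_summable_on UNIV" for w a
  proof -
    have le: "regular_norm (\<lambda>k. w * a k) \<le> norm w * regular_norm a"
      if a: "a abs_summable_on UNIV" for w and a :: "'n coeffs"
    proof (rule regular_norm_least)
      fix x :: "'n coeffs" assume x: "x abs_summable_on UNIV" "l2_norm x \<le> 1"
      have "l2_norm (nct_mult c a x) \<le> regular_norm a * 1"
        using x by (intro order_trans[OF l2_norm_le_regular_norm] a mult_left_mono regular_norm_nonneg)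
      then show "l2_norm (nct_mult c (\<lambda>k. w * a k) x) \<le> norm w * regular_norm a"
        by (simp add: nct_mult_scale l2_norm_scale mult_left_mono)
    qed
    show ?thesis
    proof (cases "w = 0")
      case True
      have "regular_norm (\<lambda>k. w * a k) \<le> 0" using le[OF a, of w] True by simp
      moreover have "0 \<le> regular_norm (\<lambda>k. w * a k)" using True by (intro regular_norm_nonneg) simp
      ultimately show ?thesis using True by simp
    next
      case False
      have wa: "(\<lambda>k. w * a k) abs_summable_on UNIV"
        using a by (simp add: norm_mult summable_on_cmult_right)
      \<comment> \<open>The reverse inequality is the same bound for the scalar
        \<open>inverse w\<close>.\<close>
      have "regular_norm (\<lambda>k. inverse w * (w * a k)) \<le> norm (inverse w) * regular_norm (\<lambda>k. w * a k)"
        by (rule le[OF wa])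
      then have "norm w * regular_norm a \<le> regular_norm (\<lambda>k. w * a k)"
        using False by (simp add: norm_divide norm_inverse field_simps)
      then show ?thesis using le[OF a, of w] by linarith
    qed
  qed
  \<comment> \<open>The half of the C*-identity that uses the adjoint: the squared length of a x is
    the inner product of x with b x, where b is the product of the adjoint of a with a, and
    Cauchy-Schwarz bounds it by the norm of b.\<close>
  have sq: "(regular_norm a)\<^sup>2 \<le> regular_norm (nct_mult c (nct_star c a) a)"
    if a: "a abs_summable_on UNIV" for a
  proof -
    let ?b = "nct_mult c (nct_star c a) a"
    have b: "?b abs_summable_on UNIV" by (intro abs_summable_nct_mult abs_summable_nct_star a)
    have "regular_norm a \<le> sqrt (regular_norm ?b)"
    proof (rule regular_norm_least)
      fix x :: "'n coeffs" assume x: "x abs_summable_on UNIV" "l2_norm x \<le> 1"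
      have ax: "nct_mult c a x abs_summable_on UNIV" by (intro abs_summable_nct_mult a x)
      have "complex_of_real ((l2_norm (nct_mult c a x))\<^sup>2) = l2_inner x (nct_mult c ?b x)"
        using l2_inner_self[OF ax] l2_inner_nct_mult[OF a x(1) ax]
        by (simp add: nct_mult_assoc abs_summable_nct_star a x)
      then have "(l2_norm (nct_mult c a x))\<^sup>2 = norm (l2_inner x (nct_mult c ?b x))"
        by (metis abs_of_nonneg norm_of_real zero_le_power2)
      also have "\<dots> \<le> l2_norm x * l2_norm (nct_mult c ?b x)"
        by (intro norm_l2_inner_le x abs_summable_nct_mult b)
      also have "\<dots> \<le> 1 * (regular_norm ?b * 1)"
        using x b by (intro mult_mono order_trans[OF l2_norm_le_regular_norm] mult_left_mono
          regular_norm_nonneg l2_norm_nonneg) auto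
      finally show "l2_norm (nct_mult c a x) \<le> sqrt (regular_norm ?b)"
        by (simp add: real_le_rsqrt)
    qed
    then have "(regular_norm a)\<^sup>2 \<le> (sqrt (regular_norm ?b))\<^sup>2"
      by (intro power_mono regular_norm_nonneg a)
    then show ?thesis by (simp add: regular_norm_nonneg b)
  qed
  \<comment> \<open>Submultiplicativity and \<open>sq\<close> bound the square of the norm of a by
    the norm of its adjoint times that of a; one factor cancels. Applied to the adjoint as well,
    this gives equality of the two norms.\<close>
  have star_le: "regular_norm a \<le> regular_norm (nct_star c a)" if a: "a abs_summable_on UNIV" for a
  proof (cases "regular_norm a = 0")
    case False
    have "regular_norm a * regular_norm a \<le> regular_norm (nct_star c a) * regular_norm a"
      using sq[OF a] mult[OF abs_summable_nct_star[OF a] a] by (simp add: power2_eq_square)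
    then show ?thesis using False regular_norm_nonneg[OF a] by simp
  qed (simp add: regular_norm_nonneg abs_summable_nct_star a)
  have cstar: "regular_norm (nct_mult c (nct_star c a) a) = (regular_norm a)\<^sup>2"
    if a: "a abs_summable_on UNIV" for a
  proof -
    have "regular_norm (nct_star c a) \<le> regular_norm a"
      using star_le[OF abs_summable_nct_star[OF a]] by (simp add: nct_star_star)
    then have "regular_norm (nct_star c a) * regular_norm a \<le> regular_norm a * regular_norm a"
      by (intro mult_right_mono regular_norm_nonneg a)
    then show ?thesis
      using sq[OF a] mult[OF abs_summable_nct_star[OF a] a] by (simp add: power2_eq_square)
  qed
  show ?thesis
    unfolding nct_cstar_seminorm_def
    by (intro conjI ballI allI add mult scale cstar regular_norm_nonneg regular_norm_le_sum smooth_abs_summable)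
qed

text \<open>Left multiplication by \<open>a\<close> sends \<open>nct_U 0\<close> to
  \<open>a\<close>, so a coefficient is at most the l2 norm of \<open>a\<close>, hence at most the
  operator norm, which is one of the seminorms in the supremum. The l1 bound in
  \<open>nct_cstar_seminorm\<close> keeps that supremum finite. All later use of
  \<open>nct_norm\<close> passes through this estimate.\<close>

lemma norm_coeff_le_nct_norm:
  assumes "a \<in> nct_smooth_algebra"
  shows "norm (a k) \<le> nct_norm c a"
proof -
  have a: "a abs_summable_on UNIV" by (rule smooth_abs_summable[OF assms])
  have U: "nct_U 0 abs_summable_on (UNIV :: (int ^ 'n) set)" "l2_norm (nct_U 0 :: 'n coeffs) = 1"
  proof -
    have *: "((\<lambda>k. (norm (nct_U 0 k)) ^ m) has_sum 1) (UNIV :: (int ^ 'n) set)" if "m > 0" for m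
    proof -
      have "((\<lambda>k. (norm (nct_U 0 k)) ^ m) has_sum 1) {0 :: int ^ 'n}"
        by (rule has_sum_finiteI) (auto simp: nct_U_def)
      then show ?thesis
        using that by (subst has_sum_cong_neutral[where T = "{0}"]) (auto simp: nct_U_def)
    qed
    show "nct_U 0 abs_summable_on (UNIV :: (int ^ 'n) set)"
      using has_sum_imp_summable[OF *[of 1]] by simp
    show "l2_norm (nct_U 0 :: 'n coeffs) = 1"
      using infsumI[OF *[of 2]] by (simp add: l2_norm_def)
  qed
  have "nct_mult c a (nct_U 0) = a"
  proof
    fix m
    have "nct_mult c a (nct_U 0) m = (\<Sum>\<^sub>\<infinity>j\<in>{m}. a j * nct_U 0 (m - j) * c j (m - j))"
      unfolding nct_mult_def by (rule infsum_cong_neutral) (auto simp: nct_U_def)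
    then show "nct_mult c a (nct_U 0) m = a m" by (simp add: nct_U_def cocycle_0)
  qed
  then have "norm (a k) \<le> regular_norm a"
    using l2_norm_le_regular_norm[OF a U(1)] norm_le_l2_norm[OF a, of k] U(2) by simp
  also have "\<dots> \<le> nct_norm c a"
    unfolding nct_norm_def
  proof (rule cSUP_upper)
    show "bdd_above ((\<lambda>p. p a) ` Collect (nct_cstar_seminorm c))"
      by (rule bdd_aboveI2[where M = "\<Sum>\<^sub>\<infinity>k. norm (a k)"])
        (use assms in \<open>auto simp: nct_cstar_seminorm_def\<close>)
  qed (simp add: nct_cstar_seminorm_regular_norm)
  finally show ?thesis .
qed

end

section \<open>Uniqueness of asymptotic expansions\<close>

text \<open>Suppose that p^s = 1 for all p >= 2. The case p = 2 forces s = i t with t real, and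
  quotients of consecutive integers give \<open>cis (t * u) = 1\<close> with u = ln ((p + 1) / p).
  For p larger than |t| the angle is nonzero and smaller than pi, which is impossible.\<close>

lemma exists_nat_powr_neq_1:
  fixes s :: complex assumes "s \<noteq> 0"
  shows "\<exists>p::nat. 2 \<le> p \<and> of_nat p powr s \<noteq> (1::complex)"
proof (rule ccontr)
  assume "\<not> ?thesis"
  then have *: "of_nat p powr s = (1::complex)" if "2 \<le> p" for p :: nat using that by blast
  have one: "exp (s * of_real (ln (real p))) = 1" if "2 \<le> p" for p :: nat
    using *[OF that] that by (simp add: powr_def Ln_of_nat)
  have "exp (s * of_real (ln 2)) = 1" using one[of 2] by simp
  then have "norm (exp (s * of_real (ln 2))) = 1" by simp
  then have re: "Re s = 0" by simp
  define t where "t = Im s"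
  have t: "t \<noteq> 0" and s: "s = \<i> * of_real t" using assms re by (auto simp: t_def complex_eq_iff)
  obtain p :: nat where p: "p \<ge> 2" "\<bar>t\<bar> / real p < 1"
  proof -
    obtain m :: nat where "\<bar>t\<bar> < real m" using reals_Archimedean2 by blast
    then show ?thesis by (intro that[of "m + 2"]) (auto simp: field_simps)
  qed
  define u where "u = ln (real (p + 1) / real p)"
  have u0: "0 < u" using p by (simp add: u_def)
  have "u \<le> real (p + 1) / real p - 1" unfolding u_def using p by (intro ln_le_minus_one) simp
  then have u1: "u \<le> 1 / real p" using p by (simp add: field_simps)
  have tu: "0 < \<bar>t * u\<bar>" "\<bar>t * u\<bar> < 1"
  proof -
    show "0 < \<bar>t * u\<bar>" using t u0 by simp
    have "\<bar>t * u\<bar> \<le> \<bar>t\<bar> * (1 / real p)"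
      using u0 mult_left_mono[OF u1, of "\<bar>t\<bar>"] by (simp add: abs_mult)
    also have "\<bar>t\<bar> * (1 / real p) < 1" using p(2) by simp
    finally show "\<bar>t * u\<bar> < 1" .
  qed
  have "exp (s * of_real (ln (real (p + 1)))) / exp (s * of_real (ln (real p))) = 1"
    using one[of p] one[of "p + 1"] p by simp
  then have "exp (s * of_real u) = 1"
    using p unfolding exp_diff[symmetric] u_def
    by (simp add: ln_div right_diff_distrib del: of_nat_Suc)
  then have "cis (t * u) = 1" by (simp add: s cis_conv_exp mult.assoc)
  then have "sin (t * u) = 0" by (metis cis.simps(2) one_complex.simps(2))
  moreover have "\<bar>t * u\<bar> < pi" using tu pi_gt3 by linarith
  ultimately show False using tu sin_eq_0_pi[of "t * u"] by (auto simp: abs_less_iff)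
qed

lemma of_nat_mult_powr:
  fixes s :: complex
  shows "of_nat (p * N) powr s = of_nat p powr s * of_nat N powr s"
  using powr_times_real[of "of_nat p" "of_nat N" s] by simp

text \<open>If \<open>p\<^sup>s \<noteq> 1\<close>, the operator \<open>f \<mapsto> f (p \<cdot>) - p\<^sup>s f\<close>, applied twice, kills the term
  \<open>(c + d ln N) N\<^sup>s\<close>, preserves the shape of the other terms and multiplies limits by
  \<open>(1 - p\<^sup>s)\<^sup>2 \<noteq> 0\<close>.\<close>

lemma limit_sum_powr_eq_0:
  fixes s c d :: "'i \<Rightarrow> complex"
  assumes "finite I" "\<And>i. i \<in> I \<Longrightarrow> s i \<noteq> 0"
    and "(\<lambda>N. \<Sum>i\<in>I. (c i + d i * of_real (ln (real N))) * of_nat N powr s i) \<longlonglongrightarrow> L"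
  shows "L = 0"
  using assms
proof (induction I arbitrary: c d L rule: finite_induct)
  case empty
  then show ?case by (simp add: LIMSEQ_const_iff)
next
  case (insert i0 I)
  obtain p :: nat where p: "2 \<le> p" "of_nat p powr s i0 \<noteq> (1::complex)"
    using exists_nat_powr_neq_1[of "s i0"] insert.prems(1) by blast
  define w where "w = (of_nat p :: complex) powr s i0"
  define F where "F c d N = (\<Sum>i\<in>insert i0 I. (c i + d i * of_real (ln (real N))) * of_nat N powr s i)"
    for c d :: "'i \<Rightarrow> complex" and N
  define c' where "c' c d i = (c i + d i * of_real (ln (real p))) * of_nat p powr s i - w * c i"
    for c d :: "'i \<Rightarrow> complex" and i
  define d' where "d' d i = d i * of_nat p powr s i - w * d i" for d :: "'i \<Rightarrow> complex" and i
  have step: "F c d (p * N) - w * F c d N = F (c' c d) (d' d) N" if "N > 0" for c d N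
  proof -
    have "ln (real (p * N)) = ln (real p) + ln (real N)" using that p by (simp add: ln_mult)
    then show ?thesis
      unfolding F_def c'_def d'_def of_nat_mult_powr sum_distrib_left sum_subtractf[symmetric]
      by (intro sum.cong refl) (simp add: algebra_simps)
  qed
  have lim: "F (c' c d) (d' d) \<longlonglongrightarrow> (1 - w) * l" if "F c d \<longlonglongrightarrow> l" for c d l
  proof -
    have "filterlim (\<lambda>N. p * N) sequentially sequentially"
      using p by (intro filterlim_subseq) (auto simp: strict_mono_def)
    from filterlim_compose[OF that this]
    have "(\<lambda>N. F c d (p * N) - w * F c d N) \<longlonglongrightarrow> l - w * l"
      by (intro tendsto_intros that)
    moreover have "\<forall>\<^sub>F N in sequentially. F c d (p * N) - w * F c d N = F (c' c d) (d' d) N"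
      using eventually_gt_at_top[of 0] by eventually_elim (rule step)
    ultimately have "F (c' c d) (d' d) \<longlonglongrightarrow> l - w * l"
      by (rule Lim_transform_eventually)
    then show ?thesis by (simp add: algebra_simps)
  qed
  define c2 where "c2 = c' (c' c d) (d' d)"
  define d2 where "d2 = d' (d' d)"
  have "F c d \<longlonglongrightarrow> L" using insert.prems(2) by (simp add: F_def[abs_def])
  then have "F c2 d2 \<longlonglongrightarrow> (1 - w) * ((1 - w) * L)" unfolding c2_def d2_def by (intro lim)
  moreover have "c2 i0 = 0" "d2 i0 = 0"
    by (simp_all add: c2_def d2_def c'_def d'_def w_def algebra_simps)
  ultimately have "(\<lambda>N. \<Sum>i\<in>I. (c2 i + d2 i * of_real (ln (real N))) * of_nat N powr s i)
      \<longlonglongrightarrow> (1 - w) * ((1 - w) * L)"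
    using insert.hyps by (simp add: F_def[abs_def])
  then have "(1 - w) * ((1 - w) * L) = 0"
    using insert.IH[of c2 d2] insert.prems(1) by blast
  then show ?case using p by (simp add: w_def)
qed

section \<open>Smooth functions\<close>

text \<open>The coordinates of the increment are switched on one at a time. On each coordinate
  segment the function minus its linear part has a small derivative, by continuity of the partials,
  and the mean value inequality bounds its increment by e / n times the norm of y.\<close>

lemma has_derivative_of_partials:
  fixes f :: "real ^ 'n::finite \<Rightarrow> 'b::real_normed_vector"
  assumes cont: "\<And>i. continuous_on UNIV (g i)"
    and deriv: "\<And>i x. ((\<lambda>h. f (x + h *\<^sub>R axis i 1)) has_vector_derivative g i x) (at 0)"
  shows "(f has_derivative (\<lambda>y. \<Sum>i\<in>UNIV. y $ i *\<^sub>R g i x)) (at x)"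
proof -
  let ?L = "\<lambda>y. \<Sum>i\<in>UNIV. y $ i *\<^sub>R g i x"
  let ?n = "real CARD('n)"
  have line: "((\<lambda>t. f (w + (t * r) *\<^sub>R axis i 1)) has_vector_derivative r *\<^sub>R g i (w + (t * r) *\<^sub>R axis i 1)) (at t)"
    for w i t r
  proof -
    let ?x = "w + (t * r) *\<^sub>R axis i 1"
    have inner: "((\<lambda>u. (u - t) * r) has_vector_derivative r) (at t)"
      by (auto intro!: derivative_eq_intros simp: has_real_derivative_iff_has_vector_derivative[symmetric])
    have "((\<lambda>h. f (?x + h *\<^sub>R axis i 1)) \<circ> (\<lambda>u. (u - t) * r) has_vector_derivative r *\<^sub>R g i ?x) (at t)"
      by (rule vector_diff_chain_at[OF inner]) (simp add: deriv)
    moreover have "?x + ((u - t) * r) *\<^sub>R axis i 1 = w + (u * r) *\<^sub>R axis i 1" for u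
      by (simp add: algebra_simps)
    ultimately show ?thesis by (simp add: o_def)
  qed
  have "\<exists>d>0. \<forall>y. norm (y - x) < d \<longrightarrow> norm (f y - f x - ?L (y - x)) \<le> e * norm (y - x)"
    if e: "e > 0" for e
  proof -
    have "\<exists>d>0. \<forall>y. dist y x < d \<longrightarrow> dist (g i y) (g i x) < e / ?n" for i
      using cont[of i] e unfolding continuous_on_iff by (metis UNIV_I divide_pos_pos of_nat_0_less_iff zero_less_card_finite)
    then obtain d where d: "\<And>i. d i > 0" "\<And>i y. dist y x < d i \<Longrightarrow> dist (g i y) (g i x) < e / ?n"
      by metis
    define \<delta> where "\<delta> = Min (range d)"
    have \<delta>: "\<delta> > 0" using d(1) by (simp add: \<delta>_def)
    have gd: "norm (g i y - g i x) \<le> e / ?n" if "norm (y - x) < \<delta>" for i y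
    proof -
      have "\<delta> \<le> d i" by (simp add: \<delta>_def)
      then show ?thesis using d(2)[of y i] that by (simp add: dist_norm)
    qed
    have main: "norm (f (x + (\<chi> i. if i \<in> A then y $ i else 0)) - f x - (\<Sum>i\<in>A. y $ i *\<^sub>R g i x)) \<le>
        real (card A) * (e / ?n) * norm y" if y: "norm y < \<delta>" for y and A :: "'n set"
      using finite[of A]
    proof (induction A rule: finite_induct)
      case empty
      have "(\<chi> i. 0) = (0 :: real ^ 'n)" by (simp add: vec_eq_iff)
      then show ?case by simp
    next
      case (insert j A)
      define w where "w = x + (\<chi> i. if i \<in> A then y $ i else 0)"
      let ?\<phi> = "\<lambda>t. f (w + (t * y $ j) *\<^sub>R axis j 1) - (t * y $ j) *\<^sub>R g j x"
      have eq: "x + (\<chi> i. if i \<in> insert j A then y $ i else 0) = w + (1 * y $ j) *\<^sub>R axis j 1"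
        using insert.hyps by (auto simp: w_def vec_eq_iff axis_def)
      have deriv\<phi>: "(?\<phi> has_derivative (\<lambda>h. h *\<^sub>R (y $ j *\<^sub>R (g j (w + (t * y $ j) *\<^sub>R axis j 1) - g j x))))
          (at t within {0..1})" for t
      proof -
        have "((\<lambda>t. (t * y $ j) *\<^sub>R g j x) has_vector_derivative y $ j *\<^sub>R g j x) (at t)"
          by (auto intro!: derivative_eq_intros)
        from has_vector_derivative_diff[OF line[of w "y $ j" j t] this]
        have "(?\<phi> has_vector_derivative y $ j *\<^sub>R (g j (w + (t * y $ j) *\<^sub>R axis j 1) - g j x)) (at t)"
          by (simp add: scaleR_diff_right)
        then show ?thesis
          unfolding has_vector_derivative_def by (rule has_derivative_at_withinI)
      qed
      have "norm (?\<phi> 1 - ?\<phi> 0) \<le> (e / ?n * norm y) * norm (1 - 0 :: real)"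
      proof (rule differentiable_bound[where S = "{0..1}", OF _ deriv\<phi>])
        fix t :: real assume t: "t \<in> {0..1}"
        let ?z = "w + (t * y $ j) *\<^sub>R axis j 1"
        have "norm (?z - x) \<le> norm y"
        proof (rule norm_le_componentwise_cart)
          show "norm ((?z - x) $ i) \<le> norm (y $ i)" for i
            using insert.hyps t by (auto simp: w_def axis_def abs_mult mult_left_le_one_le)
        qed
        then have "norm (g j ?z - g j x) \<le> e / ?n" using y by (intro gd) linarith
        then have "norm (y $ j *\<^sub>R (g j ?z - g j x)) \<le> norm y * (e / ?n)"
          unfolding norm_scaleR using component_le_norm_cart[of y j] by (intro mult_mono) auto
        then have "norm (h *\<^sub>R (y $ j *\<^sub>R (g j ?z - g j x))) \<le> (e / ?n * norm y) * norm h" for h :: real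
          unfolding norm_scaleR[of h] by (simp only: mult.commute real_norm_def mult_left_mono abs_ge_zero)
        then show "onorm (\<lambda>h. h *\<^sub>R (y $ j *\<^sub>R (g j ?z - g j x))) \<le> e / ?n * norm y"
          using e by (intro onorm_bound) auto
      qed auto
      then have "norm (f (w + (1 * y $ j) *\<^sub>R axis j 1) - f w - y $ j *\<^sub>R g j x) \<le> e / ?n * norm y"
        by (simp add: algebra_simps)
      moreover have "norm (f w - f x - (\<Sum>i\<in>A. y $ i *\<^sub>R g i x)) \<le> real (card A) * (e / ?n) * norm y"
        using insert.IH by (simp add: w_def)
      moreover have "f (w + (1 * y $ j) *\<^sub>R axis j 1) - f x - (\<Sum>i\<in>insert j A. y $ i *\<^sub>R g i x) =
          (f (w + (1 * y $ j) *\<^sub>R axis j 1) - f w - y $ j *\<^sub>R g j x) +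
          (f w - f x - (\<Sum>i\<in>A. y $ i *\<^sub>R g i x))"
        using insert.hyps by (simp add: algebra_simps)
      ultimately have "norm (f (w + (1 * y $ j) *\<^sub>R axis j 1) - f x - (\<Sum>i\<in>insert j A. y $ i *\<^sub>R g i x)) \<le>
          e / ?n * norm y + real (card A) * (e / ?n) * norm y"
        by (simp only:) (rule norm_triangle_le[OF add_mono])
      then show ?case unfolding eq using insert.hyps by (simp add: algebra_simps add_divide_distrib)
    qed
    show ?thesis
    proof (intro exI[of _ \<delta>] conjI allI impI \<delta>)
      fix y assume "norm (y - x) < \<delta>"
      have "(\<chi> i. y $ i - x $ i) = y - x" by (simp add: vec_eq_iff)
      with main[OF \<open>norm (y - x) < \<delta>\<close>, of UNIV] show "norm (f y - f x - ?L (y - x)) \<le> e * norm (y - x)"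
        by simp
    qed
  qed
  moreover have "bounded_linear ?L"
    by (intro bounded_linear_sum bounded_linear_compose[OF bounded_linear_scaleR_left] bounded_linear_vec_nth)
  ultimately show ?thesis unfolding has_derivative_within_alt by simp
qed

text \<open>\<open>D l\<close> is the iterated partial derivative of the smooth function \<open>D []\<close> in the directions \<open>l\<close>.\<close>

definition smooth_derivs :: "('n::finite list \<Rightarrow> real ^ 'n \<Rightarrow> complex) \<Rightarrow> bool" where
  "smooth_derivs D \<longleftrightarrow> (\<forall>l. continuous_on UNIV (D l)) \<and>
     (\<forall>l i x. ((\<lambda>h. D l (x + h *\<^sub>R axis i 1)) has_vector_derivative D (i # l) x) (at 0))"

lemma smooth_derivs_continuous: "smooth_derivs D \<Longrightarrow> continuous_on UNIV (D l)"
  by (simp add: smooth_derivs_def)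

lemma smooth_derivs_append: "smooth_derivs D \<Longrightarrow> smooth_derivs (\<lambda>l. D (l @ u))"
  by (simp add: smooth_derivs_def)

lemma smooth_derivs_line:
  assumes "smooth_derivs D"
  shows "((\<lambda>t. D l (x + t *\<^sub>R y)) has_vector_derivative (\<Sum>i\<in>UNIV. y $ i *\<^sub>R D (i # l) (x + t *\<^sub>R y))) (at t)"
proof -
  have "(D l has_derivative (\<lambda>v. \<Sum>i\<in>UNIV. v $ i *\<^sub>R D (i # l) (x + t *\<^sub>R y))) (at (x + t *\<^sub>R y))"
    using assms by (intro has_derivative_of_partials) (simp_all add: smooth_derivs_def)
  then have "((\<lambda>t. D l (x + t *\<^sub>R y)) has_derivative
      (\<lambda>h. \<Sum>i\<in>UNIV. (h *\<^sub>R y) $ i *\<^sub>R D (i # l) (x + t *\<^sub>R y))) (at t)"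
    by (rule has_derivative_compose[rotated]) (auto intro!: derivative_eq_intros)
  then show ?thesis
    by (simp add: has_vector_derivative_def scaleR_sum_right)
qed

section \<open>Words as derivative indices and Taylor's formula\<close>

lemma lists_of_length: "{u :: 'n list. length u = Suc m} = (\<lambda>(i, u). i # u) ` (UNIV \<times> {u. length u = m})"
  by (auto simp: length_Suc_conv)

lemma finite_lists_of_length [simp]: "finite {u :: 'n::finite list. length u = m}"
  using finite_lists_length_eq[of "UNIV :: 'n set" m] by simp

lemma finite_lists_length_less [simp]: "finite {u :: 'n::finite list. length u < m}"
proof -
  have "{u :: 'n list. length u < m} = (\<Union>k<m. {u. length u = k})" by auto
  then show ?thesis by simp
qed

lemma sum_lists_Suc:
  "(\<Sum>u | length u = Suc m. F u) = (\<Sum>i\<in>UNIV. \<Sum>u | length (u :: 'n::finite list) = m. F (i # u))"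
  unfolding lists_of_length
  by (subst sum.reindex) (auto simp: inj_on_def sum.cartesian_product case_prod_unfold)

lemma card_lists_of_length: "card {u :: 'n::finite list. length u = m} = CARD('n) ^ m"
  using card_lists_length_eq[of "UNIV :: 'n set" m] by simp

lemma sum_lists_length_less:
  "(\<Sum>u | length (u :: 'n::finite list) < M. F u) = (\<Sum>m<M. \<Sum>u | length u = m. F u)"
proof -
  have "{u :: 'n list. length u < M} = (\<Union>m<M. {u. length u = m})" by auto
  then show ?thesis by (simp only:) (subst sum.UNION_disjoint; auto)
qed

text \<open>Words replace multi-indices: a multi-index \<alpha> occurs once for each of its
  orderings, so that summing over words with the weight 1 / (length)! reproduces the usual 1 /
  \<alpha>! without multinomial coefficients.\<close>

definition list_monomial :: "real ^ 'n \<Rightarrow> 'n list \<Rightarrow> real" where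
  "list_monomial y u = prod_list (map (($) y) u)"

lemma list_monomial_simps [simp]:
  "list_monomial y [] = 1" "list_monomial y (i # u) = y $ i * list_monomial y u"
  by (simp_all add: list_monomial_def)

lemma abs_list_monomial_le:
  fixes y :: "real ^ 'n"
  assumes "\<And>i. \<bar>y $ i\<bar> \<le> 1" shows "\<bar>list_monomial y u\<bar> \<le> 1"
  using assms by (induction u) (simp_all add: abs_mult mult_le_one)

lemma continuous_on_list_monomial: "continuous_on UNIV (\<lambda>y :: real ^ 'n::finite. list_monomial y u)"
  by (induction u) (auto intro!: continuous_intros)

text \<open>Restriction to the segment \<open>x + t *\<^sub>R y\<close> reduces this to one
  variable: \<open>F m\<close> is the m-th derivative in t, because each differentiation prepends a
  letter in all n ways. The factor \<open>CARD('n) ^ M\<close> counts the words of length M.\<close>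

lemma multivariate_Taylor:
  fixes D :: "'n::finite list \<Rightarrow> real ^ 'n \<Rightarrow> complex" and x y :: "real ^ 'n"
  assumes D: "smooth_derivs D" and M: "0 < M" and y: "\<And>i. \<bar>y $ i\<bar> \<le> 1"
    and B: "\<And>u t. length u = M \<Longrightarrow> 0 \<le> t \<Longrightarrow> t \<le> 1 \<Longrightarrow> norm (D u (x + t *\<^sub>R y)) \<le> B"
  shows "norm (D [] (x + y) - (\<Sum>u | length u < M. (list_monomial y u / fact (length u)) *\<^sub>R D u x))
    \<le> real CARD('n) ^ M * B"
proof -
  define F where "F m t = (\<Sum>u | length u = m. list_monomial y u *\<^sub>R D u (x + t *\<^sub>R y))" for m t
  have deriv: "(F m has_vector_derivative F (Suc m) t) (at t within {0..1})" for m t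
  proof -
    have "(F m has_vector_derivative (\<Sum>u | length u = m. list_monomial y u *\<^sub>R
        (\<Sum>i\<in>UNIV. y $ i *\<^sub>R D (i # u) (x + t *\<^sub>R y)))) (at t)"
      unfolding F_def
      by (intro has_vector_derivative_sum bounded_linear.has_vector_derivative[OF bounded_linear_scaleR_right]
          smooth_derivs_line[OF D])
    also have "(\<Sum>u | length u = m. list_monomial y u *\<^sub>R (\<Sum>i\<in>UNIV. y $ i *\<^sub>R D (i # u) (x + t *\<^sub>R y))) = F (Suc m) t"
      unfolding F_def sum_lists_Suc scaleR_sum_right
      by (subst sum.swap) (simp add: mult_ac)
    finally show ?thesis by (rule has_vector_derivative_at_within)
  qed
  have bound: "norm (F M t) \<le> real CARD('n) ^ M * B" if t: "0 \<le> t" "t \<le> 1" for t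
  proof -
    have "norm (F M t) \<le> (\<Sum>u\<in>{u :: 'n list. length u = M}. 1 * B)"
      unfolding F_def
      by (rule sum_norm_le, unfold norm_scaleR, rule mult_mono)
        (use B t abs_list_monomial_le[OF y] in auto)
    then show ?thesis by (simp add: card_lists_of_length)
  qed
  have "((\<lambda>t. ((1 - t) ^ (M - 1) / fact (M - 1)) *\<^sub>R F M t) has_integral
      F 0 1 - (\<Sum>m<M. ((1 - 0) ^ m / fact m) *\<^sub>R F m 0)) {0..1}"
    by (rule Taylor_has_integral) (use M deriv in auto)
  then have "norm (F 0 1 - (\<Sum>m<M. ((1 - 0) ^ m / fact m) *\<^sub>R F m 0)) \<le>
      real CARD('n) ^ M * B * measure lborel (cbox (0::real) 1)"
  proof (intro has_integral_bound[where f = "\<lambda>t. ((1 - t) ^ (M - 1) / fact (M - 1)) *\<^sub>R F M t"])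
    show nonneg: "0 \<le> real CARD('n) ^ M * B" 
      by (rule order_trans[OF norm_ge_zero bound[of 0]]) auto
    fix t :: real assume "t \<in> cbox 0 1"
    then have t: "0 \<le> t" "t \<le> 1" by auto
    have "(1 - t) ^ (M - 1) / fact (M - 1) \<le> 1"
      using t by (simp add: divide_le_eq_1 power_le_one fact_ge_1 order_trans[OF power_le_one])
    then have "norm (((1 - t) ^ (M - 1) / fact (M - 1)) *\<^sub>R F M t) \<le> 1 * (real CARD('n) ^ M * B)"
      using t bound[OF t] unfolding norm_scaleR by (intro mult_mono) (auto simp: nonneg)
    then show "norm (((1 - t) ^ (M - 1) / fact (M - 1)) *\<^sub>R F M t) \<le> real CARD('n) ^ M * B" by simp
  qed auto
  moreover have "F 0 1 = D [] (x + y)" by (simp add: F_def)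
  moreover have "(\<Sum>m<M. ((1 - 0) ^ m / fact m) *\<^sub>R F m 0) =
      (\<Sum>u | length u < M. (list_monomial y u / fact (length u)) *\<^sub>R D u x)"
    unfolding sum_lists_length_less F_def scaleR_sum_right by simp
  ultimately show ?thesis by simp
qed

section \<open>Inversion of cell averages\<close>

text \<open>Half-open, so that the translates of the unit cell by lattice vectors are disjoint and
  cover the space.\<close>

definition half_open_cube :: "real \<Rightarrow> (real ^ 'n::finite) set" where
  "half_open_cube R = {x. \<forall>i. - R \<le> x $ i \<and> x $ i < R}"

abbreviation unit_cell :: "(real ^ 'n::finite) set" where
  "unit_cell \<equiv> half_open_cube (1 / 2)"

lemma half_open_cube_borel [measurable]: "(half_open_cube R :: (real ^ 'n::finite) set) \<in> sets borel"
proof -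
  have "(half_open_cube R :: (real ^ 'n) set) = (\<Inter>i. {x :: real ^ 'n. - R \<le> x $ i \<and> x $ i < R})"
    by (auto simp: half_open_cube_def)
  also have "\<dots> \<in> sets borel"
  proof (intro sets.finite_INT)
    fix i :: 'n
    have [measurable]: "(\<lambda>x :: real ^ 'n. x $ i) \<in> borel_measurable borel"
      by (intro borel_measurable_continuous_onI continuous_intros)
    show "{x :: real ^ 'n. - R \<le> x $ i \<and> x $ i < R} \<in> sets borel" by measurable
  qed auto
  finally show ?thesis .
qed

lemma bounded_half_open_cube: "bounded (half_open_cube R)"
proof (rule bounded_subset[OF bounded_cbox])
  show "half_open_cube R \<subseteq> cbox (\<chi> i. - R) (\<chi> i. R)"
    by (auto simp: half_open_cube_def mem_box_cart less_imp_le)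
qed

lemma ball_subset_half_open_cube: "ball 0 R \<subseteq> half_open_cube R"
proof
  fix x :: "real ^ 'n" assume "x \<in> ball 0 R"
  then have "\<bar>x $ i\<bar> < R" for i
    using component_le_norm_cart[of x i] by (simp add: le_less_trans)
  then show "x \<in> half_open_cube R"
    by (auto simp: half_open_cube_def abs_less_iff minus_less_iff less_imp_le)
qed

lemma half_open_cube_scaleR:
  assumes "0 < c" shows "c *\<^sub>R x \<in> half_open_cube (c * R) \<longleftrightarrow> x \<in> half_open_cube R"
proof -
  have "- (c * R) \<le> c * t \<and> c * t < c * R \<longleftrightarrow> - R \<le> t \<and> t < R" for t
    using assms mult_le_cancel_left_pos[of c "- R" t] by simp
  then show ?thesis by (simp add: half_open_cube_def)
qed

lemma set_integrable_continuous:
  fixes F :: "'a::euclidean_space \<Rightarrow> 'b::{banach, second_countable_topology}"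
  assumes "continuous_on UNIV F" "A \<in> sets borel" "bounded A"
  shows "set_integrable lborel A F"
proof -
  obtain r where "A \<subseteq> cball 0 r" using bounded_subset_ballD[OF assms(3), of 0] ball_subset_cball by blast
  moreover have "set_integrable lborel (cball 0 r) F"
    unfolding set_integrable_def
    by (rule borel_integrable_compact[OF compact_cball continuous_on_subset[OF assms(1)]]) simp
  ultimately show ?thesis using assms(2) set_integrable_subset[of lborel "cball 0 r" F A] by simp
qed

lemma lborel_integral_translate:
  fixes F :: "'a::euclidean_space \<Rightarrow> 'b::{banach, second_countable_topology}"
  assumes "F \<in> borel_measurable borel"
  shows "(LINT x|lborel. F (a + x)) = (LINT x|lborel. F x)"
  using integral_distr[of "(+) a" lborel borel F] assms by (simp add: lborel_distr_plus)

lemma lborel_integral_scale: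
  fixes F :: "'a::euclidean_space \<Rightarrow> 'b::{banach, second_countable_topology}"
  assumes [measurable]: "F \<in> borel_measurable borel" and "0 < c"
  shows "(LINT x|lborel. F x) = c ^ DIM('a) *\<^sub>R (LINT x|lborel. F (c *\<^sub>R x))"
proof -
  have "(LINT x|lborel. F x) = (LINT x|density (distr lborel borel (\<lambda>x. 0 + c *\<^sub>R x)) (\<lambda>_. \<bar>c\<bar> ^ DIM('a)). F x)"
    using assms lborel_affine[where 'a = 'a, of c 0] by simp
  also have "\<dots> = c ^ DIM('a) *\<^sub>R (LINT x|lborel. F (c *\<^sub>R x))"
    using assms(2) by (subst integral_density) (auto simp: integral_distr simp del: scaleR_scaleR)
  finally show ?thesis .
qed

text \<open>The half-open cell lies between an open and a closed box of volume 1.\<close>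

lemma measure_unit_cell: "measure lborel (unit_cell :: (real ^ 'n::finite) set) = 1"
  and emeasure_unit_cell: "emeasure lborel (unit_cell :: (real ^ 'n::finite) set) \<noteq> \<infinity>"
proof -
  let ?a = "(\<chi> i. - 1 / 2) :: real ^ 'n" and ?b = "(\<chi> i. 1 / 2) :: real ^ 'n"
  have sub: "box ?a ?b \<subseteq> unit_cell" "unit_cell \<subseteq> cbox ?a ?b"
    by (auto simp: half_open_cube_def mem_box_cart less_imp_le)
  have prod: "(\<Prod>i\<in>Basis. (?b - ?a) \<bullet> i) = 1"
    by (rule prod.neutral) (auto simp: Basis_vec_def inner_axis)
  have le: "?a \<bullet> b \<le> ?b \<bullet> b" if "b \<in> Basis" for b using that by (auto simp: Basis_vec_def inner_axis)
  have fm: "cbox ?a ?b \<in> fmeasurable lborel" by simp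
  have cell: "unit_cell \<in> fmeasurable (lborel :: (real ^ 'n) measure)"
    by (rule fmeasurableI2[OF fm sub(2)]) simp
  then show "emeasure lborel (unit_cell :: (real ^ 'n::finite) set) \<noteq> \<infinity>"
    by (auto simp: fmeasurable_def)
  have "measure lborel (box ?a ?b) \<le> measure lborel (unit_cell :: (real ^ 'n) set)"
    by (rule measure_mono_fmeasurable[OF sub(1) _ cell]) simp
  moreover have "measure lborel (unit_cell :: (real ^ 'n) set) \<le> measure lborel (cbox ?a ?b)"
    by (rule measure_mono_fmeasurable[OF sub(2) _ fm]) simp
  ultimately show "measure lborel (unit_cell :: (real ^ 'n::finite) set) = 1"
    using le prod by (simp add: measure_lborel_box_eq measure_lborel_cbox_eq)
qed

text \<open>The cell has volume 1, so this integral is a mean value.\<close>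

definition cell_avg :: "(real ^ 'n::finite \<Rightarrow> complex) \<Rightarrow> real ^ 'n \<Rightarrow> complex" where
  "cell_avg H x = (LINT y:unit_cell|lborel. H (x + y))"

lemma cell_integral_norm_le:
  fixes F :: "real ^ 'n::finite \<Rightarrow> 'b::{banach, second_countable_topology}"
  assumes "continuous_on UNIV F" and B: "\<And>y. y \<in> unit_cell \<Longrightarrow> norm (F y) \<le> B"
  shows "norm (LINT y:unit_cell|lborel. F y) \<le> B"
proof -
  have i: "set_integrable lborel unit_cell F"
    using assms(1) by (intro set_integrable_continuous bounded_half_open_cube) auto
  have "norm (LINT y:unit_cell|lborel. F y) \<le> (LINT y:unit_cell|lborel. norm (F y))"
    by (rule set_integral_norm_bound[OF i])
  also have "\<dots> \<le> (LINT y:(unit_cell :: (real ^ 'n) set)|lborel. B)"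
    using B by (intro set_integral_mono set_integrable_norm i set_integrable_continuous bounded_half_open_cube) auto
  also have "\<dots> = B" by (subst set_integral_const) (use measure_unit_cell emeasure_unit_cell in auto)
  finally show ?thesis .
qed

lemma zero_in_unit_cell: "0 \<in> unit_cell"
  by (simp add: half_open_cube_def)

lemma unit_cell_scale:
  assumes "y \<in> unit_cell" "0 \<le> t" "t \<le> 1" shows "t *\<^sub>R y \<in> unit_cell"
proof -
  have "- (1 / 2) \<le> t * a \<and> t * a < 1 / 2" if "- (1 / 2) \<le> a" "a < 1 / 2" for a
  proof (cases "0 \<le> a")
    case True
    then have "0 \<le> t * a" "t * a \<le> a" using assms by (auto simp: mult_left_le_one_le)
    then show ?thesis using that by linarith
  next
    case False
    then have "t * a \<le> 0" "a \<le> t * a"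
      using assms mult_left_le_one_le[of "- a" t] by (auto simp: mult_nonneg_nonpos)
    then show ?thesis using that by linarith
  qed
  then show ?thesis using assms(1) by (auto simp: half_open_cube_def)
qed

definition cell_moment :: "'n::finite list \<Rightarrow> real" where
  "cell_moment u = (LINT y:unit_cell|lborel. list_monomial y u / fact (length u))"

lemma cell_moment_Nil: "cell_moment ([] :: 'n::finite list) = 1"
  unfolding cell_moment_def list_monomial_simps
  by (subst set_integral_const) (use measure_unit_cell emeasure_unit_cell in auto)

lemma cell_avg_Taylor:
  fixes D :: "'n::finite list \<Rightarrow> real ^ 'n \<Rightarrow> complex"
  assumes D: "smooth_derivs D" and M: "0 < M"
    and B: "\<And>u y. length u = M \<Longrightarrow> y \<in> unit_cell \<Longrightarrow> norm (D u (x + y)) \<le> B"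
  shows "norm (cell_avg (D []) x - (\<Sum>u | length u < M. cell_moment u *\<^sub>R D u x)) \<le> real CARD('n) ^ M * B"
proof -
  let ?T = "\<lambda>y. \<Sum>u | length u < M. (list_monomial y u / fact (length u)) *\<^sub>R D u x"
  have cont: "continuous_on UNIV (\<lambda>y. D [] (x + y))"
    by (rule continuous_on_compose2[OF smooth_derivs_continuous[OF D]]) (auto intro!: continuous_intros)
  have contm: "continuous_on UNIV (\<lambda>y :: real ^ 'n. list_monomial y u / fact (length u))" for u
    by (intro continuous_intros continuous_on_list_monomial) simp
  note int = set_integrable_continuous[OF _ half_open_cube_borel bounded_half_open_cube]
  have "(LINT y:unit_cell|lborel. ?T y) =
      (\<Sum>u | length u < M. LINT y:unit_cell|lborel. (list_monomial y u / fact (length u)) *\<^sub>R D u x)"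
    unfolding set_lebesgue_integral_def scaleR_sum_right
    by (rule Bochner_Integration.integral_sum, rule int[unfolded set_integrable_def])
      (intro continuous_intros contm)
  also have "\<dots> = (\<Sum>u | length u < M. cell_moment u *\<^sub>R D u x)"
    unfolding cell_moment_def set_lebesgue_integral_def
  proof (rule sum.cong[OF refl])
    fix u :: "'n list"
    have "integrable lborel (\<lambda>y :: real ^ 'n. indicator unit_cell y *\<^sub>R (list_monomial y u / fact (length u)))"
      by (rule int[OF contm, unfolded set_integrable_def])
    then show "(LINT y|lborel. indicator unit_cell y *\<^sub>R (list_monomial y u / fact (length u)) *\<^sub>R D u x) =
        (LINT y|lborel. indicator unit_cell y *\<^sub>R (list_monomial y u / fact (length u))) *\<^sub>R D u x"
      by (subst integral_scaleR_left[symmetric]) simp_all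
  qed
  finally have "(\<Sum>u | length u < M. cell_moment u *\<^sub>R D u x) = (LINT y:unit_cell|lborel. ?T y)"
    by (rule sym)
  then have "cell_avg (D []) x - (\<Sum>u | length u < M. cell_moment u *\<^sub>R D u x) =
      (LINT y:unit_cell|lborel. D [] (x + y) - ?T y)"
    unfolding cell_avg_def
    by (subst set_integral_diff) (auto intro!: int cont continuous_intros contm)
  also have "norm \<dots> \<le> real CARD('n) ^ M * B"
  proof (rule cell_integral_norm_le)
    show "continuous_on UNIV (\<lambda>y. D [] (x + y) - ?T y)"
      by (intro continuous_intros cont contm)
    fix y :: "real ^ 'n" assume y: "y \<in> unit_cell"
    show "norm (D [] (x + y) - ?T y) \<le> real CARD('n) ^ M * B"
    proof (rule multivariate_Taylor[OF D M])
      have "- (1 / 2) \<le> y $ i" "y $ i < 1 / 2" for i using y by (auto simp: half_open_cube_def)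
      then show "\<bar>y $ i\<bar> \<le> 1" for i by (smt (verit) field_sum_of_halves)
    qed (use B unit_cell_scale y in blast)
  qed
  finally show ?thesis .
qed

text \<open>The coefficients of the formal inverse of \<open>\<Sum>\<^sub>u cell_moment u \<partial>\<^sub>u\<close>, the operator that
  averages over the unit cell.\<close>

function inv_moment :: "'n::finite list \<Rightarrow> real" where
  "inv_moment l = (if l = [] then 1 else
     - (\<Sum>k<length l. inv_moment (take k l) * cell_moment (drop k l)))"
  by auto
termination by (relation "Wellfounded.measure length") auto

declare inv_moment.simps [simp del]

lemma inv_moment_Nil: "inv_moment [] = 1"
  by (simp add: inv_moment.simps)

text \<open>A word cut before its last letter is the same as a pair of a prefix w and a nonempty
  suffix u. Regrouping by u lets the recursion for \<open>inv_moment\<close> be read as a product of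
  two formal series in noncommuting letters.\<close>

lemma sum_list_splits:
  fixes F :: "'n::finite list \<Rightarrow> 'n list \<Rightarrow> 'b::comm_monoid_add"
  shows "(\<Sum>l | l \<noteq> [] \<and> length l < M. \<Sum>k<length l. F (take k l) (drop k l)) =
    (\<Sum>u | u \<noteq> [] \<and> length u < M. \<Sum>w | length w < M - length u. F w u)"
proof -
  have fin: "finite {l :: 'n list. l \<noteq> [] \<and> length l < M}"
    by (rule finite_subset[OF _ finite_lists_length_less[of M]]) auto
  show ?thesis
    using fin
    by (simp add: sum.Sigma)
      (rule sum.reindex_bij_witness[of _ "\<lambda>(u, w). (w @ u, length w)" "\<lambda>(l, k). (drop k l, take k l)"]; auto)
qed

text \<open>Taylor's formula expresses the average through the value and the higher derivatives at
  x; the induction hypothesis at order \<open>M - length u\<close> replaces the derivative along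
  each nonempty word \<open>u\<close> by averages. Only derivatives of order M over one cell enter,
  and C depends on M and n alone: the bound is later used uniformly in z, and with B = 0 for
  polynomials.\<close>

lemma inverse_cell_avg_bound:
  "\<exists>C\<ge>0. \<forall>(D :: 'n::finite list \<Rightarrow> real ^ 'n \<Rightarrow> complex) x B.
     smooth_derivs D \<longrightarrow> (\<forall>u y. length u = M \<longrightarrow> y \<in> unit_cell \<longrightarrow> norm (D u (x + y)) \<le> B) \<longrightarrow>
     norm (D [] x - (\<Sum>l | length l < M. inv_moment l *\<^sub>R cell_avg (D l) x)) \<le> C * B"
proof (induction M rule: less_induct)
  case (less M)
  show ?case
  proof (cases "M = 0")
    case True
    show ?thesis
    proof (intro exI[of _ 1] conjI allI impI)
      fix D :: "'n list \<Rightarrow> real ^ 'n \<Rightarrow> complex" and x B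
      assume "\<forall>u y. length u = M \<longrightarrow> y \<in> unit_cell \<longrightarrow> norm (D u (x + y)) \<le> B"
      then have "norm (D [] (x + 0)) \<le> B" using zero_in_unit_cell True by blast
      then show "norm (D [] x - (\<Sum>l | length l < M. inv_moment l *\<^sub>R cell_avg (D l) x)) \<le> 1 * B"
        using True by simp
    qed simp
  next
    case False
    define Q where "Q m C \<longleftrightarrow> C \<ge> 0 \<and> (\<forall>(D :: 'n list \<Rightarrow> real ^ 'n \<Rightarrow> complex) x B.
      smooth_derivs D \<longrightarrow> (\<forall>u y. length u = m \<longrightarrow> y \<in> unit_cell \<longrightarrow> norm (D u (x + y)) \<le> B) \<longrightarrow>
      norm (D [] x - (\<Sum>l | length l < m. inv_moment l *\<^sub>R cell_avg (D l) x)) \<le> C * B)" for m C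
    have "\<forall>m\<in>{..<M}. \<exists>C. Q m C"
      using less.IH unfolding Q_def by blast
    then obtain C where Q: "\<And>m. m < M \<Longrightarrow> Q m (C m)"
      unfolding bchoice_iff by blast
    have C0: "C m \<ge> 0" if "m < M" for m
      using Q[OF that] unfolding Q_def by blast
    have C: "norm (D [] x - (\<Sum>l | length l < m. inv_moment l *\<^sub>R cell_avg (D l) x)) \<le> C m * B"
      if "m < M" "smooth_derivs D" "\<forall>u y. length u = m \<longrightarrow> y \<in> unit_cell \<longrightarrow> norm (D u (x + y)) \<le> B"
      for m and D :: "'n list \<Rightarrow> real ^ 'n \<Rightarrow> complex" and x B
      using Q[OF that(1)] that(2,3) unfolding Q_def by blast
    let ?U = "{u :: 'n list. u \<noteq> [] \<and> length u < M}"
    have fin: "finite ?U" by (rule finite_subset[OF _ finite_lists_length_less[of M]]) auto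
    have ins: "{u :: 'n list. length u < M} = insert [] ?U" using False by auto
    define C' where "C' = real CARD('n) ^ M + (\<Sum>u\<in>?U. \<bar>cell_moment u\<bar> * C (M - length u))"
    show ?thesis
    proof (intro exI[of _ C'] conjI allI impI)
      show "0 \<le> C'" unfolding C'_def
        by (intro add_nonneg_nonneg sum_nonneg mult_nonneg_nonneg C0) auto
      fix D :: "'n list \<Rightarrow> real ^ 'n \<Rightarrow> complex" and x B
      assume D: "smooth_derivs D"
        and B: "\<forall>u y. length u = M \<longrightarrow> y \<in> unit_cell \<longrightarrow> norm (D u (x + y)) \<le> B"
      define I where "I u = (\<Sum>w | length w < M - length u. inv_moment w *\<^sub>R cell_avg (D (w @ u)) x)" for u
      have 1: "norm (cell_avg (D []) x - (\<Sum>u | length u < M. cell_moment u *\<^sub>R D u x)) \<le> real CARD('n) ^ M * B"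
        using D False B by (intro cell_avg_Taylor) auto
      have 2: "norm (D u x - I u) \<le> C (M - length u) * B" if u: "u \<in> ?U" for u
      proof -
        have "norm (D ([] @ u) x - (\<Sum>l | length l < M - length u. inv_moment l *\<^sub>R cell_avg (D (l @ u)) x))
            \<le> C (M - length u) * B"
        proof (rule C[where D = "\<lambda>l. D (l @ u)"])
          show "\<forall>v y. length v = M - length u \<longrightarrow> y \<in> unit_cell \<longrightarrow> norm (D (v @ u) (x + y)) \<le> B"
            using B u by auto
        qed (use u D in \<open>auto intro: smooth_derivs_append\<close>)
        then show ?thesis by (simp add: I_def)
      qed
      \<comment> \<open>Unfolding the recursion of \<open>inv_moment\<close> and regrouping by the
        suffix \<open>u\<close> turns this sum into minus the inductive approximations
        \<open>I u\<close>, weighted by the cell moments.\<close>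
      have "(\<Sum>l\<in>?U. inv_moment l *\<^sub>R cell_avg (D l) x) =
          - (\<Sum>l\<in>?U. \<Sum>k<length l. (inv_moment (take k l) * cell_moment (drop k l)) *\<^sub>R
               cell_avg (D (take k l @ drop k l)) x)"
        unfolding sum_negf[symmetric]
        by (rule sum.cong[OF refl], subst inv_moment.simps) (simp add: scaleR_sum_left sum_negf)
      also have "\<dots> = - (\<Sum>u\<in>?U. \<Sum>w | length w < M - length u. (inv_moment w * cell_moment u) *\<^sub>R
               cell_avg (D (w @ u)) x)"
        by (subst sum_list_splits[where F = "\<lambda>w u. (inv_moment w * cell_moment u) *\<^sub>R cell_avg (D (w @ u)) x"]) simp
      also have "\<dots> = - (\<Sum>u\<in>?U. cell_moment u *\<^sub>R I u)"
        by (simp add: I_def scaleR_sum_right mult.commute)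
      finally have "D [] x - (\<Sum>l | length l < M. inv_moment l *\<^sub>R cell_avg (D l) x) =
          - (cell_avg (D []) x - (\<Sum>u | length u < M. cell_moment u *\<^sub>R D u x))
          - (\<Sum>u\<in>?U. cell_moment u *\<^sub>R (D u x - I u))"
        unfolding ins using fin
        by (simp add: inv_moment_Nil cell_moment_Nil scaleR_diff_right sum_subtractf)
      also have "norm \<dots> \<le> real CARD('n) ^ M * B + (\<Sum>u\<in>?U. \<bar>cell_moment u\<bar> * (C (M - length u) * B))"
      proof (rule order_trans[OF norm_triangle_ineq4 add_mono])
        show "norm (- (cell_avg (D []) x - (\<Sum>u | length u < M. cell_moment u *\<^sub>R D u x))) \<le> real CARD('n) ^ M * B"
          using 1 by (simp only: norm_minus_cancel)
        show "norm (\<Sum>u\<in>?U. cell_moment u *\<^sub>R (D u x - I u)) \<le>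
            (\<Sum>u\<in>?U. \<bar>cell_moment u\<bar> * (C (M - length u) * B))"
          by (rule sum_norm_le) (use 2 in \<open>simp add: mult_left_mono\<close>)
      qed
      also have "\<dots> = C' * B"
        by (simp add: C'_def distrib_right sum_distrib_right mult.assoc)
      finally show "norm (D [] x - (\<Sum>l | length l < M. inv_moment l *\<^sub>R cell_avg (D l) x)) \<le> C' * B" .
    qed
  qed
qed

text \<open>A point x lies in the cell of the lattice point whose i-th coordinate is the floor of
  \<open>x $ i + 1 / 2\<close>. The cells of a box therefore fill the cube of half-side N + 1/2; the
  shift by 1/2 in the later expansions originates here.\<close>

lemma sum_cell_avg_lattice_box:
  fixes H :: "real ^ 'n::finite \<Rightarrow> complex"
  assumes H: "continuous_on UNIV H"
  shows "(\<Sum>k\<in>lattice_box N. cell_avg H (lattice_vec k)) = (LINT x:half_open_cube (real N + 1 / 2)|lborel. H x)"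
proof -
  define A where "A k = {x :: real ^ 'n. x - lattice_vec k \<in> unit_cell}" for k
  have A_iff: "x \<in> A k \<longleftrightarrow> (\<forall>i. k $ i = \<lfloor>x $ i + 1 / 2\<rfloor>)" for x k
  proof -
    have "- (1 / 2) \<le> t - real_of_int j \<and> t - real_of_int j < 1 / 2 \<longleftrightarrow> j = \<lfloor>t + 1 / 2\<rfloor>" for t j
      by linarith
    then show ?thesis by (simp add: A_def half_open_cube_def lattice_vec_def)
  qed
  have Un: "(\<Union>k\<in>lattice_box N. A k) = half_open_cube (real N + 1 / 2)"
  proof -
    have *: "\<bar>\<lfloor>t + 1 / 2\<rfloor>\<bar> \<le> int N \<longleftrightarrow> - (real N + 1 / 2) \<le> t \<and> t < real N + 1 / 2" for t
      by linarith
    have "x \<in> (\<Union>k\<in>lattice_box N. A k) \<longleftrightarrow> (\<chi> i. \<lfloor>x $ i + 1 / 2\<rfloor>) \<in> lattice_box N" for x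
    proof -
      have "x \<in> A k \<longleftrightarrow> k = (\<chi> i. \<lfloor>x $ i + 1 / 2\<rfloor>)" for k
        by (simp add: A_iff vec_eq_iff)
      then show ?thesis by simp
    qed
    then show ?thesis
      by (auto simp: lattice_box_def half_open_cube_def *)
  qed
  have meas: "A k \<in> sets borel" for k unfolding A_def by measurable
  have int: "set_integrable lborel (A k) H" for k
  proof (rule set_integrable_continuous[OF H meas])
    have "A k = (+) (lattice_vec k) ` unit_cell"
      by (force simp: A_def image_iff intro: exI[of _ "x - lattice_vec k" for x])
    then show "bounded (A k)" using bounded_translation[OF bounded_half_open_cube] by simp
  qed
  have disj: "disjoint_family_on A (lattice_box N)"
    by (auto simp: disjoint_family_on_def A_iff vec_eq_iff)
  have eq: "cell_avg H (lattice_vec k) = (LINT x:A k|lborel. H x)" for k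
  proof -
    have [measurable]: "H \<in> borel_measurable borel" using H by (rule borel_measurable_continuous_onI)
    have [measurable]: "A k \<in> sets borel" by (rule meas)
    have "(LINT x:A k|lborel. H x) = (LINT x|lborel. indicator (A k) (lattice_vec k + x) *\<^sub>R H (lattice_vec k + x))"
      unfolding set_lebesgue_integral_def
      by (rule lborel_integral_translate[symmetric]) measurable
    then show ?thesis
      by (simp add: cell_avg_def set_lebesgue_integral_def A_def indicator_def)
  qed
  show ?thesis
    unfolding eq Un[symmetric]
    by (rule set_integral_finite_Union[symmetric]) (auto simp: sum_lattice_box_prod(1) disj int meas)
qed

section \<open>Homogeneous functions\<close>

lemma has_vector_derivative_quotient:
  fixes f :: "real \<Rightarrow> 'a::real_normed_vector"
  assumes "(f has_vector_derivative d) (at 0)"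
  shows "((\<lambda>h. (f h - f 0) /\<^sub>R h) \<longlongrightarrow> d) (at 0)"
proof -
  have "((\<lambda>h. norm ((f h - f 0 - h *\<^sub>R d) /\<^sub>R \<bar>h\<bar>)) \<longlongrightarrow> 0) (at 0)"
    using assms by (simp only: has_vector_derivative_def has_derivative_at_within has_derivative_at tendsto_norm_zero_iff)
      (auto dest: tendsto_norm_zero)
  moreover have "\<forall>\<^sub>F h in at 0. norm ((f h - f 0 - h *\<^sub>R d) /\<^sub>R \<bar>h\<bar>) = norm ((f h - f 0) /\<^sub>R h - d)"
    unfolding eventually_at_filter
  proof (rule always_eventually, intro allI impI)
    fix h :: real assume h: "h \<noteq> 0"
    then have "(f h - f 0) /\<^sub>R h - d = (f h - f 0 - h *\<^sub>R d) /\<^sub>R h"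
      by (simp add: scaleR_diff_right)
    then show "norm ((f h - f 0 - h *\<^sub>R d) /\<^sub>R \<bar>h\<bar>) = norm ((f h - f 0) /\<^sub>R h - d)" by simp
  qed
  ultimately have "((\<lambda>h. norm ((f h - f 0) /\<^sub>R h - d)) \<longlongrightarrow> 0) (at 0)"
    by (rule Lim_transform_eventually)
  then show ?thesis by (metis LIM_zero_cancel tendsto_norm_zero_cancel)
qed

text \<open>Translation invariance makes the integral of every difference quotient vanish, and
  dominated convergence passes to the derivative.\<close>

lemma integral_partial_derivative_compact_support:
  fixes K K' :: "real ^ 'n::finite \<Rightarrow> complex"
  assumes K: "continuous_on UNIV K" and K': "continuous_on UNIV K'"
    and deriv: "\<And>x. ((\<lambda>h. K (x + h *\<^sub>R axis i 1)) has_vector_derivative K' x) (at 0)"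
    and supp: "\<And>x. r < norm x \<Longrightarrow> K x = 0" "\<And>x. r < norm x \<Longrightarrow> K' x = 0"
  shows "(LINT x|lborel. K' x) = 0"
proof -
  let ?e = "axis i 1 :: real ^ 'n"
  have [measurable]: "K \<in> borel_measurable borel" "K' \<in> borel_measurable borel"
    using K K' by (auto intro: borel_measurable_continuous_onI)
  have line: "((\<lambda>t. K (x + t *\<^sub>R ?e)) has_vector_derivative K' (x + t *\<^sub>R ?e)) (at t)" for x t
  proof -
    have "((\<lambda>h. K ((x + t *\<^sub>R ?e) + h *\<^sub>R ?e)) \<circ> (\<lambda>u. u - t) has_vector_derivative 1 *\<^sub>R K' (x + t *\<^sub>R ?e)) (at t)"
    proof (rule vector_diff_chain_at)
      show "((\<lambda>u. u - t) has_vector_derivative 1) (at t)"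
        by (auto intro!: derivative_eq_intros)
    qed (simp add: deriv)
    then show ?thesis by (simp add: o_def algebra_simps)
  qed
  obtain B where B: "\<And>x. norm (K' x) \<le> B" and B0: "0 \<le> B"
  proof -
    have "compact (K' ` cball 0 r)"
      by (rule compact_continuous_image[OF continuous_on_subset[OF K'] compact_cball]) simp
    then obtain B where "B > 0" "\<forall>y\<in>K' ` cball 0 r. norm y \<le> B"
      using compact_imp_bounded bounded_pos by metis
    then show ?thesis using supp(2) by (intro that[of B]) (force simp: not_less)+
  qed
  let ?s = "\<lambda>m x. (K (x + (1 / real (Suc m)) *\<^sub>R ?e) - K x) /\<^sub>R (1 / real (Suc m))"
  have intK: "integrable lborel K"
  proof -
    have "set_integrable lborel (cball 0 r) K"
      by (rule set_integrable_continuous[OF K]) auto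
    moreover have "indicator (cball 0 r) x *\<^sub>R K x = K x" for x
      using supp(1)[of x] by (auto simp: indicator_def)
    ultimately show ?thesis by (simp add: set_integrable_def)
  qed
  have intKt: "integrable lborel (\<lambda>x. K (x + a))" for a
  proof -
    have "integrable (distr lborel borel ((+) a)) K" using intK by (simp add: lborel_distr_plus)
    then show ?thesis by (subst (asm) integrable_distr_eq) (auto simp: add.commute)
  qed
  have "(\<lambda>m. LINT x|lborel. ?s m x) \<longlonglongrightarrow> (LINT x|lborel. K' x)"
  \<comment> \<open>The increments 1 / (m + 1) are at most 1, so all quotients vanish outside the
    ball of radius r + 1; inside it the mean value inequality bounds them by B.\<close>
  proof (rule integral_dominated_convergence[where w = "\<lambda>x. indicator (cball 0 (r + 1)) x *\<^sub>R B"])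
    show "integrable lborel (\<lambda>x :: real ^ 'n. indicator (cball 0 (r + 1)) x *\<^sub>R B)"
      using set_integrable_continuous[of "\<lambda>_ :: real ^ 'n. B" "cball 0 (r + 1)"] by (simp add: set_integrable_def)
    show "AE x in lborel. (\<lambda>m. ?s m x) \<longlonglongrightarrow> K' x"
    proof (rule AE_I2)
      fix x
      have "((\<lambda>h. (K (x + h *\<^sub>R ?e) - K x) /\<^sub>R h) \<longlongrightarrow> K' x) (at 0)"
        using has_vector_derivative_quotient[OF deriv[of x]] by simp
      moreover have "filterlim (\<lambda>m. 1 / real (Suc m)) (at 0) sequentially"
        using LIMSEQ_Suc[OF lim_1_over_n] by (auto simp: filterlim_at)
      ultimately show "(\<lambda>m. ?s m x) \<longlonglongrightarrow> K' x" by (rule filterlim_compose)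
    qed
    show "AE x in lborel. norm (?s m x) \<le> indicator (cball 0 (r + 1)) x *\<^sub>R B" for m
    proof (rule AE_I2)
      fix x
      let ?h = "1 / real (Suc m)"
      have h: "0 < ?h" "?h \<le> 1" by auto
      show "norm (?s m x) \<le> indicator (cball 0 (r + 1)) x *\<^sub>R B"
      proof (cases "norm x \<le> r + 1")
        case True
        have "norm (K (x + ?h *\<^sub>R ?e) - K (x + 0 *\<^sub>R ?e)) \<le> B * norm (?h - 0)"
        proof (rule differentiable_bound[where S = UNIV and f = "\<lambda>t. K (x + t *\<^sub>R ?e)"])
          show "((\<lambda>t. K (x + t *\<^sub>R ?e)) has_derivative (\<lambda>h. h *\<^sub>R K' (x + t *\<^sub>R ?e))) (at t within UNIV)" for t
            using line[of x t] by (simp add: has_vector_derivative_def)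
          show "onorm (\<lambda>h. h *\<^sub>R K' (x + t *\<^sub>R ?e)) \<le> B" for t
            using B B0 by (intro onorm_bound) (auto simp: mult.commute[of B] intro!: mult_left_mono)
        qed auto
        then have "norm (K (x + ?h *\<^sub>R ?e) - K x) / ?h \<le> B"
          using h by (simp add: field_simps)
        then show ?thesis using True h by (simp add: divide_inverse mult.commute)
      next
        case False
        have "norm x \<le> norm (x + ?h *\<^sub>R ?e) + norm (?h *\<^sub>R ?e)"
          by (metis add_diff_cancel norm_triangle_ineq4)
        moreover have "norm (?h *\<^sub>R ?e) = ?h" by simp
        ultimately have "r < norm (x + ?h *\<^sub>R ?e)" using False h(2) by linarith
        then show ?thesis using False supp(1) by simp
      qed
    qed
  qed auto
  moreover have "(LINT x|lborel. ?s m x) = 0" for m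
  proof -
    have "(LINT x|lborel. K (x + a)) = (LINT x|lborel. K x)" for a
      using lborel_integral_translate[of K a] by (simp add: add.commute)
    then show ?thesis
      using intK intKt by (simp add: Bochner_Integration.integral_diff)
  qed
  ultimately have "(\<lambda>m::nat. 0) \<longlonglongrightarrow> (LINT x|lborel. K' x)" by (simp only:)
  then show ?thesis by (simp add: LIMSEQ_const_iff)
qed

lemma of_real_powr_mult:
  "0 \<le> a \<Longrightarrow> 0 \<le> b \<Longrightarrow> complex_of_real (a * b) powr s = of_real a powr s * of_real b powr s"
  using powr_times_real[of "of_real a" "of_real b" s] by simp

text \<open>Positive homogeneity outside the unit ball only: the functions below are smooth at the
  origin.\<close>

definition outer_homogeneous :: "complex \<Rightarrow> (real ^ 'n::finite \<Rightarrow> complex) \<Rightarrow> bool" where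
  "outer_homogeneous s g \<longleftrightarrow>
     (\<forall>x t. 1 \<le> norm x \<longrightarrow> 1 \<le> t \<longrightarrow> g (t *\<^sub>R x) = of_real t powr s * g x)"

text \<open>Differentiating the homogeneity relation lowers the degree by one but requires the
  relation on an open set. The induction therefore runs over \<open>1 < norm x\<close>, and the unit
  sphere is reached by continuity through the factors \<open>1 + 1 / real (Suc m)\<close>.\<close>

lemma outer_homogeneous_deriv:
  fixes D :: "'n::finite list \<Rightarrow> real ^ 'n \<Rightarrow> complex"
  assumes D: "smooth_derivs D" and hom: "outer_homogeneous s (D [])" and x: "1 \<le> norm x" and t: "1 \<le> t"
  shows "D l (t *\<^sub>R x) = of_real t powr (s - of_nat (length l)) * D l x"
proof -
  have strict: "D l (t *\<^sub>R x) = of_real t powr (s - of_nat (length l)) * D l x" if "1 < norm x" for l x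
    using that
  proof (induction l arbitrary: x)
    case Nil
    then show ?case using hom t by (simp add: outer_homogeneous_def)
  next
    case (Cons i l)
    let ?e = "axis i 1 :: real ^ 'n"
    let ?w = "of_real t powr (s - of_nat (length l)) :: complex"
    have 1: "((\<lambda>h. ?w * D l (x + h *\<^sub>R ?e)) has_vector_derivative ?w * D (i # l) x) (at 0)"
      using D by (intro has_vector_derivative_mult_right) (simp add: smooth_derivs_def)
    have "((\<lambda>h. D l (t *\<^sub>R x + h *\<^sub>R ?e)) \<circ> (\<lambda>h. t * h) has_vector_derivative t *\<^sub>R D (i # l) (t *\<^sub>R x)) (at 0)"
    proof (rule vector_diff_chain_at)
      show "((\<lambda>h. t * h) has_vector_derivative t) (at 0)"
        by (auto intro!: derivative_eq_intros simp: has_real_derivative_iff_has_vector_derivative[symmetric])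
    qed (use D in \<open>simp add: smooth_derivs_def\<close>)
    then have 2: "((\<lambda>h. D l (t *\<^sub>R (x + h *\<^sub>R ?e))) has_vector_derivative t *\<^sub>R D (i # l) (t *\<^sub>R x)) (at 0)"
      by (simp add: o_def algebra_simps)
    have "\<forall>\<^sub>F h in nhds 0. 1 < norm (x + h *\<^sub>R ?e)"
    proof -
      have "((\<lambda>h. norm (x + h *\<^sub>R ?e)) \<longlongrightarrow> norm (x + 0 *\<^sub>R ?e)) (nhds 0)"
        by (intro tendsto_intros) (simp add: filterlim_ident)
      then show ?thesis using Cons.prems by (intro order_tendstoD(1)) simp
    qed
    then have ev: "\<forall>\<^sub>F h in nhds 0. D l (t *\<^sub>R (x + h *\<^sub>R ?e)) = ?w * D l (x + h *\<^sub>R ?e)"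
      by eventually_elim (rule Cons.IH)
    have "((\<lambda>h. ?w * D l (x + h *\<^sub>R ?e)) has_vector_derivative t *\<^sub>R D (i # l) (t *\<^sub>R x)) (at 0)"
      using 2 ev eventually_nhds_x_imp_x[OF ev]
      by (subst (asm) has_vector_derivative_cong_ev[where g = "\<lambda>h. ?w * D l (x + h *\<^sub>R ?e)"])
        (auto elim: eventually_mono)
    then have "t *\<^sub>R D (i # l) (t *\<^sub>R x) = ?w * D (i # l) x"
      using 1 vector_derivative_unique_at by blast
    moreover have "of_real t powr (s - of_nat (length (i # l))) = ?w / of_real t"
    proof -
      have "s - of_nat (length (i # l)) = (s - of_nat (length l)) - 1" by simp
      then show ?thesis using t by (simp only: powr_diff) simp
    qed
    moreover have "D (i # l) (t *\<^sub>R x) = (?w * D (i # l) x) / of_real t"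
      if "t *\<^sub>R D (i # l) (t *\<^sub>R x) = ?w * D (i # l) x"
      using t that[symmetric] by (simp add: scaleR_conv_of_real)
    ultimately show ?case by simp
  qed
  have cont: "continuous_on UNIV (D l)" by (rule smooth_derivs_continuous[OF D])
  have x0: "x \<noteq> 0" using x by auto
  let ?a = "\<lambda>m. 1 + 1 / real (Suc m)"
  have a: "?a \<longlonglongrightarrow> 1" using tendsto_add[OF tendsto_const LIMSEQ_Suc[OF lim_1_over_n], of 1] by simp
  have lim: "(\<lambda>m. D l (?a m *\<^sub>R y)) \<longlonglongrightarrow> D l y" for y
  proof -
    have "(\<lambda>m. ?a m *\<^sub>R y) \<longlonglongrightarrow> 1 *\<^sub>R y" by (intro tendsto_scaleR a tendsto_const)
    then show ?thesis
      using continuous_on_tendsto_compose[OF cont, of "\<lambda>m. ?a m *\<^sub>R y" y] by simp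
  qed
  have "D l (?a m *\<^sub>R (t *\<^sub>R x)) = of_real t powr (s - of_nat (length l)) * D l (?a m *\<^sub>R x)" for m
  proof -
    have "1 < ?a m * norm x" using x x0
      by (smt (verit) divide_pos_pos mult_le_cancel_left1 mult_less_cancel_right2 of_nat_0_less_iff zero_less_Suc zero_less_norm_iff)
    then have "1 < norm (?a m *\<^sub>R x)" by (simp del: of_nat_Suc)
    from strict[OF this, of l] show ?thesis by (simp add: mult.commute)
  qed
  then have "(\<lambda>m. of_real t powr (s - of_nat (length l)) * D l (?a m *\<^sub>R x)) \<longlonglongrightarrow> D l (t *\<^sub>R x)"
    using lim[of "t *\<^sub>R x"] by simp
  moreover have "(\<lambda>m. of_real t powr (s - of_nat (length l)) * D l (?a m *\<^sub>R x)) \<longlonglongrightarrow>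
      of_real t powr (s - of_nat (length l)) * D l x"
    by (intro tendsto_intros lim)
  ultimately show ?thesis by (rule LIMSEQ_unique)
qed

lemma set_integral_scale:
  fixes H :: "real ^ 'n::finite \<Rightarrow> complex"
  assumes [measurable]: "H \<in> borel_measurable borel" "A \<in> sets borel" and t: "0 < t"
    and AB: "\<And>x. t *\<^sub>R x \<in> A \<longleftrightarrow> x \<in> B"
  shows "(LINT x:A|lborel. H x) = of_real t ^ CARD('n) * (LINT x:B|lborel. H (t *\<^sub>R x))"
proof -
  have "(LINT x:A|lborel. H x) = t ^ CARD('n) *\<^sub>R (LINT x|lborel. indicator A (t *\<^sub>R x) *\<^sub>R H (t *\<^sub>R x))"
    unfolding set_lebesgue_integral_def
    by (subst lborel_integral_scale[OF _ t]) auto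
  also have "(\<lambda>x :: real ^ 'n. indicator A (t *\<^sub>R x) :: real) = indicator B"
    using AB by (auto simp: indicator_def fun_eq_iff)
  finally show ?thesis
    by (simp add: set_lebesgue_integral_def scaleR_conv_of_real)
qed

text \<open>The rescaled function minus the original one has compact support, so its derivative
  integrates to zero.\<close>

lemma cube_integral_deriv_scale:
  fixes D :: "'n::finite list \<Rightarrow> real ^ 'n \<Rightarrow> complex"
  assumes D: "smooth_derivs D" and hom: "outer_homogeneous s (D [])" and t: "1 \<le> t" and l: "l \<noteq> []"
  shows "(LINT x:half_open_cube (t * 2)|lborel. D l x) =
    of_real t powr (s + of_nat CARD('n) - of_nat (length l)) * (LINT x:half_open_cube 2|lborel. D l x)"
proof -
  obtain i u where l: "l = i # u" using l by (cases l) auto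
  define w where "w = (of_real t :: complex) powr (s - of_nat (length l))"
  have w0: "w \<noteq> 0" using t by (simp add: w_def)
  have wu: "of_real t powr (s - of_nat (length u)) = w * of_real t"
  proof -
    have "s - of_nat (length u) = (s - of_nat (length l)) + 1" by (simp add: l)
    then show ?thesis using t by (simp only: powr_add w_def) simp
  qed
  let ?K = "\<lambda>x. D u (t *\<^sub>R x) - (w * of_real t) * D u x"
  let ?K' = "\<lambda>x. of_real t * (D l (t *\<^sub>R x) - w * D l x)"
  have cont: "continuous_on UNIV (\<lambda>x. D v (t *\<^sub>R x))" "continuous_on UNIV (D v)" for v
    using smooth_derivs_continuous[OF D]
    by (auto intro!: continuous_on_compose2[OF smooth_derivs_continuous[OF D]] continuous_intros)
  have supp: "D v (t *\<^sub>R x) = of_real t powr (s - of_nat (length v)) * D v x" if "1 < norm x" for v x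
    using outer_homogeneous_deriv[OF D hom _ t] that by simp
  have zero: "(LINT x|lborel. ?K' x) = 0"
  proof (rule integral_partial_derivative_compact_support[where K = ?K and r = 1 and i = i])
    fix x
    let ?e = "axis i 1 :: real ^ 'n"
    have "((\<lambda>h. D u (t *\<^sub>R x + h *\<^sub>R ?e)) \<circ> (\<lambda>h. t * h) has_vector_derivative t *\<^sub>R D l (t *\<^sub>R x)) (at 0)"
    proof (rule vector_diff_chain_at)
      show "((\<lambda>h. t * h) has_vector_derivative t) (at 0)"
        by (auto intro!: derivative_eq_intros simp: has_real_derivative_iff_has_vector_derivative[symmetric])
    qed (use D in \<open>simp add: smooth_derivs_def l\<close>)
    then have "((\<lambda>h. D u (t *\<^sub>R (x + h *\<^sub>R ?e))) has_vector_derivative t *\<^sub>R D l (t *\<^sub>R x)) (at 0)"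
      by (simp add: o_def algebra_simps)
    moreover have "((\<lambda>h. (w * of_real t) * D u (x + h *\<^sub>R ?e)) has_vector_derivative (w * of_real t) * D l x) (at 0)"
      using D by (intro has_vector_derivative_mult_right) (simp add: smooth_derivs_def l)
    ultimately have "((\<lambda>h. ?K (x + h *\<^sub>R ?e)) has_vector_derivative
        t *\<^sub>R D l (t *\<^sub>R x) - (w * of_real t) * D l x) (at 0)"
      by (rule has_vector_derivative_diff)
    then show "((\<lambda>h. ?K (x + h *\<^sub>R ?e)) has_vector_derivative ?K' x) (at 0)"
      by (simp add: scaleR_conv_of_real algebra_simps)
  next
    fix x :: "real ^ 'n" assume "1 < norm x"
    from supp[OF this] show "?K x = 0" "?K' x = 0" by (simp_all add: wu w_def)
  qed (intro continuous_intros cont)+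
  \<comment> \<open>The integrand vanishes for norm larger than 1, and the cube of half-side 2
    contains the closed unit ball, so the integral over the cube is the one over the whole space.
    The half-open cube of half-side 1 would miss boundary points of that ball.\<close>
  have "of_real t * (LINT x:half_open_cube 2|lborel. D l (t *\<^sub>R x) - w * D l x) = (LINT x|lborel. ?K' x)"
  proof -
    have "indicator (half_open_cube 2) x *\<^sub>R (D l (t *\<^sub>R x) - w * D l x) = D l (t *\<^sub>R x) - w * D l x" for x
    proof (cases "1 < norm x")
      case True
      then show ?thesis using supp[OF True, of l] by (simp add: w_def)
    next
      case False
      then have "x \<in> half_open_cube 2" using ball_subset_half_open_cube[of 2] by auto
      then show ?thesis by simp
    qed
    then show ?thesis by (simp add: set_lebesgue_integral_def)
  qed
  then have "(LINT x:half_open_cube 2|lborel. D l (t *\<^sub>R x) - w * D l x) = 0" using zero t by auto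
  moreover have "(LINT x:half_open_cube 2|lborel. D l (t *\<^sub>R x) - w * D l x) =
      (LINT x:half_open_cube 2|lborel. D l (t *\<^sub>R x)) - w * (LINT x:half_open_cube 2|lborel. D l x)"
    by (subst set_integral_diff)
      (auto intro!: set_integrable_continuous bounded_half_open_cube cont continuous_intros)
  ultimately have "(LINT x:half_open_cube 2|lborel. D l (t *\<^sub>R x)) = w * (LINT x:half_open_cube 2|lborel. D l x)"
    by simp
  moreover have "of_real t ^ CARD('n) * w = of_real t powr (s + of_nat CARD('n) - of_nat (length l))"
  proof -
    have "s + of_nat CARD('n) - of_nat (length l) = of_nat CARD('n) + (s - of_nat (length l))" by simp
    then show ?thesis using t by (simp only: powr_add w_def) (simp add: powr_nat)
  qed
  ultimately show ?thesis
    using t by (subst set_integral_scale[OF borel_measurable_continuous_onI[OF smooth_derivs_continuous[OF D]] half_open_cube_borel _ half_open_cube_scaleR]) (auto simp flip: mult.assoc)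
qed

section \<open>Cube integrals of homogeneous functions\<close>

text \<open>The integral against \<open>sphere_measure\<close>, unfolded into a Lebesgue integral:
  the cone construction makes the integral of \<open>g (sgn x)\<close> over the punctured ball equal
  to 1/n of the surface integral.\<close>

definition sphere_int :: "(real ^ 'n::finite \<Rightarrow> complex) \<Rightarrow> complex" where
  "sphere_int g = of_nat CARD('n) * (LINT x:ball 0 1 - {0}|lborel. g (sgn x))"

lemma sphere_int_eq:
  fixes g :: "real ^ 'n::finite \<Rightarrow> complex"
  assumes [measurable]: "g \<in> borel_measurable borel"
  shows "(LINT \<xi>|sphere_measure. g \<xi>) = sphere_int g"
proof -
  have [measurable]: "(sgn :: real ^ 'n \<Rightarrow> real ^ 'n) \<in> borel_measurable borel"
    unfolding sgn_div_norm by measurable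
  have 1: "sgn \<in> measurable (restrict_space lborel (ball 0 1 - {0} :: (real ^ 'n) set)) borel"
    by (rule measurable_restrict_space1) simp
  have "(LINT \<xi>|sphere_measure. g \<xi>) =
      of_nat DIM(real ^ 'n) * (LINT \<xi>|distr (restrict_space lborel (ball 0 1 - {0} :: (real ^ 'n) set)) borel sgn. g \<xi>)"
  proof -
    have "scale_measure (of_nat DIM(real ^ 'n)) (distr (restrict_space lborel (ball 0 1 - {0} :: (real ^ 'n) set)) borel sgn) =
        density (distr (restrict_space lborel (ball 0 1 - {0} :: (real ^ 'n) set)) borel sgn) (\<lambda>_. ennreal (real DIM(real ^ 'n)))"
      by (rule measure_eqI) (simp_all add: emeasure_density_const ennreal_of_nat_eq_real_of_nat del: DIM_cart)
    then show ?thesis unfolding sphere_measure_def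
      by (simp only:) (subst integral_density; simp add: scaleR_conv_of_real)
  qed
  also have "\<dots> = of_nat CARD('n) * (LINT x|restrict_space lborel (ball 0 1 - {0} :: (real ^ 'n) set). g (sgn x))"
    using 1 by (simp add: integral_distr)
  also have "\<dots> = sphere_int g"
    unfolding sphere_int_def set_lebesgue_integral_def
    by (subst integral_restrict_space) auto
  finally show ?thesis .
qed

lemma sphere_int_cong:
  assumes "\<And>x. norm x = 1 \<Longrightarrow> f x = g x"
  shows "sphere_int f = sphere_int g"
proof -
  have "indicator (ball 0 1 - {0}) x *\<^sub>R f (sgn x) = indicator (ball 0 1 - {0}) x *\<^sub>R g (sgn x)" for x :: "real ^ 'a"
    using assms[of "sgn x"] by (auto simp: indicator_def norm_sgn)
  then show ?thesis unfolding sphere_int_def set_lebesgue_integral_def by (simp only:)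
qed

definition shell :: "real \<Rightarrow> real \<Rightarrow> (real ^ 'n::finite) set" where
  "shell a b = {x. a \<le> norm x \<and> norm x < b}"

lemma shell_borel [measurable]: "(shell a b :: (real ^ 'n::finite) set) \<in> sets borel"
  unfolding shell_def by measurable

lemma bounded_shell: "bounded (shell a b)"
  by (rule bounded_subset[OF bounded_ball[of 0 b]]) (auto simp: shell_def)

context
  fixes g :: "real ^ 'n::finite \<Rightarrow> complex" and s w :: complex
  assumes g: "continuous_on UNIV g" and hom: "outer_homogeneous s g"
    and w: "w = s + of_nat CARD('n)" "w \<noteq> 0"
begin

lemma g_borel: "g \<in> borel_measurable borel"
  using g by (rule borel_measurable_continuous_onI)

lemma powr_scale_dimension: "0 < t \<Longrightarrow> of_real t ^ CARD('n) * of_real t powr s = (of_real t :: complex) powr w"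
  by (simp add: w(1) powr_add powr_nat mult.commute)

lemma shell_integral_scale:
  assumes "1 \<le> t" "1 \<le> a"
  shows "(LINT x:shell (t * a) (t * b)|lborel. g x) = of_real t powr w * (LINT x:shell a b|lborel. g x)"
proof -
  have "(LINT x:shell (t * a) (t * b)|lborel. g x) =
      of_real t ^ CARD('n) * (LINT x:shell a b|lborel. g (t *\<^sub>R x))"
    by (rule set_integral_scale[OF g_borel]) (use assms in \<open>auto simp: shell_def\<close>)
  also have "(LINT x:shell a b|lborel. g (t *\<^sub>R x)) = (LINT x:shell a b|lborel. of_real t powr s * g x)"
    unfolding set_lebesgue_integral_def
    by (rule Bochner_Integration.integral_cong)
      (use assms hom in \<open>auto simp: indicator_def shell_def outer_homogeneous_def\<close>)
  finally show ?thesis using powr_scale_dimension[of t] assms by (simp flip: mult.assoc)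
qed

text \<open>This function of r is determined by its multiplicative functional equation
  \<open>shell_int_mult\<close> and its derivative at r = 1. Integration in polar coordinates thus
  follows from scaling alone.\<close>

definition shell_int :: "real \<Rightarrow> complex" where
  "shell_int r = (LINT x:shell 1 r|lborel. g x)"

lemma shell_int_mult:
  assumes "1 \<le> a" "1 \<le> b"
  shows "shell_int (a * b) = shell_int a + of_real a powr w * shell_int b"
proof -
  have "a \<le> a * b" using assms by simp
  then have "norm x < a \<Longrightarrow> norm x < a * b" for x :: "real ^ 'n" by linarith
  then have "shell 1 (a * b) = shell 1 a \<union> (shell a (a * b) :: (real ^ 'n) set)" "shell 1 a \<inter> (shell a (a * b) :: (real ^ 'n) set) = {}"
    using assms by (auto simp: shell_def)
  then show ?thesis
    using shell_integral_scale[of a 1 b] assms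
    by (simp add: shell_int_def set_integral_Un set_integrable_continuous[OF g shell_borel bounded_shell])
qed

text \<open>The comparison function \<open>g0\<close> is homogeneous of degree 0, so its integral
  over the shell is exactly t^n - 1 times the one over the unit ball, whose n-fold is the sphere
  integral. On a thin shell g and g0 differ by the factor \<open>of_real (norm x) powr s\<close>,
  which is close to 1, while the volume of the shell is O(t - 1).\<close>

lemma shell_int_limit:
  "((\<lambda>t. shell_int t / of_real (t - 1)) \<longlongrightarrow> sphere_int g) (at_right 1)"
proof -
  let ?n = "CARD('n)"
  define g0 where "g0 x = g (sgn x)" for x
  define V where "V r = (LINT x:ball 0 r - {0}|lborel. g0 x)" for r
  define vol where "vol = measure lborel (ball 0 1 :: (real ^ 'n) set)"
  have [measurable]: "g \<in> borel_measurable borel" by (rule g_borel)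
  have [measurable]: "(sgn :: real ^ 'n \<Rightarrow> real ^ 'n) \<in> borel_measurable borel"
    unfolding sgn_div_norm by measurable
  have [measurable]: "g0 \<in> borel_measurable borel" unfolding g0_def[abs_def] by measurable
  obtain B where B: "\<And>x. norm (g0 x) \<le> B" and B0: "0 \<le> B"
  proof -
    have "compact (g ` cball 0 1)"
      by (rule compact_continuous_image[OF continuous_on_subset[OF g] compact_cball]) simp
    then obtain B where "B > 0" "\<forall>y\<in>g ` cball 0 1. norm y \<le> B"
      using compact_imp_bounded bounded_pos by metis
    then show ?thesis by (intro that[of B]) (auto simp: g0_def norm_sgn)
  qed
  have int0: "set_integrable lborel A g0" if [measurable]: "A \<in> sets borel" and "bounded A" for A
  proof -
    have c: "set_integrable lborel A (\<lambda>_. B)"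
      by (rule set_integrable_continuous) (use that in auto)
    show ?thesis
      unfolding set_integrable_def
      by (rule Bochner_Integration.integrable_bound[OF c[unfolded set_integrable_def]])
        (auto simp: indicator_def B abs_of_nonneg[OF B0])
  qed
  have V: "V r = of_real r ^ ?n * V 1" if "r > 0" for r
  proof -
    have "V r = of_real r ^ ?n * (LINT x:ball 0 1 - {0}|lborel. g0 (r *\<^sub>R x))"
      unfolding V_def by (rule set_integral_scale) (use that in auto)
    also have "(\<lambda>x. g0 (r *\<^sub>R x)) = g0" using that by (simp add: g0_def sgn_scaleR fun_eq_iff)
    finally show ?thesis by (simp add: V_def)
  qed
  have shellV: "(LINT x:shell 1 t|lborel. g0 x) = (of_real t ^ ?n - 1) * V 1" if "t \<ge> 1" for t
  proof -
    have *: "ball 0 t - {0} = (ball 0 1 - {0}) \<union> (shell 1 t :: (real ^ 'n) set)" "(ball 0 1 - {0}) \<inter> (shell 1 t :: (real ^ 'n) set) = {}"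
      using that by (auto simp: shell_def)
    have "V t = V 1 + (LINT x:shell 1 t|lborel. g0 x)"
      unfolding V_def *(1) by (rule set_integral_Un[OF *(2)]) (auto intro!: int0 bounded_shell intro: bounded_subset[OF bounded_ball])
    then show ?thesis using V[of t] that by (simp add: algebra_simps)
  qed
  have vol: "measure lborel (shell 1 t :: (real ^ 'n) set) = (t ^ ?n - 1) * vol" if "t \<ge> 1" for t
  proof -
    have ballt: "measure lborel (ball 0 t :: (real ^ 'n) set) = t ^ ?n * vol" 
    proof -
      have "measure lborel (ball 0 t :: (real ^ 'n) set) = (LINT x|lborel. indicator (ball 0 t :: (real ^ 'n) set) x)"
        by simp
      also have "\<dots> = t ^ ?n *\<^sub>R (LINT x|lborel. indicator (ball 0 t :: (real ^ 'n) set) (t *\<^sub>R x))"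
      proof -
        have "(indicator (ball 0 t) :: real ^ 'n \<Rightarrow> real) \<in> borel_measurable borel"
          by (rule borel_measurable_indicator) simp
        from lborel_integral_scale[OF this, of t] that show ?thesis
          by (simp only: DIM_cart DIM_real mult_1_right)
      qed
      also have "(\<lambda>x. indicator (ball 0 t :: (real ^ 'n) set) (t *\<^sub>R x) :: real) = indicator (ball 0 1)"
        using that by (auto simp: indicator_def fun_eq_iff)
      finally show ?thesis by (simp add: vol_def)
    qed
    have "shell 1 t = ball 0 t - (ball 0 1 :: (real ^ 'n) set)" using that by (auto simp: shell_def)
    moreover have "measure lborel (ball 0 t - ball 0 1 :: (real ^ 'n) set) = measure lborel (ball 0 t :: (real ^ 'n) set) - vol"
      unfolding vol_def
    proof (rule measurable_measure_Diff)
      show "ball 0 t \<in> fmeasurable (lborel :: (real ^ 'n) measure)"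
        by (rule fmeasurableI) (use emeasure_lborel_ball_finite in \<open>simp_all add: less_top\<close>)
    qed (use that in auto)
    ultimately have "measure lborel (shell 1 t :: (real ^ 'n) set) = measure lborel (ball 0 t :: (real ^ 'n) set) - vol"
      by (simp only:)
    then show ?thesis using ballt by (simp add: algebra_simps)
  qed
  have est: "norm (shell_int t - (of_real t ^ ?n - 1) * V 1) \<le> (B * e) * ((t ^ ?n - 1) * vol)"
    if t: "1 \<le> t" and e: "\<And>r. 1 \<le> r \<Longrightarrow> r \<le> t \<Longrightarrow> norm (of_real r powr s - 1) \<le> e" for t e
  proof -
    have e0: "0 \<le> e" using e[of 1] t norm_ge_zero order_trans by blast
    have gi: "set_integrable lborel (shell 1 t) g"
      by (rule set_integrable_continuous[OF g shell_borel bounded_shell])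
    have "shell_int t - (of_real t ^ ?n - 1) * V 1 = (LINT x:shell 1 t|lborel. g x - g0 x)"
      using shellV[OF t] by (simp add: shell_int_def set_integral_diff gi int0 bounded_shell)
    also have "norm \<dots> \<le> (LINT x:shell 1 t|lborel. norm (g x - g0 x))"
      by (rule set_integral_norm_bound) (intro set_integral_diff gi int0 bounded_shell, simp)
    also have "\<dots> \<le> (LINT x:(shell 1 t :: (real ^ 'n) set)|lborel. B * e)"
    proof (rule set_integral_mono)
      show "set_integrable lborel (shell 1 t) (\<lambda>x. norm (g x - g0 x))"
        by (intro set_integrable_norm set_integral_diff gi int0 bounded_shell) simp
      show "set_integrable lborel (shell 1 t :: (real ^ 'n) set) (\<lambda>x. B * e)"
        by (rule set_integrable_continuous[OF _ shell_borel bounded_shell]) simp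
      fix x :: "real ^ 'n" assume x: "x \<in> shell 1 t"
      then have "norm (sgn x) = 1" by (auto simp: norm_sgn shell_def)
      with x have "g (norm x *\<^sub>R sgn x) = of_real (norm x) powr s * g (sgn x)"
        using hom by (simp add: outer_homogeneous_def shell_def)
      moreover have "norm x *\<^sub>R sgn x = x"
      proof -
        have "norm x \<noteq> 0" using x unfolding shell_def mem_Collect_eq by linarith
        then show ?thesis by (simp add: sgn_div_norm)
      qed
      ultimately have "g x - g0 x = g0 x * (of_real (norm x) powr s - 1)"
        by (simp add: g0_def algebra_simps)
      moreover have "norm (of_real (norm x) powr s - 1) \<le> e" using x by (intro e) (auto simp: shell_def)
      ultimately show "norm (g x - g0 x) \<le> B * e"
        using B[of x] e0 B0 by (simp add: norm_mult mult_mono)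
    qed
    also have "\<dots> = (B * e) * ((t ^ ?n - 1) * vol)"
    proof (subst set_integral_const)
      show "emeasure lborel (shell 1 t :: (real ^ 'n) set) \<noteq> \<infinity>"
      proof -
        have "emeasure lborel (shell 1 t :: (real ^ 'n) set) \<le> emeasure lborel (ball 0 t :: (real ^ 'n) set)"
          by (rule emeasure_mono) (auto simp: shell_def)
        then show ?thesis using emeasure_lborel_ball_finite[of "0 :: real ^ 'n" t] by (auto simp: top_unique)
      qed
    qed (use vol[OF t] in auto)
    finally show ?thesis .
  qed
  have Q: "((\<lambda>t :: real. (t ^ ?n - 1) / (t - 1)) \<longlongrightarrow> real ?n) (at_right 1)"
  proof -
    have "((\<lambda>t :: real. t ^ ?n) has_real_derivative real ?n * 1 ^ (?n - 1)) (at 1 within {1<..})"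
      by (rule has_field_derivative_at_within) (auto intro!: derivative_eq_intros)
    then show ?thesis by (simp add: has_field_derivative_iff)
  qed
  have Qc: "((\<lambda>t :: real. (of_real t ^ ?n - 1) * V 1 / of_real (t - 1)) \<longlongrightarrow> sphere_int g) (at_right 1)"
  proof -
    have "((\<lambda>t :: real. of_real ((t ^ ?n - 1) / (t - 1)) * V 1) \<longlongrightarrow> of_real (real ?n) * V 1) (at_right 1)"
      by (intro tendsto_intros Q)
    moreover have "of_real (real ?n) * V 1 = sphere_int g"
      by (simp add: sphere_int_def V_def g0_def)
    ultimately show ?thesis by simp
  qed
  have "((\<lambda>t. shell_int t / of_real (t - 1) - (of_real t ^ ?n - 1) * V 1 / of_real (t - 1)) \<longlongrightarrow> 0) (at_right 1)"
  proof (rule tendstoI)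
    fix \<epsilon> :: real assume \<epsilon>: "0 < \<epsilon>"
    define C where "C = B * (real ?n + 1) * vol + 1"
    have vol0: "0 \<le> vol" by (simp add: vol_def)
    have C: "0 < C" using B0 vol0 by (simp add: C_def add_nonneg_pos)
    define e where "e = \<epsilon> / (2 * C)"
    have e: "0 < e" using \<epsilon> C by (simp add: e_def)
    have "((\<lambda>r. of_real r powr s) \<longlongrightarrow> of_real 1 powr s) (at (1::real))"
      by (intro tendsto_intros) auto
    then have "\<forall>\<^sub>F r in at (1::real). dist (of_real r powr s) 1 < e"
      using e by (simp add: tendsto_iff)
    then obtain d where d: "d > 0" "\<And>r. r \<noteq> 1 \<Longrightarrow> dist r 1 < d \<Longrightarrow> dist (of_real r powr s) 1 < e"
      unfolding eventually_at by blast
    have close: "norm (of_real r powr s - 1) \<le> e" if "\<bar>r - 1\<bar> < d" for r :: real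
      using d(2)[of r] that e by (cases "r = 1") (auto simp: dist_norm less_imp_le)
    have "\<forall>\<^sub>F t in at_right 1. (t ^ ?n - 1) / (t - 1) < real ?n + 1"
      by (rule order_tendstoD(2)[OF Q]) simp
    moreover have "\<forall>\<^sub>F t :: real in at_right 1. t < 1 + d"
      using d by (intro eventually_at_right_less order_tendstoD) (auto intro: eventually_at_right_real[THEN eventually_mono])
    moreover have "\<forall>\<^sub>F t :: real in at_right 1. 1 < t" by (simp add: eventually_at_right_less)
    ultimately show "\<forall>\<^sub>F t in at_right 1. dist (shell_int t / of_real (t - 1) - (of_real t ^ ?n - 1) * V 1 / of_real (t - 1)) 0 < \<epsilon>"
    proof eventually_elim
      case (elim t)
      have "norm (shell_int t - (of_real t ^ ?n - 1) * V 1) \<le> (B * e) * ((t ^ ?n - 1) * vol)"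
        using elim by (intro est close) auto
      then have "norm (shell_int t - (of_real t ^ ?n - 1) * V 1) / (t - 1) \<le> (B * e) * ((t ^ ?n - 1) * vol) / (t - 1)"
        using elim by (intro divide_right_mono) auto
      also have "\<dots> = (B * e * vol) * ((t ^ ?n - 1) / (t - 1))" by simp
      also have "\<dots> \<le> (B * e * vol) * (real ?n + 1)"
        using elim B0 e vol0 by (intro mult_left_mono) auto
      also have "\<dots> = (C - 1) * e" by (simp add: C_def)
      also have "\<dots> \<le> C * e" using e by simp
      also have "\<dots> < \<epsilon>" using C \<epsilon> by (simp add: e_def)
      finally show ?case
        using elim by (simp add: norm_divide flip: diff_divide_distrib of_real_diff)
    qed
  qed
  from tendsto_add[OF this Qc] show ?thesis by simp
qed

text \<open>Swapping the factors in \<open>shell_int_mult\<close> gives F(r) (t^w - 1) = F(t) (r^w -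
  1) for F = \<open>shell_int\<close>. Divided by t - 1, as t decreases to 1, the left side tends to
  w F(r) and the right side to the sphere integral times r^w - 1.\<close>

lemma shell_int_eq:
  assumes r: "1 \<le> r"
  shows "shell_int r = sphere_int g * (of_real r powr w - 1) / w"
proof -
  have sym: "shell_int r * (of_real t powr w - 1) = shell_int t * (of_real r powr w - 1)" if "1 \<le> t" for t
    using shell_int_mult[OF r that] shell_int_mult[OF that r] by (simp add: mult.commute algebra_simps)
  have W: "((\<lambda>t :: real. (of_real t powr w - 1) / of_real (t - 1)) \<longlongrightarrow> w) (at_right 1)"
  proof -
    have "((\<lambda>z :: complex. z powr w) has_field_derivative w * 1 powr (w - 1)) (at (of_real 1))"
      by (auto intro!: derivative_eq_intros)
    then have "((\<lambda>t :: real. of_real t powr w) has_vector_derivative w * 1 powr (w - 1)) (at 1)"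
      by (rule has_vector_derivative_real_field)
    then have "((\<lambda>t :: real. of_real t powr w) has_vector_derivative w) (at (1 + 0))" by simp
    then have "((\<lambda>h. of_real (1 + h) powr w) has_vector_derivative 1 *\<^sub>R w) (at 0)"
    proof -
      have "((\<lambda>h :: real. 1 + h) has_vector_derivative 1) (at 0)"
        by (auto simp: has_real_derivative_iff_has_vector_derivative[symmetric] intro!: derivative_eq_intros)
      from vector_diff_chain_at[OF this] \<open>((\<lambda>t :: real. of_real t powr w) has_vector_derivative w) (at (1 + 0))\<close>
      show ?thesis by (simp only: o_def)
    qed
    from has_vector_derivative_quotient[OF this]
    have "((\<lambda>h :: real. (of_real (1 + h) powr w - 1) / of_real (1 + h - 1)) \<longlongrightarrow> w) (at 0)"
      by (simp add: scaleR_conv_of_real divide_inverse mult.commute)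
    from LIM_offset_zero_cancel[OF this] show ?thesis
      by (rule tendsto_mono[rotated]) (simp add: at_le)
  qed
  have "((\<lambda>t. shell_int r * ((of_real t powr w - 1) / of_real (t - 1))) \<longlongrightarrow> shell_int r * w) (at_right 1)"
    by (intro tendsto_intros W)
  moreover have "((\<lambda>t. (shell_int t / of_real (t - 1)) * (of_real r powr w - 1)) \<longlongrightarrow> sphere_int g * (of_real r powr w - 1)) (at_right 1)"
    by (intro tendsto_intros shell_int_limit)
  moreover have "\<forall>\<^sub>F t in at_right 1. shell_int r * ((of_real t powr w - 1) / of_real (t - 1)) =
      (shell_int t / of_real (t - 1)) * (of_real r powr w - 1)"
    using eventually_at_right_less[of 1]
  proof eventually_elim
    case (elim t)
    then show ?case using sym[of t] by simp
  qed
  ultimately have "shell_int r * w = sphere_int g * (of_real r powr w - 1)"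
    by (intro tendsto_unique[OF trivial_limit_at_right_real Lim_transform_eventually])
  then show ?thesis using w(2) by (simp add: eq_divide_eq)
qed

text \<open>The cube is cut into the unit ball, the shell up to radius R and what lies outside the
  ball of radius R. The last piece scales exactly with R, and the shell is given by
  \<open>shell_int_eq\<close>.\<close>

lemma cube_integral_outer_homogeneous:
  assumes R: "1 \<le> R"
  shows "(LINT x:half_open_cube R|lborel. g x) = (LINT x:ball 0 1|lborel. g x) - sphere_int g / w +
    of_real R powr w * (sphere_int g / w + (LINT x:half_open_cube 1 - ball 0 1|lborel. g x))"
proof -
  note int = set_integrable_continuous[OF g]
  have sub: "ball 0 R \<subseteq> half_open_cube R" by (rule ball_subset_half_open_cube)
  have "half_open_cube R = (ball 0 1 \<union> shell 1 R) \<union> (half_open_cube R - (ball 0 R :: (real ^ 'n) set))"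
    using R sub by (auto simp: shell_def)
  then have "(LINT x:half_open_cube R|lborel. g x) =
      (LINT x:(ball 0 1 \<union> shell 1 R) \<union> (half_open_cube R - (ball 0 R :: (real ^ 'n) set))|lborel. g x)"
    by (simp only:)
  also have "\<dots> = (LINT x:ball 0 1 \<union> shell 1 R|lborel. g x) + (LINT x:half_open_cube R - ball 0 R|lborel. g x)"
    using R by (intro set_integral_Un int)
      (auto simp: shell_def intro: bounded_subset[OF bounded_half_open_cube] bounded_shell[unfolded shell_def])
  also have "(LINT x:ball 0 1 \<union> shell 1 R|lborel. g x) = (LINT x:ball 0 1|lborel. g x) + shell_int R"
    unfolding shell_int_def
    by (intro set_integral_Un int) (auto simp: shell_def intro: bounded_shell[unfolded shell_def])
  also have "(LINT x:half_open_cube R - ball 0 R|lborel. g x) =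
      of_real R powr w * (LINT x:half_open_cube 1 - ball 0 1|lborel. g x)"
  proof -
    have "(LINT x:half_open_cube R - ball 0 R|lborel. g x) =
        of_real R ^ CARD('n) * (LINT x:half_open_cube 1 - ball 0 1|lborel. g (R *\<^sub>R x))"
    proof (rule set_integral_scale[OF g_borel])
      show "R *\<^sub>R x \<in> half_open_cube R - ball 0 R \<longleftrightarrow> x \<in> half_open_cube 1 - ball 0 1" for x :: "real ^ 'n"
        using half_open_cube_scaleR[of R x 1] R by auto
    qed (use R in auto)
    also have "(LINT x:half_open_cube 1 - ball 0 1|lborel. g (R *\<^sub>R x)) =
        (LINT x:half_open_cube 1 - ball 0 1|lborel. of_real R powr s * g x)"
      unfolding set_lebesgue_integral_def
      by (rule Bochner_Integration.integral_cong)
        (use R hom in \<open>auto simp: indicator_def outer_homogeneous_def\<close>)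
    finally show ?thesis using powr_scale_dimension[of R] R by (simp flip: mult.assoc)
  qed
  finally show ?thesis
    unfolding shell_int_eq[OF R] by (simp add: diff_divide_distrib algebra_simps)
qed

end

section \<open>Expansions in powers\<close>

text \<open>\<open>has_constant_term\<close> demands one coefficient sequence for all orders; here a
  single truncation order J is considered, and the coefficients may depend on it. L carries
  information only when \<open>Re s < real J\<close>, where the error tends to 0.\<close>

definition has_expansion :: "complex \<Rightarrow> nat \<Rightarrow> (nat \<Rightarrow> complex) \<Rightarrow> complex \<Rightarrow> bool" where
  "has_expansion s J f L \<longleftrightarrow>
     (\<exists>b. (\<lambda>N. f N - L - (\<Sum>j<J. b j * of_nat N powr (s - of_nat j)))
        \<in> O(\<lambda>N. of_real (real N powr (Re s - real J))))"

lemma norm_of_nat_powr: "0 < N \<Longrightarrow> norm (of_nat N powr s :: complex) = real N powr Re s"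
  using norm_powr_real_powr[of "of_nat N" s] by simp

lemma bigo_powrI:
  assumes "\<forall>\<^sub>F N in sequentially. norm (f N :: complex) \<le> C * real N powr e"
  shows "f \<in> O(\<lambda>N. of_real (real N powr e))"
  by (rule bigoI[of _ C]) (use assms in \<open>simp add: abs_of_nonneg\<close>)

lemma has_expansion_bigo:
  assumes "f \<in> O(\<lambda>N. of_real (real N powr (Re s - real J)))"
  shows "has_expansion s J f 0"
  unfolding has_expansion_def using assms by (intro exI[of _ "\<lambda>_. 0"]) simp

lemma powr_bigo:
  assumes "Re s \<le> e"
  shows "(\<lambda>N. of_nat N powr s :: complex) \<in> O(\<lambda>N. of_real (real N powr e))"
proof (rule bigo_powrI[where C = 1])
  show "\<forall>\<^sub>F N in sequentially. norm (of_nat N powr s :: complex) \<le> 1 * real N powr e"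
    using eventually_gt_at_top[of 0]
    by eventually_elim (use assms in \<open>simp add: norm_of_nat_powr powr_mono\<close>)
qed

lemma has_expansion_powr: "has_expansion s J (\<lambda>N. of_nat N powr (s - of_nat i)) 0"
proof (cases "i < J")
  case True
  have "(\<Sum>j<J. (if j = i then 1 else 0) * (of_nat N :: complex) powr (s - of_nat j)) = of_nat N powr (s - of_nat i)" for N
    using True by (simp add: if_distrib[of "\<lambda>x. x * _"] sum.delta cong: if_cong)
  then show ?thesis unfolding has_expansion_def by (intro exI[of _ "\<lambda>j. if j = i then 1 else 0"]) simp
next
  case False
  then show ?thesis by (intro has_expansion_bigo powr_bigo) simp
qed

lemma has_expansion_const: "has_expansion s J (\<lambda>_. L) L"
  unfolding has_expansion_def by (intro exI[of _ "\<lambda>_. 0"]) simp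

lemma has_expansion_add:
  assumes "has_expansion s J f L" "has_expansion s J g K"
  shows "has_expansion s J (\<lambda>N. f N + g N) (L + K)"
proof -
  obtain b b' where "(\<lambda>N. f N - L - (\<Sum>j<J. b j * of_nat N powr (s - of_nat j))) \<in> O(\<lambda>N. of_real (real N powr (Re s - real J)))"
    "(\<lambda>N. g N - K - (\<Sum>j<J. b' j * of_nat N powr (s - of_nat j))) \<in> O(\<lambda>N. of_real (real N powr (Re s - real J)))"
    using assms unfolding has_expansion_def by blast
  from sum_in_bigo(1)[OF this] show ?thesis
    unfolding has_expansion_def
    by (intro exI[of _ "\<lambda>j. b j + b' j"]) (simp add: algebra_simps sum.distrib)
qed

lemma has_expansion_cmult:
  assumes "has_expansion s J f L"
  shows "has_expansion s J (\<lambda>N. w * f N) (w * L)"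
proof -
  obtain b where "(\<lambda>N. f N - L - (\<Sum>j<J. b j * of_nat N powr (s - of_nat j))) \<in> O(\<lambda>N. of_real (real N powr (Re s - real J)))"
    using assms unfolding has_expansion_def by blast
  then have "(\<lambda>N. w * (f N - L - (\<Sum>j<J. b j * of_nat N powr (s - of_nat j)))) \<in> O(\<lambda>N. of_real (real N powr (Re s - real J)))"
    by (cases "w = 0") simp_all
  then show ?thesis
    unfolding has_expansion_def
    by (intro exI[of _ "\<lambda>j. w * b j"]) (simp add: algebra_simps sum_distrib_left)
qed

lemma has_expansion_sum:
  assumes "\<And>i. i \<in> I \<Longrightarrow> has_expansion s J (f i) (L i)"
  shows "has_expansion s J (\<lambda>N. \<Sum>i\<in>I. f i N) (\<Sum>i\<in>I. L i)"
  using assms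
  by (induction I rule: infinite_finite_induct)
    (use has_expansion_const[of s J 0] in \<open>auto intro: has_expansion_add\<close>)

lemma has_expansion_cong:
  assumes "has_expansion s J f L" "\<forall>\<^sub>F N in sequentially. f N = g N"
  shows "has_expansion s J g L"
proof -
  obtain b where "(\<lambda>N. f N - L - (\<Sum>j<J. b j * of_nat N powr (s - of_nat j))) \<in> O(\<lambda>N. of_real (real N powr (Re s - real J)))"
    using assms unfolding has_expansion_def by blast
  moreover have "\<forall>\<^sub>F N in sequentially. f N - L - (\<Sum>j<J. b j * of_nat N powr (s - of_nat j)) =
      g N - L - (\<Sum>j<J. b j * of_nat N powr (s - of_nat j))"
    using assms(2) by eventually_elim simp
  from landau_o.big.in_cong[OF this] calculation
  have "(\<lambda>N. g N - L - (\<Sum>j<J. b j * of_nat N powr (s - of_nat j))) \<in> O(\<lambda>N. of_real (real N powr (Re s - real J)))"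
    by (simp only:)
  then show ?thesis
    unfolding has_expansion_def by (rule exI[of _ b])
qed

text \<open>An expansion in the exponents s - i - j is one in the exponents s - j with indices
  shifted by i; terms beyond the order J' are moved into the error.\<close>

lemma has_expansion_weaken:
  assumes "has_expansion (s - of_nat i) J f L" "J' \<le> i + J"
  shows "has_expansion s J' f L"
proof -
  obtain b where b: "(\<lambda>N. f N - L - (\<Sum>j<J. b j * of_nat N powr (s - of_nat i - of_nat j)))
      \<in> O(\<lambda>N. of_real (real N powr (Re (s - of_nat i) - real J)))" (is "?r \<in> _")
    using assms unfolding has_expansion_def by blast
  have "(\<lambda>N. complex_of_real (real N powr (Re (s - of_nat i) - real J))) \<in> O(\<lambda>N. of_real (real N powr (Re s - real J')))"
    by (rule bigo_powrI[where C = 1], rule eventually_mono[OF eventually_gt_at_top[of 0]])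
      (use assms(2) in \<open>auto intro!: powr_mono simp flip: of_nat_add\<close>)
  with b have "?r \<in> O(\<lambda>N. of_real (real N powr (Re s - real J')))" by (rule landau_o.big_trans)
  then have "has_expansion s J' ?r 0" by (rule has_expansion_bigo)
  moreover have "has_expansion s J' (\<lambda>N. \<Sum>j<J. b j * of_nat N powr (s - of_nat i - of_nat j)) (\<Sum>j<J. b j * 0)"
    using has_expansion_powr[of s J' "i + j" for j]
    by (intro has_expansion_sum has_expansion_cmult) (simp add: diff_diff_eq)
  ultimately have "has_expansion s J' (\<lambda>N. (?r N + (\<Sum>j<J. b j * of_nat N powr (s - of_nat i - of_nat j))) + L) ((0 + (\<Sum>j<J. b j * 0)) + L)"
    by (intro has_expansion_add has_expansion_const)
  then show ?thesis by simp
qed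

section \<open>Uniqueness of constant terms\<close>

lemma has_expansion_limit:
  assumes "has_expansion s J f L" "Re s < real J"
  obtains b where "(\<lambda>N. f N - L - (\<Sum>j<J. b j * of_nat N powr (s - of_nat j))) \<longlonglongrightarrow> 0"
proof -
  obtain b where b: "(\<lambda>N. f N - L - (\<Sum>j<J. b j * of_nat N powr (s - of_nat j))) \<in> O(\<lambda>N. of_real (real N powr (Re s - real J)))"
    using assms unfolding has_expansion_def by blast
  have "(\<lambda>N. complex_of_real (real N powr (Re s - real J))) \<longlonglongrightarrow> of_real 0"
    using assms(2) by (intro tendsto_of_real tendsto_neg_powr filterlim_real_sequentially) simp
  then have "(\<lambda>N. complex_of_real (real N powr (Re s - real J))) \<in> o(\<lambda>_. 1)"
    by (intro smalloI_tendsto) auto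
  with b have "(\<lambda>N. f N - L - (\<Sum>j<J. b j * of_nat N powr (s - of_nat j))) \<in> o(\<lambda>_. 1)"
    by (rule landau_o.big_small_trans)
  from smalloD_tendsto[OF this] show ?thesis by (intro that) simp
qed

text \<open>Subtraction exhibits L2 - L1 as the limit of a finite sum of powers with exponents s -
  j, all of them nonzero by assumption.\<close>

lemma has_expansion_unique:
  assumes 1: "has_expansion s J1 f L1" "Re s < real J1" and 2: "has_expansion s J2 f L2" "Re s < real J2"
    and s: "\<And>j. s \<noteq> of_nat j"
  shows "L1 = L2"
proof -
  define J where "J = max J1 J2"
  obtain b1 where b1: "(\<lambda>N. f N - L1 - (\<Sum>j<J1. b1 j * of_nat N powr (s - of_nat j))) \<longlonglongrightarrow> 0"
    using has_expansion_limit[OF 1] by blast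
  obtain b2 where b2: "(\<lambda>N. f N - L2 - (\<Sum>j<J2. b2 j * of_nat N powr (s - of_nat j))) \<longlonglongrightarrow> 0"
    using has_expansion_limit[OF 2] by blast
  have pad: "(\<Sum>j<J'. b j * of_nat N powr (s - of_nat j)) =
      (\<Sum>j<J. (if j < J' then b j else 0) * of_nat N powr (s - of_nat j))" if "J' \<le> J" for J' b N
    using that by (intro sum.mono_neutral_cong_left) auto
  have "(\<lambda>N. (f N - L2 - (\<Sum>j<J2. b2 j * of_nat N powr (s - of_nat j))) -
      (f N - L1 - (\<Sum>j<J1. b1 j * of_nat N powr (s - of_nat j))) - (L1 - L2)) \<longlonglongrightarrow> 0 - 0 - (L1 - L2)"
    by (intro tendsto_intros b1 b2)
  also have "(\<lambda>N. (f N - L2 - (\<Sum>j<J2. b2 j * of_nat N powr (s - of_nat j))) -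
      (f N - L1 - (\<Sum>j<J1. b1 j * of_nat N powr (s - of_nat j))) - (L1 - L2)) =
    (\<lambda>N. \<Sum>j<J. (((if j < J1 then b1 j else 0) - (if j < J2 then b2 j else 0)) + 0 * of_real (ln (real N))) *
       of_nat N powr (s - of_nat j))"
    by (rule ext) (simp add: pad[of J1] pad[of J2] J_def left_diff_distrib sum_subtractf)
  finally have "0 - 0 - (L1 - L2) = 0"
    using s by (intro limit_sum_powr_eq_0[of "{..<J}" "\<lambda>j. s - of_nat j"
      "\<lambda>j. (if j < J1 then b1 j else 0) - (if j < J2 then b2 j else 0)" "\<lambda>_. 0"]) auto
  then show ?thesis by simp
qed

text \<open>The canonical trace is described over all presentations of an operator, so the two
  expansions may have unrelated orders; their exponents are put side by side over a disjoint
  sum.\<close>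

lemma has_constant_term_unique:
  assumes 1: "has_constant_term s f L" and 2: "has_constant_term s' f L'"
    and s: "\<And>j. s \<noteq> of_nat j" "\<And>j. s' \<noteq> of_nat j"
  shows "L = L'"
proof -
  obtain J J' :: nat where J: "Re s < real J" "Re s' < real J'" using reals_Archimedean2 by metis
  have "has_expansion s J f L" "has_expansion s' J' f L'"
    using 1 2 unfolding has_constant_term_def has_expansion_def by blast+
  note e = this
  obtain b where b1: "(\<lambda>N. f N - L - (\<Sum>j<J. b j * of_nat N powr (s - of_nat j))) \<longlonglongrightarrow> 0"
    using has_expansion_limit[OF e(1) J(1)] by blast
  obtain b' where b2: "(\<lambda>N. f N - L' - (\<Sum>j<J'. b' j * of_nat N powr (s' - of_nat j))) \<longlonglongrightarrow> 0"
    using has_expansion_limit[OF e(2) J(2)] by blast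
  let ?I = "{..<J} <+> {..<J'}"
  let ?e = "\<lambda>i. case i of Inl j \<Rightarrow> s - of_nat j | Inr j \<Rightarrow> s' - of_nat j"
  let ?c = "\<lambda>i. case i of Inl j \<Rightarrow> b j | Inr j \<Rightarrow> - b' j"
  have "(\<lambda>N. (f N - L' - (\<Sum>j<J'. b' j * of_nat N powr (s' - of_nat j))) -
      (f N - L - (\<Sum>j<J. b j * of_nat N powr (s - of_nat j))) - (L - L')) \<longlonglongrightarrow> 0 - 0 - (L - L')"
    by (intro tendsto_intros b1 b2)
  also have "(\<lambda>N. (f N - L' - (\<Sum>j<J'. b' j * of_nat N powr (s' - of_nat j))) -
      (f N - L - (\<Sum>j<J. b j * of_nat N powr (s - of_nat j))) - (L - L')) =
    (\<lambda>N. \<Sum>i\<in>?I. (?c i + 0 * of_real (ln (real N))) * of_nat N powr ?e i)"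
    by (rule ext) (simp add: sum.Plus sum_negf)
  finally have "0 - 0 - (L - L') = 0"
    using s by (intro limit_sum_powr_eq_0[of ?I ?e ?c "\<lambda>_. 0"]) auto
  then show ?thesis by simp
qed

text \<open>Expansions to different orders could have unrelated coefficients. Comparing them shows
  that the j-th coefficient is the same at every order above j, so the diagonal
  \<open>b (Suc j) j\<close> serves all orders at once.\<close>

lemma has_constant_termI:
  assumes ex: "\<And>J. \<exists>J'\<ge>J. \<exists>L. has_expansion s J' f L" and L: "has_expansion s J0 f L" "Re s < real J0"
    and s: "\<And>j. s \<noteq> of_nat j"
  shows "has_constant_term s f L"
proof -
  have "has_expansion s J f L" for J
  proof -
    obtain J' L' where J': "J' \<ge> max J J0" "has_expansion s J' f L'" using ex by blast
    then have "L' = L" using L s by (intro has_expansion_unique[of s J' f L' J0 L]) auto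
    then show ?thesis using has_expansion_weaken[of s 0 J' f L J] J' by simp
  qed
  then have "\<forall>J. \<exists>b. (\<lambda>N. f N - L - (\<Sum>j<J. b j * of_nat N powr (s - of_nat j)))
      \<in> O(\<lambda>N. of_real (real N powr (Re s - real J)))"
    unfolding has_expansion_def by blast
  from choice[OF this] obtain b where b: "\<And>J. (\<lambda>N. f N - L - (\<Sum>j<J. b J j * of_nat N powr (s - of_nat j)))
      \<in> O(\<lambda>N. of_real (real N powr (Re s - real J)))"
    by blast
  have step: "b J j0 = b (Suc j0) j0" if j0: "j0 < J" for J j0
  proof -
    define d where "d j = b J j - (if j \<le> j0 then b (Suc j0) j else 0)" for j
    have diff: "(\<Sum>j<J. d j * of_nat N powr (s - of_nat j)) =
        (f N - L - (\<Sum>j<Suc j0. b (Suc j0) j * of_nat N powr (s - of_nat j))) -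
        (f N - L - (\<Sum>j<J. b J j * of_nat N powr (s - of_nat j)))" for N
    proof -
      have "(\<Sum>j<Suc j0. b (Suc j0) j * of_nat N powr (s - of_nat j)) =
          (\<Sum>j<J. (if j \<le> j0 then b (Suc j0) j else 0) * of_nat N powr (s - of_nat j))"
        using j0 by (intro sum.mono_neutral_cong_left) auto
      then show ?thesis by (simp add: d_def left_diff_distrib sum_subtractf)
    qed
    have "(\<lambda>N. complex_of_real (real N powr (Re s - real J))) \<in> O(\<lambda>N. of_real (real N powr (Re s - real (Suc j0))))"
      by (rule bigo_powrI[where C = 1], rule eventually_mono[OF eventually_gt_at_top[of 0]])
        (use j0 in \<open>auto intro!: powr_mono\<close>)
    then have "(\<lambda>N. \<Sum>j<J. d j * of_nat N powr (s - of_nat j)) \<in> O(\<lambda>N. of_real (real N powr (Re s - real (Suc j0))))"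
      unfolding diff by (intro sum_in_bigo b landau_o.big_trans[OF b])
    \<comment> \<open>After this multiplication the term of index j0 is constant, the others have
      nonzero exponents and the whole is O(1 / N), so \<open>limit_sum_powr_eq_0\<close> forces
      \<open>d j0 = 0\<close>.\<close>
    then have "(\<lambda>N. of_nat N powr (of_nat j0 - s) * (\<Sum>j<J. d j * of_nat N powr (s - of_nat j)))
        \<in> O(\<lambda>N. of_nat N powr (of_nat j0 - s) * of_real (real N powr (Re s - real (Suc j0))))"
      by (intro landau_o.big.mult) auto
    also have "(\<lambda>N. (of_nat N :: complex) powr (of_nat j0 - s) * of_real (real N powr (Re s - real (Suc j0))))
        \<in> O(\<lambda>N. of_real (real N powr (-1)))"
    proof (rule bigo_powrI[where C = 1], rule eventually_mono[OF eventually_gt_at_top[of 0]])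
      fix N :: nat assume "0 < N"
      then show "norm (of_nat N powr (of_nat j0 - s) * complex_of_real (real N powr (Re s - real (Suc j0)))) \<le> 1 * real N powr (-1)"
        by (simp add: norm_mult norm_of_nat_powr flip: powr_add)
    qed
    also have "(\<lambda>N. complex_of_real (real N powr (-1))) \<in> o(\<lambda>_. 1)"
    proof (rule smalloI_tendsto)
      have "(\<lambda>N. complex_of_real (real N powr (-1))) \<longlonglongrightarrow> of_real 0"
        by (intro tendsto_of_real tendsto_neg_powr filterlim_real_sequentially) simp
      then show "(\<lambda>N. complex_of_real (real N powr (-1)) / 1) \<longlonglongrightarrow> 0" by simp
    qed auto
    finally have "(\<lambda>N. of_nat N powr (of_nat j0 - s) * (\<Sum>j<J. d j * of_nat N powr (s - of_nat j))) \<in> o(\<lambda>_. 1)" .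
    from smalloD_tendsto[OF this]
    have lim: "(\<lambda>N. of_nat N powr (of_nat j0 - s) * (\<Sum>j<J. d j * of_nat N powr (s - of_nat j))) \<longlonglongrightarrow> 0"
      by simp
    have "(\<lambda>N. of_nat N powr (of_nat j0 - s) * (\<Sum>j<J. d j * of_nat N powr (s - of_nat j)) - d j0) \<longlonglongrightarrow> 0 - d j0"
      by (intro tendsto_intros lim)
    moreover have "\<forall>\<^sub>F N in sequentially. of_nat N powr (of_nat j0 - s) * (\<Sum>j<J. d j * of_nat N powr (s - of_nat j)) - d j0 =
        (\<Sum>j\<in>{..<J} - {j0}. (d j + 0 * of_real (ln (real N))) * of_nat N powr (of_nat j0 - of_nat j))"
    proof (rule eventually_mono[OF eventually_gt_at_top[of 0]])
      fix N :: nat assume N: "0 < N"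
      have "of_nat N powr (of_nat j0 - s) * (\<Sum>j<J. d j * of_nat N powr (s - of_nat j)) =
          (\<Sum>j<J. d j * of_nat N powr (of_nat j0 - of_nat j))"
        unfolding sum_distrib_left
        by (rule sum.cong[OF refl]) (simp add: mult.left_commute flip: powr_add)
      also have "\<dots> = d j0 + (\<Sum>j\<in>{..<J} - {j0}. d j * of_nat N powr (of_nat j0 - of_nat j))"
        using j0 N by (subst sum.remove[of _ j0]) auto
      finally show "of_nat N powr (of_nat j0 - s) * (\<Sum>j<J. d j * of_nat N powr (s - of_nat j)) - d j0 =
        (\<Sum>j\<in>{..<J} - {j0}. (d j + 0 * of_real (ln (real N))) * of_nat N powr (of_nat j0 - of_nat j))" by simp
    qed
    ultimately have "(\<lambda>N. \<Sum>j\<in>{..<J} - {j0}. (d j + 0 * of_real (ln (real N))) * of_nat N powr (of_nat j0 - of_nat j)) \<longlonglongrightarrow> 0 - d j0"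
      by (rule Lim_transform_eventually)
    then have "0 - d j0 = 0"
      by (rule limit_sum_powr_eq_0[rotated 2]) auto
    then show ?thesis by (simp add: d_def)
  qed
  have "(\<Sum>j<J. b (Suc j) j * of_nat N powr (s - of_nat j)) = (\<Sum>j<J. b J j * of_nat N powr (s - of_nat j))" for J N
  proof (rule sum.cong[OF refl])
    fix j assume "j \<in> {..<J}"
    then show "b (Suc j) j * of_nat N powr (s - of_nat j) = b J j * of_nat N powr (s - of_nat j)"
      using step[of j J] by simp
  qed
  then show ?thesis
    unfolding has_constant_term_def using b by (intro exI[of _ "\<lambda>j. b (Suc j) j"]) simp
qed

text \<open>The factor N^w is taken out and the binomial series of (1 + 1/(2N))^w is used. As 1/(2N)
  is at most 1/2 for every N >= 1, the tail of absolute values at 1/2 bounds all errors at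
  once.\<close>

lemma has_expansion_shifted_powr:
  "has_expansion w J (\<lambda>N. of_real (real N + 1 / 2) powr w) 0"
proof -
  define a where "a p = (w gchoose p)" for p
  define B where "B = (\<Sum>p. norm (a (p + J) * (1 / 2) ^ p))"
  have sm: "summable (\<lambda>p. norm (a (p + J) * (1 / 2) ^ p))"
  proof -
    \<comment> \<open>Convergence at 3/4, still inside the unit disc, gives absolute convergence at
      the smaller point 1/2.\<close>
    have "summable (\<lambda>p. a p * (3 / 4) ^ p)"
      using sums_summable[OF gen_binomial_complex[of "3 / 4" w]] by (simp add: a_def)
    then have "summable (\<lambda>p. norm (a p * (1 / 2) ^ p))"
      by (rule powser_insidea) simp
    then have "summable (\<lambda>p. norm (a (p + J) * (1 / 2) ^ (p + J)))"
      by (rule summable_ignore_initial_segment)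
    then have "summable (\<lambda>p. 2 ^ J * norm (a (p + J) * (1 / 2) ^ (p + J)))"
      by (rule summable_mult)
    then show ?thesis
      by (simp add: norm_mult norm_power norm_divide power_add power_divide)
  qed
  have est: "norm (of_real (real N + 1 / 2) powr w - (\<Sum>p<J. (a p * (1 / 2) ^ p) * of_nat N powr (w - of_nat p)))
      \<le> B * real N powr (Re w - real J)" if N: "0 < N" for N :: nat
  proof -
    let ?x = "1 / (2 * of_nat N) :: complex"
    have "norm ?x = 1 / (2 * real N)" by (simp add: norm_divide norm_mult)
    also have "\<dots> \<le> 1 / 2" using N by (simp add: field_simps)
    finally have x: "norm ?x \<le> 1 / 2" .
    then have sums: "(\<lambda>p. a p * ?x ^ p) sums (1 + ?x) powr w"
      unfolding a_def by (intro gen_binomial_complex) linarith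
    have term_le: "norm (a (p + J) * ?x ^ p) \<le> norm (a (p + J) * (1 / 2) ^ p)" for p
    proof -
      have "norm ?x \<le> norm (1 / 2 :: complex)" using x by simp
      then have "norm ?x ^ p \<le> norm (1 / 2 :: complex) ^ p" by (rule power_mono) simp
      then show ?thesis by (simp only: norm_mult norm_power mult_left_mono norm_ge_zero)
    qed
    have sx: "summable (\<lambda>p. norm (a (p + J) * ?x ^ p))"
    proof (rule summable_comparison_test'[OF sm])
      show "norm (norm (a (p + J) * ?x ^ p)) \<le> norm (a (p + J) * (1 / 2) ^ p)" for p
        using term_le[of p] by simp
    qed
    have "(1 + ?x) powr w - (\<Sum>p<J. a p * ?x ^ p) = (\<Sum>p. a (p + J) * ?x ^ (p + J))"
      using suminf_split_initial_segment[OF sums_summable[OF sums], of J] sums_unique[OF sums] by simp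
    also have "\<dots> = ?x ^ J * (\<Sum>p. a (p + J) * ?x ^ p)"
      using summable_norm_cancel[OF sx] by (subst suminf_mult[symmetric]) (simp_all add: power_add mult_ac)
    finally have "norm ((1 + ?x) powr w - (\<Sum>p<J. a p * ?x ^ p)) = norm ?x ^ J * norm (\<Sum>p. a (p + J) * ?x ^ p)"
      by (simp add: norm_mult norm_power)
    also have "\<dots> \<le> (1 / real N) ^ J * B"
    proof (rule mult_mono)
      show "norm ?x ^ J \<le> (1 / real N) ^ J"
        using N by (intro power_mono) (auto simp: norm_divide norm_mult field_simps)
      have "norm (\<Sum>p. a (p + J) * ?x ^ p) \<le> (\<Sum>p. norm (a (p + J) * ?x ^ p))" by (rule summable_norm[OF sx])
      also have "\<dots> \<le> B" unfolding B_def
        by (intro suminf_le sx sm term_le)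
      finally show "norm (\<Sum>p. a (p + J) * ?x ^ p) \<le> B" .
    qed auto
    finally have rem: "norm ((1 + ?x) powr w - (\<Sum>p<J. a p * ?x ^ p)) \<le> (1 / real N) ^ J * B" .
    have 1: "of_real (real N + 1 / 2) powr w = of_nat N powr w * (1 + ?x) powr w"
    proof -
      have "complex_of_real (real N + 1 / 2) = of_real (real N) * of_real (1 + 1 / (2 * real N))"
        using N by (simp add: field_simps)
      moreover have "(of_real (real N) * of_real (1 + 1 / (2 * real N))) powr w =
          of_real (real N) powr w * of_real (1 + 1 / (2 * real N)) powr w"
        by (rule powr_times_real) auto
      ultimately show ?thesis by simp
    qed
    have 2: "(a p * (1 / 2) ^ p) * of_nat N powr (w - of_nat p) = of_nat N powr w * (a p * ?x ^ p)" for p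
      using N by (simp add: powr_diff powr_nat power_divide power_mult_distrib)
    have "norm (of_real (real N + 1 / 2) powr w - (\<Sum>p<J. (a p * (1 / 2) ^ p) * of_nat N powr (w - of_nat p)))
        = norm (of_nat N powr w * ((1 + ?x) powr w - (\<Sum>p<J. a p * ?x ^ p)))"
      unfolding 1 2 by (simp add: right_diff_distrib sum_distrib_left)
    also have "\<dots> \<le> real N powr Re w * ((1 / real N) ^ J * B)"
      unfolding norm_mult using N rem by (intro mult_mono) (auto simp: norm_of_nat_powr)
    also have "\<dots> = B * real N powr (Re w - real J)"
      using N by (simp add: powr_diff powr_realpow power_divide)
    finally show ?thesis .
  qed
  show ?thesis
    unfolding has_expansion_def
    by (rule exI[of _ "\<lambda>p. a p * (1 / 2) ^ p"], rule bigo_powrI[where C = B])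
      (use est in \<open>auto intro: eventually_mono[OF eventually_gt_at_top[of 0]]\<close>)
qed

section \<open>Lattice sums\<close>

lemma holomorphic_difference_bound:
  assumes hol: "f holomorphic_on ball z0 r" and r: "0 < r" and B: "\<And>z. z \<in> ball z0 r \<Longrightarrow> norm (f z) \<le> B"
    and h: "norm h \<le> r / 3"
  shows "norm (f (z0 + h) - f z0) \<le> (3 / r * B) * norm h"
proof -
  \<comment> \<open>Discs of radius r / 3 about points of the closed disc of radius r / 3 stay
    inside the ball of radius r; the Cauchy estimate on them gives the factor 3 / r.\<close>
  have deriv_le: "norm (deriv f z) \<le> 3 / r * B" if z: "z \<in> cball z0 (r / 3)" for z
  proof -
    have sub: "cball z (r / 3) \<subseteq> ball z0 r"
    proof
      fix w assume "w \<in> cball z (r / 3)"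
      then have "dist z0 w \<le> r / 3 + r / 3"
        using z dist_triangle[of z0 w z] by simp
      then show "w \<in> ball z0 r" using r by simp
    qed
    have "norm ((deriv ^^ 1) f z) \<le> fact 1 * B / (r / 3) ^ 1"
    proof (rule Cauchy_inequality)
      show "f holomorphic_on ball z (r / 3)"
        using sub ball_subset_cball by (blast intro: holomorphic_on_subset[OF hol])
      show "continuous_on (cball z (r / 3)) f"
        by (rule continuous_on_subset[OF holomorphic_on_imp_continuous_on[OF hol] sub])
      show "norm (f x) \<le> B" if "norm (z - x) = r / 3" for x
        using sub that by (intro B) (auto simp: dist_norm)
    qed (use r in auto)
    then show ?thesis by (simp add: mult.commute)
  qed
  have "norm (f (z0 + h) - f z0) \<le> (3 / r * B) * norm (z0 + h - z0)"
  proof (rule field_differentiable_bound[where S = "cball z0 (r / 3)" and f' = "deriv f"])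
    show "(f has_field_derivative deriv f z) (at z within cball z0 (r / 3))" if "z \<in> cball z0 (r / 3)" for z
    proof -
      have "z \<in> ball z0 r" using that r by simp
      then show ?thesis
        using holomorphic_derivI[OF hol open_ball] has_field_derivative_at_within by blast
    qed
  qed (use deriv_le h r in \<open>auto simp: dist_norm\<close>)
  then show ?thesis by simp
qed

text \<open>A bound on \<open>F\<close> itself suffices, since the Cauchy estimate turns it into one
  for the difference quotients. The measure is arbitrary because both Lebesgue measure and counting
  measure on the lattice occur.\<close>

lemma has_field_derivative_integral_parameter:
  fixes F :: "complex \<Rightarrow> 'a \<Rightarrow> complex"
  assumes r: "0 < r"
    and meas: "\<And>z. z \<in> ball z0 r \<Longrightarrow> F z \<in> borel_measurable M"
    and hol: "\<And>x. x \<in> space M \<Longrightarrow> (\<lambda>z. F z x) holomorphic_on ball z0 r"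
    and bound: "\<And>x z. x \<in> space M \<Longrightarrow> z \<in> ball z0 r \<Longrightarrow> norm (F z x) \<le> w x"
    and w: "integrable M w"
  shows "((\<lambda>z. LINT x|M. F z x) has_field_derivative (LINT x|M. deriv (\<lambda>z. F z x) z0)) (at z0)"
  unfolding DERIV_def tendsto_at_iff_sequentially
proof (intro allI impI)
  fix X :: "nat \<Rightarrow> complex" assume X0: "\<forall>i. X i \<in> UNIV - {0}" and X: "X \<longlonglongrightarrow> 0"
  have "\<forall>\<^sub>F i in sequentially. norm (X i) < r / 3"
    by (rule order_tendstoD(2)[OF tendsto_norm_zero[OF X]]) (use r in simp)
  then obtain k where k: "\<And>i. i \<ge> k \<Longrightarrow> norm (X i) < r / 3" by (auto simp: eventually_sequentially)
  \<comment> \<open>Dropping an initial segment brings all increments into the range r / 3 of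
    \<open>holomorphic_difference_bound\<close>.\<close>
  define Y where "Y i = X (i + k)" for i
  have Y: "Y i \<noteq> 0" "norm (Y i) \<le> r / 3" for i using X0 k[of "i + k"] by (auto simp: Y_def)
  have Ylim: "filterlim Y (at 0) sequentially"
    using LIMSEQ_ignore_initial_segment[OF X, of k] Y(1) by (auto simp: Y_def[abs_def] filterlim_at)
  have inb: "z0 + Y i \<in> ball z0 r" "z0 \<in> ball z0 r" for i
    using Y(2)[of i] r by (auto simp: dist_norm)
  have int: "integrable M (F z)" if "z \<in> ball z0 r" for z
    by (rule Bochner_Integration.integrable_bound[OF w meas[OF that]])
      (use bound that in \<open>fastforce intro: AE_I2 order_trans\<close>)
  let ?q = "\<lambda>i x. (F (z0 + Y i) x - F z0 x) / Y i"
  have qm: "?q i \<in> borel_measurable M" for i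
    using meas[OF inb(1)[of i]] meas[OF inb(2)] by measurable
  have lim: "(\<lambda>i. ?q i x) \<longlonglongrightarrow> deriv (\<lambda>z. F z x) z0" if x: "x \<in> space M" for x
  proof -
    have "((\<lambda>z. F z x) has_field_derivative deriv (\<lambda>z. F z x) z0) (at z0)"
      by (rule holomorphic_derivI[OF hol[OF x] open_ball inb(2)])
    from filterlim_compose[OF this[unfolded DERIV_def] Ylim] show ?thesis .
  qed
  have "(\<lambda>i. LINT x|M. ?q i x) \<longlonglongrightarrow> (LINT x|M. deriv (\<lambda>z. F z x) z0)"
  proof (rule integral_dominated_convergence[where w = "\<lambda>x. 3 / r * w x"])
    show "(\<lambda>x. deriv (\<lambda>z. F z x) z0) \<in> borel_measurable M"
      by (rule borel_measurable_LIMSEQ_metric[OF qm lim])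
    show "AE x in M. norm (?q i x) \<le> 3 / r * w x" for i
    proof (rule AE_I2)
      fix x assume x: "x \<in> space M"
      have "norm (F (z0 + Y i) x - F z0 x) \<le> (3 / r * w x) * norm (Y i)"
        by (rule holomorphic_difference_bound[OF hol[OF x] r bound[OF x] Y(2)])
      then show "norm (?q i x) \<le> 3 / r * w x"
        using Y(1)[of i] by (simp add: norm_divide pos_divide_le_eq)
    qed
    show "integrable M (\<lambda>x. 3 / r * w x)" using w by (rule integrable_mult_right)
  qed (use qm lim in \<open>auto intro: AE_I2\<close>)
  moreover have "(\<lambda>i. LINT x|M. ?q i x) = (\<lambda>i. ((LINT x|M. F (z0 + Y i) x) - (LINT x|M. F z0 x)) / Y i)"
    using int[OF inb(1)] int[OF inb(2)] by (simp add: fun_eq_iff)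
  ultimately have "(\<lambda>i. ((LINT x|M. F (z0 + X (i + k)) x) - (LINT x|M. F z0 x)) / X (i + k))
      \<longlonglongrightarrow> (LINT x|M. deriv (\<lambda>z. F z x) z0)"
    by (simp only: Y_def)
  then have "(\<lambda>i. ((LINT x|M. F (z0 + X i) x) - (LINT x|M. F z0 x)) / X i) \<longlonglongrightarrow> (LINT x|M. deriv (\<lambda>z. F z x) z0)"
    by (rule LIMSEQ_offset)
  then show "((\<lambda>h. ((LINT x|M. F (z0 + h) x) - (LINT x|M. F z0 x)) / h) \<circ> X) \<longlonglongrightarrow> (LINT x|M. deriv (\<lambda>z. F z x) z0)"
    by (simp add: o_def)
qed

section \<open>Absolutely convergent sums over the lattice\<close>

definition lattice_weight :: "int ^ 'n::finite \<Rightarrow> real" where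
  "lattice_weight k = 1 / (1 + norm (lattice_vec k)) ^ (2 * CARD('n))"

text \<open>Written as an integral for counting measure, so that holomorphy in a parameter comes
  from the same theorem as for integrals over balls and cells.\<close>

definition lattice_sum :: "(int ^ 'n::finite \<Rightarrow> complex) \<Rightarrow> complex" where
  "lattice_sum f = (LINT k|count_space UNIV. f k)"

lemma integrable_lattice_weight: "integrable (count_space UNIV) (lattice_weight :: int ^ 'n::finite \<Rightarrow> real)"
proof -
  have "Infinite_Sum.abs_summable_on (lattice_weight :: int ^ 'n \<Rightarrow> real) UNIV"
    using summable_lattice_weight[where 'n = 'n] by (simp add: lattice_weight_def[abs_def] abs_of_nonneg)
  then show ?thesis
    using abs_summable_equivalent unfolding Infinite_Set_Sum.abs_summable_on_def by blast
qed

lemma lattice_weight_pos: "0 < lattice_weight k"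
  unfolding lattice_weight_def by (intro divide_pos_pos zero_less_power add_pos_nonneg) auto

lemma integrable_lattice_bound:
  fixes f :: "int ^ 'n::finite \<Rightarrow> complex"
  assumes "\<And>k. norm (f k) \<le> C * lattice_weight k"
  shows "integrable (count_space UNIV) f"
proof (rule Bochner_Integration.integrable_bound)
  show "integrable (count_space UNIV) (\<lambda>k :: int ^ 'n. C * lattice_weight k)"
    by (intro integrable_mult_right integrable_lattice_weight)
  show "AE k in count_space UNIV. norm (f k) \<le> norm (C * lattice_weight k)"
    by (rule AE_I2, unfold real_norm_def, rule order_trans[OF assms abs_ge_self])
qed simp

lemma lattice_weight_powr:
  "lattice_weight (k :: int ^ 'n::finite) = (1 + norm (lattice_vec k)) powr (- (2 * real CARD('n)))"
proof -
  have "0 < 1 + norm (lattice_vec k)" by (simp add: add_pos_nonneg)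
  then show ?thesis
    unfolding lattice_weight_def by (simp add: powr_minus_divide powr_realpow flip: powr_realpow)
qed

lemma powr_le_lattice_weight:
  assumes "e + 2 * real CARD('n) \<le> 0"
  shows "(1 + norm (lattice_vec (k :: int ^ 'n::finite))) powr e \<le> lattice_weight k"
  using assms by (auto simp: lattice_weight_powr intro!: powr_mono)

text \<open>Outside the box some coordinate exceeds N, so 1 + |k| is at least 1 + N there. The power
  of 1 + |k| left over after one lattice weight is split off is then bounded by the same power of 1
  + N, and the weight is summed.\<close>

lemma lattice_sum_tail:
  fixes f :: "int ^ 'n::finite \<Rightarrow> complex"
  assumes e: "e + 2 * real CARD('n) \<le> 0" and C: "0 \<le> C"
    and f: "\<And>k. norm (f k) \<le> C * (1 + norm (lattice_vec k)) powr e"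
  shows "integrable (count_space UNIV) f"
    and "norm ((\<Sum>k\<in>lattice_box N. f k) - lattice_sum f) \<le>
      (C * (LINT k|count_space UNIV. lattice_weight (k :: int ^ 'n))) * (1 + real N) powr (e + 2 * real CARD('n))"
proof -
  let ?p = "e + 2 * real CARD('n)"
  have split: "(1 + norm (lattice_vec k)) powr e = (1 + norm (lattice_vec k)) powr ?p * lattice_weight k" for k :: "int ^ 'n"
    by (simp add: lattice_weight_powr flip: powr_add)
  have f1: "norm (f k) \<le> C * lattice_weight k" for k
    using f[of k] mult_left_mono[OF powr_le_lattice_weight[OF e] C] order_trans by blast
  show int: "integrable (count_space UNIV) f" by (rule integrable_lattice_bound[OF f1])
  let ?B = "lattice_box N :: (int ^ 'n) set"
  have fin: "finite ?B" by (rule sum_lattice_box_prod(1))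
  have intB: "integrable (count_space UNIV) (\<lambda>k. indicator ?B k *\<^sub>R f k)"
    by (rule integrable_mult_indicator[OF _ int]) simp
  have "(LINT k|count_space UNIV. indicator ?B k *\<^sub>R f k) = (\<Sum>k\<in>?B. f k)"
  proof -
    have "(LINT k|count_space UNIV. indicator ?B k *\<^sub>R f k) =
        (\<Sum>k | k \<in> UNIV \<and> indicator ?B k *\<^sub>R f k \<noteq> 0. indicator ?B k *\<^sub>R f k)"
      by (rule lebesgue_integral_count_space_finite_support)
        (rule finite_subset[OF _ fin], auto simp: indicator_def split: if_splits)
    also have "\<dots> = (\<Sum>k\<in>?B. f k)"
      by (rule sum.mono_neutral_cong_left[OF fin]) (auto simp: indicator_def split: if_splits)
    finally show ?thesis .
  qed
  then have "(\<Sum>k\<in>?B. f k) - lattice_sum f = (LINT k|count_space UNIV. indicator ?B k *\<^sub>R f k - f k)"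
    using int intB by (simp add: lattice_sum_def Bochner_Integration.integral_diff)
  also have "norm \<dots> \<le> (LINT k|count_space UNIV. (C * (1 + real N) powr ?p) * lattice_weight (k :: int ^ 'n))"
  proof (rule order_trans[OF integral_norm_bound integral_mono])
    show "integrable (count_space UNIV) (\<lambda>k. norm (indicator ?B k *\<^sub>R f k - f k))"
      by (intro integrable_norm Bochner_Integration.integrable_diff intB int)
    show "integrable (count_space UNIV) (\<lambda>k :: int ^ 'n. (C * (1 + real N) powr ?p) * lattice_weight k)"
      by (intro integrable_mult_right integrable_lattice_weight)
    fix k :: "int ^ 'n"
    show "norm (indicator ?B k *\<^sub>R f k - f k) \<le> (C * (1 + real N) powr ?p) * lattice_weight k"
    proof (cases "k \<in> ?B")
      case True
      then show ?thesis using C lattice_weight_pos[of k] by simp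
    next
      case False
      then obtain i where "int N < \<bar>k $ i\<bar>" by (auto simp: lattice_box_def not_le)
      then have "1 + real N \<le> 1 + norm (lattice_vec k)"
        using norm_lattice_vec_ge[of k i] by linarith
      then have "(1 + norm (lattice_vec k)) powr ?p \<le> (1 + real N) powr ?p"
        using e by (intro powr_mono2') auto
      then have "C * ((1 + norm (lattice_vec k)) powr ?p * lattice_weight k) \<le> C * ((1 + real N) powr ?p * lattice_weight k)"
        using C lattice_weight_pos[of k] by (intro mult_left_mono mult_right_mono) auto
      then show ?thesis using False f[of k] unfolding split by (simp add: mult.assoc)
    qed
  qed
  also have "\<dots> = (C * (LINT k|count_space UNIV. lattice_weight (k :: int ^ 'n))) * (1 + real N) powr ?p"
    by simp
  finally show "norm ((\<Sum>k\<in>lattice_box N. f k) - lattice_sum f) \<le>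
      (C * (LINT k|count_space UNIV. lattice_weight (k :: int ^ 'n))) * (1 + real N) powr ?p" .
qed

section \<open>Sums of homogeneous families over boxes\<close>

lemma powr_ratio_le:
  fixes a b c e :: real
  assumes "0 < a" "0 < b" "a \<le> c * b" "b \<le> c * a" "1 \<le> c"
  shows "a powr e \<le> c powr \<bar>e\<bar> * b powr e"
proof (cases "0 \<le> e")
  case True
  then have "a powr e \<le> (c * b) powr e" using assms by (intro powr_mono2) auto
  then show ?thesis using True assms by (simp add: powr_mult)
next
  case False
  have "b / c \<le> a" using assms by (simp add: pos_divide_le_eq mult.commute)
  then have "a powr e \<le> (b / c) powr e" using False assms by (intro powr_mono2') auto
  also have "\<dots> = c powr \<bar>e\<bar> * b powr e" using False assms by (simp add: powr_divide powr_minus divide_simps)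
  finally show ?thesis .
qed

text \<open>Homogeneity is asked outside the unit ball only, as the components are cut off near the
  origin. Joint continuity in z and x is recorded for bounds that are uniform on compact
  sets.\<close>

definition homogeneous_family ::
    "(complex \<Rightarrow> complex) \<Rightarrow> (complex \<Rightarrow> 'n::finite list \<Rightarrow> real ^ 'n \<Rightarrow> complex) \<Rightarrow> bool" where
  "homogeneous_family s D \<longleftrightarrow>
     (\<forall>z. smooth_derivs (D z)) \<and>
     (\<forall>l. continuous_on UNIV (\<lambda>(z, x). D z l x)) \<and>
     (\<forall>l x. (\<lambda>z. D z l x) holomorphic_on UNIV) \<and>
     (\<forall>z. outer_homogeneous (s z) (D z []))"

lemma homogeneous_familyD:
  assumes "homogeneous_family s D"
  shows "smooth_derivs (D z)" "continuous_on UNIV (\<lambda>(z, x). D z l x)"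
    "(\<lambda>z. D z l x) holomorphic_on UNIV" "outer_homogeneous (s z) (D z [])"
  using assms unfolding homogeneous_family_def by simp_all

text \<open>The error at \<open>k\<close> when a value is recovered from cell averages to order M;
  for a homogeneous family it gains M orders of decay.\<close>

definition cell_remainder :: "nat \<Rightarrow> ('n::finite list \<Rightarrow> real ^ 'n \<Rightarrow> complex) \<Rightarrow> int ^ 'n \<Rightarrow> complex" where
  "cell_remainder M D k = D [] (lattice_vec k) -
     (\<Sum>l | length l < M. inv_moment l *\<^sub>R cell_avg (D l) (lattice_vec k))"

text \<open>On the unit ball this is compactness and joint continuity; outside, homogeneity carries
  the bound from \<open>sgn x\<close>. The factor 2 compares \<open>1 + norm x\<close> with
  \<open>max 1 (norm x)\<close>, and E bounds the exponent over Z, so the constant is uniform in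
  z.\<close>

lemma homogeneous_family_bound:
  fixes D :: "complex \<Rightarrow> 'n::finite list \<Rightarrow> real ^ 'n \<Rightarrow> complex"
  assumes F: "homogeneous_family s D" and Z: "compact Z" "continuous_on Z s"
  shows "\<exists>C\<ge>0. \<forall>z\<in>Z. \<forall>x. norm (D z l x) \<le> C * (1 + norm x) powr (Re (s z) - real (length l))"
proof -
  have "compact ((\<lambda>(z, x). D z l x) ` (Z \<times> cball 0 1))"
    using homogeneous_familyD(2)[OF F, of l] Z(1)
    by (intro compact_continuous_image compact_Times compact_cball) (auto intro: continuous_on_subset)
  then obtain B where B: "B > 0" "\<And>z x. z \<in> Z \<Longrightarrow> norm x \<le> 1 \<Longrightarrow> norm (D z l x) \<le> B"
    unfolding bounded_pos[of "(\<lambda>(z, x). D z l x) ` (Z \<times> cball 0 1)"] compact_imp_bounded[THEN bounded_pos[THEN iffD1]]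
    by (auto dest!: compact_imp_bounded simp: bounded_pos)
  have "compact ((\<lambda>z. \<bar>Re (s z) - real (length l)\<bar>) ` Z)"
    using Z by (intro compact_continuous_image continuous_intros)
  then obtain E where E: "\<And>z. z \<in> Z \<Longrightarrow> \<bar>Re (s z) - real (length l)\<bar> \<le> E"
    by (auto dest!: compact_imp_bounded simp: bounded_real) blast
  have main: "norm (D z l x) \<le> (B * 2 powr E) * (1 + norm x) powr (Re (s z) - real (length l))" if z: "z \<in> Z" for z x
  proof -
    let ?e = "Re (s z) - real (length l)"
    define m where "m = max 1 (norm x)"
    have m: "1 \<le> m" "m \<le> 1 + norm x" "1 + norm x \<le> 2 * m" by (auto simp: m_def)
    have "norm (D z l x) \<le> B * m powr ?e"
    proof (cases "norm x \<le> 1")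
      case True
      then show ?thesis using B(2)[OF z True] by (simp add: m_def)
    next
      case False
      then have x: "1 \<le> norm x" "norm (sgn x) = 1" by (auto simp: norm_sgn)
      have "norm x \<noteq> 0" using False by linarith
      then have "norm x *\<^sub>R sgn x = x" by (simp add: sgn_div_norm)
      then have "D z l x = of_real (norm x) powr (s z - of_nat (length l)) * D z l (sgn x)"
        using outer_homogeneous_deriv[OF homogeneous_familyD(1)[OF F] homogeneous_familyD(4)[OF F], of "sgn x" "norm x" z l] x
        by simp
      then have "norm (D z l x) = norm x powr ?e * norm (D z l (sgn x))"
        using False by (simp add: norm_mult norm_powr_real_powr)
      also have "\<dots> \<le> norm x powr ?e * B" using B(2)[OF z, of "sgn x"] x by (intro mult_left_mono) auto
      finally show ?thesis using False by (simp add: m_def mult.commute)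
    qed
    also have "m powr ?e \<le> 2 powr \<bar>?e\<bar> * (1 + norm x) powr ?e"
      using m norm_ge_zero[of x] by (intro powr_ratio_le) auto
    also have "\<dots> \<le> 2 powr E * (1 + norm x) powr ?e"
      using E[OF z] by (intro mult_right_mono powr_mono) auto
    finally show ?thesis using B(1) by (simp add: mult.assoc mult_left_mono)
  qed
  show ?thesis
    using main B(1) by (intro exI[of _ "B * 2 powr E"]) auto
qed

lemma norm_unit_cell_le: "y \<in> unit_cell \<Longrightarrow> norm (y :: real ^ 'n::finite) \<le> real CARD('n)"
proof -
  assume y: "y \<in> unit_cell"
  have "norm y \<le> (\<Sum>i\<in>UNIV. \<bar>y $ i\<bar>)" by (rule norm_le_l1_cart)
  also have "\<dots> \<le> (\<Sum>i\<in>(UNIV :: 'n set). 1)"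
  proof (rule sum_mono)
    fix i
    have "- (1 / 2) \<le> y $ i" "y $ i < 1 / 2" using y by (auto simp: half_open_cube_def)
    then show "\<bar>y $ i\<bar> \<le> 1" by linarith
  qed
  finally show ?thesis by simp
qed

text \<open>Within the cell of k the quantity \<open>1 + norm x\<close> varies by a factor of at
  most 1 + n, so the M-th derivatives obey one bound on the whole cell, and the constant of
  \<open>inverse_cell_avg_bound\<close> does not depend on z.\<close>

lemma cell_remainder_bound:
  fixes D :: "complex \<Rightarrow> 'n::finite list \<Rightarrow> real ^ 'n \<Rightarrow> complex"
  assumes F: "homogeneous_family s D" and Z: "compact Z" "continuous_on Z s"
  shows "\<exists>C\<ge>0. \<forall>z\<in>Z. \<forall>k. norm (cell_remainder M (D z) k) \<le> C * (1 + norm (lattice_vec k)) powr (Re (s z) - real M)"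
proof -
  obtain C0 where C0: "C0 \<ge> 0" "\<And>(D :: 'n list \<Rightarrow> real ^ 'n \<Rightarrow> complex) x B.
     smooth_derivs D \<Longrightarrow> (\<forall>u y. length u = M \<longrightarrow> y \<in> unit_cell \<longrightarrow> norm (D u (x + y)) \<le> B) \<Longrightarrow>
     norm (D [] x - (\<Sum>l | length l < M. inv_moment l *\<^sub>R cell_avg (D l) x)) \<le> C0 * B"
    using inverse_cell_avg_bound[where 'n = 'n, of M] by blast
  have "\<forall>u. \<exists>C\<ge>0. \<forall>z\<in>Z. \<forall>x. norm (D z u x) \<le> C * (1 + norm x) powr (Re (s z) - real (length u))"
    using homogeneous_family_bound[OF F Z] by blast
  from choice[OF this] obtain c where c: "\<And>u. c u \<ge> 0"
    "\<And>u z x. z \<in> Z \<Longrightarrow> norm (D z u x) \<le> c u * (1 + norm x) powr (Re (s z) - real (length u))" by blast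
  define C1 where "C1 = (\<Sum>u | length (u :: 'n list) = M. c u)"
  have C1: "C1 \<ge> 0" unfolding C1_def by (intro sum_nonneg c)
  have cC1: "c u \<le> C1" if "length u = M" for u
    unfolding C1_def using that c(1) by (intro member_le_sum) auto
  have "compact ((\<lambda>z. \<bar>Re (s z) - real M\<bar>) ` Z)"
    using Z by (intro compact_continuous_image continuous_intros)
  then obtain E where E: "\<And>z. z \<in> Z \<Longrightarrow> \<bar>Re (s z) - real M\<bar> \<le> E"
    by (auto dest!: compact_imp_bounded simp: bounded_real) blast
  let ?n = "1 + real CARD('n)"
  have main: "norm (cell_remainder M (D z) k) \<le> (C0 * (C1 * ?n powr E)) * (1 + norm (lattice_vec k)) powr (Re (s z) - real M)"
    if z: "z \<in> Z" for z and k :: "int ^ 'n"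
  proof -
    let ?e = "Re (s z) - real M"
    have "norm (D z u (lattice_vec k + y)) \<le> (C1 * ?n powr E) * (1 + norm (lattice_vec k)) powr ?e"
      if u: "length u = M" and y: "y \<in> unit_cell" for u y
    proof -
      let ?x = "lattice_vec k"
      have ny: "norm y \<le> real CARD('n)" by (rule norm_unit_cell_le[OF y])
      have t: "norm (?x + y) \<le> norm ?x + norm y" "norm ?x \<le> norm (?x + y) + norm y"
        using norm_triangle_ineq[of ?x y] norm_triangle_ineq4[of "?x + y" y] by auto
      have p: "0 \<le> real CARD('n) * norm ?x" "0 \<le> real CARD('n) * norm (?x + y)" by auto
      have "(1 + norm (?x + y)) powr ?e \<le> ?n powr \<bar>?e\<bar> * (1 + norm ?x) powr ?e"
      proof (rule powr_ratio_le)
        show "0 < 1 + norm (?x + y)" "0 < 1 + norm ?x" by (simp_all add: add_pos_nonneg)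
        show "1 + norm (?x + y) \<le> ?n * (1 + norm ?x)" "1 + norm ?x \<le> ?n * (1 + norm (?x + y))"
          using t ny p unfolding distrib_left distrib_right mult_1 mult_1_right by linarith+
      qed simp
      also have "\<dots> \<le> ?n powr E * (1 + norm ?x) powr ?e"
        using E[OF z] by (intro mult_right_mono powr_mono) auto
      finally have "c u * (1 + norm (?x + y)) powr ?e \<le> C1 * (?n powr E * (1 + norm ?x) powr ?e)"
        using cC1[OF u] c(1)[of u] by (intro mult_mono) auto
      then show ?thesis using c(2)[OF z, of u "?x + y"] u by (simp add: mult.assoc)
    qed
    then have "norm (cell_remainder M (D z) k) \<le> C0 * ((C1 * ?n powr E) * (1 + norm (lattice_vec k)) powr ?e)"
      unfolding cell_remainder_def by (intro C0(2) homogeneous_familyD(1)[OF F]) blast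
    then show ?thesis by (simp add: mult.assoc)
  qed
  show ?thesis
    using main C0(1) C1 by (intro exI[of _ "C0 * (C1 * ?n powr E)"]) auto
qed

text \<open>An exact Euler-Maclaurin formula: the cell averages over a box assemble into integrals
  over one cube, and only the remainders stay discrete.\<close>

lemma sum_lattice_box_cell_remainder:
  assumes D: "smooth_derivs D"
  shows "(\<Sum>k\<in>lattice_box N. D [] (lattice_vec k)) = (\<Sum>k\<in>lattice_box N. cell_remainder M D k) +
    (\<Sum>l | length l < M. inv_moment l *\<^sub>R (LINT x:half_open_cube (real N + 1 / 2)|lborel. D l x))"
proof -
  have "(\<Sum>l | length l < M. inv_moment l *\<^sub>R (LINT x:half_open_cube (real N + 1 / 2)|lborel. D l x)) =
      (\<Sum>k\<in>lattice_box N. \<Sum>l | length l < M. inv_moment l *\<^sub>R cell_avg (D l) (lattice_vec k))"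
    by (subst sum.swap)
      (simp add: scaleR_sum_right[symmetric] sum_cell_avg_lattice_box[OF smooth_derivs_continuous[OF D]])
  then show ?thesis by (simp add: cell_remainder_def sum_subtractf)
qed

text \<open>The constant term of the box sums without its polar part
  \<open>- sphere_int (D []) / w\<close>. It is holomorphic in z as long as M makes the remainders
  summable.\<close>

definition regularized_part :: "nat \<Rightarrow> ('n::finite list \<Rightarrow> real ^ 'n \<Rightarrow> complex) \<Rightarrow> complex" where
  "regularized_part M D = (LINT x:ball 0 1|lborel. D [] x) + lattice_sum (cell_remainder M D)"

text \<open>Nonempty words contribute pure powers of N + 1/2 with exponents w - length l. Constants
  arise only from the empty word and from the summed cell remainders.\<close>

lemma lattice_box_sum_expansion:
  fixes D :: "'n::finite list \<Rightarrow> real ^ 'n \<Rightarrow> complex"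
  assumes D: "smooth_derivs D" and hom: "outer_homogeneous s (D [])"
    and w: "w = s + of_nat CARD('n)" "w \<noteq> 0"
    and C: "0 \<le> C" "\<And>k. norm (cell_remainder M D k) \<le> C * (1 + norm (lattice_vec k)) powr (Re s - real M)"
    and M: "0 < M" "Re s - real M + 2 * real CARD('n) \<le> 0" and J: "J + CARD('n) \<le> M"
  shows "has_expansion w J (\<lambda>N. \<Sum>k\<in>lattice_box N. D [] (lattice_vec k)) (regularized_part M D - sphere_int (D []) / w)"
proof -
  let ?R = "\<lambda>N. real N + 1 / 2"
  let ?U = "{l :: 'n list. l \<noteq> [] \<and> length l < M}"
  have fin: "finite ?U" by (rule finite_subset[OF _ finite_lists_length_less[of M]]) auto
  have ins: "{l :: 'n list. length l < M} = insert [] ?U" using M by auto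
  let ?L0 = "(LINT x:ball 0 1|lborel. D [] x) - sphere_int (D []) / w"
  let ?c1 = "sphere_int (D []) / w + (LINT x:half_open_cube 1 - ball 0 1|lborel. D [] x)"
  \<comment> \<open>The scaling law for cube integrals starts from half-side 2, so the scale is (N +
    1/2) / 2, which is at least 1 from N = 2 on. The power of 1/2 converts powers of this scale into
    powers of N + 1/2.\<close>
  define c where "c l = of_real (inv_moment l) * ((LINT x:half_open_cube 2|lborel. D l x) * (1 / 2) powr (w - of_nat (length l)))" for l
  have R: "of_real (?R N) powr u = of_real (?R N / 2) powr u * 2 powr u" for N and u :: complex
  proof -
    have "of_real (?R N / 2 * 2) powr u = of_real (?R N / 2) powr u * of_real 2 powr u"
      by (rule of_real_powr_mult) simp_all
    moreover have "?R N / 2 * 2 = ?R N" by simp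
    ultimately show ?thesis by (simp only: of_real_numeral)
  qed
  have eq: "(\<Sum>k\<in>lattice_box N. D [] (lattice_vec k)) =
      ((\<Sum>k\<in>lattice_box N. cell_remainder M D k) - lattice_sum (cell_remainder M D)) +
      ((\<Sum>l\<in>?U. c l * of_real (?R N) powr (w - of_nat (length l))) + ?c1 * of_real (?R N) powr w) +
      (lattice_sum (cell_remainder M D) + ?L0)" if N: "2 \<le> N" for N
  proof -
    have "inv_moment l *\<^sub>R (LINT x:half_open_cube (?R N)|lborel. D l x) = c l * of_real (?R N) powr (w - of_nat (length l))"
      if l: "l \<in> ?U" for l
    proof -
      let ?u = "w - of_nat (length l)"
      have half: "(1 / 2) powr ?u * 2 powr ?u = (1 :: complex)"
        using of_real_powr_mult[of "1 / 2" 2 ?u] by simp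
      have "(LINT x:half_open_cube (?R N)|lborel. D l x) = of_real (?R N / 2) powr ?u * (LINT x:half_open_cube 2|lborel. D l x)"
        using cube_integral_deriv_scale[OF D hom, of "?R N / 2" l] l N by (simp add: w(1) add_divide_distrib)
      also have "\<dots> = (LINT x:half_open_cube 2|lborel. D l x) * ((1 / 2) powr ?u * 2 powr ?u) * of_real (?R N / 2) powr ?u"
        unfolding half by simp
      also have "\<dots> = (LINT x:half_open_cube 2|lborel. D l x) * (1 / 2) powr ?u * of_real (?R N) powr ?u"
        unfolding R by (simp only: mult_ac)
      finally show ?thesis by (simp add: c_def scaleR_conv_of_real)
    qed
    moreover have "(LINT x:half_open_cube (?R N)|lborel. D [] x) = ?L0 + ?c1 * of_real (?R N) powr w"
      using cube_integral_outer_homogeneous[OF smooth_derivs_continuous[OF D] hom w, of "?R N"] N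
      by (simp add: mult.commute)
    ultimately show ?thesis
      unfolding sum_lattice_box_cell_remainder[OF D, of N M] ins
      using fin by (simp add: inv_moment_Nil algebra_simps)
  qed
  have pw: "has_expansion w J (\<lambda>N. of_real (?R N) powr (w - of_nat i)) 0" for i
    using has_expansion_weaken[OF has_expansion_shifted_powr[of "w - of_nat i" J]] by simp
  have e1: "has_expansion w J (\<lambda>N. (\<Sum>l\<in>?U. c l * of_real (?R N) powr (w - of_nat (length l))) + ?c1 * of_real (?R N) powr w)
      ((\<Sum>l\<in>?U. c l * 0) + ?c1 * 0)"
    using pw[of 0] by (intro has_expansion_add has_expansion_sum has_expansion_cmult pw) simp
  \<comment> \<open>The tail of the remainder sum has order Re s - M + 2n; the condition
    \<open>J + CARD('n) \<le> M\<close> makes this at most Re w - J, since w = s + n.\<close>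
  have e2: "has_expansion w J (\<lambda>N. (\<Sum>k\<in>lattice_box N. cell_remainder M D k) - lattice_sum (cell_remainder M D)) 0"
  proof (rule has_expansion_bigo, rule bigo_powrI, rule eventually_mono[OF eventually_gt_at_top[of 0]])
    fix N :: nat assume N: "0 < N"
    let ?W = "C * (LINT k|count_space UNIV. lattice_weight (k :: int ^ 'n))"
    have W: "0 \<le> ?W" using C(1) lattice_weight_pos by (intro mult_nonneg_nonneg integral_nonneg_AE) (auto intro: AE_I2 less_imp_le)
    have "(1 + real N) powr (Re s - real M + 2 * real CARD('n)) \<le> real N powr (Re s - real M + 2 * real CARD('n))"
      using M N by (intro powr_mono2') auto
    also have "\<dots> \<le> real N powr (Re w - real J)"
      using J N w(1) by (intro powr_mono) auto
    finally show "norm ((\<Sum>k\<in>lattice_box N. cell_remainder M D k) - lattice_sum (cell_remainder M D)) \<le> ?W * real N powr (Re w - real J)"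
      using lattice_sum_tail(2)[OF M(2) C(1) C(2), of N] W
      by (meson mult_left_mono order_trans)
  qed
  have "has_expansion w J (\<lambda>N. ((\<Sum>k\<in>lattice_box N. cell_remainder M D k) - lattice_sum (cell_remainder M D)) +
      ((\<Sum>l\<in>?U. c l * of_real (?R N) powr (w - of_nat (length l))) + ?c1 * of_real (?R N) powr w) +
      (lattice_sum (cell_remainder M D) + ?L0)) (0 + ((\<Sum>l\<in>?U. c l * 0) + ?c1 * 0) + (lattice_sum (cell_remainder M D) + ?L0))"
    by (intro has_expansion_add[OF _ has_expansion_const] has_expansion_add[OF e2 e1])
  then have "has_expansion w J (\<lambda>N. ((\<Sum>k\<in>lattice_box N. cell_remainder M D k) - lattice_sum (cell_remainder M D)) +
      ((\<Sum>l\<in>?U. c l * of_real (?R N) powr (w - of_nat (length l))) + ?c1 * of_real (?R N) powr w) +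
      (lattice_sum (cell_remainder M D) + ?L0)) (regularized_part M D - sphere_int (D []) / w)"
    by (simp add: regularized_part_def algebra_simps)
  then show ?thesis
    by (rule has_expansion_cong) (rule eventually_mono[OF eventually_ge_at_top[of 2]], simp only: eq)
qed

section \<open>Meromorphic continuation\<close>

text \<open>The inner map \<open>p\<close> covers the identity, translation by a lattice point and
  \<open>sgn\<close>. Joint continuity on a compact set supplies the dominating constant.\<close>

lemma set_integral_parameter_deriv:
  fixes F :: "complex \<Rightarrow> real ^ 'n::finite \<Rightarrow> complex" and p :: "real ^ 'n \<Rightarrow> real ^ 'n" and A :: "(real ^ 'n) set"
  assumes cont: "continuous_on UNIV (\<lambda>(z, x). F z x)" and hol: "\<And>x. (\<lambda>z. F z x) holomorphic_on UNIV"
    and p [measurable]: "p \<in> borel_measurable borel" and A [measurable]: "A \<in> sets borel" "bounded A"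
    and r: "\<And>x. x \<in> A \<Longrightarrow> norm (p x) \<le> r"
  shows "((\<lambda>z. LINT x:A|lborel. F z (p x)) has_field_derivative
    (LINT x:A|lborel. deriv (\<lambda>z. F z (p x)) z0)) (at z0)"
proof -
  have "compact ((\<lambda>(z, x). F z x) ` (cball z0 1 \<times> cball 0 r))"
    by (intro compact_continuous_image compact_Times compact_cball continuous_on_subset[OF cont]) simp
  then obtain B where B: "\<And>z x. z \<in> cball z0 1 \<Longrightarrow> norm x \<le> r \<Longrightarrow> norm (F z x) \<le> B" and B0: "0 \<le> B"
  proof -
    obtain b where b: "b > 0" "\<forall>y\<in>(\<lambda>(z, x). F z x) ` (cball z0 1 \<times> cball 0 r). norm y \<le> b"
      using \<open>compact _\<close> compact_imp_bounded bounded_pos by metis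
    have "norm (F z x) \<le> b" if "z \<in> cball z0 1" "norm x \<le> r" for z x
      using b(2) that by auto
    then show ?thesis using b(1) by (intro that[of b]) auto
  qed
  have Fm [measurable]: "F z \<in> borel_measurable borel" for z
  proof -
    have "continuous_on UNIV (\<lambda>x. case (z, x) of (z, x) \<Rightarrow> F z x)"
      by (rule continuous_on_compose2[OF cont]) (auto intro!: continuous_intros)
    then show ?thesis by (intro borel_measurable_continuous_onI) simp
  qed
  have "((\<lambda>z. LINT x|lborel. indicator A x *\<^sub>R F z (p x)) has_field_derivative
    (LINT x|lborel. deriv (\<lambda>z. indicator A x *\<^sub>R F z (p x)) z0)) (at z0)"
  proof (rule has_field_derivative_integral_parameter[where r = 1 and w = "\<lambda>x. indicator A x *\<^sub>R B"])
    show "(\<lambda>x. indicator A x *\<^sub>R F z (p x)) \<in> borel_measurable lborel" for z by measurable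
    show "(\<lambda>z. indicator A x *\<^sub>R F z (p x)) holomorphic_on ball z0 1" for x
      using holomorphic_on_subset[OF hol[of "p x"], of "ball z0 1"]
      by (auto simp: indicator_def)
    show "integrable lborel (\<lambda>x. indicator A x *\<^sub>R B)"
      using set_integrable_continuous[of "\<lambda>_ :: real ^ 'n. B" A] A by (simp add: set_integrable_def)
    show "norm (indicator A x *\<^sub>R F z (p x)) \<le> indicator A x *\<^sub>R B" if "z \<in> ball z0 1" for z x
      using B[of z "p x"] r[of x] that by (auto simp: indicator_def)
  qed simp
  moreover have "(\<lambda>x. deriv (\<lambda>z. indicator A x *\<^sub>R F z (p x)) z0) = (\<lambda>x. indicator A x *\<^sub>R deriv (\<lambda>z. F z (p x)) z0)"
    by (auto simp: indicator_def fun_eq_iff)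
  ultimately show ?thesis by (simp add: set_lebesgue_integral_def)
qed

lemma sgn_borel: "(sgn :: real ^ 'n::finite \<Rightarrow> real ^ 'n) \<in> borel_measurable borel"
  unfolding sgn_div_norm by measurable

lemma sphere_int_deriv:
  fixes F :: "complex \<Rightarrow> real ^ 'n::finite \<Rightarrow> complex"
  assumes cont: "continuous_on UNIV (\<lambda>(z, x). F z x)" and hol: "\<And>x. (\<lambda>z. F z x) holomorphic_on UNIV"
  shows "((\<lambda>z. sphere_int (F z)) has_field_derivative sphere_int (\<lambda>x. deriv (\<lambda>z. F z x) z0)) (at z0)"
  unfolding sphere_int_def
  by (intro DERIV_cmult set_integral_parameter_deriv[OF cont hol sgn_borel, where r = 1])
    (auto simp: norm_sgn intro: bounded_subset[OF bounded_ball])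

lemma holomorphic_onI_deriv: "(\<And>z. z \<in> S \<Longrightarrow> \<exists>d. (f has_field_derivative d) (at z)) \<Longrightarrow> f holomorphic_on S"
  unfolding holomorphic_on_def field_differentiable_def by (meson has_field_derivative_at_within)

lemma lattice_sum_holomorphic:
  fixes f :: "complex \<Rightarrow> int ^ 'n::finite \<Rightarrow> complex"
  assumes S: "open S" and hol: "\<And>k. (\<lambda>z. f z k) holomorphic_on UNIV"
    and bound: "\<And>Z. compact Z \<Longrightarrow> \<exists>C\<ge>0. \<forall>z\<in>Z. \<forall>k. norm (f z k) \<le> C * (1 + norm (lattice_vec k)) powr e z"
    and e: "\<And>z. z \<in> S \<Longrightarrow> e z + 2 * real CARD('n) \<le> 0"
  shows "(\<lambda>z. lattice_sum (f z)) holomorphic_on S"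
proof (rule holomorphic_onI_deriv)
  fix z0 assume "z0 \<in> S"
  then obtain r where r: "r > 0" "cball z0 r \<subseteq> S" using S open_contains_cball by blast
  obtain C where C: "C \<ge> 0" "\<And>z k. z \<in> cball z0 r \<Longrightarrow> norm (f z k) \<le> C * (1 + norm (lattice_vec k)) powr e z"
    using bound[OF compact_cball] by metis
  have "((\<lambda>z. LINT k|count_space UNIV. f z k) has_field_derivative (LINT k|count_space UNIV. deriv (\<lambda>z. f z k) z0)) (at z0)"
  proof (rule has_field_derivative_integral_parameter[where w = "\<lambda>k. C * lattice_weight k", OF r(1)])
    show "integrable (count_space UNIV) (\<lambda>k :: int ^ 'n. C * lattice_weight k)"
      by (intro integrable_mult_right integrable_lattice_weight)
    fix z and k :: "int ^ 'n" assume z: "z \<in> ball z0 r"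
    then have "e z + 2 * real CARD('n) \<le> 0" using r(2) e ball_subset_cball by blast
    then have "C * (1 + norm (lattice_vec k)) powr e z \<le> C * lattice_weight k"
      by (intro mult_left_mono powr_le_lattice_weight C(1))
    then show "norm (f z k) \<le> C * lattice_weight k" using C(2)[of z k] z by simp
  qed (auto intro: holomorphic_on_subset[OF hol])
  then show "\<exists>d. ((\<lambda>z. lattice_sum (f z)) has_field_derivative d) (at z0)"
    unfolding lattice_sum_def by blast
qed

lemma cell_remainder_holomorphic:
  fixes D :: "complex \<Rightarrow> 'n::finite list \<Rightarrow> real ^ 'n \<Rightarrow> complex"
  assumes F: "homogeneous_family s D"
  shows "(\<lambda>z. cell_remainder M (D z) k) holomorphic_on UNIV"
proof -
  have "(\<lambda>z. cell_avg (D z l) (lattice_vec k)) holomorphic_on UNIV" for l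
  proof (rule holomorphic_onI_deriv)
    fix z0
    show "\<exists>d. ((\<lambda>z. cell_avg (D z l) (lattice_vec k)) has_field_derivative d) (at z0)"
      unfolding cell_avg_def
      by (rule exI, rule set_integral_parameter_deriv[OF homogeneous_familyD(2,3)[OF F], where r = "norm (lattice_vec k) + real CARD('n)"])
        (auto intro!: bounded_half_open_cube norm_triangle_le norm_unit_cell_le)
  qed
  then show ?thesis
    unfolding cell_remainder_def scaleR_conv_of_real
    by (intro holomorphic_intros homogeneous_familyD(3)[OF F])
qed

lemma regularized_part_holomorphic:
  fixes D :: "complex \<Rightarrow> 'n::finite list \<Rightarrow> real ^ 'n \<Rightarrow> complex"
  assumes F: "homogeneous_family s D" and s: "continuous_on UNIV s" and S: "open S"
    and M: "\<And>z. z \<in> S \<Longrightarrow> Re (s z) - real M + 2 * real CARD('n) \<le> 0"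
  shows "(\<lambda>z. regularized_part M (D z)) holomorphic_on S"
  unfolding regularized_part_def
proof (intro holomorphic_on_add)
  show "(\<lambda>z. LINT x:ball 0 1|lborel. D z [] x) holomorphic_on S"
  proof (rule holomorphic_onI_deriv)
    fix z0
    show "\<exists>d. ((\<lambda>z. LINT x:ball 0 1|lborel. D z [] x) has_field_derivative d) (at z0)"
      by (rule exI, rule set_integral_parameter_deriv[OF homogeneous_familyD(2,3)[OF F], where r = 1 and p = "\<lambda>x. x"]) auto
  qed
  show "(\<lambda>z. lattice_sum (cell_remainder M (D z))) holomorphic_on S"
    by (rule lattice_sum_holomorphic[OF S cell_remainder_holomorphic[OF F] cell_remainder_bound[OF F]])
      (use M in \<open>auto intro: continuous_on_subset[OF s]\<close>)
qed

text \<open>Here \<open>f\<close> stands for the trace of the symbol at lattice points and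
  \<open>D i\<close> for the derivatives of its i-th component, cut off near the origin. The extra 1
  in the exponent is a fixed choice of the loss \<epsilon> that a holomorphic family is
  allowed.\<close>

locale scalar_family =
  fixes q a :: real and f :: "complex \<Rightarrow> int ^ 'n::finite \<Rightarrow> complex"
    and D :: "nat \<Rightarrow> complex \<Rightarrow> 'n list \<Rightarrow> real ^ 'n \<Rightarrow> complex"
  assumes q: "0 < q"
    and family: "homogeneous_family (\<lambda>z. nct_order q a z - of_nat i) (D i)"
    and f_holomorphic: "(\<lambda>z. f z k) holomorphic_on UNIV"
    and remainder_bound: "compact Z \<Longrightarrow> \<exists>C\<ge>0. \<forall>z\<in>Z. \<forall>k.
      norm (f z k - (\<Sum>i<M. D i z [] (lattice_vec k))) \<le>
        C * (1 + norm (lattice_vec k)) powr (Re (nct_order q a z) - real M + 1)"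
begin

definition pole :: "nat \<Rightarrow> complex" where
  "pole j = of_real ((a + real CARD('n) - real j) / q)"

lemma order_pole: "nct_order q a z - of_nat i + of_nat CARD('n) = - of_real q * (z - pole i)"
  using q by (simp add: nct_order_def pole_def field_simps)

lemma order_at_pole: "nct_order q a (pole j) = of_nat j - of_nat CARD('n)"
  using order_pole[of "pole j" j] by (simp add: algebra_simps)

lemma continuous_order: "continuous_on Z (\<lambda>z. nct_order q a z - of_nat i)"
  unfolding nct_order_def by (intro continuous_intros)

definition remainder :: "nat \<Rightarrow> complex \<Rightarrow> int ^ 'n \<Rightarrow> complex" where
  "remainder M z k = f z k - (\<Sum>i<M. D i z [] (lattice_vec k))"

definition regular :: "nat \<Rightarrow> complex \<Rightarrow> complex" where
  "regular M z = (\<Sum>i<M. regularized_part M (D i z)) + lattice_sum (remainder M z)"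

text \<open>The margin 2n pays for summation over the lattice and 1 for the loss in
  \<open>remainder_bound\<close>. These half-planes exhaust the plane as M grows.\<close>

definition region :: "nat \<Rightarrow> complex set" where
  "region M = {z. Re (nct_order q a z) + 1 + 2 * real CARD('n) < real M}"

lemma open_region: "open (region M)"
  unfolding region_def nct_order_def by (intro open_Collect_less continuous_intros)

lemma regular_holomorphic: "regular M holomorphic_on region M"
proof -
  have "(\<lambda>z. regularized_part M (D i z)) holomorphic_on region M" for i
    by (rule regularized_part_holomorphic[OF family continuous_order open_region]) (auto simp: region_def)
  moreover have "(\<lambda>z. lattice_sum (remainder M z)) holomorphic_on region M"
  proof (rule lattice_sum_holomorphic[OF open_region, where e = "\<lambda>z. Re (nct_order q a z) - real M + 1"])
    show "(\<lambda>z. remainder M z k) holomorphic_on UNIV" for k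
      unfolding remainder_def by (intro holomorphic_intros f_holomorphic homogeneous_familyD(3)[OF family])
    show "\<exists>C\<ge>0. \<forall>z\<in>Z. \<forall>k. norm (remainder M z k) \<le> C * (1 + norm (lattice_vec k)) powr (Re (nct_order q a z) - real M + 1)"
      if "compact Z" for Z unfolding remainder_def by (rule remainder_bound[OF that])
  qed (auto simp: region_def)
  ultimately show ?thesis unfolding regular_def[abs_def] by (intro holomorphic_intros)
qed

text \<open>For the i-th component the denominator s + n equals - q (z - \<open>pole i\<close>),
  which turns the constants - S / (s + n) into polar terms with a plus sign. Off the poles, in
  \<open>region M\<close> and for M > n, the value is the constant term of the box sums and hence
  independent of M.\<close>

definition continuation :: "nat \<Rightarrow> complex \<Rightarrow> complex" where
  "continuation M z = regular M z + (\<Sum>i<M. sphere_int (D i z []) / (of_real q * (z - pole i)))"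

text \<open>Compared with a single component, the condition on J has an additional 1, which offsets
  the loss in the bound of the symbol remainder.\<close>

lemma lattice_box_sum_has_expansion:
  assumes z: "z \<notin> range pole" and M: "z \<in> region M" and J: "J + CARD('n) + 1 \<le> M"
  shows "has_expansion (nct_order q a z + of_nat CARD('n)) J (\<lambda>N. \<Sum>k\<in>lattice_box N. f z k) (continuation M z)"
proof -
  let ?w = "nct_order q a z + of_nat CARD('n)"
  have Mz: "Re (nct_order q a z) + 1 + 2 * real CARD('n) < real M" using M by (simp add: region_def)
  have comp: "has_expansion ?w J (\<lambda>N. \<Sum>k\<in>lattice_box N. D i z [] (lattice_vec k))
      (regularized_part M (D i z) + sphere_int (D i z []) / (of_real q * (z - pole i)))" for i
  proof -
    let ?wi = "?w - of_nat i"
    have wi: "?wi = - of_real q * (z - pole i)" using order_pole[of z i] by (simp add: algebra_simps)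
    have nz: "?wi \<noteq> 0" unfolding wi using q z by auto
    obtain C where C: "C \<ge> 0" "\<And>k. norm (cell_remainder M (D i z) k) \<le>
        C * (1 + norm (lattice_vec k)) powr (Re (nct_order q a z - of_nat i) - real M)"
      using cell_remainder_bound[OF family, of "{z}" i M] continuous_order by auto
    have "has_expansion ?wi J (\<lambda>N. \<Sum>k\<in>lattice_box N. D i z [] (lattice_vec k))
        (regularized_part M (D i z) - sphere_int (D i z []) / ?wi)"
      by (rule lattice_box_sum_expansion[OF homogeneous_familyD(1,4)[OF family] _ nz C]) (use Mz J in auto)
    then have "has_expansion ?w J (\<lambda>N. \<Sum>k\<in>lattice_box N. D i z [] (lattice_vec k))
        (regularized_part M (D i z) - sphere_int (D i z []) / ?wi)"
      by (rule has_expansion_weaken) simp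
    then show ?thesis unfolding wi by simp
  qed
  have rem: "has_expansion ?w J (\<lambda>N. (\<Sum>k\<in>lattice_box N. remainder M z k) - lattice_sum (remainder M z)) 0"
  proof (rule has_expansion_bigo)
    obtain C where C: "C \<ge> 0" "\<And>k. norm (remainder M z k) \<le>
        C * (1 + norm (lattice_vec k)) powr (Re (nct_order q a z) - real M + 1)"
      using remainder_bound[of "{z}" M] unfolding remainder_def by auto
    let ?p = "Re (nct_order q a z) - real M + 1 + 2 * real CARD('n)"
    let ?W = "C * (LINT k|count_space UNIV. lattice_weight (k :: int ^ 'n))"
    have W: "0 \<le> ?W" using C(1) lattice_weight_pos by (intro mult_nonneg_nonneg integral_nonneg_AE) (auto intro: AE_I2 less_imp_le)
    have p: "?p \<le> 0" using Mz by simp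
    show "(\<lambda>N. (\<Sum>k\<in>lattice_box N. remainder M z k) - lattice_sum (remainder M z)) \<in>
        O(\<lambda>N. of_real (real N powr (Re ?w - real J)))"
    proof (rule bigo_powrI, rule eventually_mono[OF eventually_gt_at_top[of 0]])
      fix N :: nat assume N: "0 < N"
      have "(1 + real N) powr ?p \<le> real N powr ?p" using p N by (intro powr_mono2') auto
      also have "\<dots> \<le> real N powr (Re ?w - real J)" using J N by (intro powr_mono) auto
      finally show "norm ((\<Sum>k\<in>lattice_box N. remainder M z k) - lattice_sum (remainder M z)) \<le> ?W * real N powr (Re ?w - real J)"
        using lattice_sum_tail(2)[OF p C, of N] W by (meson mult_left_mono order_trans)
    qed
  qed
  have "has_expansion ?w J (\<lambda>N. (\<Sum>i<M. \<Sum>k\<in>lattice_box N. D i z [] (lattice_vec k)) +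
      ((\<Sum>k\<in>lattice_box N. remainder M z k) - lattice_sum (remainder M z)) + lattice_sum (remainder M z))
      ((\<Sum>i<M. regularized_part M (D i z) + sphere_int (D i z []) / (of_real q * (z - pole i))) + 0 + lattice_sum (remainder M z))"
    by (intro has_expansion_add has_expansion_sum has_expansion_const comp rem)
  moreover have "(\<Sum>i<M. \<Sum>k\<in>lattice_box N. D i z [] (lattice_vec k)) +
      ((\<Sum>k\<in>lattice_box N. remainder M z k) - lattice_sum (remainder M z)) + lattice_sum (remainder M z) =
      (\<Sum>k\<in>lattice_box N. f z k)" for N
    by (subst sum.swap) (simp add: remainder_def sum_subtractf)
  ultimately show ?thesis
    by (simp add: continuation_def regular_def sum.distrib algebra_simps)
qed

text \<open>A fixed M gives an expansion to finite order only. Higher orders come from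
  \<open>continuation (M + J)\<close>, and \<open>has_constant_termI\<close> reconciles the
  constants.\<close>

lemma has_constant_term_continuation:
  assumes z: "z \<notin> range pole" and M: "z \<in> region M" "CARD('n) + 1 \<le> M"
  shows "has_constant_term (nct_order q a z + of_nat CARD('n)) (\<lambda>N. \<Sum>k\<in>lattice_box N. f z k) (continuation M z)"
proof (rule has_constant_termI)
  show "nct_order q a z + of_nat CARD('n) \<noteq> of_nat j" for j
  proof
    assume "nct_order q a z + of_nat CARD('n) = of_nat j"
    then have "of_real q * (z - pole j) = 0" using order_pole[of z j] by (simp add: algebra_simps)
    then show False using q z by auto
  qed
  show "has_expansion (nct_order q a z + of_nat CARD('n)) (M - CARD('n) - 1) (\<lambda>N. \<Sum>k\<in>lattice_box N. f z k) (continuation M z)"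
    using M by (intro lattice_box_sum_has_expansion z) auto
  show "Re (nct_order q a z + of_nat CARD('n)) < real (M - CARD('n) - 1)"
    using M by (simp add: region_def of_nat_diff)
  show "\<exists>J'\<ge>J. \<exists>L. has_expansion (nct_order q a z + of_nat CARD('n)) J' (\<lambda>N. \<Sum>k\<in>lattice_box N. f z k) L" for J
  proof (intro exI[of _ J] exI conjI)
    show "has_expansion (nct_order q a z + of_nat CARD('n)) J (\<lambda>N. \<Sum>k\<in>lattice_box N. f z k) (continuation (M + J) z)"
      using M by (intro lattice_box_sum_has_expansion z) (auto simp: region_def)
  qed simp
qed

end

text \<open>Near z0, T = g / (z - z0) with g holomorphic, whence the residue. As g z0 may vanish,
  the order is claimed only for an actual pole. If S z0 = 0, then S / (z - z0) extends
  holomorphically with value \<open>deriv S z0\<close> at z0.\<close>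

lemma simple_pole_expansion:
  assumes U: "open U" "z0 \<in> U" and H: "H holomorphic_on U" and S: "S holomorphic_on U" and c: "c \<noteq> 0"
    and T: "\<forall>\<^sub>F z in at z0. T z = H z + S z / (c * (z - z0))"
  shows "\<exists>F. (\<lambda>w. T (z0 + w)) has_laurent_expansion F" (is ?thesis1)
    and "residue T z0 = S z0 / c" (is ?thesis2)
    and "is_pole T z0 \<Longrightarrow> zorder T z0 = - 1"
    and "S z0 = 0 \<Longrightarrow> finite_part T z0 = H z0 + deriv S z0 / c"
proof -
  define g where "g z = H z * (z - z0) + S z / c" for z
  have g: "g holomorphic_on U" unfolding g_def by (intro holomorphic_intros H S) (use c in auto)
  have Tg: "\<forall>\<^sub>F z in at z0. T z = g z / (z - z0)"
    using T eventually_neq_at_within[of z0 z0 UNIV]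
  proof eventually_elim
    case (elim z)
    then have "z - z0 \<noteq> 0" by simp
    then show ?case using elim(1) c by (simp add: g_def field_simps)
  qed
  have "g analytic_on {z0}" using g U analytic_at by blast
  then have "(\<lambda>z. g z / (z - z0)) meromorphic_on {z0}"
    by (intro meromorphic_intros analytic_on_imp_meromorphic_on) (auto intro!: analytic_intros)
  then obtain F where F: "(\<lambda>w. g (z0 + w) / (z0 + w - z0)) has_laurent_expansion F"
    unfolding meromorphic_on_def by blast
  show ?thesis1
    using has_laurent_expansion_cong'[OF Tg refl refl, of F] F by blast
  show ?thesis2
    using residue_cong[OF Tg refl] residue_simple[OF U g] by (simp add: g_def)
  show "zorder T z0 = - 1" if pole: "is_pole T z0"
  proof -
    \<comment> \<open>Otherwise g / (z - z0) extends continuously with value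
      \<open>deriv g z0\<close>, and T has no pole.\<close>
    have g0: "g z0 \<noteq> 0"
    proof
      assume 0: "g z0 = 0"
      define k where "k z = (if z = z0 then deriv g z0 else (g z - g z0) / (z - z0))" for z
      have "k holomorphic_on U" unfolding k_def[abs_def] by (rule pole_lemma_open[OF g U(1)])
      then have "isCont k z0"
        using U continuous_on_interior holomorphic_on_imp_continuous_on by (metis interior_open)
      then have "\<not> is_pole k z0"
        using not_tendsto_and_filterlim_at_infinity[OF trivial_limit_at] unfolding is_pole_def isCont_def by blast
      moreover have "\<forall>\<^sub>F z in at z0. T z = k z"
        using Tg eventually_neq_at_within[of z0 z0 UNIV] by eventually_elim (simp add: k_def 0)
      ultimately show False using pole is_pole_cong by blast
    qed
    have "zorder T z0 = zorder (\<lambda>w. g w / (w - z0) ^ 1) z0"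
      by (rule zorder_cong) (use Tg in simp_all)
    also have "\<dots> = - 1"
      using zorder_nonzero_div_power[OF U g g0, of 1] by simp
    finally show ?thesis .
  qed
  show "finite_part T z0 = H z0 + deriv S z0 / c" if S0: "S z0 = 0"
  proof -
    define k where "k z = H z + (if z = z0 then deriv S z0 else (S z - S z0) / (z - z0)) / c" for z
    have "k holomorphic_on U"
      unfolding k_def[abs_def] by (intro holomorphic_intros H pole_lemma_open S U(1)) (use c in auto)
    then have "k analytic_on {z0}" using U analytic_at by blast
    then have "(\<lambda>x. k (z0 + x)) has_laurent_expansion fps_to_fls (fps_expansion k z0)"
      by (intro has_laurent_expansion_fps analytic_at_imp_has_fps_expansion)
    then have "laurent_expansion k z0 = fps_to_fls (fps_expansion k z0)"
      by (rule laurent_expansion_eqI)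
    moreover have "\<forall>\<^sub>F z in at z0. T z = k z"
      using T eventually_neq_at_within[of z0 z0 UNIV]
      by eventually_elim (simp add: k_def S0 mult.commute)
    then have "laurent_expansion T z0 = laurent_expansion k z0"
      by (rule laurent_expansion_cong) simp
    ultimately show ?thesis
      by (simp add: finite_part_def fps_expansion_def k_def)
  qed
qed

section \<open>Laurent data of the continuation\<close>

context scalar_family
begin

lemma dist_pole: "dist (pole i) (pole j) = \<bar>real i - real j\<bar> / q"
proof -
  have "pole i - pole j = of_real ((real j - real i) / q)"
    unfolding pole_def of_real_diff[symmetric] using q by (simp add: field_simps)
  then show ?thesis
    using q by (simp only: dist_norm norm_of_real) (simp add: abs_divide abs_minus_commute)
qed

lemma pole_eqI: "dist (pole i) (pole j) < 1 / q \<Longrightarrow> i = j"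
  unfolding dist_pole using q by (simp add: divide_less_cancel)

text \<open>Poles are spaced by 1 / q, so at most one of them lies within 1 / (2 q) of z0.\<close>

lemma eventually_not_pole: "\<forall>\<^sub>F z in at z0. z \<notin> range pole"
proof (cases "\<exists>j. 0 < dist (pole j) z0 \<and> dist (pole j) z0 < 1 / (2 * q)")
  case True
  then obtain j where j: "0 < dist (pole j) z0" "dist (pole j) z0 < 1 / (2 * q)" by blast
  show ?thesis
    unfolding eventually_at
  proof (intro exI[of _ "dist (pole j) z0"] conjI ballI impI j(1))
    fix z assume z: "z \<noteq> z0 \<and> dist z z0 < dist (pole j) z0"
    show "z \<notin> range pole"
    proof
      assume "z \<in> range pole"
      then obtain i where i: "z = pole i" by blast
      have "dist (pole i) (pole j) \<le> dist (pole i) z0 + dist (pole j) z0"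
        by (rule dist_triangle2)
      also have "\<dots> < 1 / (2 * q) + 1 / (2 * q)" using z j i by auto
      also have "\<dots> = 1 / q" using q by (simp add: field_simps)
      finally show False using pole_eqI[of i j] z i by simp
    qed
  qed
next
  case False
  show ?thesis
    unfolding eventually_at
    by (rule exI[of _ "1 / (2 * q)"]) (use q False in auto)
qed

lemma region_exists: "\<exists>M. z \<in> region M \<and> CARD('n) + 1 \<le> M \<and> m < M"
proof -
  obtain k :: nat where "Re (nct_order q a z) + 1 + 2 * real CARD('n) < real k"
    using reals_Archimedean2 by blast
  then have "z \<in> region (k + CARD('n) + m + 1)" by (simp add: region_def)
  then show ?thesis by (intro exI[of _ "k + CARD('n) + m + 1"]) simp
qed

lemma sphere_int_holomorphic: "(\<lambda>z. sphere_int (D i z [])) holomorphic_on U"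
  using sphere_int_deriv[OF homogeneous_familyD(2,3)[OF family]]
  by (intro holomorphic_onI_deriv) blast

text \<open>The continuation without its j-th polar term, hence holomorphic near
  \<open>pole j\<close>. When the residue vanishes, its value there is the finite part up to the
  derivative of the sphere integral.\<close>

definition regular_at_pole :: "nat \<Rightarrow> nat \<Rightarrow> complex \<Rightarrow> complex" where
  "regular_at_pole M j z = regular M z + (\<Sum>i\<in>{..<M} - {j}. sphere_int (D i z []) / (of_real q * (z - pole i)))"

text \<open>Only the values of T off the poles are prescribed: at a pole the order of the family is
  an integer at least - n, to which the constant-term description of the trace does not
  apply.\<close>

context
  fixes T :: "complex \<Rightarrow> complex"
  assumes T: "\<And>z M. z \<notin> range pole \<Longrightarrow> z \<in> region M \<Longrightarrow> CARD('n) + 1 \<le> M \<Longrightarrow> T z = continuation M z"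
begin

lemma analytic_off_poles:
  assumes z0: "z0 \<notin> range pole"
  shows "T analytic_on {z0}"
proof -
  obtain M where M: "z0 \<in> region M" "CARD('n) + 1 \<le> M" using region_exists by blast
  obtain V where V: "open V" "z0 \<in> V" "\<And>z. z \<in> V \<Longrightarrow> z \<notin> range pole"
  proof -
    have "\<forall>\<^sub>F z in nhds z0. z \<notin> range pole"
      using eventually_not_pole[of z0] unfolding eventually_at_filter
      by eventually_elim (use z0 in auto)
    then show ?thesis using that unfolding eventually_nhds by blast
  qed
  have "continuation M holomorphic_on V \<inter> region M"
    unfolding continuation_def[abs_def]
    by (intro holomorphic_intros sphere_int_holomorphic holomorphic_on_subset[OF regular_holomorphic])
      (use V(3) q in auto)
  then have "T holomorphic_on V \<inter> region M"
    by (rule holomorphic_transform) (use T V(3) M(2) in auto)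
  then show ?thesis
    unfolding analytic_at using V M open_region by (intro exI[of _ "V \<inter> region M"]) auto
qed

lemma pole_expansion:
  assumes M: "pole j \<in> region M" "CARD('n) + 1 \<le> M" "j < M"
  shows "\<exists>F. (\<lambda>w. T (pole j + w)) has_laurent_expansion F"
    and "residue T (pole j) = sphere_int (D j (pole j) []) / of_real q"
    and "is_pole T (pole j) \<Longrightarrow> zorder T (pole j) = - 1"
    and "sphere_int (D j (pole j) []) = 0 \<Longrightarrow> finite_part T (pole j) =
      regular_at_pole M j (pole j) + deriv (\<lambda>z. sphere_int (D j z [])) (pole j) / of_real q"
proof -
  \<comment> \<open>\<open>continuation M\<close> involves only the poles with index below M, so
    removing finitely many points leaves an open set on which all terms but the j-th are
    holomorphic.\<close>
  let ?U = "region M - pole ` ({..<M} - {j})"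
  have U: "open ?U" by (intro open_Diff open_region finite_imp_closed) auto
  have jU: "pole j \<in> ?U" using M pole_eqI[of _ j] q by (auto simp: image_iff)
  have H: "regular_at_pole M j holomorphic_on ?U"
    unfolding regular_at_pole_def[abs_def]
    by (intro holomorphic_intros sphere_int_holomorphic holomorphic_on_subset[OF regular_holomorphic])
      (use q in auto)
  have "\<forall>\<^sub>F z in at (pole j). z \<in> region M"
    using open_region M(1) by (rule eventually_at_in_open')
  then have ev: "\<forall>\<^sub>F z in at (pole j). T z = regular_at_pole M j z + sphere_int (D j z []) / (of_real q * (z - pole j))"
    using eventually_not_pole[of "pole j"]
  proof eventually_elim
    case (elim z)
    have "continuation M z = regular_at_pole M j z + sphere_int (D j z []) / (of_real q * (z - pole j))"
      unfolding continuation_def regular_at_pole_def using M(3) by (subst sum.remove[of _ j]) auto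
    then show ?case using T[OF elim(2,1) M(2)] by simp
  qed
  have q0: "complex_of_real q \<noteq> 0" using q by simp
  note * = simple_pole_expansion[OF U jU H sphere_int_holomorphic q0 ev]
  show "\<exists>F. (\<lambda>w. T (pole j + w)) has_laurent_expansion F"
    and "residue T (pole j) = sphere_int (D j (pole j) []) / of_real q"
    and "is_pole T (pole j) \<Longrightarrow> zorder T (pole j) = - 1"
    and "sphere_int (D j (pole j) []) = 0 \<Longrightarrow> finite_part T (pole j) =
      regular_at_pole M j (pole j) + deriv (\<lambda>z. sphere_int (D j z [])) (pole j) / of_real q"
    by (rule *, assumption?)+
qed

lemma meromorphic_UNIV: "T meromorphic_on UNIV"
  unfolding meromorphic_on_def
proof
  fix z0
  show "\<exists>F. (\<lambda>w. T (z0 + w)) has_laurent_expansion F"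
  proof (cases "z0 \<in> range pole")
    case True
    then obtain j where "z0 = pole j" by blast
    then show ?thesis using region_exists[of "pole j" j] pole_expansion(1) by blast
  next
    case False
    then show ?thesis
      using analytic_on_imp_meromorphic_on[OF analytic_off_poles] unfolding meromorphic_on_def by blast
  qed
qed

end

end

section \<open>Polynomial symbols\<close>

text \<open>The k-th derivative of x^a, with the falling factorial as coefficient. For k > a the
  product contains the factor 0, which makes the truncated exponent \<open>a - k\<close>
  harmless.\<close>

definition power_deriv :: "nat \<Rightarrow> nat \<Rightarrow> real \<Rightarrow> real" where
  "power_deriv a k x = (\<Prod>m<k. real a - real m) * x ^ (a - k)"

lemma power_deriv_has_derivative: "(power_deriv a k has_real_derivative power_deriv a (Suc k) x) (at x)"
proof (cases "k < a")
  case True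
  have "((\<lambda>x. (\<Prod>m<k. real a - real m) * x ^ (a - k)) has_real_derivative
      (\<Prod>m<k. real a - real m) * (real (a - k) * x ^ (a - k - 1))) (at x)"
    by (auto intro!: derivative_eq_intros)
  then show ?thesis using True by (simp add: power_deriv_def[abs_def] of_nat_diff mult.assoc)
next
  case False
  then have "(\<Prod>m<Suc k. real a - real m) = 0" by (intro prod_zero) auto
  then have "power_deriv a (Suc k) x = 0" unfolding power_deriv_def by simp
  moreover have "power_deriv a k = (\<lambda>x. \<Prod>m<k. real a - real m)"
    using False by (simp add: power_deriv_def fun_eq_iff)
  ultimately show ?thesis by simp
qed

lemma power_deriv_eq_0: "a < k \<Longrightarrow> power_deriv a k x = 0"
proof -
  assume "a < k"
  then have "(\<Prod>m<k. real a - real m) = 0" by (intro prod_zero) auto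
  then show ?thesis by (simp add: power_deriv_def)
qed

definition monomial_deriv :: "('n::finite \<Rightarrow> nat) \<Rightarrow> 'n list \<Rightarrow> real ^ 'n \<Rightarrow> real" where
  "monomial_deriv \<alpha> l x = (\<Prod>i\<in>UNIV. power_deriv (\<alpha> i) (count_list l i) (x $ i))"

lemma monomial_deriv_Nil: "monomial_deriv \<alpha> [] x = (\<Prod>i\<in>UNIV. x $ i ^ \<alpha> i)"
  by (simp add: monomial_deriv_def power_deriv_def)

lemma monomial_deriv_eq_0:
  fixes \<alpha> :: "'n::finite \<Rightarrow> nat"
  assumes "(\<Sum>i\<in>UNIV. \<alpha> i) < length l" shows "monomial_deriv \<alpha> l x = 0"
proof -
  have "(\<Sum>i\<in>UNIV. count_list l i) = length l" by (rule sum_count_set) auto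
  then have "\<not> (\<forall>i. count_list l i \<le> \<alpha> i)"
    using assms sum_mono[of UNIV "count_list l" \<alpha>] by auto
  then obtain i where "\<alpha> i < count_list l i" by (auto simp: not_le)
  then show ?thesis
    unfolding monomial_deriv_def by (intro prod_zero) (auto intro!: bexI[of _ i] power_deriv_eq_0)
qed

lemma continuous_monomial_deriv: "continuous_on UNIV (monomial_deriv \<alpha> l)"
  unfolding monomial_deriv_def[abs_def] power_deriv_def by (intro continuous_intros)

lemma monomial_deriv_has_derivative:
  "((\<lambda>h. monomial_deriv \<alpha> l (x + h *\<^sub>R axis i 1)) has_real_derivative monomial_deriv \<alpha> (i # l) x) (at 0)"
proof -
  let ?c = "\<Prod>j\<in>UNIV - {i}. power_deriv (\<alpha> j) (count_list l j) (x $ j)"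
  have 1: "monomial_deriv \<alpha> l (x + h *\<^sub>R axis i 1) = power_deriv (\<alpha> i) (count_list l i) (x $ i + h) * ?c" for h
  proof -
    have "(\<Prod>j\<in>UNIV - {i}. power_deriv (\<alpha> j) (count_list l j) ((x + h *\<^sub>R axis i 1) $ j)) = ?c"
      by (rule prod.cong) (auto simp: axis_def)
    then show ?thesis unfolding monomial_deriv_def by (subst prod.remove[of _ i]) (auto simp: axis_def)
  qed
  have 2: "monomial_deriv \<alpha> (i # l) x = power_deriv (\<alpha> i) (Suc (count_list l i)) (x $ i) * ?c"
  proof -
    have "(\<Prod>j\<in>UNIV - {i}. power_deriv (\<alpha> j) (count_list (i # l) j) (x $ j)) = ?c"
      by (rule prod.cong) auto
    then show ?thesis unfolding monomial_deriv_def by (subst prod.remove[of _ i]) auto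
  qed
  have "((\<lambda>h. power_deriv (\<alpha> i) (count_list l i) (x $ i + h)) has_real_derivative
      power_deriv (\<alpha> i) (Suc (count_list l i)) (x $ i)) (at 0)"
    using power_deriv_has_derivative[of "\<alpha> i" "count_list l i" "x $ i"]
    by (simp add: DERIV_shift[where z = "x $ i" and x = 0, simplified, symmetric] add.commute)
  then show ?thesis unfolding 1 2 by (rule DERIV_cmult_right)
qed

definition polynomial_deriv :: "(('n::finite \<Rightarrow> nat) \<Rightarrow> complex) \<Rightarrow> ('n \<Rightarrow> nat) set \<Rightarrow> 'n list \<Rightarrow> real ^ 'n \<Rightarrow> complex" where
  "polynomial_deriv b A l x = (\<Sum>\<alpha>\<in>A. b \<alpha> * of_real (monomial_deriv \<alpha> l x))"

lemma smooth_derivs_polynomial: "smooth_derivs (polynomial_deriv b A)"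
  unfolding smooth_derivs_def
proof (intro conjI allI)
  show "continuous_on UNIV (polynomial_deriv b A l)" for l
    unfolding polynomial_deriv_def[abs_def]
    by (intro continuous_intros continuous_on_compose2[OF continuous_monomial_deriv]) auto
  show "((\<lambda>h. polynomial_deriv b A l (x + h *\<^sub>R axis i 1)) has_vector_derivative polynomial_deriv b A (i # l) x) (at 0)" for l i x
    unfolding polynomial_deriv_def
    by (intro has_vector_derivative_sum has_vector_derivative_mult_right has_vector_derivative_of_real)
      (rule monomial_deriv_has_derivative)
qed

lemma polynomial_deriv_eq_0:
  assumes "\<And>\<alpha>. \<alpha> \<in> A \<Longrightarrow> (\<Sum>i\<in>UNIV. \<alpha> i) < length l"
  shows "polynomial_deriv b A l x = 0"
  unfolding polynomial_deriv_def using assms by (intro sum.neutral) (simp add: monomial_deriv_eq_0)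

lemma polynomial_deriv_homogeneous:
  assumes "\<And>\<alpha>. \<alpha> \<in> A \<Longrightarrow> (\<Sum>i\<in>UNIV. \<alpha> i) = e"
  shows "polynomial_deriv b A [] (t *\<^sub>R x) = of_real t ^ e * polynomial_deriv b A [] x"
proof -
  have "monomial_deriv \<alpha> [] (t *\<^sub>R x) = t ^ e * monomial_deriv \<alpha> [] x" if "\<alpha> \<in> A" for \<alpha>
  proof -
    have "t ^ e = (\<Prod>i\<in>UNIV. t ^ \<alpha> i)" by (simp only: assms[OF that, symmetric] power_sum)
    then show ?thesis by (simp add: monomial_deriv_Nil power_mult_distrib prod.distrib)
  qed
  then show ?thesis
    unfolding polynomial_deriv_def sum_distrib_left by (intro sum.cong) (simp_all add: mult_ac)
qed

section \<open>Compactly supported corrections of polynomials\<close>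

lemma smooth_derivs_diff:
  "smooth_derivs D \<Longrightarrow> smooth_derivs E \<Longrightarrow> smooth_derivs (\<lambda>l x. D l x - E l x)"
  by (auto simp: smooth_derivs_def intro!: continuous_intros has_vector_derivative_diff)

lemma smooth_derivs_vanish:
  assumes D: "smooth_derivs D" and zero: "\<And>x. 1 < norm x \<Longrightarrow> D [] x = 0" and x: "1 < norm x"
  shows "D l x = 0"
  using x
proof (induction l arbitrary: x)
  case Nil
  then show ?case by (rule zero)
next
  case (Cons i l)
  have "\<forall>\<^sub>F h in nhds 0. 1 < norm (x + h *\<^sub>R axis i 1)"
  proof -
    have "((\<lambda>h. norm (x + h *\<^sub>R axis i 1)) \<longlongrightarrow> norm (x + 0 *\<^sub>R axis i 1)) (nhds 0)"
      by (intro tendsto_intros) (simp add: filterlim_ident)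
    then show ?thesis using Cons.prems by (intro order_tendstoD(1)) simp
  qed
  then have ev: "\<forall>\<^sub>F h in nhds 0. D l (x + h *\<^sub>R axis i 1) = 0"
    by eventually_elim (rule Cons.IH)
  have "((\<lambda>h. D l (x + h *\<^sub>R axis i 1)) has_vector_derivative D (i # l) x) (at 0)"
    using D by (simp add: smooth_derivs_def)
  then have "((\<lambda>h::real. 0) has_vector_derivative D (i # l) x) (at 0)"
    using ev eventually_nhds_x_imp_x[OF ev]
    by (subst (asm) has_vector_derivative_cong_ev[where g = "\<lambda>_. 0"]) (auto elim: eventually_mono)
  then show ?case
    using vector_derivative_unique_at[OF has_vector_derivative_const[of 0]] by metis
qed

lemma cell_remainder_diff:
  assumes D: "smooth_derivs D" and E: "smooth_derivs E"
  shows "cell_remainder M (\<lambda>l x. D l x - E l x) k = cell_remainder M D k - cell_remainder M E k"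
proof -
  have int: "set_integrable lborel unit_cell (\<lambda>y. F l (x + y))" if "smooth_derivs F" for F :: "'a list \<Rightarrow> real ^ 'a \<Rightarrow> complex" and l x
    by (rule set_integrable_continuous[OF continuous_on_compose2[OF smooth_derivs_continuous[OF that]]])
      (auto intro!: continuous_intros bounded_half_open_cube)
  have "cell_avg (\<lambda>x. D l x - E l x) x = cell_avg (D l) x - cell_avg (E l) x" for l x
    unfolding cell_avg_def by (rule set_integral_diff(2)[OF int[OF D] int[OF E]])
  then show ?thesis
    by (simp add: cell_remainder_def scaleR_diff_right sum_subtractf)
qed

text \<open>With vanishing derivatives of order M the inversion of cell averages is exact: its bound
  applies with B = 0.\<close>

lemma cell_remainder_polynomial:
  fixes P :: "'n::finite list \<Rightarrow> real ^ 'n \<Rightarrow> complex"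
  assumes P: "smooth_derivs P" and zero: "\<And>l x. length l = M \<Longrightarrow> P l x = 0"
  shows "cell_remainder M P k = 0"
proof -
  obtain C where "\<And>(D :: 'n list \<Rightarrow> real ^ 'n \<Rightarrow> complex) x B.
     smooth_derivs D \<Longrightarrow> (\<forall>u y. length u = M \<longrightarrow> y \<in> unit_cell \<longrightarrow> norm (D u (x + y)) \<le> B) \<Longrightarrow>
     norm (D [] x - (\<Sum>l | length l < M. inv_moment l *\<^sub>R cell_avg (D l) x)) \<le> C * B"
    using inverse_cell_avg_bound[where 'n = 'n, of M] by blast
  from this[of P "lattice_vec k" 0, OF P] zero have "norm (cell_remainder M P k) \<le> C * 0"
    unfolding cell_remainder_def by simp
  then show ?thesis by simp
qed

lemma cube_integral_compact_deriv:
  fixes E :: "'n::finite list \<Rightarrow> real ^ 'n \<Rightarrow> complex"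
  assumes E: "smooth_derivs E" and zero: "\<And>x. 1 \<le> norm x \<Longrightarrow> E [] x = 0" and R: "2 \<le> R"
  shows "(LINT x:half_open_cube R|lborel. E l x) = (if l = [] then (LINT x:ball 0 1|lborel. E [] x) else 0)"
proof (cases l)
  case Nil
  have "indicator (half_open_cube R) x *\<^sub>R E [] x = indicator (ball 0 1) x *\<^sub>R E [] x" for x
  proof (cases "norm x < 1")
    case True
    then have "x \<in> half_open_cube R" using R ball_subset_half_open_cube[of R] by auto
    then show ?thesis using True by simp
  qed (simp add: zero)
  then show ?thesis unfolding set_lebesgue_integral_def Nil by (simp only: if_True refl)
next
  case (Cons i u)
  have van: "E v x = 0" if "1 < norm x" for v x
    using smooth_derivs_vanish[OF E _ that] zero by simp
  have "indicator (half_open_cube R) x *\<^sub>R E l x = E l x" for x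
  proof (cases "1 < norm x")
    case False
    then have "x \<in> half_open_cube R" using R ball_subset_half_open_cube[of R] by auto
    then show ?thesis by simp
  qed (simp add: van)
  moreover have "(LINT x|lborel. E l x) = 0"
    by (rule integral_partial_derivative_compact_support[where K = "E u" and r = 1 and i = i])
      (use E van Cons in \<open>auto simp: smooth_derivs_def\<close>)
  ultimately show ?thesis using Cons by (simp add: set_lebesgue_integral_def)
qed

lemma lattice_sum_limit:
  fixes f :: "int ^ 'n::finite \<Rightarrow> complex"
  assumes e: "e + 2 * real CARD('n) < 0" and C: "0 \<le> C"
    and f: "\<And>k. norm (f k) \<le> C * (1 + norm (lattice_vec k)) powr e"
  shows "(\<lambda>N. \<Sum>k\<in>lattice_box N. f k) \<longlonglongrightarrow> lattice_sum f"
proof (rule LIM_zero_cancel, rule Lim_null_comparison)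
  let ?W = "C * (LINT k|count_space UNIV. lattice_weight (k :: int ^ 'n))"
  have "e + 2 * real CARD('n) \<le> 0" using e by simp
  then show "\<forall>\<^sub>F N in sequentially. norm ((\<Sum>k\<in>lattice_box N. f k) - lattice_sum f) \<le>
      ?W * (1 + real N) powr (e + 2 * real CARD('n))"
    using lattice_sum_tail(2)[OF _ C f] by (intro always_eventually allI) blast
  have "filterlim (\<lambda>N. 1 + real N) at_top sequentially"
    by (rule filterlim_tendsto_add_at_top[OF tendsto_const filterlim_real_sequentially])
  then have "(\<lambda>N. ?W * (1 + real N) powr (e + 2 * real CARD('n))) \<longlonglongrightarrow> ?W * 0"
    using e by (intro tendsto_intros tendsto_neg_powr)
  then show "(\<lambda>N. ?W * (1 + real N) powr (e + 2 * real CARD('n))) \<longlonglongrightarrow> 0" by simp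
qed

text \<open>Scaling gives the integral over the ball of radius 2 as
  \<open>2 ^ (e + CARD('n))\<close> times the one over the unit ball, and
  \<open>shell_int_eq\<close> gives the shell in between. Comparing the two determines the
  integral.\<close>

lemma ball_integral_homogeneous:
  fixes g :: "real ^ 'n::finite \<Rightarrow> complex"
  assumes g: "continuous_on UNIV g" and hom: "\<And>x t. 1 \<le> t \<Longrightarrow> g (t *\<^sub>R x) = of_real t ^ e * g x"
  shows "(LINT x:ball 0 1|lborel. g x) = sphere_int g / of_nat (e + CARD('n))"
proof -
  let ?m = "e + CARD('n)"
  let ?w = "of_nat e + of_nat CARD('n) :: complex"
  have [measurable]: "g \<in> borel_measurable borel" using g by (rule borel_measurable_continuous_onI)
  have w: "?w \<noteq> 0"
    unfolding of_nat_add[symmetric] of_nat_eq_0_iff by simp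
  have out: "outer_homogeneous (of_nat e) g"
    unfolding outer_homogeneous_def using hom by (simp add: powr_nat)
  have pw: "(2 :: complex) powr ?w = 2 ^ ?m"
    by (simp only: of_nat_add[symmetric] powr_nat) simp
  have split: "ball 0 2 = ball 0 1 \<union> (shell 1 2 :: (real ^ 'n) set)" "ball 0 1 \<inter> (shell 1 2 :: (real ^ 'n) set) = {}"
    by (auto simp: shell_def)
  have "(LINT x:ball 0 2|lborel. g x) = of_real 2 ^ CARD('n) * (LINT x:ball 0 1|lborel. g (2 *\<^sub>R x))"
    by (rule set_integral_scale) auto
  also have "\<dots> = 2 ^ ?m * (LINT x:ball 0 1|lborel. g x)"
    by (simp add: hom power_add mult_ac)
  finally have "2 ^ ?m * (LINT x:ball 0 1|lborel. g x) = (LINT x:ball 0 1|lborel. g x) + (LINT x:shell 1 2|lborel. g x)"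
    unfolding split(1) by (subst (asm) set_integral_Un[OF split(2)])
      (auto intro!: set_integrable_continuous[OF g] bounded_shell)
  moreover have "(LINT x:shell 1 2|lborel. g x) = sphere_int g * (2 ^ ?m - 1) / ?w"
    using shell_int_eq[OF g out refl w, of 2] pw by (simp add: shell_int_def[OF g out refl w])
  ultimately have "(2 ^ ?m - 1) * (LINT x:ball 0 1|lborel. g x) = (2 ^ ?m - 1) * (sphere_int g / ?w)"
    by (simp add: algebra_simps diff_divide_distrib)
  moreover have "(2 :: complex) ^ ?m - 1 \<noteq> 0"
  proof
    assume "(2 :: complex) ^ ?m - 1 = 0"
    then have "norm ((2 :: complex) ^ ?m) = 1" by simp
    then have "(2 :: real) ^ ?m = 1" by (simp only: norm_power norm_numeral)
    moreover have "(1 :: real) < 2 ^ ?m" by (rule one_less_power) simp_all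
    ultimately show False by simp
  qed
  ultimately show ?thesis unfolding of_nat_add by (simp only: mult_cancel_left) simp
qed

context scalar_family
begin

text \<open>Each polynomial \<open>P i\<close> differs from the i-th cut-off component by a function
  supported in the unit ball and has no cell remainder. So the symbol and cell remainders sum up to
  ball integrals of these differences, and \<open>regular\<close> collapses to the ball integrals of
  the \<open>P i\<close>. These equal S_i / (j - i), where S_i is the sphere integral, and cancel
  the polar terms S_i / (i - j).\<close>

lemma regular_at_pole_polynomial:
  assumes M: "pole j \<in> region M" "j < M"
    and P: "\<And>i. smooth_derivs (P i)" and P0: "\<And>i l x. length l = M \<Longrightarrow> P i l x = 0"
    and out: "\<And>i x. 1 \<le> norm x \<Longrightarrow> P i [] x = D i (pole j) [] x"
    and hom: "\<And>i x t. CARD('n) + i \<le> j \<Longrightarrow> 1 \<le> t \<Longrightarrow> P i [] (t *\<^sub>R x) = of_real t ^ (j - (CARD('n) + i)) * P i [] x"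
    and none: "\<And>i x. \<not> CARD('n) + i \<le> j \<Longrightarrow> P i [] x = 0"
    and f: "\<And>k. f (pole j) k = (\<Sum>i<M. P i [] (lattice_vec k))"
  shows "regular_at_pole M j (pole j) = 0"
proof -
  let ?z = "pole j"
  let ?E = "\<lambda>i l x. P i l x - D i ?z l x"
  have D: "smooth_derivs (D i ?z)" for i by (rule homogeneous_familyD(1)[OF family])
  have E: "smooth_derivs (?E i)" for i by (intro smooth_derivs_diff P D)
  have order: "Re (nct_order q a ?z) + 1 + 2 * real CARD('n) < real M" using M(1) by (simp add: region_def)
  have lim_cell: "(\<lambda>N. \<Sum>k\<in>lattice_box N. cell_remainder M (D i ?z) k) \<longlonglongrightarrow> lattice_sum (cell_remainder M (D i ?z))" for i
  proof -
    obtain C where C: "C \<ge> 0" "\<And>k. norm (cell_remainder M (D i ?z) k) \<le>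
        C * (1 + norm (lattice_vec k)) powr (Re (nct_order q a ?z - of_nat i) - real M)"
      using cell_remainder_bound[OF family, of "{?z}" i M] continuous_order by auto
    show ?thesis by (rule lattice_sum_limit[OF _ C]) (use order in simp)
  qed
  have lim_rem: "(\<lambda>N. \<Sum>k\<in>lattice_box N. remainder M ?z k) \<longlonglongrightarrow> lattice_sum (remainder M ?z)"
  proof -
    obtain C where C: "C \<ge> 0" "\<And>k. norm (remainder M ?z k) \<le>
        C * (1 + norm (lattice_vec k)) powr (Re (nct_order q a ?z) - real M + 1)"
      using remainder_bound[of "{?z}" M] unfolding remainder_def by auto
    show ?thesis by (rule lattice_sum_limit[OF _ C]) (use order in simp)
  qed
  have box: "(\<Sum>k\<in>lattice_box N. remainder M ?z k) + (\<Sum>i<M. \<Sum>k\<in>lattice_box N. cell_remainder M (D i ?z) k) =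
      (\<Sum>i<M. LINT x:ball 0 1|lborel. ?E i [] x)" if N: "2 \<le> N" for N
  proof -
    \<comment> \<open>As \<open>P i\<close> has no cell remainder, that of the component is minus
      that of the compactly supported difference.\<close>
    have "cell_remainder M (D i ?z) k = - cell_remainder M (?E i) k" for i k
      using cell_remainder_diff[OF P D, of M i i k] cell_remainder_polynomial[OF P P0, of M i k] by simp
    then have "(\<Sum>k\<in>lattice_box N. remainder M ?z k) + (\<Sum>i<M. \<Sum>k\<in>lattice_box N. cell_remainder M (D i ?z) k) =
        (\<Sum>i<M. (\<Sum>k\<in>lattice_box N. ?E i [] (lattice_vec k)) - (\<Sum>k\<in>lattice_box N. cell_remainder M (?E i) k))"
      by (simp add: remainder_def f sum_subtractf sum_negf sum.swap[of _ _ "{..<M}"])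
    also have "\<dots> = (\<Sum>i<M. \<Sum>l | length l < M. inv_moment l *\<^sub>R (LINT x:half_open_cube (real N + 1 / 2)|lborel. ?E i l x))"
      by (intro sum.cong refl) (simp only: sum_lattice_box_cell_remainder[OF E, where M = M] add_diff_cancel_left')
    also have "\<dots> = (\<Sum>i<M. \<Sum>l | length (l :: 'n list) < M. if l = [] then (LINT x:ball 0 1|lborel. ?E i [] x) else 0)"
    proof (intro sum.cong refl)
      fix i :: nat and l :: "'n list"
      show "inv_moment l *\<^sub>R (LINT x:half_open_cube (real N + 1 / 2)|lborel. ?E i l x) =
          (if l = [] then (LINT x:ball 0 1|lborel. ?E i [] x) else 0)"
        using cube_integral_compact_deriv[OF E, of i "real N + 1 / 2" l] out N by (simp add: inv_moment_Nil)
    qed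
    also have "\<dots> = (\<Sum>i<M. LINT x:ball 0 1|lborel. ?E i [] x)"
      using M(2) by (subst sum.delta) auto
    finally show ?thesis .
  qed
  have "(\<lambda>N. (\<Sum>k\<in>lattice_box N. remainder M ?z k) + (\<Sum>i<M. \<Sum>k\<in>lattice_box N. cell_remainder M (D i ?z) k))
      \<longlonglongrightarrow> lattice_sum (remainder M ?z) + (\<Sum>i<M. lattice_sum (cell_remainder M (D i ?z)))"
    by (intro tendsto_intros lim_rem lim_cell)
  moreover have "\<forall>\<^sub>F N in sequentially. (\<Sum>k\<in>lattice_box N. remainder M ?z k) +
      (\<Sum>i<M. \<Sum>k\<in>lattice_box N. cell_remainder M (D i ?z) k) = (\<Sum>i<M. LINT x:ball 0 1|lborel. ?E i [] x)"
    by (rule eventually_mono[OF eventually_ge_at_top[of 2]]) (rule box)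
  ultimately have "(\<lambda>N::nat. \<Sum>i<M. LINT x:ball 0 1|lborel. ?E i [] x)
      \<longlonglongrightarrow> lattice_sum (remainder M ?z) + (\<Sum>i<M. lattice_sum (cell_remainder M (D i ?z)))"
    by (rule Lim_transform_eventually)
  then have sums: "lattice_sum (remainder M ?z) + (\<Sum>i<M. lattice_sum (cell_remainder M (D i ?z))) =
      (\<Sum>i<M. LINT x:ball 0 1|lborel. ?E i [] x)"
    by (simp only: LIMSEQ_const_iff)
  have ball: "(LINT x:ball 0 1|lborel. ?E i [] x) = (LINT x:ball 0 1|lborel. P i [] x) - (LINT x:ball 0 1|lborel. D i ?z [] x)" for i
    by (intro set_integral_diff(2) set_integrable_continuous smooth_derivs_continuous P D) auto
  have "regular M ?z = (\<Sum>i<M. LINT x:ball 0 1|lborel. P i [] x)"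
    using sums by (simp add: regular_def regularized_part_def ball sum.distrib sum_subtractf algebra_simps)
  also have "\<dots> = - (\<Sum>i<M. sphere_int (D i ?z []) / (of_nat i - of_nat j))"
    unfolding sum_negf[symmetric]
  proof (rule sum.cong[OF refl])
    fix i
    have S: "sphere_int (D i ?z []) = sphere_int (P i [])" by (rule sphere_int_cong) (simp add: out)
    show "(LINT x:ball 0 1|lborel. P i [] x) = - (sphere_int (D i ?z []) / (of_nat i - of_nat j))"
    proof (cases "CARD('n) + i \<le> j")
      case True
      have "(LINT x:ball 0 1|lborel. P i [] x) = sphere_int (P i []) / of_nat (j - (CARD('n) + i) + CARD('n))"
        by (rule ball_integral_homogeneous[OF smooth_derivs_continuous[OF P] hom[OF True]])
      also have "j - (CARD('n) + i) + CARD('n) = j - i" using True by simp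
      finally show ?thesis
        unfolding S using True by (simp add: of_nat_diff minus_divide_right)
    next
      case False
      have "P i [] = (\<lambda>_. 0)" using none[OF False] by (simp add: fun_eq_iff)
      then show ?thesis unfolding S by (simp add: sphere_int_def set_lebesgue_integral_def)
    qed
  qed
  \<comment> \<open>For i = j the summand is a division by zero, hence 0, so the index j may be
    dropped.\<close>
  also have "(\<Sum>i<M. sphere_int (D i ?z []) / (of_nat i - of_nat j)) =
      (\<Sum>i\<in>{..<M} - {j}. sphere_int (D i ?z []) / (of_real q * (?z - pole i)))"
  proof -
    have "complex_of_real q * (?z - pole i) = of_nat i - of_nat j" for i
      using order_pole[of ?z i] order_at_pole[of j] by (simp add: algebra_simps)
    then show ?thesis using M(2) by (simp add: sum.remove[of _ j])
  qed
  finally show ?thesis by (simp add: regular_at_pole_def)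
qed

end

section \<open>Symbols on the noncommutative torus\<close>

lemma smooth_algebra_lincomb:
  assumes "x \<in> nct_smooth_algebra" "y \<in> nct_smooth_algebra"
  shows "(\<lambda>k. u * x k + v * y k) \<in> nct_smooth_algebra"
  unfolding nct_smooth_algebra_def
proof (intro CollectI allI)
  fix N
  obtain C C' where C: "\<And>k. norm (x k) * (1 + norm (lattice_vec k)) ^ N \<le> C"
      "\<And>k. norm (y k) * (1 + norm (lattice_vec k)) ^ N \<le> C'"
    using assms unfolding nct_smooth_algebra_def by blast
  have "norm (u * x k + v * y k) * (1 + norm (lattice_vec k)) ^ N \<le> norm u * C + norm v * C'" for k
  proof -
    have "norm (u * x k + v * y k) * (1 + norm (lattice_vec k)) ^ N \<le>
        (norm u * norm (x k) + norm v * norm (y k)) * (1 + norm (lattice_vec k)) ^ N"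
      by (intro mult_right_mono norm_triangle_le) (auto simp: norm_mult)
    also have "\<dots> = norm u * (norm (x k) * (1 + norm (lattice_vec k)) ^ N) + norm v * (norm (y k) * (1 + norm (lattice_vec k)) ^ N)"
      by (simp add: algebra_simps)
    also have "\<dots> \<le> norm u * C + norm v * C'"
      by (intro add_mono mult_left_mono C) auto
    finally show ?thesis .
  qed
  then show "\<exists>C. \<forall>k. norm (u * x k + v * y k) * (1 + norm (lattice_vec k)) ^ N \<le> C" by blast
qed

lemma smooth_algebra_diff:
  "x \<in> nct_smooth_algebra \<Longrightarrow> y \<in> nct_smooth_algebra \<Longrightarrow> (\<lambda>k. x k - y k) \<in> nct_smooth_algebra"
  using smooth_algebra_lincomb[of x y 1 "- 1"] by simp

lemma smooth_algebra_quotient: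
  assumes "x \<in> nct_smooth_algebra" "y \<in> nct_smooth_algebra" "w \<in> nct_smooth_algebra"
  shows "(\<lambda>k. (x k - y k) / h - w k) \<in> nct_smooth_algebra"
  using smooth_algebra_lincomb[OF smooth_algebra_diff[OF assms(1,2)] assms(3), of "1 / h" "- 1"] by simp

lemma nct_U_smooth: "nct_U k \<in> nct_smooth_algebra"
  unfolding nct_smooth_algebra_def
proof (intro CollectI allI)
  fix N
  show "\<exists>C. \<forall>l. norm (nct_U k l) * (1 + norm (lattice_vec l)) ^ N \<le> C"
    by (rule exI[of _ "(1 + norm (lattice_vec k)) ^ N"]) (auto simp: nct_U_def)
qed

lemma nct_delta_0: "nct_delta (\<lambda>_. 0) x = x"
  by (simp add: nct_delta_def)

text \<open>Applied to \<open>nct_U k\<close>, the operator returns the coefficients of the symbol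
  at k up to cocycle scalars. As these scalars are unimodular, this is the injectivity of
  \<open>nct_Op\<close> on lattice symbols.\<close>

lemma nct_Op_U: "nct_Op c \<sigma> (nct_U k) (k + \<kappa>) = \<sigma> k \<kappa> * c \<kappa> k"
proof -
  have "nct_Op c \<sigma> (nct_U k) (k + \<kappa>) = (\<Sum>\<^sub>\<infinity>j. nct_U k j * nct_mult c (\<sigma> j) (nct_U j) (k + \<kappa>))"
    by (simp only: nct_Op_def restrict_apply nct_U_smooth if_True)
  also have "\<dots> = (\<Sum>\<^sub>\<infinity>j\<in>{k}. nct_U k j * nct_mult c (\<sigma> j) (nct_U j) (k + \<kappa>))"
    by (rule infsum_cong_neutral) (auto simp: nct_U_def)
  also have "\<dots> = nct_mult c (\<sigma> k) (nct_U k) (k + \<kappa>)" by (simp add: nct_U_def)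
  also have "\<dots> = (\<Sum>\<^sub>\<infinity>j\<in>{\<kappa>}. \<sigma> k j * nct_U k (k + \<kappa> - j) * c j (k + \<kappa> - j))"
    unfolding nct_mult_def by (rule infsum_cong_neutral) (auto simp: nct_U_def)
  also have "\<dots> = \<sigma> k \<kappa> * c \<kappa> k" by (simp add: nct_U_def)
  finally show ?thesis .
qed

text \<open>Passage from words to multi-indices: prepending a letter raises one entry, so
  derivatives indexed by multi-indices induce a family indexed by words.\<close>

definition multiplicities :: "'n list \<Rightarrow> 'n multiindex" where
  "multiplicities l = (\<lambda>i. count_list l i)"

lemma multiplicities_simps:
  "multiplicities [] = (\<lambda>_. 0)" "multiplicities (i # l) = (multiplicities l)(i := Suc (multiplicities l i))"
  by (auto simp: multiplicities_def fun_eq_iff)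

lemma has_vector_derivative_iff_quotient:
  fixes f :: "real \<Rightarrow> complex"
  shows "(f has_vector_derivative d) (at 0) \<longleftrightarrow> ((\<lambda>h. (f h - f 0) / of_real h) \<longlongrightarrow> d) (at 0)"
proof
  assume "(f has_vector_derivative d) (at 0)"
  from has_vector_derivative_quotient[OF this] show "((\<lambda>h. (f h - f 0) / of_real h) \<longlongrightarrow> d) (at 0)"
    by (simp add: scaleR_conv_of_real divide_inverse mult.commute)
next
  assume lim: "((\<lambda>h. (f h - f 0) / of_real h) \<longlongrightarrow> d) (at 0)"
  have "((\<lambda>h. norm ((f h - f 0) / of_real h - d)) \<longlongrightarrow> 0) (at 0)"
    using lim by (simp add: LIM_zero tendsto_norm_zero)
  moreover have "\<forall>\<^sub>F h in at 0. norm ((f h - f 0) / of_real h - d) = norm ((f h - f 0 - h *\<^sub>R d) /\<^sub>R \<bar>h\<bar>)"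
    unfolding eventually_at_filter
  proof (rule always_eventually, intro allI impI)
    fix h :: real assume h: "h \<noteq> 0"
    then have "(f h - f 0) / of_real h - d = (f h - f 0 - h *\<^sub>R d) / of_real h"
      by (simp add: scaleR_conv_of_real field_simps)
    then show "norm ((f h - f 0) / of_real h - d) = norm ((f h - f 0 - h *\<^sub>R d) /\<^sub>R \<bar>h\<bar>)"
      by (simp add: norm_divide norm_mult norm_inverse divide_inverse mult.commute)
  qed
  ultimately have "((\<lambda>h. norm ((f h - f 0 - h *\<^sub>R d) /\<^sub>R \<bar>h\<bar>)) \<longlongrightarrow> 0) (at 0)"
    by (rule Lim_transform_eventually)
  then show "(f has_vector_derivative d) (at 0)"
    unfolding has_vector_derivative_def has_derivative_at
    by (simp add: bounded_linear_scaleR_left divide_inverse mult.commute)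
qed

lemma nct_derivs_smooth: "nct_derivs c S f D \<Longrightarrow> \<xi> \<in> S \<Longrightarrow> D \<beta> \<xi> \<in> nct_smooth_algebra"
  unfolding nct_derivs_def by blast

lemma nct_holo_derivs_derivs:
  "nct_holo_derivs c S f D \<Longrightarrow> nct_derivs c S (D k (\<lambda>_. 0) z) (\<lambda>\<beta>. D k \<beta> z)"
  unfolding nct_holo_derivs_def by blast

section \<open>From symbols with values in the algebra to scalar coefficients\<close>

context
  fixes \<theta> :: "real ^ 'n::finite ^ 'n" and c :: "'n cocycle"
  assumes cocycle: "nct_cocycle \<theta> c"
begin

lemma coeff_tendsto:
  assumes "nct_tendsto c f l F" "\<forall>\<^sub>F x in F. (\<lambda>k. f x k - l k) \<in> nct_smooth_algebra"
  shows "((\<lambda>x. f x \<kappa>) \<longlongrightarrow> l \<kappa>) F"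
proof (rule LIM_zero_cancel, rule Lim_null_comparison)
  show "((\<lambda>x. nct_norm c (\<lambda>k. f x k - l k)) \<longlongrightarrow> 0) F"
    using assms(1)[unfolded nct_tendsto_def, rule_format, of "\<lambda>_. 0"] by (simp only: nct_delta_0)
  show "\<forall>\<^sub>F x in F. norm (f x \<kappa> - l \<kappa>) \<le> nct_norm c (\<lambda>k. f x k - l k)"
    using assms(2) by eventually_elim (rule norm_coeff_le_nct_norm[OF cocycle])
qed

lemma nct_derivs_continuous:
  assumes D: "nct_derivs c S f D"
  shows "continuous_on S (\<lambda>\<xi>. D \<beta> \<xi> \<kappa>)"
  unfolding continuous_on_def
proof
  fix \<xi> assume \<xi>: "\<xi> \<in> S"
  show "((\<lambda>\<xi>. D \<beta> \<xi> \<kappa>) \<longlongrightarrow> D \<beta> \<xi> \<kappa>) (at \<xi> within S)"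
  proof (rule coeff_tendsto)
    show "nct_tendsto c (D \<beta>) (D \<beta> \<xi>) (at \<xi> within S)"
      using D \<xi> unfolding nct_derivs_def by blast
    show "\<forall>\<^sub>F x in at \<xi> within S. (\<lambda>k. D \<beta> x k - D \<beta> \<xi> k) \<in> nct_smooth_algebra"
      unfolding eventually_at_filter
      by (rule always_eventually) (use \<xi> nct_derivs_smooth[OF D] in \<open>auto intro: smooth_algebra_diff\<close>)
  qed
qed

lemma nct_derivs_partial:
  assumes D: "nct_derivs c S f D" and S: "open S" and \<xi>: "\<xi> \<in> S"
  shows "((\<lambda>h. D \<beta> (\<xi> + h *\<^sub>R axis i 1) \<kappa>) has_vector_derivative D (\<beta>(i := Suc (\<beta> i))) \<xi> \<kappa>) (at 0)"
proof -
  have "((\<lambda>h. (D \<beta> (\<xi> + h *\<^sub>R axis i 1) \<kappa> - D \<beta> \<xi> \<kappa>) / of_real h) \<longlongrightarrow> D (\<beta>(i := Suc (\<beta> i))) \<xi> \<kappa>) (at 0)"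
  proof (rule coeff_tendsto)
    show "nct_tendsto c (\<lambda>h k. (D \<beta> (\<xi> + h *\<^sub>R axis i 1) k - D \<beta> \<xi> k) / of_real h) (D (\<beta>(i := Suc (\<beta> i))) \<xi>) (at 0)"
      using D \<xi> unfolding nct_derivs_def by blast
    have "((\<lambda>h. \<xi> + h *\<^sub>R axis i 1) \<longlongrightarrow> \<xi> + 0 *\<^sub>R axis i 1) (at 0)" by (intro tendsto_intros)
    then have "\<forall>\<^sub>F h in at 0. \<xi> + h *\<^sub>R axis i 1 \<in> S"
      using S \<xi> by (intro topological_tendstoD[of _ \<xi>]) simp_all
    then show "\<forall>\<^sub>F h in at 0. (\<lambda>k. (D \<beta> (\<xi> + h *\<^sub>R axis i 1) k - D \<beta> \<xi> k) / of_real h -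
        D (\<beta>(i := Suc (\<beta> i))) \<xi> k) \<in> nct_smooth_algebra"
      by eventually_elim (use \<xi> nct_derivs_smooth[OF D] in \<open>auto intro: smooth_algebra_quotient\<close>)
  qed
  then show ?thesis by (simp add: has_vector_derivative_iff_quotient)
qed

lemma nct_holo_derivs_quotient:
  assumes D: "nct_holo_derivs c S f D" and K: "compact K" "K \<subseteq> S" and e: "0 < e"
  shows "\<forall>\<^sub>F h in at 0. \<forall>\<xi>\<in>K. norm ((D k \<beta> (z + h) \<xi> \<kappa> - D k \<beta> z \<xi> \<kappa>) / h - D (Suc k) \<beta> z \<xi> \<kappa>) < e"
proof -
  have "uniform_limit K (\<lambda>h \<xi>. nct_norm c (nct_delta (\<lambda>_. 0)
      (\<lambda>l. (D k \<beta> (z + h) \<xi> l - D k \<beta> z \<xi> l) / h - D (Suc k) \<beta> z \<xi> l))) (\<lambda>\<xi>. 0) (at 0)"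
    using D K unfolding nct_holo_derivs_def by blast
  from uniform_limitD[OF this e] show ?thesis
  proof eventually_elim
    case (elim h)
    show ?case
    proof
      fix \<xi> assume \<xi>: "\<xi> \<in> K"
      then have "(\<lambda>l. (D k \<beta> (z + h) \<xi> l - D k \<beta> z \<xi> l) / h - D (Suc k) \<beta> z \<xi> l) \<in> nct_smooth_algebra"
        using K by (intro smooth_algebra_quotient nct_derivs_smooth[OF nct_holo_derivs_derivs[OF D]]) auto
      from norm_coeff_le_nct_norm[OF cocycle this, of \<kappa>]
      show "norm ((D k \<beta> (z + h) \<xi> \<kappa> - D k \<beta> z \<xi> \<kappa>) / h - D (Suc k) \<beta> z \<xi> \<kappa>) < e"
        using elim \<xi> by (force simp: nct_delta_0 dist_real_def)
    qed
  qed
qed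

lemma nct_holo_derivs_deriv:
  assumes D: "nct_holo_derivs c S f D" and \<xi>: "\<xi> \<in> S"
  shows "((\<lambda>z. D k \<beta> z \<xi> \<kappa>) has_field_derivative D (Suc k) \<beta> z \<xi> \<kappa>) (at z)"
  unfolding DERIV_def
proof (rule tendstoI)
  fix e :: real assume "0 < e"
  then show "\<forall>\<^sub>F h in at 0. dist ((D k \<beta> (z + h) \<xi> \<kappa> - D k \<beta> z \<xi> \<kappa>) / h) (D (Suc k) \<beta> z \<xi> \<kappa>) < e"
    using nct_holo_derivs_quotient[OF D, of "{\<xi>}" e] \<xi> by (simp add: dist_norm)
qed

text \<open>On a small ball around \<xi> the z-quotients are within 1 of the z-derivative at z,
  which is bounded by B there. This makes the increment in z at most 1 + B times |h|, uniformly in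
  the ball; continuity in \<xi> at the fixed z does the rest.\<close>

lemma nct_holo_derivs_continuous:
  assumes D: "nct_holo_derivs c S f D" and S: "open S"
  shows "continuous_on (UNIV \<times> S) (\<lambda>(z, \<xi>). D k \<beta> z \<xi> \<kappa>)"
  unfolding continuous_on_eq_continuous_at[OF open_Times[OF open_UNIV S]]
proof (intro ballI)
  fix p :: "complex \<times> (real ^ 'n)" assume "p \<in> UNIV \<times> S"
  then obtain z \<xi> where p: "p = (z, \<xi>)" and \<xi>: "\<xi> \<in> S" by auto
  obtain r where r: "r > 0" "cball \<xi> r \<subseteq> S" using S \<xi> open_contains_cball by blast
  have cont: "continuous_on S (\<lambda>\<xi>. D k' \<beta> z \<xi> \<kappa>)" for k'
    by (rule nct_derivs_continuous[OF nct_holo_derivs_derivs[OF D]])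
  have "compact ((\<lambda>\<xi>. D (Suc k) \<beta> z \<xi> \<kappa>) ` cball \<xi> r)"
    by (rule compact_continuous_image[OF continuous_on_subset[OF cont r(2)] compact_cball])
  then obtain B where B: "B > 0" "\<forall>y\<in>(\<lambda>\<xi>. D (Suc k) \<beta> z \<xi> \<kappa>) ` cball \<xi> r. norm y \<le> B"
    using compact_imp_bounded bounded_pos by metis
  have "\<forall>\<^sub>F h in at 0. \<forall>\<xi>'\<in>cball \<xi> r. norm ((D k \<beta> (z + h) \<xi>' \<kappa> - D k \<beta> z \<xi>' \<kappa>) / h - D (Suc k) \<beta> z \<xi>' \<kappa>) < 1"
    by (rule nct_holo_derivs_quotient[OF D compact_cball r(2)]) simp
  then obtain d where d: "d > 0" "\<And>h \<xi>'. h \<noteq> 0 \<Longrightarrow> norm h < d \<Longrightarrow> \<xi>' \<in> cball \<xi> r \<Longrightarrow>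
      norm ((D k \<beta> (z + h) \<xi>' \<kappa> - D k \<beta> z \<xi>' \<kappa>) / h - D (Suc k) \<beta> z \<xi>' \<kappa>) < 1"
    unfolding eventually_at by auto
  have est: "norm (D k \<beta> (z + h) \<xi>' \<kappa> - D k \<beta> z \<xi>' \<kappa>) \<le> (1 + B) * norm h"
    if h: "norm h < d" and \<xi>': "\<xi>' \<in> cball \<xi> r" for h \<xi>'
  proof (cases "h = 0")
    case False
    let ?Q = "(D k \<beta> (z + h) \<xi>' \<kappa> - D k \<beta> z \<xi>' \<kappa>) / h"
    have "norm ?Q \<le> norm (?Q - D (Suc k) \<beta> z \<xi>' \<kappa>) + norm (D (Suc k) \<beta> z \<xi>' \<kappa>)"
      using norm_triangle_ineq[of "?Q - D (Suc k) \<beta> z \<xi>' \<kappa>" "D (Suc k) \<beta> z \<xi>' \<kappa>"] by simp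
    also have "\<dots> \<le> 1 + B" using d(2)[OF False h \<xi>'] B(2) \<xi>' by (intro add_mono) auto
    finally show ?thesis using False by (simp add: norm_divide pos_divide_le_eq)
  qed simp
  let ?g = "\<lambda>(w, \<eta>). D k \<beta> w \<eta> \<kappa>"
  have "(?g \<longlongrightarrow> ?g (z, \<xi>)) (at (z, \<xi>))"
  proof (rule LIM_zero_cancel, rule Lim_null_comparison)
    have c1: "((\<lambda>p. snd p) \<longlongrightarrow> \<xi>) (at (z, \<xi>))" "((\<lambda>p. fst p - z) \<longlongrightarrow> 0) (at (z, \<xi>))"
      by (auto intro!: tendsto_eq_intros)
    have inS: "\<forall>\<^sub>F p in at (z, \<xi>). snd p \<in> cball \<xi> r"
      using tendstoD[OF c1(1) r(1)] by eventually_elim (simp add: dist_commute)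
    have inD: "\<forall>\<^sub>F p in at (z, \<xi>). norm (fst p - z) < d"
      using tendstoD[OF c1(2) d(1)] by eventually_elim simp
    show "\<forall>\<^sub>F p in at (z, \<xi>). norm (?g p - ?g (z, \<xi>)) \<le>
        (1 + B) * norm (fst p - z) + norm (D k \<beta> z (snd p) \<kappa> - D k \<beta> z \<xi> \<kappa>)"
      using inS inD
    proof eventually_elim
      case (elim p)
      have "norm (D k \<beta> (fst p) (snd p) \<kappa> - D k \<beta> z (snd p) \<kappa>) \<le> (1 + B) * norm (fst p - z)"
        using est[OF elim(2,1)] by simp
      then show ?case
        using norm_triangle_ineq[of "D k \<beta> (fst p) (snd p) \<kappa> - D k \<beta> z (snd p) \<kappa>" "D k \<beta> z (snd p) \<kappa> - D k \<beta> z \<xi> \<kappa>"]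
        by (simp add: case_prod_unfold)
    qed
    have "((\<lambda>p. D k \<beta> z (snd p) \<kappa>) \<longlongrightarrow> D k \<beta> z \<xi> \<kappa>) (at (z, \<xi>))"
    proof -
      have "isCont (\<lambda>\<xi>. D k \<beta> z \<xi> \<kappa>) \<xi>" using cont S \<xi> by (simp add: continuous_on_eq_continuous_at)
      then show ?thesis using c1(1) isCont_tendsto_compose by fastforce
    qed
    then show "((\<lambda>p. (1 + B) * norm (fst p - z) + norm (D k \<beta> z (snd p) \<kappa> - D k \<beta> z \<xi> \<kappa>)) \<longlongrightarrow> 0) (at (z, \<xi>))"
      using c1(2) by (auto intro!: tendsto_eq_intros)
  qed
  then show "isCont ?g p" unfolding p isCont_def .
qed

text \<open>The derivatives of a cut-off component are taken as differences of those of consecutive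
  remainders. Smoothness on the whole space, holomorphy and joint continuity are then inherited,
  with no product rule for the cut-off.\<close>

lemma family_scalar:
  assumes F: "nct_family_symbol c q a A \<sigma> \<tau>" and q: "0 < q"
  shows "\<exists>D. scalar_family q a (\<lambda>z k. \<sigma> z (lattice_vec k) 0) D \<and>
    (\<forall>i z x. 1 \<le> norm x \<longrightarrow> D i z [] x = \<tau> i z x 0)"
proof -
  obtain \<omega> where op: "\<And>z. nct_classical_op c (A z) \<omega> (nct_order q a z) (\<sigma> z) (\<lambda>j. \<tau> j z)"
    and hol: "nct_holomorphic c UNIV \<sigma>"
    and rem: "\<forall>N. \<exists>D. nct_holo_derivs c UNIV (\<lambda>z. nct_remainder \<omega> (\<sigma> z) (\<lambda>j. \<tau> j z) N) D \<and>
          (\<forall>k \<epsilon> Z \<alpha> \<beta>. 0 < \<epsilon> \<and> compact Z \<longrightarrow>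
             (\<exists>C. \<forall>z\<in>Z. \<forall>\<xi>. nct_norm c (nct_delta \<alpha> (D k \<beta> z \<xi>)) \<le>
                C * (1 + norm \<xi>) powr
                  (Re (nct_order q a z) - real N + \<epsilon> - real (\<Sum>i\<in>UNIV. \<beta> i))))"
    using F unfolding nct_family_symbol_def by blast
  from choice[OF rem] obtain R where R':
    "\<forall>N. nct_holo_derivs c UNIV (\<lambda>z. nct_remainder \<omega> (\<sigma> z) (\<lambda>j. \<tau> j z) N) (R N) \<and>
          (\<forall>k \<epsilon> Z \<alpha> \<beta>. 0 < \<epsilon> \<and> compact Z \<longrightarrow>
             (\<exists>C. \<forall>z\<in>Z. \<forall>\<xi>. nct_norm c (nct_delta \<alpha> (R N k \<beta> z \<xi>)) \<le>
                C * (1 + norm \<xi>) powr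
                  (Re (nct_order q a z) - real N + \<epsilon> - real (\<Sum>i\<in>UNIV. \<beta> i))))" ..
  have R: "nct_holo_derivs c UNIV (\<lambda>z. nct_remainder \<omega> (\<sigma> z) (\<lambda>j. \<tau> j z) N) (R N)" for N
    using R' by blast
  have Rb: "\<exists>C. \<forall>z\<in>Z. \<forall>\<xi>. nct_norm c (nct_delta \<alpha> (R N k \<beta> z \<xi>)) \<le>
                C * (1 + norm \<xi>) powr
                  (Re (nct_order q a z) - real N + \<epsilon> - real (\<Sum>i\<in>UNIV. \<beta> i))"
    if "0 < \<epsilon>" "compact Z" for N k \<epsilon> Z \<alpha> \<beta>
    using R' that by blast
  have \<omega>: "nct_excision \<omega>" using op unfolding nct_classical_op_def by blast
  have hom: "nct_homogeneous (nct_order q a z - of_nat j) (\<tau> j z)" for j z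
    using op unfolding nct_classical_op_def nct_classical_expansion_def by blast
  have \<omega>1: "1 \<le> norm x \<Longrightarrow> \<omega> x = 1" for x using \<omega> unfolding nct_excision_def by blast
  obtain \<Sigma> where \<Sigma>: "nct_holo_derivs c UNIV \<sigma> \<Sigma>" using hol unfolding nct_holomorphic_def by blast
  define D where "D i z l x = R i 0 (multiplicities l) z x 0 - R (Suc i) 0 (multiplicities l) z x 0" for i z l x
  have R0: "R N 0 (\<lambda>_. 0) z x = nct_remainder \<omega> (\<sigma> z) (\<lambda>j. \<tau> j z) N x" for N z x
    using R unfolding nct_holo_derivs_def by blast
  have D0: "D i z [] x = of_real (\<omega> x) * \<tau> i z x 0" for i z x
    by (simp add: D_def multiplicities_simps R0 nct_remainder_def)
  have Rd: "nct_derivs c UNIV (R N 0 (\<lambda>_. 0) z) (\<lambda>\<beta>. R N 0 \<beta> z)" for N z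
    by (rule nct_holo_derivs_derivs[OF R])
  have "scalar_family q a (\<lambda>z k. \<sigma> z (lattice_vec k) 0) D"
  proof (unfold_locales)
    show "homogeneous_family (\<lambda>z. nct_order q a z - of_nat i) (D i)" for i
      unfolding homogeneous_family_def
    proof (intro conjI allI)
      fix z
      show "smooth_derivs (D i z)"
        unfolding smooth_derivs_def D_def multiplicities_simps
        by (intro conjI allI continuous_on_diff nct_derivs_continuous[OF Rd] has_vector_derivative_diff
            nct_derivs_partial[OF Rd]) auto
      show "outer_homogeneous (nct_order q a z - of_nat i) (D i z [])"
        unfolding outer_homogeneous_def
      proof (intro allI impI)
        fix x :: "real ^ 'n" and t :: real assume x: "1 \<le> norm x" and t: "1 \<le> t"
        have "1 * 1 \<le> t * norm x" using x t by (intro mult_mono) auto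
        then have "1 \<le> norm (t *\<^sub>R x)" using t by simp
        moreover have "\<tau> i z (t *\<^sub>R x) = (\<lambda>k. of_real t powr (nct_order q a z - of_nat i) * \<tau> i z x k)"
        proof -
          have "x \<noteq> 0 \<and> 0 < t" using x t by auto
          then show ?thesis using hom[of z i] unfolding nct_homogeneous_def by blast
        qed
        ultimately show "D i z [] (t *\<^sub>R x) = of_real t powr (nct_order q a z - of_nat i) * D i z [] x"
          using x by (simp add: D0 \<omega>1)
      qed
    next
      fix l
      show "continuous_on UNIV (\<lambda>(z, x). D i z l x)"
        using nct_holo_derivs_continuous[OF R open_UNIV, of i 0 "multiplicities l" 0]
          nct_holo_derivs_continuous[OF R open_UNIV, of "Suc i" 0 "multiplicities l" 0]
        by (auto simp: D_def case_prod_unfold intro!: continuous_on_diff)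
      show "(\<lambda>z. D i z l x) holomorphic_on UNIV" for x
        unfolding D_def
        by (intro holomorphic_on_diff holomorphic_onI_deriv exI) (rule nct_holo_derivs_deriv[OF R], simp)+
    qed
    show "(\<lambda>z. \<sigma> z (lattice_vec k) 0) holomorphic_on UNIV" for k
    proof -
      have "(\<lambda>z. \<Sigma> 0 (\<lambda>_. 0) z (lattice_vec k) 0) holomorphic_on UNIV"
        by (intro holomorphic_onI_deriv exI) (rule nct_holo_derivs_deriv[OF \<Sigma>], simp)
      moreover have "\<Sigma> 0 (\<lambda>_. 0) z (lattice_vec k) = \<sigma> z (lattice_vec k)" for z
        using \<Sigma> unfolding nct_holo_derivs_def by blast
      ultimately show ?thesis by simp
    qed
    show "\<exists>C\<ge>0. \<forall>z\<in>Z. \<forall>k. norm (\<sigma> z (lattice_vec k) 0 - (\<Sum>i<M. D i z [] (lattice_vec k))) \<le>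
        C * (1 + norm (lattice_vec k)) powr (Re (nct_order q a z) - real M + 1)" if Z: "compact Z" for Z M
    proof -
      obtain C where C: "\<And>z \<xi>. z \<in> Z \<Longrightarrow> nct_norm c (nct_delta (\<lambda>_. 0) (R M 0 (\<lambda>_. 0) z \<xi>)) \<le>
                C * (1 + norm \<xi>) powr (Re (nct_order q a z) - real M + 1 - real (\<Sum>i\<in>(UNIV::'n set). 0))"
        using Rb[OF zero_less_one Z, where N = M and k = 0 and \<alpha> = "\<lambda>_. 0" and \<beta> = "\<lambda>_. 0"] by blast
      show ?thesis
      proof (intro exI[of _ "max C 0"] conjI ballI allI)
        fix z k assume z: "z \<in> Z"
        have "\<sigma> z (lattice_vec k) 0 - (\<Sum>i<M. D i z [] (lattice_vec k)) = R M 0 (\<lambda>_. 0) z (lattice_vec k) 0"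
          by (simp add: R0 nct_remainder_def D0)
        then have "norm (\<sigma> z (lattice_vec k) 0 - (\<Sum>i<M. D i z [] (lattice_vec k))) \<le> nct_norm c (R M 0 (\<lambda>_. 0) z (lattice_vec k))"
          using norm_coeff_le_nct_norm[OF cocycle nct_derivs_smooth[OF Rd UNIV_I]] by simp
        also have "\<dots> \<le> C * (1 + norm (lattice_vec k)) powr (Re (nct_order q a z) - real M + 1)"
          using C[OF z, of "lattice_vec k"] by (simp add: nct_delta_0)
        also have "\<dots> \<le> max C 0 * (1 + norm (lattice_vec k)) powr (Re (nct_order q a z) - real M + 1)"
          by (intro mult_right_mono) auto
        finally show "norm (\<sigma> z (lattice_vec k) 0 - (\<Sum>i<M. D i z [] (lattice_vec k))) \<le>
            max C 0 * (1 + norm (lattice_vec k)) powr (Re (nct_order q a z) - real M + 1)" .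
      qed simp
    qed
  qed (use q in simp)
  moreover have "D i z [] x = \<tau> i z x 0" if "1 \<le> norm x" for i z x
    using that by (simp add: D0 \<omega>1)
  ultimately show ?thesis by blast
qed

end

section \<open>Uniqueness of homogeneous components\<close>

text \<open>Multiplication by the power - e of N makes the terms of exponent e constant, provided
  that they carry no logarithm, and leaves nonzero exponents elsewhere, where logarithms are
  allowed. \<open>limit_sum_powr_eq_0\<close> then applies to the other terms.\<close>

lemma ray_coefficient_zero:
  fixes s c d :: "'i \<Rightarrow> complex"
  assumes K: "finite K" and log: "\<And>i. i \<in> K \<Longrightarrow> s i = e \<Longrightarrow> d i = 0"
    and lim: "(\<lambda>N. of_nat N powr (- e) * (\<Sum>i\<in>K. (c i + d i * of_real (ln (real N))) * of_nat N powr s i)) \<longlonglongrightarrow> 0"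
  shows "(\<Sum>i | i \<in> K \<and> s i = e. c i) = 0"
proof -
  let ?S = "\<Sum>i | i \<in> K \<and> s i = e. c i"
  let ?K = "{i. i \<in> K \<and> s i \<noteq> e}"
  have "(\<lambda>N. of_nat N powr (- e) * (\<Sum>i\<in>K. (c i + d i * of_real (ln (real N))) * of_nat N powr s i) - ?S) \<longlonglongrightarrow> 0 - ?S"
    by (intro tendsto_intros lim)
  moreover have "\<forall>\<^sub>F N in sequentially. of_nat N powr (- e) * (\<Sum>i\<in>K. (c i + d i * of_real (ln (real N))) * of_nat N powr s i) - ?S =
      (\<Sum>i\<in>?K. (c i + d i * of_real (ln (real N))) * of_nat N powr (s i - e))"
  proof (rule eventually_mono[OF eventually_gt_at_top[of 0]])
    fix N :: nat assume N: "0 < N"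
    have split: "K = {i. i \<in> K \<and> s i = e} \<union> ?K" "{i. i \<in> K \<and> s i = e} \<inter> ?K = {}" by auto
    have "of_nat N powr (- e) * (\<Sum>i\<in>K. (c i + d i * of_real (ln (real N))) * of_nat N powr s i) =
        (\<Sum>i\<in>K. (c i + d i * of_real (ln (real N))) * of_nat N powr (s i - e))"
      unfolding sum_distrib_left
      by (rule sum.cong[OF refl]) (simp add: mult.left_commute add.commute flip: powr_add)
    also have "\<dots> = (\<Sum>i | i \<in> K \<and> s i = e. (c i + d i * of_real (ln (real N))) * of_nat N powr (s i - e)) +
        (\<Sum>i\<in>?K. (c i + d i * of_real (ln (real N))) * of_nat N powr (s i - e))"
      by (subst split(1), rule sum.union_disjoint) (use K in auto)
    also have "(\<Sum>i | i \<in> K \<and> s i = e. (c i + d i * of_real (ln (real N))) * of_nat N powr (s i - e)) = ?S"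
      using N log by (intro sum.cong) auto
    finally show "of_nat N powr (- e) * (\<Sum>i\<in>K. (c i + d i * of_real (ln (real N))) * of_nat N powr s i) - ?S =
      (\<Sum>i\<in>?K. (c i + d i * of_real (ln (real N))) * of_nat N powr (s i - e))" by simp
  qed
  ultimately have "(\<lambda>N. \<Sum>i\<in>?K. (c i + d i * of_real (ln (real N))) * of_nat N powr (s i - e)) \<longlonglongrightarrow> 0 - ?S"
    by (rule Lim_transform_eventually)
  then have "0 - ?S = 0"
    by (rule limit_sum_powr_eq_0[rotated 2]) (use K in auto)
  then show ?thesis by simp
qed

text \<open>The difference of the two expansions, indexed by a disjoint sum, is one expansion of 0.
  Separate index types and exponents accommodate unrelated presentations of the same
  operator.\<close>

lemma ray_coefficient_unique:
  fixes s c d :: "'i \<Rightarrow> complex" and s' c' d' :: "'j \<Rightarrow> complex"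
  assumes K: "finite K" "finite K'"
    and log: "\<And>i. i \<in> K \<Longrightarrow> s i = e \<Longrightarrow> d i = 0" "\<And>i. i \<in> K' \<Longrightarrow> s' i = e \<Longrightarrow> d' i = 0"
    and lim: "(\<lambda>N. of_nat N powr (- e) * (g N - (\<Sum>i\<in>K. (c i + d i * of_real (ln (real N))) * of_nat N powr s i))) \<longlonglongrightarrow> 0"
      "(\<lambda>N. of_nat N powr (- e) * (g N - (\<Sum>i\<in>K'. (c' i + d' i * of_real (ln (real N))) * of_nat N powr s' i))) \<longlonglongrightarrow> 0"
  shows "(\<Sum>i | i \<in> K \<and> s i = e. c i) = (\<Sum>i | i \<in> K' \<and> s' i = e. c' i)"
proof -
  let ?s = "case_sum s s'" and ?c = "case_sum c (\<lambda>i. - c' i)" and ?d = "case_sum d (\<lambda>i. - d' i)"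
  have "(\<Sum>i | i \<in> K <+> K' \<and> ?s i = e. ?c i) = 0"
  proof (rule ray_coefficient_zero[where d = ?d])
    have "(\<lambda>N. of_nat N powr (- e) * (g N - (\<Sum>i\<in>K'. (c' i + d' i * of_real (ln (real N))) * of_nat N powr s' i)) -
        of_nat N powr (- e) * (g N - (\<Sum>i\<in>K. (c i + d i * of_real (ln (real N))) * of_nat N powr s i))) \<longlonglongrightarrow> 0 - 0"
      by (intro tendsto_intros lim)
    also have "(\<lambda>N. of_nat N powr (- e) * (g N - (\<Sum>i\<in>K'. (c' i + d' i * of_real (ln (real N))) * of_nat N powr s' i)) -
        of_nat N powr (- e) * (g N - (\<Sum>i\<in>K. (c i + d i * of_real (ln (real N))) * of_nat N powr s i))) =
      (\<lambda>N. of_nat N powr (- e) * (\<Sum>i\<in>K <+> K'. (?c i + ?d i * of_real (ln (real N))) * of_nat N powr ?s i))"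
    proof
      fix N
      have "(\<Sum>i\<in>K'. (- c' i + - d' i * of_real (ln (real N))) * of_nat N powr s' i) =
          - (\<Sum>i\<in>K'. (c' i + d' i * of_real (ln (real N))) * of_nat N powr s' i)"
        unfolding sum_negf[symmetric] by (rule sum.cong) (auto simp: algebra_simps)
      then show "of_nat N powr (- e) * (g N - (\<Sum>i\<in>K'. (c' i + d' i * of_real (ln (real N))) * of_nat N powr s' i)) -
        of_nat N powr (- e) * (g N - (\<Sum>i\<in>K. (c i + d i * of_real (ln (real N))) * of_nat N powr s i)) =
        of_nat N powr (- e) * (\<Sum>i\<in>K <+> K'. (?c i + ?d i * of_real (ln (real N))) * of_nat N powr ?s i)"
        using K by (simp add: sum.Plus right_diff_distrib distrib_left)
    qed
    finally show "(\<lambda>N. of_nat N powr (- e) * (\<Sum>i\<in>K <+> K'. (?c i + ?d i * of_real (ln (real N))) * of_nat N powr ?s i)) \<longlonglongrightarrow> 0"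
      by simp
  qed (use K log in auto)
  also have "{i. i \<in> K <+> K' \<and> ?s i = e} = {i. i \<in> K \<and> s i = e} <+> {i. i \<in> K' \<and> s' i = e}"
  proof (rule set_eqI)
    show "x \<in> {i. i \<in> K <+> K' \<and> ?s i = e} \<longleftrightarrow> x \<in> {i. i \<in> K \<and> s i = e} <+> {i. i \<in> K' \<and> s' i = e}" for x
      by (cases x) auto
  qed
  also have "(\<Sum>i\<in>\<dots>. ?c i) = (\<Sum>i | i \<in> K \<and> s i = e. c i) - (\<Sum>i | i \<in> K' \<and> s' i = e. c' i)"
    using K by (simp add: sum.Plus sum_negf)
  finally show ?thesis by simp
qed

text \<open>An operator determines its symbol at lattice points only. Along the multiples of one
  lattice vector every homogeneous component is a pure power of N, so its value at that vector can
  be read off from the operator.\<close>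

definition ray :: "nat \<Rightarrow> int ^ 'n \<Rightarrow> int ^ 'n" where
  "ray N l = (\<chi> i. int N * l $ i)"

lemma lattice_vec_ray: "lattice_vec (ray N l) = real N *\<^sub>R lattice_vec l"
  by (simp add: lattice_vec_def ray_def vec_eq_iff)

lemma lattice_vec_nonzero: "l \<noteq> 0 \<Longrightarrow> lattice_vec l \<noteq> (0 :: real ^ 'n::finite)"
  using norm_lattice_vec_ge_1[of l] by auto

lemma ray_nonzero: "0 < N \<Longrightarrow> l \<noteq> 0 \<Longrightarrow> ray N l \<noteq> 0"
  by (auto simp: ray_def vec_eq_iff)

lemma ray_remainder_limit:
  fixes r :: "nat \<Rightarrow> complex" and l :: "int ^ 'n::finite"
  assumes l: "l \<noteq> 0" and p: "p \<le> 0" "p < Re e"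
    and r: "\<And>N. 0 < N \<Longrightarrow> norm (r N) \<le> C * (1 + norm (lattice_vec (ray N l))) powr p"
  shows "(\<lambda>N. of_nat N powr (- e) * r N) \<longlonglongrightarrow> 0"
proof (rule Lim_null_comparison)
  show "\<forall>\<^sub>F N in sequentially. norm (of_nat N powr (- e) * r N) \<le> max C 0 * real N powr (p - Re e)"
  proof (rule eventually_mono[OF eventually_gt_at_top[of 0]])
    fix N :: nat assume N: "0 < N"
    have "real N * 1 \<le> real N * norm (lattice_vec l)"
      using norm_lattice_vec_ge_1[OF l] by (intro mult_left_mono) auto
    then have "real N \<le> 1 + norm (lattice_vec (ray N l))" by (simp add: lattice_vec_ray)
    then have "(1 + norm (lattice_vec (ray N l))) powr p \<le> real N powr p"
      using p N by (intro powr_mono2') auto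
    then have "C * (1 + norm (lattice_vec (ray N l))) powr p \<le> max C 0 * real N powr p"
      by (intro mult_mono) auto
    then have "norm (r N) \<le> max C 0 * real N powr p" using r[OF N] by linarith
    then have "real N powr (- Re e) * norm (r N) \<le> real N powr (- Re e) * (max C 0 * real N powr p)"
      by (intro mult_left_mono) auto
    also have "\<dots> = max C 0 * real N powr (p - Re e)"
      by (simp add: powr_diff powr_minus_divide)
    finally show "norm (of_nat N powr (- e) * r N) \<le> max C 0 * real N powr (p - Re e)"
      using N by (simp add: norm_mult norm_of_nat_powr)
  qed
  have "(\<lambda>N. max C 0 * real N powr (p - Re e)) \<longlonglongrightarrow> max C 0 * 0"
    using p by (intro tendsto_intros tendsto_neg_powr filterlim_real_sequentially) auto
  then show "(\<lambda>N. max C 0 * real N powr (p - Re e)) \<longlonglongrightarrow> 0" by simp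
qed

text \<open>Rational directions are dense.\<close>

lemma homogeneous_vanish:
  fixes g :: "real ^ 'n::finite \<Rightarrow> complex"
  assumes cont: "continuous_on (- {0}) g"
    and hom: "\<And>x t. x \<noteq> 0 \<Longrightarrow> 0 < t \<Longrightarrow> g (t *\<^sub>R x) = of_real t powr s * g x"
    and zero: "\<And>l. l \<noteq> 0 \<Longrightarrow> g (lattice_vec l) = 0" and x: "x \<noteq> 0"
  shows "g x = 0"
proof -
  \<comment> \<open>Rational points converging to x: the floor errs by at most 1, hence each
    coordinate by at most 1 / (N + 1).\<close>
  define y where "y N = (1 / real (Suc N)) *\<^sub>R lattice_vec (\<chi> i. \<lfloor>real (Suc N) * x $ i\<rfloor>)" for N
  have "(\<lambda>N. y N $ i) \<longlonglongrightarrow> x $ i" for i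
  proof -
    have lim: "(\<lambda>N. 1 / real (Suc N)) \<longlonglongrightarrow> 0" by (rule LIMSEQ_Suc[OF lim_1_over_n])
    have "(\<lambda>N. y N $ i - x $ i) \<longlonglongrightarrow> 0"
    proof (rule Lim_null_comparison[OF always_eventually[OF allI] lim])
      fix N
      have "real (Suc N) * (y N $ i - x $ i) = of_int \<lfloor>real (Suc N) * x $ i\<rfloor> - real (Suc N) * x $ i"
        by (simp add: y_def lattice_vec_def right_diff_distrib del: of_nat_Suc)
      moreover have "\<bar>of_int \<lfloor>real (Suc N) * x $ i\<rfloor> - real (Suc N) * x $ i\<bar> \<le> 1" by linarith
      ultimately have "\<bar>real (Suc N) * (y N $ i - x $ i)\<bar> \<le> 1" by simp
      then have "real (Suc N) * \<bar>y N $ i - x $ i\<bar> \<le> 1" by (simp add: abs_mult del: of_nat_Suc)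
      then show "norm (y N $ i - x $ i) \<le> 1 / real (Suc N)" by (simp add: pos_le_divide_eq mult.commute del: of_nat_Suc)
    qed
    then show ?thesis by (rule LIM_zero_cancel)
  qed
  then have y: "y \<longlonglongrightarrow> x" by (simp add: vec_tendstoI)
  have nz: "\<forall>\<^sub>F N in sequentially. y N \<noteq> 0"
    using tendsto_imp_eventually_ne[OF y x] .
  have "isCont g x" using cont x by (simp add: continuous_on_eq_continuous_at open_Compl)
  then have lim: "(\<lambda>N. g (y N)) \<longlonglongrightarrow> g x" using y by (rule isCont_tendsto_compose)
  have "\<forall>\<^sub>F N in sequentially. g (y N) = 0"
    using nz
  proof eventually_elim
    case (elim N)
    let ?l = "(\<chi> i. \<lfloor>real (Suc N) * x $ i\<rfloor>) :: int ^ 'n"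
    have "lattice_vec ?l \<noteq> 0" using elim by (auto simp: y_def)
    then have "?l \<noteq> 0" by (auto simp: lattice_vec_simps)
    then show ?case
      unfolding y_def using hom[OF lattice_vec_nonzero, of ?l "1 / real (Suc N)"] zero[of ?l] by simp
  qed
  then have "(\<lambda>N. g (y N)) \<longlonglongrightarrow> 0" by (rule tendsto_eventually)
  then show ?thesis using lim LIMSEQ_unique by blast
qed

text \<open>The value of a component at the origin is arbitrary; one exceptional point does not
  affect measurability.\<close>

lemma nct_sphere_integral_eq:
  assumes "continuous_on (- {0}) (\<lambda>\<xi>. f \<xi> 0)"
  shows "nct_sphere_integral f = sphere_int (\<lambda>\<xi>. f \<xi> 0)"
  unfolding nct_sphere_integral_def nct_trace_def
  by (rule sphere_int_eq, rule borel_measurable_continuous_countable_exceptions[of "{0}"]) (use assms in auto)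

lemma nct_homogeneousD:
  "nct_homogeneous s f \<Longrightarrow> \<xi> \<noteq> 0 \<Longrightarrow> 0 < t \<Longrightarrow> f (t *\<^sub>R \<xi>) k = of_real t powr s * f \<xi> k"
  unfolding nct_homogeneous_def by simp

section \<open>Residues do not depend on the presentation\<close>

context
  fixes \<theta> :: "real ^ 'n::finite ^ 'n" and c :: "'n cocycle"
  assumes cocycle: "nct_cocycle \<theta> c"
begin

lemma cocycle_nonzero: "c k l \<noteq> 0"
  using norm_cocycle[OF cocycle, of k l] by auto

lemma classical_op_coeff:
  assumes "nct_classical_op c A \<omega> m \<sigma> \<tau>"
  shows "\<sigma> (lattice_vec k) \<kappa> = A (nct_U k) (k + \<kappa>) / c \<kappa> k"
  using assms cocycle_nonzero[of \<kappa> k] by (simp add: nct_classical_op_def nct_Op_U)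

lemma classical_op_component_continuous:
  assumes "nct_classical_op c A \<omega> m \<sigma> \<tau>"
  shows "continuous_on (- {0}) (\<lambda>\<xi>. \<tau> j \<xi> \<kappa>)"
proof -
  obtain D where D: "nct_derivs c (- {0}) (\<tau> j) D"
    using assms unfolding nct_classical_op_def nct_classical_expansion_def nct_smooth_on_def by blast
  have "D (\<lambda>_. 0) \<xi> = \<tau> j \<xi>" if "\<xi> \<in> - {0}" for \<xi> using D that unfolding nct_derivs_def by blast
  then show ?thesis
    using continuous_on_eq[OF nct_derivs_continuous[OF cocycle D, of "\<lambda>_. 0" \<kappa>]] by simp
qed

lemma classical_op_component_homogeneous:
  assumes "nct_classical_op c A \<omega> m \<sigma> \<tau>"
  shows "nct_homogeneous (m - of_nat j) (\<tau> j)"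
  using assms unfolding nct_classical_op_def nct_classical_expansion_def by blast

lemma excision_lattice: "nct_excision \<omega> \<Longrightarrow> k \<noteq> 0 \<Longrightarrow> \<omega> (lattice_vec k) = 1"
  using norm_lattice_vec_ge_1[of k] unfolding nct_excision_def by blast

text \<open>For J large the remainder after J components decays faster than the power e of N grows
  or decays. The zero logarithmic coefficients bring the expansion into the form of
  \<open>ray_coefficient_unique\<close>.\<close>

lemma classical_op_ray:
  assumes A: "nct_classical_op c A \<omega> m \<sigma> \<tau>" and l: "l \<noteq> 0" and J: "Re m \<le> real J" "Re m - real J < Re e"
  shows "(\<lambda>N. of_nat N powr (- e) * (A (nct_U (ray N l)) (ray N l + \<kappa>) / c \<kappa> (ray N l) -
    (\<Sum>i<J. (\<tau> i (lattice_vec l) \<kappa> + 0 * of_real (ln (real N))) * of_nat N powr (m - of_nat i)))) \<longlonglongrightarrow> 0"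
proof -
  obtain D where D: "nct_derivs c UNIV (nct_remainder \<omega> \<sigma> \<tau> J) D"
    and Db: "\<And>\<alpha> \<beta>. \<exists>C. \<forall>\<xi>. nct_norm c (nct_delta \<alpha> (D \<beta> \<xi>)) \<le>
           C * (1 + norm \<xi>) powr (Re m - real J - real (\<Sum>i\<in>UNIV. \<beta> i))"
    using A unfolding nct_classical_op_def nct_classical_expansion_def by blast
  obtain C where C: "\<And>\<xi>. nct_norm c (nct_delta (\<lambda>_. 0) (D (\<lambda>_. 0) \<xi>)) \<le>
      C * (1 + norm \<xi>) powr (Re m - real J - real (\<Sum>i\<in>(UNIV :: 'n set). 0))"
    using Db[of "\<lambda>_. 0" "\<lambda>_. 0"] by blast
  have \<omega>: "nct_excision \<omega>" using A unfolding nct_classical_op_def by blast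
  show ?thesis
  proof (rule ray_remainder_limit[OF l, where p = "Re m - real J"])
    fix N :: nat assume N: "0 < N"
    let ?x = "lattice_vec (ray N l)"
    have "of_nat N powr (m - of_nat i) * \<tau> i (lattice_vec l) \<kappa> = \<tau> i ?x \<kappa>" for i
      using nct_homogeneousD[OF classical_op_component_homogeneous[OF A] lattice_vec_nonzero[OF l], of "real N" i \<kappa>] N
      by (simp add: lattice_vec_ray)
    then have "A (nct_U (ray N l)) (ray N l + \<kappa>) / c \<kappa> (ray N l) -
        (\<Sum>i<J. (\<tau> i (lattice_vec l) \<kappa> + 0 * of_real (ln (real N))) * of_nat N powr (m - of_nat i)) =
        nct_remainder \<omega> \<sigma> \<tau> J ?x \<kappa>"
      using excision_lattice[OF \<omega> ray_nonzero[OF N l]] classical_op_coeff[OF A, of "ray N l" \<kappa>]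
      by (simp add: nct_remainder_def mult.commute)
    also have "\<dots> = D (\<lambda>_. 0) ?x \<kappa>" using D unfolding nct_derivs_def by simp
    also have "norm \<dots> \<le> nct_norm c (D (\<lambda>_. 0) ?x)"
      by (rule norm_coeff_le_nct_norm[OF cocycle nct_derivs_smooth[OF D UNIV_I]])
    also have "\<dots> \<le> C * (1 + norm ?x) powr (Re m - real J)" using C[of ?x] by (simp add: nct_delta_0)
    finally show "norm (A (nct_U (ray N l)) (ray N l + \<kappa>) / c \<kappa> (ray N l) -
        (\<Sum>i<J. (\<tau> i (lattice_vec l) \<kappa> + 0 * of_real (ln (real N))) * of_nat N powr (m - of_nat i))) \<le>
        C * (1 + norm ?x) powr (Re m - real J)" .
  qed (use J in auto)
qed

lemma sum_component:
  assumes "Re m - Re s < real J"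
  shows "(\<Sum>i | i \<in> {..<J} \<and> m - of_nat i = s. \<tau> i \<xi> \<kappa>) = nct_component m \<tau> s \<xi> \<kappa>"
proof (cases "\<exists>j::nat. m - of_nat j = s")
  case True
  then obtain j :: nat where j: "m - of_nat j = s" by blast
  have uniq: "m - of_nat i = s \<longleftrightarrow> i = j" for i
    using j by (auto simp: algebra_simps)
  have "Re s = Re m - real j" using j by auto
  then have "j < J" using assms by linarith
  then have "{i. i \<in> {..<J} \<and> m - of_nat i = s} = {j}" using uniq by auto
  then show ?thesis using True by (simp add: nct_component_def uniq)
next
  case False
  then have "{i. i \<in> {..<J} \<and> m - of_nat i = s} = {}" by auto
  then show ?thesis using False by (simp add: nct_component_def)
qed

lemma component_continuous:
  assumes "nct_classical_op c A \<omega> m \<sigma> \<tau>"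
  shows "continuous_on (- {0}) (\<lambda>\<xi>. nct_component m \<tau> s \<xi> \<kappa>)"
  using classical_op_component_continuous[OF assms] by (simp add: nct_component_def)

lemma component_homogeneous:
  assumes "nct_classical_op c A \<omega> m \<sigma> \<tau>"
  shows "nct_homogeneous s (nct_component m \<tau> s)"
proof (cases "\<exists>j::nat. m - of_nat j = s")
  case True
  then obtain j :: nat where j: "m - of_nat j = s" by blast
  have uniq: "m - of_nat i = s \<longleftrightarrow> i = j" for i
    using j by (auto simp: algebra_simps)
  show ?thesis
    using classical_op_component_homogeneous[OF assms, of j] True by (simp add: nct_component_def uniq j)
next
  case False
  then show ?thesis by (simp add: nct_component_def nct_homogeneous_def)
qed

text \<open>The two presentations may have different orders, so components are matched by degree
  rather than by index. Rays give equality at every nonzero lattice point; homogeneity and density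
  give the rest.\<close>

lemma component_unique:
  assumes 1: "nct_classical_op c A \<omega> m \<sigma> \<tau>" and 2: "nct_classical_op c A \<omega>' m' \<sigma>' \<tau>'" and x: "x \<noteq> 0"
  shows "nct_component m \<tau> s x \<kappa> = nct_component m' \<tau>' s x \<kappa>"
proof -
  let ?g = "\<lambda>x. nct_component m \<tau> s x \<kappa> - nct_component m' \<tau>' s x \<kappa>"
  have "?g x = 0"
  proof (rule homogeneous_vanish[where s = s])
    show "continuous_on (- {0}) ?g"
      by (intro continuous_on_diff component_continuous[OF 1] component_continuous[OF 2])
    show "?g (t *\<^sub>R x) = of_real t powr s * ?g x" if "x \<noteq> 0" "0 < t" for x t
      using nct_homogeneousD[OF component_homogeneous[OF 1] that] nct_homogeneousD[OF component_homogeneous[OF 2] that]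
      by (simp add: right_diff_distrib)
    fix l :: "int ^ 'n" assume l: "l \<noteq> 0"
    obtain J J' :: nat where J: "\<bar>Re m\<bar> + \<bar>Re s\<bar> < real J" "\<bar>Re m'\<bar> + \<bar>Re s\<bar> < real J'"
      using reals_Archimedean2 by metis
    have "(\<Sum>i | i \<in> {..<J} \<and> m - of_nat i = s. \<tau> i (lattice_vec l) \<kappa>) =
        (\<Sum>i | i \<in> {..<J'} \<and> m' - of_nat i = s. \<tau>' i (lattice_vec l) \<kappa>)"
      by (rule ray_coefficient_unique[where d = "\<lambda>_. 0" and d' = "\<lambda>_. 0",
          OF _ _ _ _ classical_op_ray[OF 1 l] classical_op_ray[OF 2 l]]) (use J in auto)
    then show "?g (lattice_vec l) = 0"
      using J by (subst (asm) (1 2) sum_component) auto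
  qed (use x in simp)
  then show ?thesis by simp
qed

lemma nct_Res_eq:
  assumes A: "nct_classical_op c A \<omega> m \<sigma> \<tau>" and j: "m - of_nat j = - of_nat CARD('n)"
  shows "nct_Res c A = sphere_int (\<lambda>\<xi>. \<tau> j \<xi> 0)"
proof -
  have uniq: "m - of_nat i = - of_nat CARD('n) \<longleftrightarrow> i = j" for i
    using j by (auto simp: algebra_simps)
  have comp: "nct_component m \<tau> (- of_nat CARD('n)) = \<tau> j"
    using j by (auto simp: nct_component_def uniq)
  have "nct_Res c A = nct_sphere_integral (nct_component m \<tau> (- of_nat CARD('n)))"
    unfolding nct_Res_def
  proof (rule the_equality)
    fix r assume "\<exists>\<omega> m \<sigma> \<tau>. nct_classical_op c A \<omega> m \<sigma> \<tau> \<and> r = nct_sphere_integral (nct_component m \<tau> (- of_nat CARD('n)))"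
    then obtain \<omega>' m' \<sigma>' \<tau>' where A': "nct_classical_op c A \<omega>' m' \<sigma>' \<tau>'"
      and r: "r = nct_sphere_integral (nct_component m' \<tau>' (- of_nat CARD('n)))" by blast
    show "r = nct_sphere_integral (nct_component m \<tau> (- of_nat CARD('n)))"
      unfolding r nct_sphere_integral_eq[OF component_continuous[OF A]] nct_sphere_integral_eq[OF component_continuous[OF A']]
      by (rule sphere_int_cong, rule component_unique[OF A' A]) auto
  qed (use A in blast)
  also have "\<dots> = sphere_int (\<lambda>\<xi>. \<tau> j \<xi> 0)"
    unfolding comp by (rule nct_sphere_integral_eq[OF classical_op_component_continuous[OF A]])
  finally show ?thesis .
qed

lemma family_classical_op:
  assumes "nct_family_symbol c q a A \<sigma> \<tau>"
  shows "\<exists>\<omega>. \<forall>z. nct_classical_op c (A z) \<omega> (nct_order q a z) (\<sigma> z) (\<lambda>j. \<tau> j z)"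
  using assms unfolding nct_family_symbol_def by blast

lemma family_component_deriv:
  assumes F: "nct_family_symbol c q a A \<sigma> \<tau>"
  shows "\<xi> \<noteq> 0 \<Longrightarrow> ((\<lambda>z. \<tau> j z \<xi> \<kappa>) has_field_derivative nct_component_deriv \<tau> j z0 \<xi> \<kappa>) (at z0)"
    and "continuous_on (- {0}) (\<lambda>\<xi>. nct_component_deriv \<tau> j z0 \<xi> \<kappa>)"
proof -
  obtain D where D: "nct_holo_derivs c (- {0}) (\<tau> j) D"
    using F unfolding nct_family_symbol_def nct_holomorphic_def by blast
  have D0: "D 0 (\<lambda>_. 0) z \<xi> = \<tau> j z \<xi>" if "\<xi> \<in> - {0}" for z \<xi>
    using D that unfolding nct_holo_derivs_def by blast
  have deriv: "((\<lambda>z. \<tau> j z \<xi> \<kappa>) has_field_derivative D (Suc 0) (\<lambda>_. 0) z0 \<xi> \<kappa>) (at z0)" if "\<xi> \<in> - {0}" for \<xi>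
    using nct_holo_derivs_deriv[OF cocycle D that, of 0 "\<lambda>_. 0"] D0[OF that] by simp
  then have eq: "nct_component_deriv \<tau> j z0 \<xi> \<kappa> = D (Suc 0) (\<lambda>_. 0) z0 \<xi> \<kappa>" if "\<xi> \<in> - {0}" for \<xi>
    using that by (simp add: nct_component_deriv_def DERIV_imp_deriv)
  show "((\<lambda>z. \<tau> j z \<xi> \<kappa>) has_field_derivative nct_component_deriv \<tau> j z0 \<xi> \<kappa>) (at z0)" if "\<xi> \<noteq> 0"
    using deriv eq that by simp
  have "continuous_on (- {0}) (\<lambda>\<xi>. D (Suc 0) (\<lambda>_. 0) z0 \<xi> \<kappa>)"
    by (rule nct_derivs_continuous[OF cocycle nct_holo_derivs_derivs[OF D]])
  then show "continuous_on (- {0}) (\<lambda>\<xi>. nct_component_deriv \<tau> j z0 \<xi> \<kappa>)"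
    by (rule continuous_on_eq) (use eq in simp)
qed

text \<open>Differentiating the homogeneity factor in z produces the logarithm, with coefficient - q
  from the order. The derivative is therefore homogeneous exactly when the component itself vanishes
  at z0.\<close>

lemma component_deriv_scale:
  assumes F: "nct_family_symbol c q a A \<sigma> \<tau>" and \<xi>: "\<xi> \<noteq> 0" and t: "0 < t"
  shows "nct_component_deriv \<tau> j z0 (t *\<^sub>R \<xi>) \<kappa> = of_real t powr (nct_order q a z0 - of_nat j) *
    (nct_component_deriv \<tau> j z0 \<xi> \<kappa> - of_real q * of_real (ln t) * \<tau> j z0 \<xi> \<kappa>)"
proof -
  obtain \<omega> where op: "\<And>z. nct_classical_op c (A z) \<omega> (nct_order q a z) (\<sigma> z) (\<lambda>j. \<tau> j z)"
    using family_classical_op[OF F] by blast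
  let ?w = "\<lambda>z. of_real t powr (nct_order q a z - of_nat j) :: complex"
  have eq: "\<tau> j z (t *\<^sub>R \<xi>) \<kappa> = ?w z * \<tau> j z \<xi> \<kappa>" for z
    using nct_homogeneousD[OF classical_op_component_homogeneous[OF op[of z], of j] \<xi> t] by simp
  have order: "((\<lambda>z. nct_order q a z - of_nat j) has_field_derivative - of_real q) (at z0)"
    unfolding nct_order_def by (auto intro!: derivative_eq_intros)
  have "(?w has_field_derivative ?w z0 * (of_real (ln t) * (- of_real q))) (at z0)"
    using DERIV_fun_exp[OF DERIV_cmult_right[OF order, of "of_real (ln t)"]] t
    by (simp add: powr_def Ln_of_real mult.commute)
  from DERIV_mult[OF this family_component_deriv(1)[OF F \<xi>, of j \<kappa>]]
  have "((\<lambda>z. \<tau> j z (t *\<^sub>R \<xi>) \<kappa>) has_field_derivative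
      ?w z0 * (of_real (ln t) * (- of_real q)) * \<tau> j z0 \<xi> \<kappa> + nct_component_deriv \<tau> j z0 \<xi> \<kappa> * ?w z0) (at z0)"
    unfolding eq .
  from DERIV_imp_deriv[OF this] show ?thesis
    by (simp add: nct_component_deriv_def algebra_simps)
qed

text \<open>The coefficients of \<open>A z\<close> on the basis elements are differentiated in z
  termwise, and the differentiated remainder is bounded with a loss of 1. The logarithms come from
  \<open>component_deriv_scale\<close>.\<close>

lemma family_deriv_ray:
  assumes F: "nct_family_symbol c q a A \<sigma> \<tau>" and l: "l \<noteq> 0"
    and J: "Re (nct_order q a z0) + 1 \<le> real J" "Re (nct_order q a z0) - real J + 1 < Re e"
  shows "(\<lambda>N. of_nat N powr (- e) * (nct_family_deriv A z0 (nct_U (ray N l)) (ray N l) -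
    (\<Sum>i<J. (nct_component_deriv \<tau> i z0 (lattice_vec l) 0 + (- of_real q * \<tau> i z0 (lattice_vec l) 0) * of_real (ln (real N))) *
       of_nat N powr (nct_order q a z0 - of_nat i)))) \<longlonglongrightarrow> 0"
proof -
  obtain \<omega> where op: "\<And>z. nct_classical_op c (A z) \<omega> (nct_order q a z) (\<sigma> z) (\<lambda>j. \<tau> j z)"
    and hol: "nct_holomorphic c UNIV \<sigma>"
    and rem: "\<forall>N. \<exists>D. nct_holo_derivs c UNIV (\<lambda>z. nct_remainder \<omega> (\<sigma> z) (\<lambda>j. \<tau> j z) N) D \<and>
          (\<forall>k \<epsilon> Z \<alpha> \<beta>. 0 < \<epsilon> \<and> compact Z \<longrightarrow>
             (\<exists>C. \<forall>z\<in>Z. \<forall>\<xi>. nct_norm c (nct_delta \<alpha> (D k \<beta> z \<xi>)) \<le>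
                C * (1 + norm \<xi>) powr
                  (Re (nct_order q a z) - real N + \<epsilon> - real (\<Sum>i\<in>UNIV. \<beta> i))))"
    using F unfolding nct_family_symbol_def by blast
  from rem[rule_format, of J] obtain D where
    D': "nct_holo_derivs c UNIV (\<lambda>z. nct_remainder \<omega> (\<sigma> z) (\<lambda>j. \<tau> j z) J) D \<and>
          (\<forall>k \<epsilon> Z \<alpha> \<beta>. 0 < \<epsilon> \<and> compact Z \<longrightarrow>
             (\<exists>C. \<forall>z\<in>Z. \<forall>\<xi>. nct_norm c (nct_delta \<alpha> (D k \<beta> z \<xi>)) \<le>
                C * (1 + norm \<xi>) powr
                  (Re (nct_order q a z) - real J + \<epsilon> - real (\<Sum>i\<in>UNIV. \<beta> i))))" ..
  have D: "nct_holo_derivs c UNIV (\<lambda>z. nct_remainder \<omega> (\<sigma> z) (\<lambda>j. \<tau> j z) J) D"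
    using D' by blast
  obtain C where C: "\<And>\<xi>. nct_norm c (nct_delta (\<lambda>_. 0) (D 1 (\<lambda>_. 0) z0 \<xi>)) \<le>
      C * (1 + norm \<xi>) powr (Re (nct_order q a z0) - real J + 1 - real (\<Sum>i\<in>(UNIV :: 'n set). 0))"
    using conjunct2[OF D', rule_format, of 1 "{z0}" "\<lambda>_. 0" 1 "\<lambda>_. 0"] by auto
  have \<omega>: "nct_excision \<omega>" using op unfolding nct_classical_op_def by blast
  show ?thesis
  proof (rule ray_remainder_limit[OF l, where p = "Re (nct_order q a z0) - real J + 1"])
    fix N :: nat assume N: "0 < N"
    let ?k = "ray N l"
    let ?x = "lattice_vec ?k"
    have k: "?k \<noteq> 0" by (rule ray_nonzero[OF N l])
    have "D 0 (\<lambda>_. 0) z ?x = nct_remainder \<omega> (\<sigma> z) (\<lambda>j. \<tau> j z) J ?x" for z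
      using D unfolding nct_holo_derivs_def by blast
    then have D0: "D 0 (\<lambda>_. 0) z ?x 0 = \<sigma> z ?x 0 - (\<Sum>i<J. \<tau> i z ?x 0)" for z
      using excision_lattice[OF \<omega> k] by (simp add: nct_remainder_def)
    have "((\<lambda>z. D 0 (\<lambda>_. 0) z ?x 0 + (\<Sum>i<J. \<tau> i z ?x 0)) has_field_derivative
        D 1 (\<lambda>_. 0) z0 ?x 0 + (\<Sum>i<J. nct_component_deriv \<tau> i z0 ?x 0)) (at z0)"
      using nct_holo_derivs_deriv[OF cocycle D UNIV_I, of 0 "\<lambda>_. 0" ?x 0 z0]
      by (intro DERIV_add DERIV_sum family_component_deriv(1)[OF F lattice_vec_nonzero[OF k]]) simp
    then have "((\<lambda>z. A z (nct_U ?k) ?k) has_field_derivative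
        D 1 (\<lambda>_. 0) z0 ?x 0 + (\<Sum>i<J. nct_component_deriv \<tau> i z0 ?x 0)) (at z0)"
      using classical_op_coeff[OF op, of _ ?k 0] by (simp add: D0 cocycle_0[OF cocycle])
    then have "nct_family_deriv A z0 (nct_U ?k) ?k = D 1 (\<lambda>_. 0) z0 ?x 0 + (\<Sum>i<J. nct_component_deriv \<tau> i z0 ?x 0)"
      by (simp add: nct_family_deriv_def nct_U_smooth DERIV_imp_deriv)
    moreover have "nct_component_deriv \<tau> i z0 ?x 0 =
        (nct_component_deriv \<tau> i z0 (lattice_vec l) 0 + (- of_real q * \<tau> i z0 (lattice_vec l) 0) * of_real (ln (real N))) *
       of_nat N powr (nct_order q a z0 - of_nat i)" for i
      using component_deriv_scale[OF F lattice_vec_nonzero[OF l], of "real N" i z0 0] N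
      by (simp add: lattice_vec_ray algebra_simps)
    ultimately have "nct_family_deriv A z0 (nct_U ?k) ?k -
      (\<Sum>i<J. (nct_component_deriv \<tau> i z0 (lattice_vec l) 0 + (- of_real q * \<tau> i z0 (lattice_vec l) 0) * of_real (ln (real N))) *
       of_nat N powr (nct_order q a z0 - of_nat i)) = D 1 (\<lambda>_. 0) z0 ?x 0" by simp
    also have "norm \<dots> \<le> nct_norm c (D 1 (\<lambda>_. 0) z0 ?x)"
      by (rule norm_coeff_le_nct_norm[OF cocycle nct_derivs_smooth[OF nct_holo_derivs_derivs[OF D] UNIV_I]])
    also have "\<dots> \<le> C * (1 + norm ?x) powr (Re (nct_order q a z0) - real J + 1)"
      using C[of ?x] by (simp add: nct_delta_0)
    finally show "norm (nct_family_deriv A z0 (nct_U ?k) ?k -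
      (\<Sum>i<J. (nct_component_deriv \<tau> i z0 (lattice_vec l) 0 + (- of_real q * \<tau> i z0 (lattice_vec l) 0) * of_real (ln (real N))) *
       of_nat N powr (nct_order q a z0 - of_nat i))) \<le> C * (1 + norm ?x) powr (Re (nct_order q a z0) - real J + 1)" .
  qed (use J in auto)
qed

text \<open>One operator can be the derivative of several families, with different orders, points
  and indices. Homogeneity in degree - n excludes the logarithm there, so along each ray the
  coefficient of the power - n of N is the component derivative, and the operator determines
  it.\<close>

lemma deriv_Res_unique:
  assumes "nct_has_deriv_Res c B r" "nct_has_deriv_Res c B r'"
  shows "r = r'"
proof -
  let ?n = "- of_nat CARD('n) :: complex"
  obtain q a A \<sigma> \<tau> z j where 1: "0 < q" "nct_family_symbol c q a A \<sigma> \<tau>" "B = nct_family_deriv A z"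
     "nct_order q a z - of_nat j = ?n" "nct_homogeneous ?n (nct_component_deriv \<tau> j z)"
     "r = nct_sphere_integral (nct_component_deriv \<tau> j z)"
    using assms(1) unfolding nct_has_deriv_Res_def by blast
  obtain q' a' A' \<sigma>' \<tau>' z' j' where 2: "0 < q'" "nct_family_symbol c q' a' A' \<sigma>' \<tau>'" "B = nct_family_deriv A' z'"
     "nct_order q' a' z' - of_nat j' = ?n" "nct_homogeneous ?n (nct_component_deriv \<tau>' j' z')"
     "r' = nct_sphere_integral (nct_component_deriv \<tau>' j' z')"
    using assms(2) unfolding nct_has_deriv_Res_def by blast
  \<comment> \<open>Comparing the scaling law with homogeneity at t = 2 leaves
    \<open>q * ln 2\<close> times the component, which must be zero.\<close>
  have no_log: "\<tau> j z \<xi> 0 = 0" if "0 < q" "nct_family_symbol c q a A \<sigma> \<tau>"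
     "nct_order q a z - of_nat j = ?n" "nct_homogeneous ?n (nct_component_deriv \<tau> j z)" "\<xi> \<noteq> 0" for q a A \<sigma> \<tau> z j \<xi>
    using component_deriv_scale[OF that(2) that(5), of 2 j z 0] nct_homogeneousD[OF that(4) that(5), of 2 0] that(1,3)
    by simp
  have coeff: "(\<Sum>i | i \<in> {..<J} \<and> nct_order q a z - of_nat i = ?n. nct_component_deriv \<tau> i z \<xi> 0) = nct_component_deriv \<tau> j z \<xi> 0"
    if "nct_order q a z - of_nat j = ?n" "j < J" for q a z j J \<tau> \<xi>
  proof -
    have "{i. i \<in> {..<J} \<and> nct_order q a z - of_nat i = ?n} = {j}"
      using that by (auto simp: algebra_simps)
    then show ?thesis by simp
  qed
  let ?g = "\<lambda>x. nct_component_deriv \<tau> j z x 0 - nct_component_deriv \<tau>' j' z' x 0"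
  have "?g x = 0" if "x \<noteq> 0" for x
  proof (rule homogeneous_vanish[where s = ?n])
    show "continuous_on (- {0}) ?g"
      by (intro continuous_on_diff family_component_deriv(2)[OF 1(2)] family_component_deriv(2)[OF 2(2)])
    show "?g (t *\<^sub>R x) = of_real t powr ?n * ?g x" if "x \<noteq> 0" "0 < t" for x t
      using nct_homogeneousD[OF 1(5) that] nct_homogeneousD[OF 2(5) that] by (simp add: right_diff_distrib)
    fix l :: "int ^ 'n" assume l: "l \<noteq> 0"
    obtain J0 J0' :: nat where J0: "\<bar>Re (nct_order q a z)\<bar> + 1 + real CARD('n) < real J0"
        "\<bar>Re (nct_order q' a' z')\<bar> + 1 + real CARD('n) < real J0'"
      using reals_Archimedean2 by metis
    define J where "J = max J0 (Suc j)"
    define J' where "J' = max J0' (Suc j')"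
    have J: "\<bar>Re (nct_order q a z)\<bar> + 1 + real CARD('n) < real J" "j < J"
        "\<bar>Re (nct_order q' a' z')\<bar> + 1 + real CARD('n) < real J'" "j' < J'"
      using J0 by (auto simp: J_def J'_def)
    have "(\<Sum>i | i \<in> {..<J} \<and> nct_order q a z - of_nat i = ?n. nct_component_deriv \<tau> i z (lattice_vec l) 0) =
        (\<Sum>i | i \<in> {..<J'} \<and> nct_order q' a' z' - of_nat i = ?n. nct_component_deriv \<tau>' i z' (lattice_vec l) 0)"
    proof (rule ray_coefficient_unique[OF _ _ _ _ family_deriv_ray[OF 1(2) l, of z J ?n]
          family_deriv_ray[OF 2(2) l, of z' J' ?n, folded 2(3), unfolded 1(3)]])
      show "- complex_of_real q * \<tau> i z (lattice_vec l) 0 = 0" if "nct_order q a z - of_nat i = ?n" for i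
        using no_log[OF 1(1,2,4,5) lattice_vec_nonzero[OF l]] that 1(4) by (auto simp: algebra_simps)
      show "- complex_of_real q' * \<tau>' i z' (lattice_vec l) 0 = 0" if "nct_order q' a' z' - of_nat i = ?n" for i
        using no_log[OF 2(1,2,4,5) lattice_vec_nonzero[OF l]] that 2(4) by (auto simp: algebra_simps)
    qed (use J in auto)
    then show "?g (lattice_vec l) = 0"
      by (simp only: coeff[OF 1(4) J(2)] coeff[OF 2(4) J(4)] diff_self)
  qed (use that in simp)
  note agree = this
  show ?thesis
    unfolding 1(6) 2(6) nct_sphere_integral_eq[OF family_component_deriv(2)[OF 1(2)]]
      nct_sphere_integral_eq[OF family_component_deriv(2)[OF 2(2)]]
  proof (rule sphere_int_cong)
    fix x :: "real ^ 'n" assume "norm x = 1"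
    then have "x \<noteq> 0" by auto
    from agree[OF this] show "nct_component_deriv \<tau> j z x 0 = nct_component_deriv \<tau>' j' z' x 0" by simp
  qed
qed

end

section \<open>The canonical trace\<close>

lemma finite_multiindices: "finite {\<alpha> :: 'n::finite \<Rightarrow> nat. (\<Sum>i\<in>UNIV. \<alpha> i) \<le> M}"
proof (rule finite_subset)
  show "{\<alpha> :: 'n \<Rightarrow> nat. (\<Sum>i\<in>UNIV. \<alpha> i) \<le> M} \<subseteq> UNIV \<rightarrow>\<^sub>E {..M}"
  proof
    fix \<alpha> :: "'n \<Rightarrow> nat" assume "\<alpha> \<in> {\<alpha>. (\<Sum>i\<in>UNIV. \<alpha> i) \<le> M}"
    moreover have "\<alpha> j \<le> (\<Sum>i\<in>UNIV. \<alpha> i)" for j by (rule member_le_sum) auto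
    ultimately have "\<alpha> j \<le> M" for j using le_trans by blast
    then show "\<alpha> \<in> UNIV \<rightarrow>\<^sub>E {..M}" by (simp add: PiE_def Pi_def)
  qed
qed (intro finite_PiE, auto)

lemma sum_multiindices:
  "(\<Sum>\<alpha> | (\<Sum>i\<in>UNIV. \<alpha> i) \<le> M. F \<alpha>) = (\<Sum>e\<le>M. \<Sum>\<alpha> | (\<Sum>i\<in>UNIV. (\<alpha> :: 'n::finite \<Rightarrow> nat) i) = e. F \<alpha>)"
proof -
  have fin: "finite {\<alpha> :: 'n \<Rightarrow> nat. (\<Sum>i\<in>UNIV. \<alpha> i) = e}" for e
    by (rule finite_subset[OF _ finite_multiindices[of e]]) auto
  have "{\<alpha> :: 'n \<Rightarrow> nat. (\<Sum>i\<in>UNIV. \<alpha> i) \<le> M} = (\<Union>e\<le>M. {\<alpha>. (\<Sum>i\<in>UNIV. \<alpha> i) = e})" by auto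
  then show ?thesis by (simp only:) (subst sum.UNION_disjoint, auto simp: fin)
qed

definition homogeneous_polynomial :: "('n::finite multiindex \<Rightarrow> complex) \<Rightarrow> nat \<Rightarrow> real ^ 'n \<Rightarrow> complex" where
  "homogeneous_polynomial b e = polynomial_deriv b {\<alpha>. (\<Sum>i\<in>UNIV. \<alpha> i) = e} []"

lemma homogeneous_polynomial_scale:
  "homogeneous_polynomial b e (t *\<^sub>R x) = of_real t ^ e * homogeneous_polynomial b e x"
  unfolding homogeneous_polynomial_def by (rule polynomial_deriv_homogeneous) simp

lemma polynomial_symbol_decomposition:
  "(\<Sum>\<alpha> | (\<Sum>i\<in>UNIV. \<alpha> i) \<le> M. (\<Prod>i\<in>UNIV. of_int (k $ i) ^ \<alpha> i) * b \<alpha>) =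
    (\<Sum>e\<le>M. homogeneous_polynomial b e (lattice_vec k))"
  unfolding sum_multiindices homogeneous_polynomial_def polynomial_deriv_def
  by (simp add: monomial_deriv_Nil lattice_vec_def mult.commute)

section \<open>Differential operators and the value of the trace\<close>

context
  fixes \<theta> :: "real ^ 'n::finite ^ 'n" and c :: "'n cocycle"
  assumes cocycle: "nct_cocycle \<theta> c"
begin

text \<open>Comparing the growth along the rays \<open>N \<mapsto> N l\<close> identifies the homogeneous components of the
  symbol with those of the polynomial.\<close>

lemma differential_operator_components:
  assumes op: "nct_classical_op c A \<omega> (of_nat j - of_nat CARD('n)) \<sigma> \<tau>"
    and poly: "A = nct_Op c (\<lambda>k l. \<Sum>\<alpha> | (\<Sum>i\<in>UNIV. \<alpha> i) \<le> M.
              (\<Prod>i\<in>UNIV. of_int (k $ i) ^ \<alpha> i) * b \<alpha> l)"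
  shows "x \<noteq> 0 \<Longrightarrow> \<tau> i x \<kappa> =
      (if CARD('n) + i \<le> j \<and> j - (CARD('n) + i) \<le> M
       then homogeneous_polynomial (\<lambda>\<alpha>. b \<alpha> \<kappa>) (j - (CARD('n) + i)) x else 0)"
    and "j < CARD('n) + e \<Longrightarrow> e \<le> M \<Longrightarrow> homogeneous_polynomial (\<lambda>\<alpha>. b \<alpha> \<kappa>) e (lattice_vec k) = 0"
proof -
  let ?m = "of_nat j - of_nat CARD('n) :: complex"
  let ?Q = "homogeneous_polynomial (\<lambda>\<alpha>. b \<alpha> \<kappa>)"
  \<comment> \<open>Along a ray the polynomial symbol is an expansion with the exponents e and no
    error at all, to be compared with the classical expansion.\<close>
  have coeff: "(\<Sum>i | i \<in> {..<J} \<and> ?m - of_nat i = s. \<tau> i (lattice_vec l) \<kappa>) =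
      (\<Sum>e | e \<in> {..M} \<and> of_nat e = s. ?Q e (lattice_vec l))"
    if l: "l \<noteq> 0" and J: "\<bar>Re ?m\<bar> + \<bar>Re s\<bar> < real J" for l s J
  proof (rule ray_coefficient_unique[where d = "\<lambda>_. 0" and d' = "\<lambda>_. 0",
        OF _ _ _ _ classical_op_ray[OF cocycle op l]])
    have "A (nct_U (ray N l)) (ray N l + \<kappa>) / c \<kappa> (ray N l) -
        (\<Sum>e\<le>M. (?Q e (lattice_vec l) + 0 * of_real (ln (real N))) * of_nat N powr of_nat e) = 0" if "0 < N" for N
    proof -
      have "A (nct_U (ray N l)) (ray N l + \<kappa>) / c \<kappa> (ray N l) = (\<Sum>e\<le>M. ?Q e (lattice_vec (ray N l)))"
        unfolding poly nct_Op_U polynomial_symbol_decomposition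
        using cocycle_nonzero[OF cocycle] by simp
      also have "\<dots> = (\<Sum>e\<le>M. (?Q e (lattice_vec l) + 0 * of_real (ln (real N))) * of_nat N powr of_nat e)"
        using that by (simp add: lattice_vec_ray homogeneous_polynomial_scale powr_nat mult.commute)
      finally show ?thesis by simp
    qed
    then have "\<forall>\<^sub>F N in sequentially. of_nat N powr (- s) * (A (nct_U (ray N l)) (ray N l + \<kappa>) / c \<kappa> (ray N l) -
        (\<Sum>e\<le>M. (?Q e (lattice_vec l) + 0 * of_real (ln (real N))) * of_nat N powr of_nat e)) = 0"
      by (intro eventually_mono[OF eventually_gt_at_top[of 0]]) simp
    then show "(\<lambda>N. of_nat N powr (- s) * (A (nct_U (ray N l)) (ray N l + \<kappa>) / c \<kappa> (ray N l) -
        (\<Sum>e\<le>M. (?Q e (lattice_vec l) + 0 * of_real (ln (real N))) * of_nat N powr of_nat e))) \<longlonglongrightarrow> 0"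
      by (rule tendsto_eventually)
  qed (use J in auto)
  let ?P = "\<lambda>i x. if CARD('n) + i \<le> j \<and> j - (CARD('n) + i) \<le> M then ?Q (j - (CARD('n) + i)) x else 0"
  show "\<tau> i x \<kappa> = ?P i x" if x: "x \<noteq> 0" for x
  proof -
    have "\<tau> i x \<kappa> - ?P i x = 0"
    proof (rule homogeneous_vanish[where s = "?m - of_nat i"])
      have "continuous_on UNIV (?Q e)" for e
        unfolding homogeneous_polynomial_def by (rule smooth_derivs_continuous[OF smooth_derivs_polynomial])
      then have Q: "continuous_on (- {0}) (?Q e)" for e
        by (rule continuous_on_subset) simp
      have "continuous_on (- {0}) (?P i)"
      proof (cases "CARD('n) + i \<le> j \<and> j - (CARD('n) + i) \<le> M")
        case True
        show ?thesis by (simp only: if_P[OF True] Q)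
      next
        case False
        show ?thesis by (simp only: if_not_P[OF False] continuous_on_const)
      qed
      then show "continuous_on (- {0}) (\<lambda>x. \<tau> i x \<kappa> - ?P i x)"
        by (intro continuous_on_diff classical_op_component_continuous[OF cocycle op])
    next
      fix x :: "real ^ 'n" and t :: real assume x: "x \<noteq> 0" and t: "0 < t"
      have "?P i (t *\<^sub>R x) = of_real t powr (?m - of_nat i) * ?P i x"
      proof (cases "CARD('n) + i \<le> j")
        case True
        then have "?m - of_nat i = of_nat (j - (CARD('n) + i))" by (simp add: of_nat_diff)
        then show ?thesis using t by (simp add: homogeneous_polynomial_scale powr_nat)
      qed simp
      then show "\<tau> i (t *\<^sub>R x) \<kappa> - ?P i (t *\<^sub>R x) = of_real t powr (?m - of_nat i) * (\<tau> i x \<kappa> - ?P i x)"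
        using nct_homogeneousD[OF classical_op_component_homogeneous[OF cocycle op] x t] by (simp add: right_diff_distrib)
    next
      fix l :: "int ^ 'n" assume l: "l \<noteq> 0"
      let ?s = "?m - of_nat i"
      obtain J0 :: nat where J0: "\<bar>Re ?m\<bar> + \<bar>Re ?s\<bar> < real J0" using reals_Archimedean2 by blast
      define J where "J = max J0 (Suc i)"
      have J: "\<bar>Re ?m\<bar> + \<bar>Re ?s\<bar> < real J" "i < J" using J0 by (auto simp: J_def)
      have "{i'. i' \<in> {..<J} \<and> ?m - of_nat i' = ?s} = {i}" using J(2) by auto
      then have left: "(\<Sum>i' | i' \<in> {..<J} \<and> ?m - of_nat i' = ?s. \<tau> i' (lattice_vec l) \<kappa>) = \<tau> i (lattice_vec l) \<kappa>"
        by (simp only: sum.insert[OF finite.emptyI] sum.empty) simp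
      have iff: "of_nat e = ?s \<longleftrightarrow> CARD('n) + i \<le> j \<and> e = j - (CARD('n) + i)" for e
      proof -
        have "of_nat e = ?s \<longleftrightarrow> (of_nat (e + (CARD('n) + i)) :: complex) = of_nat j"
          by (auto simp: algebra_simps)
        also have "\<dots> \<longleftrightarrow> e + (CARD('n) + i) = j" by (simp only: of_nat_eq_iff)
        finally show ?thesis by auto
      qed
      have "{e. e \<in> {..M} \<and> of_nat e = ?s} =
          (if CARD('n) + i \<le> j \<and> j - (CARD('n) + i) \<le> M then {j - (CARD('n) + i)} else {})"
        unfolding iff by auto
      then have right: "(\<Sum>e | e \<in> {..M} \<and> of_nat e = ?s. ?Q e (lattice_vec l)) = ?P i (lattice_vec l)"
        by (simp only:) simp
      from coeff[OF l J(1)] show "\<tau> i (lattice_vec l) \<kappa> - ?P i (lattice_vec l) = 0"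
        unfolding left right by simp
    qed (rule x)
    then show ?thesis by simp
  qed
  show "?Q e (lattice_vec k) = 0" if e: "j < CARD('n) + e" "e \<le> M"
  proof -
    \<comment> \<open>A degree e above the order j - n matches no exponent of the classical
      expansion, so its coefficient is an empty sum.\<close>
    have nz: "?Q e (lattice_vec l) = 0" if l: "l \<noteq> 0" for l
    proof -
      obtain J :: nat where J: "\<bar>Re ?m\<bar> + \<bar>Re (of_nat e :: complex)\<bar> < real J" using reals_Archimedean2 by blast
      have "?m - of_nat i \<noteq> of_nat e" for i
      proof
        assume "?m - of_nat i = of_nat e"
        then have "(of_nat j :: complex) = of_nat (CARD('n) + e + i)" by (simp add: algebra_simps)
        then have "j = CARD('n) + e + i" by (simp only: of_nat_eq_iff)
        then show False using e by simp
      qed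
      then have "{i. i \<in> {..<J} \<and> ?m - of_nat i = of_nat e} = {}" by auto
      moreover have "{e'. e' \<in> {..M} \<and> of_nat e' = (of_nat e :: complex)} = {e}" using e by auto
      ultimately show ?thesis using coeff[OF l J] by (simp only: sum.empty) simp
    qed
    show ?thesis
    proof (cases "k = 0")
      case True
      have "1 \<noteq> (0 :: int ^ 'n)" by (simp add: vec_eq_iff)
      \<comment> \<open>The origin lies on no ray through a nonzero point at positive N; scaling
        another lattice point by 0 reaches it, also when e = 0.\<close>
      have "?Q e (0 *\<^sub>R lattice_vec 1) = 0 ^ e * ?Q e (lattice_vec 1)"
        by (subst homogeneous_polynomial_scale) simp
      also have "\<dots> = 0" using nz[OF \<open>1 \<noteq> 0\<close>] by simp
      finally show ?thesis using True by (simp add: lattice_vec_simps)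
    qed (rule nz)
  qed
qed

text \<open>Any two presentations agree on the lattice and hence have the same box sums, whose
  constant term does not depend on the order used to expand them.\<close>

lemma nct_TR_eq:
  assumes op: "nct_classical_op c A \<omega> m \<sigma> \<tau>" and m: "\<And>j. m + of_nat CARD('n) \<noteq> of_nat j"
    and L: "has_constant_term (m + of_nat CARD('n)) (\<lambda>N. \<Sum>k\<in>lattice_box N. \<sigma> (lattice_vec k) 0) L"
  shows "nct_TR c A = L"
proof -
  have box: "{k. \<forall>i. \<bar>k $ i\<bar> \<le> int N} = (lattice_box N :: (int ^ 'n) set)" for N
    by (simp add: lattice_box_def)
  \<comment> \<open>The orders excluded in \<open>nct_TR\<close> are exactly those for which some
    exponent m + n - j of the expansion vanishes.\<close>
  have not_int: "m \<notin> of_int ` {- int CARD('n)..} \<longleftrightarrow> (\<forall>j. m + of_nat CARD('n) \<noteq> of_nat j)" for m :: complex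
  proof -
    have "m \<in> of_int ` {- int CARD('n)..} \<longleftrightarrow> (\<exists>j. m + of_nat CARD('n) = of_nat j)"
    proof
      assume "m \<in> of_int ` {- int CARD('n)..}"
      then obtain i where i: "m = of_int i" "- int CARD('n) \<le> i" by auto
      then have "m + of_nat CARD('n) = of_int (int (nat (i + int CARD('n))))" by simp
      then show "\<exists>j. m + of_nat CARD('n) = of_nat j" by (metis of_int_of_nat_eq)
    next
      assume "\<exists>j. m + of_nat CARD('n) = of_nat j"
      then obtain j where "m + of_nat CARD('n) = of_nat j" by blast
      then have "m = of_int (int j - int CARD('n))" by (simp add: algebra_simps)
      then show "m \<in> of_int ` {- int CARD('n)..}" by (rule image_eqI) simp
    qed
    then show ?thesis by blast
  qed
  show ?thesis
    unfolding nct_TR_def box nct_trace_def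
  proof (rule the_equality)
    show "\<exists>\<omega> m \<sigma> \<tau>. nct_classical_op c A \<omega> m \<sigma> \<tau> \<and> m \<notin> of_int ` {- int CARD('n)..} \<and>
        has_constant_term (m + of_nat CARD('n)) (\<lambda>N. \<Sum>k\<in>lattice_box N. \<sigma> (lattice_vec k) 0) L"
      using op L m not_int by blast
  next
    fix L' assume "\<exists>\<omega> m \<sigma> \<tau>. nct_classical_op c A \<omega> m \<sigma> \<tau> \<and> m \<notin> of_int ` {- int CARD('n)..} \<and>
        has_constant_term (m + of_nat CARD('n)) (\<lambda>N. \<Sum>k\<in>lattice_box N. \<sigma> (lattice_vec k) 0) L'"
    then obtain \<omega>' m' \<sigma>' \<tau>' where op': "nct_classical_op c A \<omega>' m' \<sigma>' \<tau>'"
      and m': "m' \<notin> of_int ` {- int CARD('n)..}"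
      and L': "has_constant_term (m' + of_nat CARD('n)) (\<lambda>N. \<Sum>k\<in>lattice_box N. \<sigma>' (lattice_vec k) 0) L'" by blast
    have "\<sigma>' (lattice_vec k) 0 = \<sigma> (lattice_vec k) 0" for k
      by (simp only: classical_op_coeff[OF cocycle op] classical_op_coeff[OF cocycle op'])
    then have "has_constant_term (m' + of_nat CARD('n)) (\<lambda>N. \<Sum>k\<in>lattice_box N. \<sigma> (lattice_vec k) 0) L'"
      using L' by simp
    then show "L' = L"
      by (rule has_constant_term_unique[OF _ L]) (use m m' not_int in auto)
  qed
qed

end

theorem theorem4p1:
  fixes \<theta> :: "real ^ 'n ^ 'n"
    and c :: "int ^ 'n \<Rightarrow> int ^ 'n \<Rightarrow> complex"
    and A :: "complex \<Rightarrow> 'n coeffs \<Rightarrow> 'n coeffs"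
    and q a :: real
    and d :: "nat \<Rightarrow> complex"
  assumes "transpose \<theta> = - \<theta>"
    and "nct_cocycle \<theta> c"
    and "0 < q"
    and "nct_holomorphic_family c q a A"
    and "\<And>j. d j = of_real ((a + real CARD('n) - real j) / q)"
  shows
    "((\<lambda>z. nct_TR c (A z)) meromorphic_on UNIV \<and>
      (\<forall>z. z \<notin> range d \<longrightarrow> (\<lambda>z. nct_TR c (A z)) analytic_on {z}) \<and>
      (\<forall>j. is_pole (\<lambda>z. nct_TR c (A z)) (d j) \<longrightarrow> zorder (\<lambda>z. nct_TR c (A z)) (d j) = - 1)) \<and>
     (\<forall>j. residue (\<lambda>z. nct_TR c (A z)) (d j) = 1 / of_real q * nct_Res c (A (d j))) \<and>
     (\<forall>j. nct_differential_operator c (A (d j)) \<longrightarrow>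
        (\<forall>\<sigma> \<tau>. nct_family_symbol c q a A \<sigma> \<tau> \<longrightarrow>
           nct_homogeneous (- of_nat CARD('n)) (nct_component_deriv \<tau> j (d j))) \<and>
        (\<exists>!r. nct_has_deriv_Res c (nct_family_deriv A (d j)) r) \<and>
        finite_part (\<lambda>z. nct_TR c (A z)) (d j) =
          1 / of_real q * nct_deriv_Res c (nct_family_deriv A (d j)))"
proof -
  note cocycle = \<open>nct_cocycle \<theta> c\<close> and q = \<open>0 < q\<close>
  let ?T = "\<lambda>z. nct_TR c (A z)"
  obtain \<sigma> \<tau> where F: "nct_family_symbol c q a A \<sigma> \<tau>"
    using assms(4) unfolding nct_holomorphic_family_def by blast
  obtain D where D: "scalar_family q a (\<lambda>z k. \<sigma> z (lattice_vec k) 0) D"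
    and D\<tau>: "\<And>i z x. 1 \<le> norm x \<Longrightarrow> D i z [] x = \<tau> i z x 0"
    using family_scalar[OF cocycle F q] by blast
  interpret scalar_family q a "\<lambda>z k. \<sigma> z (lattice_vec k) 0" D by (rule D)
  have d: "d j = pole j" for j using assms(5) by (simp add: pole_def)
  obtain \<omega> where op: "\<And>z. nct_classical_op c (A z) \<omega> (nct_order q a z) (\<sigma> z) (\<lambda>j. \<tau> j z)"
    using family_classical_op[OF cocycle F] by blast
  \<comment> \<open>Off the poles the order of the family avoids the excluded integers, so the trace
    is the constant term computed for the scalar family.\<close>
  have T: "?T z = continuation M z" if z: "z \<notin> range pole" "z \<in> region M" "CARD('n) + 1 \<le> M" for z M
  proof (rule nct_TR_eq[OF cocycle op _ has_constant_term_continuation[OF z]])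
    fix j
    show "nct_order q a z + of_nat CARD('n) \<noteq> of_nat j"
    proof
      assume "nct_order q a z + of_nat CARD('n) = of_nat j"
      then have "of_real q * (z - pole j) = 0" using order_pole[of z j] by (simp add: algebra_simps)
      then show False using q z by auto
    qed
  qed
  have sphere: "sphere_int (D j z []) = sphere_int (\<lambda>\<xi>. \<tau> j z \<xi> 0)" for j z
    by (rule sphere_int_cong) (simp add: D\<tau>)
  have exponent: "nct_order q a (pole j) - of_nat j = - of_nat CARD('n)" for j
    by (simp add: order_at_pole)
  have part3: "(\<forall>\<sigma> \<tau>. nct_family_symbol c q a A \<sigma> \<tau> \<longrightarrow>
           nct_homogeneous (- of_nat CARD('n)) (nct_component_deriv \<tau> j (d j))) \<and>
        (\<exists>!r. nct_has_deriv_Res c (nct_family_deriv A (d j)) r) \<and>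
        finite_part ?T (d j) = 1 / of_real q * nct_deriv_Res c (nct_family_deriv A (d j))"
    if diff: "nct_differential_operator c (A (d j))" for j
  proof -
    obtain Md b where poly: "A (pole j) = nct_Op c (\<lambda>k l. \<Sum>\<alpha> | (\<Sum>i\<in>UNIV. \<alpha> i) \<le> Md.
        (\<Prod>i\<in>UNIV. of_int (k $ i) ^ \<alpha> i) * b \<alpha> l)"
      using diff unfolding nct_differential_operator_def d by blast
    have comp: "\<tau>' i (pole j) x \<kappa> = (if CARD('n) + i \<le> j \<and> j - (CARD('n) + i) \<le> Md
        then homogeneous_polynomial (\<lambda>\<alpha>. b \<alpha> \<kappa>) (j - (CARD('n) + i)) x else 0)"
      if F': "nct_family_symbol c q a A \<sigma>' \<tau>'" and x: "x \<noteq> 0" for \<sigma>' \<tau>' i x \<kappa>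
    proof -
      obtain \<omega>' where op': "\<And>z. nct_classical_op c (A z) \<omega>' (nct_order q a z) (\<sigma>' z) (\<lambda>j. \<tau>' j z)"
        using family_classical_op[OF cocycle F'] by blast
      show ?thesis
        by (rule differential_operator_components(1)[OF cocycle op'[of "pole j", unfolded order_at_pole] poly x])
    qed
    \<comment> \<open>At index j the condition \<open>CARD('n) + j \<le> j\<close> fails, so the
      component of degree - n vanishes, and with it the logarithmic term of the scaling law.\<close>
    have hom: "nct_homogeneous (- of_nat CARD('n)) (nct_component_deriv \<tau>' j (pole j))"
      if F': "nct_family_symbol c q a A \<sigma>' \<tau>'" for \<sigma>' \<tau>'
      unfolding nct_homogeneous_def
    proof (intro allI impI ext)
      fix \<xi> :: "real ^ 'n" and t :: real and \<kappa> assume *: "\<xi> \<noteq> 0 \<and> 0 < t"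
      then show "nct_component_deriv \<tau>' j (pole j) (t *\<^sub>R \<xi>) \<kappa> =
          of_real t powr (- of_nat CARD('n)) * nct_component_deriv \<tau>' j (pole j) \<xi> \<kappa>"
        using component_deriv_scale[OF cocycle F', of \<xi> t j "pole j" \<kappa>] comp[OF F', of \<xi> j \<kappa>]
        by (simp add: exponent)
    qed
    let ?r = "nct_sphere_integral (nct_component_deriv \<tau> j (pole j))"
    have res: "nct_has_deriv_Res c (nct_family_deriv A (pole j)) ?r"
      unfolding nct_has_deriv_Res_def using q F hom[OF F] exponent by blast
    have uniq: "\<exists>!r. nct_has_deriv_Res c (nct_family_deriv A (pole j)) r"
      using res deriv_Res_unique[OF cocycle] by blast
    have val: "nct_deriv_Res c (nct_family_deriv A (pole j)) = ?r"
      unfolding nct_deriv_Res_def using res deriv_Res_unique[OF cocycle] by (intro the_equality) blast+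
    obtain M where M: "pole j \<in> region M" "CARD('n) + 1 \<le> M" "j < M" using region_exists by blast
    \<comment> \<open>At the pole the i-th component has degree j - n - i. It is extended over the
      origin by the polynomial part of that degree, or by 0 if there is none.\<close>
    define P where "P i = polynomial_deriv (\<lambda>\<alpha>. b \<alpha> 0)
      (if CARD('n) + i \<le> j \<and> j - (CARD('n) + i) \<le> Md then {\<alpha>. (\<Sum>i\<in>UNIV. \<alpha> i) = j - (CARD('n) + i)} else {})" for i
    have P_Nil: "P i [] x = (if CARD('n) + i \<le> j \<and> j - (CARD('n) + i) \<le> Md
        then homogeneous_polynomial (\<lambda>\<alpha>. b \<alpha> 0) (j - (CARD('n) + i)) x else 0)" for i x
      by (simp add: P_def homogeneous_polynomial_def polynomial_deriv_def)
    have "regular_at_pole M j (pole j) = 0"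
    proof (rule regular_at_pole_polynomial[OF M(1,3), of P])
      show "smooth_derivs (P i)" for i unfolding P_def by (rule smooth_derivs_polynomial)
      show "P i l x = 0" if "length l = M" for i l x
        unfolding P_def using that M(3) by (intro polynomial_deriv_eq_0) (auto split: if_splits)
      show "P i [] x = D i (pole j) [] x" if "1 \<le> norm x" for i x
      proof -
        have "x \<noteq> 0" using that by auto
        then show ?thesis using D\<tau>[OF that] comp[OF F] by (simp add: P_Nil)
      qed
      show "P i [] (t *\<^sub>R x) = of_real t ^ (j - (CARD('n) + i)) * P i [] x" for i x t
        by (simp add: P_Nil homogeneous_polynomial_scale)
      show "P i [] x = 0" if "\<not> CARD('n) + i \<le> j" for i x using that by (simp add: P_Nil)
      show "\<sigma> (pole j) (lattice_vec k) 0 = (\<Sum>i<M. P i [] (lattice_vec k))" for k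
      proof -
        let ?Q = "\<lambda>e. homogeneous_polynomial (\<lambda>\<alpha>. b \<alpha> 0) e (lattice_vec k)"
        have "\<sigma> (pole j) (lattice_vec k) 0 = (\<Sum>e\<le>Md. ?Q e)"
          using classical_op_coeff[OF cocycle op[of "pole j"], of k 0] cocycle_nonzero[OF cocycle, of 0 k]
          unfolding poly nct_Op_U polynomial_symbol_decomposition by simp
        \<comment> \<open>The given polynomial may list degrees above the order j - n, but those
          parts vanish at every lattice point.\<close>
        also have "\<dots> = (\<Sum>e | e \<le> Md \<and> CARD('n) + e \<le> j. ?Q e)"
        proof (rule sum.mono_neutral_right)
          have "?Q e = 0" if "e \<le> Md" "\<not> CARD('n) + e \<le> j" for e
            using differential_operator_components(2)[OF cocycle op[of "pole j", unfolded order_at_pole] poly, of e 0 k] that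
            by simp
          then show "\<forall>e\<in>{..Md} - {e. e \<le> Md \<and> CARD('n) + e \<le> j}. ?Q e = 0" by blast
        qed auto
        \<comment> \<open>Substitution e = j - n - i; the inequality n + i <= j together with j < M
          keeps i below M.\<close>
        also have "\<dots> = (\<Sum>i | i < M \<and> CARD('n) + i \<le> j \<and> j - (CARD('n) + i) \<le> Md. ?Q (j - (CARD('n) + i)))"
          by (rule sum.reindex_bij_witness[of _ "\<lambda>i. j - (CARD('n) + i)" "\<lambda>e. j - (CARD('n) + e)"])
            (use M(3) in auto)
        also have "\<dots> = (\<Sum>i<M. P i [] (lattice_vec k))"
          unfolding P_Nil by (rule sum.mono_neutral_cong_left) auto
        finally show ?thesis .
      qed
    qed
    moreover have "sphere_int (D j (pole j) []) = 0"
    proof -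
      have "sphere_int (D j (pole j) []) = sphere_int (\<lambda>_ :: real ^ 'n. 0)"
      proof (rule sphere_int_cong)
        fix x :: "real ^ 'n" assume x: "norm x = 1"
        then have "x \<noteq> 0" by auto
        then show "D j (pole j) [] x = 0" using D\<tau>[of x j "pole j"] comp[OF F, of x j 0] x by simp
      qed
      then show ?thesis by (simp add: sphere_int_def set_lebesgue_integral_def)
    qed
    moreover have "deriv (\<lambda>z. sphere_int (D j z [])) (pole j) = ?r"
    proof -
      have "deriv (\<lambda>z. sphere_int (D j z [])) (pole j) = sphere_int (\<lambda>x. deriv (\<lambda>z. D j z [] x) (pole j))"
        by (intro DERIV_imp_deriv sphere_int_deriv homogeneous_familyD(2,3)[OF family])
      also have "\<dots> = sphere_int (\<lambda>x. nct_component_deriv \<tau> j (pole j) x 0)"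
        by (rule sphere_int_cong) (simp add: D\<tau> nct_component_deriv_def)
      also have "\<dots> = ?r"
        by (rule nct_sphere_integral_eq[OF family_component_deriv(2)[OF cocycle F], symmetric])
      finally show ?thesis .
    qed
    \<comment> \<open>Both the sphere integral and the regular part vanish at the pole, so only the
      derivative of the sphere integral, divided by q, survives.\<close>
    ultimately have "finite_part ?T (pole j) = ?r / of_real q"
      using pole_expansion(4)[of ?T, OF T M] by simp
    then show ?thesis using hom uniq val by (simp add: d)
  qed
  have "range d = range pole" using d by (auto simp: fun_eq_iff image_def)
  moreover have "zorder ?T (pole j) = - 1" if "is_pole ?T (pole j)" for j
  proof -
    obtain M where "pole j \<in> region M" "CARD('n) + 1 \<le> M" "j < M" using region_exists by blast
    from pole_expansion(3)[of ?T, OF T this that] show ?thesis .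
  qed
  moreover have "residue ?T (pole j) = 1 / of_real q * nct_Res c (A (pole j))" for j
  proof -
    obtain M where "pole j \<in> region M" "CARD('n) + 1 \<le> M" "j < M" using region_exists by blast
    from pole_expansion(2)[of ?T, OF T this]
    show ?thesis using nct_Res_eq[OF cocycle op exponent] by (simp add: sphere)
  qed
  ultimately show ?thesis
    using meromorphic_UNIV[of ?T, OF T] analytic_off_poles[of ?T, OF T] part3 by (simp add: d)
qed

end
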